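(* Let $E$ be a reflexive Banach space and let $\{M^{n}\}_{n}$ be a bounded sequence in $H^{1}(\mu,E)$. Suppose that at least one of the following conditions holds. (1) The set $\{M^{n}_{T}:n\in\mathbb{N},\ T\text{ a stopping time}\}$ is uniformly integrable. (2) The set $\{\Delta M^{n}_{T}:n\in\mathbb{N},\ T\text{ a stopping time}\}$ is uniformly integrable. Then there is a subsequence $\{n_{k}\}_{k}$ such that $$M^{n_{k}}=N^{k}+L^{k}\quad\text{for each }k\in\mathbb{N},$$ where $\{N^{k}\}_{k}\subset H^{1}(\mu,E)$ is a relatively weakly compact sequence in $H^{1}(\mu,E)$, and $\{L^{k}\}_{k}$ is a null sequence in the u.c.p. topology.
   Context: Stochastic basis: $(X,\mathscr{F},\mu)$ is a complete probability space with a filtration $\{\mathscr{F}_{t}:t\geq0\}$ of sub-$\sigma$-algebras of $\mathscr{F}$ such that $\mathscr{F}_{0}$ is the $\sigma$-algebra generated by the $\mu$-null sets and $\mathscr{F}_{t}=\bigcap_{s>t}\mathscr{F}_{s}$ for all $t\geq0$. All processes are indexed by $[0,\infty)$ and identified when they agree outside an evanescent set, i.e. a set $A\subset[0,\infty)\times X$ whose projection onto $X$ is $\mu$-null. Banach spaces are real. For an $E$-valued process $M$, $M^{\ast}_{t}=\sup_{s\leq t}\Vert M_{s}\Vert_{E}$ and $M^{\ast}_{\infty}=\sup_{t>0}M^{\ast}_{t}$. $H^{1}(\mu,E)$ is the Banach space of càdlàg $E$-valued martingales $M$ such that $M^{\ast}_{\infty}\in L^{1}(\mu)$ and such that there is a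 terminal value $M_{\infty}\in L^{1}(\mu,E)$ (Bochner space) with $M_{t}=\mathbb{E}[M_{\infty}\mid\mathscr{F}_{t}]$ for all $t\in[0,\infty)$; its norm is $M\mapsto\Vert M^{\ast}_{\infty}\Vert_{L^{1}}$. Stopping times take values in $[0,\infty]$. On $\{T=\infty\}$, $M_{T}$ is the a.e. limit $\lim_{t\to\infty}M_{t}$. $\Delta M_{t}=M_{t}-M_{t-}$ is the jump at time $t$ (with $M_{0-}=M_0$), and $\Delta M_{T}$ is set equal to $0$ on $\{T=\infty\}$. A subset of $L^{1}(\mu)$ is uniformly integrable if it is $L^{1}$-bounded and for each $\varepsilon>0$ there is $\delta>0$ such that $\int_{A}|\xi|\,d\mu\leq\varepsilon$ for all $\xi$ in the subset and all $A\in\mathscr{F}$ with $\mu(A)\leq\delta$; a set of $E$-valued random variables is uniformly integrable if the set of their $E$-norms is. The u.c.p. topology on adapted $E$-valued càdlàg processes (modulo evanescence) is given by the metric $D(M,N)=\sum_{n=1}^{\infty}2^{-n}\int_{X}1\wedge(M-N)^{\ast}_{n}\,d\mu$; a null sequence is one converging to $0$. *)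

theory Defs
  imports "HOL-Probability.Probability"
begin

definition reflexive_space :: "'e::banach itself \<Rightarrow> bool" where
  "reflexive_space _ \<longleftrightarrow>
     (\<forall>\<Phi> :: ('e \<Rightarrow>\<^sub>L real) \<Rightarrow>\<^sub>L real. \<exists>x :: 'e. \<forall>f. blinfun_apply \<Phi> f = blinfun_apply f x)"

text \<open>The library's \<^const>\<open>integrable\<close> and \<^const>\<open>lebesgue_integral\<close> require a
  second countable target, hence a separable Banach space. The usual definitions are restated here
  for an arbitrary Banach space.\<close>

definition strongly_measurable :: "'x measure \<Rightarrow> ('x \<Rightarrow> 'e::banach) \<Rightarrow> bool" where
  "strongly_measurable \<mu> f \<longleftrightarrow>
     (\<exists>s. (\<forall>i::nat. simple_function \<mu> (s i)) \<and> (AE x in \<mu>. (\<lambda>i. s i x) \<longlonglongrightarrow> f x))"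

definition bochner_approx :: "'x measure \<Rightarrow> ('x \<Rightarrow> 'e::banach) \<Rightarrow> (nat \<Rightarrow> 'x \<Rightarrow> 'e) \<Rightarrow> bool" where
  "bochner_approx \<mu> f s \<longleftrightarrow>
     (\<forall>i. Bochner_Integration.simple_bochner_integrable \<mu> (s i)) \<and>
     (\<lambda>i. \<integral>\<^sup>+x. ennreal (norm (f x - s i x)) \<partial>\<mu>) \<longlonglongrightarrow> 0"

definition bochner_integrable :: "'x measure \<Rightarrow> ('x \<Rightarrow> 'e::banach) \<Rightarrow> bool" where
  "bochner_integrable \<mu> f \<longleftrightarrow> strongly_measurable \<mu> f \<and> (\<exists>s. bochner_approx \<mu> f s)"

definition bochner_integral :: "'x measure \<Rightarrow> ('x \<Rightarrow> 'e::banach) \<Rightarrow> 'e" where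
  "bochner_integral \<mu> f =
     (THE y. \<exists>s. bochner_approx \<mu> f s \<and> (\<lambda>i. Bochner_Integration.simple_bochner_integral \<mu> (s i)) \<longlonglongrightarrow> y)"

lemma bochner_integral_eq_lebesgue_integral:
  fixes f :: "'x \<Rightarrow> 'e::{banach, second_countable_topology}"
  assumes "integrable \<mu> f"
  shows "bochner_integrable \<mu> f" and "bochner_integral \<mu> f = integral\<^sup>L \<mu> f"
proof -
  have f: "f \<in> borel_measurable \<mu>" using assms by simp
  have hb: "has_bochner_integral \<mu> f (integral\<^sup>L \<mu> f)"
    using assms by (rule has_bochner_integral_integrable)
  then obtain s where s: "bochner_approx \<mu> f s"
      "(\<lambda>i. Bochner_Integration.simple_bochner_integral \<mu> (s i)) \<longlonglongrightarrow> integral\<^sup>L \<mu> f"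
    unfolding bochner_approx_def by (auto elim!: has_bochner_integral.cases)
  obtain u where u: "\<And>i. simple_function \<mu> (u i)"
      "\<And>x. x \<in> space \<mu> \<Longrightarrow> (\<lambda>i. u i x) \<longlonglongrightarrow> f x"
    using borel_measurable_implies_sequence_metric[OF f, of 0] by blast
  have "strongly_measurable \<mu> f"
    unfolding strongly_measurable_def using u by (intro exI[of _ u]) auto
  with s(1) show "bochner_integrable \<mu> f"
    unfolding bochner_integrable_def by blast
  have "y = integral\<^sup>L \<mu> f"
    if "bochner_approx \<mu> f v" "(\<lambda>i. Bochner_Integration.simple_bochner_integral \<mu> (v i)) \<longlonglongrightarrow> y" for v y
  proof -
    have "has_bochner_integral \<mu> f y"
      using that f unfolding bochner_approx_def by (intro has_bochner_integral.intros[of f \<mu> v]) auto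
    then show ?thesis using hb by (rule has_bochner_integral_eq)
  qed
  with s show "bochner_integral \<mu> f = integral\<^sup>L \<mu> f"
    unfolding bochner_integral_def by (intro the_equality) blast+
qed

text \<open>\<open>g\<close> is a version of the conditional expectation of \<open>f\<close> given \<open>G\<close>.\<close>

definition is_cond_exp ::
    "'x measure \<Rightarrow> 'x measure \<Rightarrow> ('x \<Rightarrow> 'e::banach) \<Rightarrow> ('x \<Rightarrow> 'e) \<Rightarrow> bool" where
  "is_cond_exp \<mu> G f g \<longleftrightarrow>
     bochner_integrable (restr_to_subalg \<mu> G) g \<and>
     (\<forall>A\<in>sets G. bochner_integral \<mu> (\<lambda>x. indicat_real A x *\<^sub>R g x)
               = bochner_integral \<mu> (\<lambda>x. indicat_real A x *\<^sub>R f x))"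

text \<open>Only the $\sigma$-algebras \<open>sets (F t)\<close> for \<open>0 \<le> t\<close> matter. Monotonicity in \<open>t\<close> follows from
  right-continuity.\<close>

locale stochastic_basis = prob_space \<mu> + complete_measure \<mu> for \<mu> :: "'x measure" +
  fixes F :: "real \<Rightarrow> 'x measure"
  assumes subalgebra: "\<And>t. 0 \<le> t \<Longrightarrow> subalgebra \<mu> (F t)"
    and sets_F_0: "sets (F 0) = sigma_sets (space \<mu>) (null_sets \<mu>)"
    and right_continuous: "\<And>t. 0 \<le> t \<Longrightarrow> sets (F t) = (\<Inter>s\<in>{t<..}. sets (F s))"

text \<open>Processes are total functions of \<open>t :: real\<close>, but only their values at \<open>0 \<le> t\<close> are ever used.\<close>

type_synonym ('x, 'e) process = "real \<Rightarrow> 'x \<Rightarrow> 'e"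

definition evanescent :: "'x measure \<Rightarrow> (real \<times> 'x) set \<Rightarrow> bool" where
  "evanescent \<mu> A \<longleftrightarrow> A \<subseteq> {0..} \<times> space \<mu> \<and> snd ` A \<in> null_sets \<mu>"

definition indistinguishable ::
    "'x measure \<Rightarrow> ('x, 'e) process \<Rightarrow> ('x, 'e) process \<Rightarrow> bool" where
  "indistinguishable \<mu> M N \<longleftrightarrow>
     evanescent \<mu> {(t, x). 0 \<le> t \<and> x \<in> space \<mu> \<and> M t x \<noteq> N t x}"

definition cadlag :: "'x measure \<Rightarrow> ('x, 'e::banach) process \<Rightarrow> bool" where
  "cadlag \<mu> M \<longleftrightarrow>
     (\<forall>x\<in>space \<mu>.
        (\<forall>t\<ge>0. ((\<lambda>s. M s x) \<longlongrightarrow> M t x) (at_right t)) \<and>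
        (\<forall>t>0. \<exists>l. ((\<lambda>s. M s x) \<longlongrightarrow> l) (at_left t)))"

definition adapted ::
    "'x measure \<Rightarrow> (real \<Rightarrow> 'x measure) \<Rightarrow> ('x, 'e::banach) process \<Rightarrow> bool" where
  "adapted \<mu> F M \<longleftrightarrow> (\<forall>t\<ge>0. strongly_measurable (restr_to_subalg \<mu> (F t)) (M t))"

definition martingale ::
    "'x measure \<Rightarrow> (real \<Rightarrow> 'x measure) \<Rightarrow> ('x, 'e::banach) process \<Rightarrow> bool" where
  "martingale \<mu> F M \<longleftrightarrow>
     adapted \<mu> F M \<and> (\<forall>t\<ge>0. bochner_integrable \<mu> (M t)) \<and>
     (\<forall>s t. 0 \<le> s \<and> s \<le> t \<longrightarrow> is_cond_exp \<mu> (F s) (M t) (M s))"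

definition stopping_time_inf :: "(real \<Rightarrow> 'x measure) \<Rightarrow> ('x \<Rightarrow> ennreal) \<Rightarrow> bool" where
  "stopping_time_inf F T \<longleftrightarrow> (\<forall>t\<ge>0. Measurable.pred (F t) (\<lambda>x. T x \<le> ennreal t))"

definition stopped :: "('x, 'e::banach) process \<Rightarrow> ('x \<Rightarrow> ennreal) \<Rightarrow> 'x \<Rightarrow> 'e" where
  "stopped M T x =
     (if T x = \<infinity> then Lim at_top (\<lambda>t. M t x) else M (enn2real (T x)) x)"

definition jump :: "('x, 'e::banach) process \<Rightarrow> ('x, 'e) process" where
  "jump M t x = M t x - (if t = 0 then M 0 x else Lim (at_left t) (\<lambda>s. M s x))"

definition stopped_jump :: "('x, 'e::banach) process \<Rightarrow> ('x \<Rightarrow> ennreal) \<Rightarrow> 'x \<Rightarrow> 'e" where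
  "stopped_jump M T x = (if T x = \<infinity> then 0 else jump M (enn2real (T x)) x)"

definition unif_integrable :: "'x measure \<Rightarrow> ('x \<Rightarrow> real) set \<Rightarrow> bool" where
  "unif_integrable \<mu> S \<longleftrightarrow>
     (\<forall>\<xi>\<in>S. integrable \<mu> \<xi>) \<and>
     (\<exists>C. \<forall>\<xi>\<in>S. (\<integral>x. \<bar>\<xi> x\<bar> \<partial>\<mu>) \<le> C) \<and>
     (\<forall>\<epsilon>>0. \<exists>\<delta>>0. \<forall>\<xi>\<in>S. \<forall>A\<in>sets \<mu>. measure \<mu> A \<le> \<delta> \<longrightarrow> (LINT x:A|\<mu>. \<bar>\<xi> x\<bar>) \<le> \<epsilon>)"

definition unif_integrable_vec :: "'x measure \<Rightarrow> ('x \<Rightarrow> 'e::banach) set \<Rightarrow> bool" where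
  "unif_integrable_vec \<mu> S \<longleftrightarrow> unif_integrable \<mu> ((\<lambda>\<xi> x. norm (\<xi> x)) ` S)"

definition maximal :: "('x, 'e::banach) process \<Rightarrow> real \<Rightarrow> 'x \<Rightarrow> ennreal" where
  "maximal M t x = (\<Squnion>s\<in>{0..t}. ennreal (norm (M s x)))"

definition maximal_inf :: "('x, 'e::banach) process \<Rightarrow> 'x \<Rightarrow> ennreal" where
  "maximal_inf M x = (\<Squnion>t\<in>{0<..}. maximal M t x)"

text \<open>Elements of $H^1$ are represented by processes; \<open>H1_norm\<close> is accordingly a seminorm, vanishing
  exactly on the processes indistinguishable from \<open>0\<close>.\<close>

definition H1 ::
    "'x measure \<Rightarrow> (real \<Rightarrow> 'x measure) \<Rightarrow> ('x, 'e::banach) process set" where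
  "H1 \<mu> F = {M. cadlag \<mu> M \<and> martingale \<mu> F M \<and>
     maximal_inf M \<in> borel_measurable \<mu> \<and> (\<integral>\<^sup>+x. maximal_inf M x \<partial>\<mu>) < \<infinity> \<and>
     (\<exists>\<xi>. bochner_integrable \<mu> \<xi> \<and> (\<forall>t\<ge>0. is_cond_exp \<mu> (F t) \<xi> (M t)))}"

definition H1_norm :: "'x measure \<Rightarrow> ('x, 'e::banach) process \<Rightarrow> real" where
  "H1_norm \<mu> M = enn2real (\<integral>\<^sup>+x. maximal_inf M x \<partial>\<mu>)"

definition H1_dual ::
    "'x measure \<Rightarrow> (real \<Rightarrow> 'x measure) \<Rightarrow> (('x, 'e::banach) process \<Rightarrow> real) set" where
  "H1_dual \<mu> F = {\<phi>.
     (\<forall>M\<in>H1 \<mu> F. \<forall>N\<in>H1 \<mu> F. \<phi> (\<lambda>t x. M t x + N t x) = \<phi> M + \<phi> N) \<and>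
     (\<forall>M\<in>H1 \<mu> F. \<forall>c. \<phi> (\<lambda>t x. c *\<^sub>R M t x) = c * \<phi> M) \<and>
     (\<exists>C. \<forall>M\<in>H1 \<mu> F. \<bar>\<phi> M\<bar> \<le> C * H1_norm \<mu> M)}"

text \<open>The open sets below are the preimages of the weakly open subsets of the quotient of \<open>H1 \<mu> F\<close>
  by indistinguishability, so compactness and closures mean the same before and after passing to
  the quotient.\<close>

definition H1_weak_topology ::
    "'x measure \<Rightarrow> (real \<Rightarrow> 'x measure) \<Rightarrow> ('x, 'e::banach) process topology" where
  "H1_weak_topology \<mu> F =
     topology_generated_by {{M \<in> H1 \<mu> F. \<phi> M \<in> U} | \<phi> U. \<phi> \<in> H1_dual \<mu> F \<and> open U}"

lemma topspace_H1_weak_topology: "topspace (H1_weak_topology \<mu> F) = H1 \<mu> F"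
proof -
  have "(\<lambda>_. 0) \<in> H1_dual \<mu> F" by (auto simp: H1_dual_def intro!: exI[of _ 0])
  then have "\<exists>\<phi> U. H1 \<mu> F = {M \<in> H1 \<mu> F. \<phi> M \<in> U} \<and> \<phi> \<in> H1_dual \<mu> F \<and> open U"
    by (intro exI[of _ "\<lambda>_. 0"] exI[of _ UNIV]) auto
  then show ?thesis
    unfolding H1_weak_topology_def topology_generated_by_topspace by blast
qed

definition relatively_weakly_compact ::
    "'x measure \<Rightarrow> (real \<Rightarrow> 'x measure) \<Rightarrow> ('x, 'e::banach) process set \<Rightarrow> bool" where
  "relatively_weakly_compact \<mu> F S \<longleftrightarrow>
     S \<subseteq> H1 \<mu> F \<and> compactin (H1_weak_topology \<mu> F) (H1_weak_topology \<mu> F closure_of S)"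

definition ucp_dist ::
    "'x measure \<Rightarrow> ('x, 'e::banach) process \<Rightarrow> ('x, 'e) process \<Rightarrow> real" where
  "ucp_dist \<mu> M N =
     (\<Sum>n. (1/2) ^ Suc n *
        (\<integral>x. enn2real (min 1 (maximal (\<lambda>t x. M t x - N t x) (real (Suc n)) x)) \<partial>\<mu>))"

definition ucp_null ::
    "'x measure \<Rightarrow> (real \<Rightarrow> 'x measure) \<Rightarrow> (nat \<Rightarrow> ('x, 'e::banach) process) \<Rightarrow> bool" where
  "ucp_null \<mu> F L \<longleftrightarrow>
     (\<forall>k. cadlag \<mu> (L k) \<and> adapted \<mu> F (L k)) \<and>
     (\<lambda>k. ucp_dist \<mu> (L k) (\<lambda>t x. 0)) \<longlonglongrightarrow> 0"

end

theory Submission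
  imports Defs "HOL-Library.Function_Algebras" "HOL-Library.Diagonal_Subsequence"
begin

text \<open>Write $Y_n$ for the maximal function of $M^n$. Along a diagonal subsequence the truncated
  expectations of $Y_n \wedge m$ converge for every level $m$, fast enough that
  $Y_{n_k} \wedge c_k$ is uniformly integrable for some $c_k \to \infty$. Stop $M^{n_k}$ at the time $k + 1$
  or when its norm first exceeds $c_k$. The maximal function of the stopped martingale
  $N^k$ is at most $Y_{n_k} \wedge c_k$ plus the norm of the stopped value, respectively of
  the jump at the hitting time, so these maximal functions are uniformly integrable; $\mathscr{F}_0$ is
  trivial, so a hitting time $0$ does not occur. The hitting time is finite with probability at most
  $C / c_k$, hence $L^k = M^{n_k} - N^k$ tends to $0$ u.c.p.

  For the weak compactness let $\Psi$ in the algebraic bidual be a limit point of $(N^k)$. By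
  Hahn--Banach there is a generalized limit on bounded sequences that sends $(\varphi(N^k))_k$ to
  $\Psi(\varphi)$ for all $\varphi$ in the dual. The generalized limits of the set functions
  $A \mapsto \int_A f(N^k_\infty)$ have Radon--Nikodym densities, and reflexivity turns these
  into a single integrable $\xi$, which is a weak limit of $N^k_\infty$ in $L^1(\mu, E)$. By Mazur,
  convex combinations of the $N^k$ have terminal values converging to $\xi$ in norm and images under
  $\varphi$ converging to $\Psi(\varphi)$. Doob's maximal inequality and uniform integrability of the
  maximal functions lift this convergence to $H^1$, so $\Psi$ is evaluation at the martingale closed
  by $\xi$.\<close>

section \<open>Dominated linear functionals\<close>

text \<open>No description of the dual of H1 or of the dual of L1 enters. A functional
  \<open>\<phi>\<close> on H1 is not a function of terminal values that is continuous in L1, so weak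
  convergence there says nothing about \<open>\<phi>\<close>. The convex combinations are therefore
  chosen in the product of L1 with the real line, where they approach the terminal value and the
  number \<open>\<Psi> \<phi>\<close> at once. The limit martingale depends on the terminal value
  only and so serves all \<open>\<phi>\<close>. Generalized limits take the place of subsequences
  because a point of the closure in the bidual is only a limit along a net. The Banach space may be
  nonseparable, but a sequence of strongly measurable maps lives in a separable closed subspace,
  whose dual is separable by reflexivity. This countability allows densities for all functionals to
  be handled outside one null set. In the truncation the levels are fixed beforehand and the
  subsequence is adapted to them: bounded levels need not make the remainder null, and levels
  growing too fast for the subsequence would let mass escape.\<close>

instantiation "fun" :: (type, scaleR) scaleR
begin

definition "scaleR c f = (\<lambda>x. c *\<^sub>R f x)"
instance ..

end

lemma scaleR_fun_apply [simp]: "(c *\<^sub>R f) x = c *\<^sub>R f x"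
  by (simp add: scaleR_fun_def)

text \<open>Hahn--Banach is applied below to spaces of sequences and of random variables. With the
  pointwise vector space structure on function types each of them is a subspace of a type.\<close>

instance "fun" :: (type, real_vector) real_vector
  by standard (simp_all add: fun_eq_iff scaleR_add_right scaleR_add_left)

text \<open>Relative to a set \<open>S\<close>, since the supremum of a sequence or the integral of
  a norm behaves sublinearly only on the bounded sequences or on the integrable maps. Homogeneity is
  asked for \<open>c > 0\<close>; the case \<open>c = 2\<close> at the origin already gives
  \<open>p 0 = 0\<close>.\<close>

definition sublinear_on :: "'v::real_vector set \<Rightarrow> ('v \<Rightarrow> real) \<Rightarrow> bool" where
  "sublinear_on S p \<longleftrightarrow> (\<forall>x\<in>S. \<forall>y\<in>S. p (x + y) \<le> p x + p y) \<and> (\<forall>x\<in>S. \<forall>c>0. p (c *\<^sub>R x) = c * p x)"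

definition linear_functional_on :: "'v::real_vector set \<Rightarrow> ('v \<Rightarrow> real) \<Rightarrow> bool" where
  "linear_functional_on S \<Lambda> \<longleftrightarrow>
     (\<forall>x\<in>S. \<forall>y\<in>S. \<Lambda> (x + y) = \<Lambda> x + \<Lambda> y) \<and> (\<forall>x\<in>S. \<forall>c. \<Lambda> (c *\<^sub>R x) = c * \<Lambda> x)"

lemma sublinear_on_add: "sublinear_on S p \<Longrightarrow> x \<in> S \<Longrightarrow> y \<in> S \<Longrightarrow> p (x + y) \<le> p x + p y"
  and sublinear_on_scale: "sublinear_on S p \<Longrightarrow> x \<in> S \<Longrightarrow> c > 0 \<Longrightarrow> p (c *\<^sub>R x) = c * p x"
  by (auto simp: sublinear_on_def)

lemma sublinear_on_zero:
  assumes "sublinear_on S p" "subspace S" shows "p 0 = 0"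
  using sublinear_on_scale[OF assms(1) subspace_0[OF assms(2)], of 2] by simp

lemma sublinear_on_uminus:
  assumes "sublinear_on S p" "subspace S" "x \<in> S" shows "- p (- x) \<le> p x"
  using sublinear_on_add[OF assms(1,3) subspace_neg[OF assms(2,3)]] sublinear_on_zero[OF assms(1,2)] by simp

text \<open>The bound \<open>sc\<close>, read at the vector \<open>c *\<^sub>R x\<close> with factor
  \<open>1/c\<close>, is the missing reverse inequality.\<close>

lemma sublinear_onI_le:
  assumes "subspace S" "\<And>x y. x \<in> S \<Longrightarrow> y \<in> S \<Longrightarrow> p (x + y) \<le> p x + p y"
    and sc: "\<And>x c. x \<in> S \<Longrightarrow> c > 0 \<Longrightarrow> p (c *\<^sub>R x) \<le> c * p x"
  shows "sublinear_on S p"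
  unfolding sublinear_on_def
proof (intro conjI ballI allI impI)
  fix x and c :: real assume x: "x \<in> S" and c: "c > 0"
  have "p ((1/c) *\<^sub>R (c *\<^sub>R x)) \<le> (1/c) * p (c *\<^sub>R x)"
    using x c by (intro sc subspace_scale[OF assms(1)]) auto
  then have "c * p x \<le> p (c *\<^sub>R x)" using c by (simp add: field_simps)
  with sc[OF x c] show "p (c *\<^sub>R x) = c * p x" by simp
qed (use assms(2) in auto)

text \<open>\<open>q\<close> is an infimal convolution of \<open>p\<close> with the constraints in
  \<open>G\<close>: a linear functional below \<open>q\<close> stays below \<open>p\<close> (take
  \<open>g = 0\<close>) and satisfies \<open>a \<le> \<Lambda> w\<close> for
  \<open>(w, a) \<in> G\<close>, because \<open>q (- w) \<le> - a\<close>. Domination of the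
  constraints by \<open>p\<close> keeps the infimum finite, with lower bound
  \<open>- p (- v)\<close>.\<close>

lemma sublinear_on_inf_cone:
  fixes p :: "'v::real_vector \<Rightarrow> real"
  assumes S: "subspace S" and p: "sublinear_on S p"
    and G: "G \<subseteq> S \<times> UNIV" "(0, 0) \<in> G"
      "\<And>g h. g \<in> G \<Longrightarrow> h \<in> G \<Longrightarrow> g + h \<in> G" "\<And>g c. g \<in> G \<Longrightarrow> c > 0 \<Longrightarrow> c *\<^sub>R g \<in> G"
    and dom: "\<And>w a. (w, a) \<in> G \<Longrightarrow> a \<le> p w"
  defines "q \<equiv> \<lambda>v. INF g\<in>G. p (v + fst g) - snd g"
  shows "sublinear_on S q" "\<And>v. v \<in> S \<Longrightarrow> q v \<le> p v" "\<And>w a. (w, a) \<in> G \<Longrightarrow> q (- w) \<le> - a"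
proof -
  have lb: "- p (- v) \<le> p (v + fst g) - snd g" if "v \<in> S" "g \<in> G" for v g
  proof -
    have gS: "fst g \<in> S" using G(1) that by (cases g) auto
    have "snd g \<le> p (fst g)" using dom[of "fst g" "snd g"] that by simp
    also have "fst g = (v + fst g) + (- v)" by simp
    also have "p \<dots> \<le> p (v + fst g) + p (- v)"
      using that gS S by (intro sublinear_on_add[OF p] subspace_add subspace_neg) auto
    finally show ?thesis by simp
  qed
  have bdd: "bdd_below ((\<lambda>g. p (v + fst g) - snd g) ` G)" if "v \<in> S" for v
    by (rule bdd_belowI2[of _ "- p (- v)"]) (rule lb[OF that])
  have le: "q v \<le> p (v + fst g) - snd g" if "v \<in> S" "g \<in> G" for v g
    unfolding q_def using bdd[OF that(1)] that(2) by (rule cINF_lower)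
  have ge: "c \<le> q v" if "\<And>g. g \<in> G \<Longrightarrow> c \<le> p (v + fst g) - snd g" for c v
    unfolding q_def using G(2) that by (intro cINF_greatest) auto
  show "q v \<le> p v" if "v \<in> S" for v using le[OF that G(2)] by simp
  show "q (- w) \<le> - a" if "(w, a) \<in> G" for w a
    using le[of "- w" "(w, a)"] that G(1) sublinear_on_zero[OF p S] subspace_neg[OF S] by auto
  show "sublinear_on S q"
  proof (rule sublinear_onI_le[OF S])
    fix x y assume xy: "x \<in> S" "y \<in> S"
    have 1: "q (x + y) \<le> (p (x + fst g) - snd g) + (p (y + fst h) - snd h)" if "g \<in> G" "h \<in> G" for g h
    proof -
      have "fst g \<in> S" "fst h \<in> S" using that G(1) by (cases g; cases h; auto)+
      then have "p ((x + fst g) + (y + fst h)) \<le> p (x + fst g) + p (y + fst h)"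
        using xy by (intro sublinear_on_add[OF p] subspace_add[OF S])
      moreover have "q (x + y) \<le> p (x + y + fst (g + h)) - snd (g + h)"
        using xy that by (intro le subspace_add[OF S] G(3))
      ultimately show ?thesis by (simp add: algebra_simps)
    qed
    have "q (x + y) - (p (x + fst g) - snd g) \<le> q y" if "g \<in> G" for g
      by (rule ge) (use 1[OF that] in force)
    then have "q (x + y) - q y \<le> q x" by (intro ge) (force simp: algebra_simps)
    then show "q (x + y) \<le> q x + q y" by simp
  next
    fix x and c :: real assume x: "x \<in> S" and c: "c > 0"
    have "q (c *\<^sub>R x) / c \<le> q x"
    proof (rule ge)
      fix g assume g: "g \<in> G"
      have gS: "fst g \<in> S" using g G(1) by (cases g) auto
      have "q (c *\<^sub>R x) \<le> p (c *\<^sub>R x + fst (c *\<^sub>R g)) - snd (c *\<^sub>R g)"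
        using x g c by (intro le subspace_scale[OF S] G(4))
      also have "c *\<^sub>R x + fst (c *\<^sub>R g) = c *\<^sub>R (x + fst g)" by (simp add: scaleR_add_right)
      also have "p \<dots> = c * p (x + fst g)"
        using x gS c by (intro sublinear_on_scale[OF p] subspace_add[OF S])
      finally show "q (c *\<^sub>R x) / c \<le> p (x + fst g) - snd g"
        using c by (simp add: field_simps)
    qed
    then show "q (c *\<^sub>R x) \<le> c * q x" using c by (simp add: field_simps)
  qed
qed

text \<open>A sublinear functional that is minimal in the pointwise order is linear.\<close>

lemma sublinear_dominates_linear:
  fixes p :: "'v::real_vector \<Rightarrow> real"
  assumes S: "subspace S" and p: "sublinear_on S p"
  obtains \<Lambda> where "linear_functional_on S \<Lambda>" "\<And>v. v \<in> S \<Longrightarrow> \<Lambda> v \<le> p v"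
proof -
  \<comment> \<open>Candidates vanish off \<open>S\<close>, so that order and equality of total
    functions reflect their behaviour on \<open>S\<close>.\<close>
  define P where "P = {q. sublinear_on S q \<and> (\<forall>x\<in>S. q x \<le> p x) \<and> (\<forall>x. x \<notin> S \<longrightarrow> q x = 0)}"
  have nonempty: "(\<lambda>x. if x \<in> S then p x else 0) \<in> P"
    using p S by (auto simp: P_def sublinear_on_def subspace_add subspace_scale)
  have po: "partial_order_on P (relation_of (\<lambda>a b. b \<le> a) P)"
    by (rule partial_order_on_relation_ofI) auto
  have "\<exists>m\<in>P. \<forall>a\<in>P. a \<le> m \<longrightarrow> a = m"
  proof (rule predicate_Zorn[OF po])
    fix C assume C: "C \<in> Chains (relation_of (\<lambda>a b. b \<le> a) P)"
    have CP: "C \<subseteq> P" using C by (auto simp: Chains_def relation_of_def)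
    show "\<exists>u\<in>P. \<forall>a\<in>C. u \<le> a"
    proof (cases "C = {}")
      case False
      define u where "u x = (if x \<in> S then INF q\<in>C. q x else 0)" for x
      \<comment> \<open>A lower bound in terms of \<open>p\<close> alone, so that the infimum over a
        chain is finite.\<close>
      have lb: "- p (- x) \<le> q x" if "x \<in> S" "q \<in> C" for x q
        using that CP sublinear_on_uminus[of S q x] S subspace_neg[OF S that(1)]
        by (force simp: P_def)
      have bdd: "bdd_below ((\<lambda>q. q x) ` C)" if "x \<in> S" for x
        using lb[OF that] by (auto simp: bdd_below_def)
      have le: "u x \<le> q x" if "x \<in> S" "q \<in> C" for x q
        unfolding u_def using that bdd by (auto intro: cINF_lower)
      have ge: "c \<le> u x" if "x \<in> S" "\<And>q. q \<in> C \<Longrightarrow> c \<le> q x" for c x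
        unfolding u_def using that False by (auto intro: cINF_greatest)
      have "sublinear_on S u"
      proof (rule sublinear_onI_le[OF S])
        fix x y assume xy: "x \<in> S" "y \<in> S"
        \<comment> \<open>Of two members of a chain one is the smaller; that single \<open>q\<close>
          can be used for both summands.\<close>
        have 1: "u (x + y) \<le> q1 x + q2 y" if q: "q1 \<in> C" "q2 \<in> C" for q1 q2
        proof -
          have "q1 \<le> q2 \<or> q2 \<le> q1" using C q by (auto simp: Chains_def relation_of_def)
          then obtain q where q: "q \<in> C" "q \<le> q1" "q \<le> q2" using q by blast
          have "u (x + y) \<le> q (x + y)" using xy q by (intro le subspace_add[OF S])
          also have "\<dots> \<le> q x + q y" using CP q xy by (auto simp: P_def intro: sublinear_on_add)
          also have "\<dots> \<le> q1 x + q2 y" using q by (auto simp: le_fun_def intro: add_mono)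
          finally show ?thesis .
        qed
        have "u (x + y) - q x \<le> u y" if "q \<in> C" for q
          by (rule ge[OF xy(2)]) (use 1[OF that] in force)
        then have "u (x + y) - u y \<le> u x" by (intro ge[OF xy(1)]) (force simp: algebra_simps)
        then show "u (x + y) \<le> u x + u y" by simp
      next
        fix x and c :: real assume x: "x \<in> S" and c: "c > 0"
        have "u (c *\<^sub>R x) / c \<le> u x"
        proof (rule ge[OF x])
          fix q assume q: "q \<in> C"
          have "u (c *\<^sub>R x) \<le> q (c *\<^sub>R x)" using x q by (intro le subspace_scale[OF S])
          also have "\<dots> = c * q x" using q CP x c by (auto simp: P_def intro: sublinear_on_scale)
          finally show "u (c *\<^sub>R x) / c \<le> q x" using c by (simp add: field_simps)
        qed
        then show "u (c *\<^sub>R x) \<le> c * u x" using c by (simp add: field_simps)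
      qed
      moreover have "u x \<le> p x" if "x \<in> S" for x
      proof -
        obtain q where "q \<in> C" using False by auto
        then show ?thesis using le[OF that] CP that by (force simp: P_def)
      qed
      ultimately have "u \<in> P" by (auto simp: P_def u_def)
      moreover have "u \<le> q" if "q \<in> C" for q
      proof (rule le_funI)
        fix x show "u x \<le> q x"
          using le[of x q] that CP by (cases "x \<in> S") (auto simp: u_def P_def)
      qed
      ultimately show ?thesis by blast
    qed (use nonempty in auto)
  qed
  then obtain m where m: "m \<in> P" "\<And>a. a \<in> P \<Longrightarrow> a \<le> m \<Longrightarrow> a = m" by auto
  then have msub: "sublinear_on S m" by (simp add: P_def)
  have neg: "m (- y) = - m y" if y: "y \<in> S" for y
  proof -
    \<comment> \<open>Infimal convolution with the ray through \<open>(y, m y)\<close> gives a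
      sublinear \<open>q \<le> m\<close>, hence \<open>q = m\<close> by minimality. Its value at
      \<open>- y\<close> is at most \<open>- m y\<close>, which makes \<open>m\<close> odd and
      therefore linear.\<close>
    define G where "G = {(t *\<^sub>R y, t * m y) |t. t \<ge> 0}"
    define q where "q v = (if v \<in> S then INF g\<in>G. m (v + fst g) - snd g else 0)" for v
    have G1: "G \<subseteq> S \<times> UNIV" using y by (auto simp: G_def intro: subspace_scale[OF S])
    have G2: "(0, 0) \<in> G" by (auto simp: G_def intro!: exI[of _ 0])
    have G3: "g + h \<in> G" if "g \<in> G" "h \<in> G" for g h
      using that unfolding G_def by (auto simp flip: scaleR_add_left distrib_right)
    have G4: "c *\<^sub>R g \<in> G" if "g \<in> G" "c > 0" for g c
      using that unfolding G_def by clarsimp (metis less_eq_real_def mult.assoc mult_nonneg_nonneg)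
    have G5: "a \<le> m w" if wa: "(w, a) \<in> G" for w a
    proof -
      obtain t where t: "t \<ge> 0" "w = t *\<^sub>R y" "a = t * m y" using wa by (auto simp: G_def)
      show ?thesis
      proof (cases "t = 0")
        case True then show ?thesis using t sublinear_on_zero[OF msub S] by simp
      next
        case False then show ?thesis using t sublinear_on_scale[OF msub y, of t] by simp
      qed
    qed
    note q = sublinear_on_inf_cone[OF S msub G1 G2, OF G3 G4 G5, simplified]
    have "sublinear_on S q"
      using q(1) S by (auto simp: sublinear_on_def q_def subspace_add subspace_scale)
    moreover have qm: "q x \<le> m x" for x
      using q(2) m(1) by (auto simp: q_def P_def)
    moreover have "q x \<le> p x" if "x \<in> S" for x
      using qm[of x] m(1) that unfolding P_def by force
    moreover have "q x = 0" if "x \<notin> S" for x using that by (simp add: q_def)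
    ultimately have "q \<in> P" by (simp add: P_def)
    then have qeq: "q = m" using m(2) qm by (auto simp: le_fun_def)
    have "(y, m y) \<in> G" by (auto simp: G_def intro!: exI[of _ 1])
    then have "q (- y) \<le> - m y"
      using q(3)[of y "m y"] subspace_neg[OF S y] by (simp add: q_def)
    then have "m (- y) \<le> - m y" by (simp add: qeq)
    then show ?thesis using sublinear_on_uminus[OF msub S y] by simp
  qed
  have "linear_functional_on S m"
    unfolding linear_functional_on_def
  proof (intro conjI ballI allI)
    fix x y assume xy: "x \<in> S" "y \<in> S"
    have "m (- (x + y)) \<le> m (- x) + m (- y)"
      using sublinear_on_add[OF msub, of "- x" "- y"] xy subspace_neg[OF S] by simp
    then show "m (x + y) = m x + m y"
      using sublinear_on_add[OF msub xy] neg[OF xy(1)] neg[OF xy(2)] neg[OF subspace_add[OF S xy]] by simp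
  next
    fix x and c :: real assume x: "x \<in> S"
    consider "c > 0" | "c = 0" | "c < 0" by linarith
    then show "m (c *\<^sub>R x) = c * m x"
    proof cases
      case 3
      then have "m (- (c *\<^sub>R x)) = - c * m x"
        using sublinear_on_scale[OF msub x, of "- c"] by simp
      then show ?thesis using neg[OF subspace_scale[OF S x, of c]] by simp
    qed (use sublinear_on_scale[OF msub x] sublinear_on_zero[OF msub S] in auto)
  qed
  then show ?thesis using that m(1) by (auto simp: P_def)
qed

text \<open>Lower bounds prescribed on a convex cone unify all later uses: the graph of a functional
  as cone gives extension, a ray plus a subspace gives separation, and the cone over a convex hull
  gives Mazur's theorem.\<close>

theorem Hahn_Banach_cone:
  fixes p :: "'v::real_vector \<Rightarrow> real"
  assumes S: "subspace S" and p: "sublinear_on S p"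
    and G: "G \<subseteq> S \<times> UNIV" "(0, 0) \<in> G"
      "\<And>g h. g \<in> G \<Longrightarrow> h \<in> G \<Longrightarrow> g + h \<in> G" "\<And>g c. g \<in> G \<Longrightarrow> c > 0 \<Longrightarrow> c *\<^sub>R g \<in> G"
    and dom: "\<And>w a. (w, a) \<in> G \<Longrightarrow> a \<le> p w"
  obtains \<Lambda> where "linear_functional_on S \<Lambda>" "\<And>v. v \<in> S \<Longrightarrow> \<Lambda> v \<le> p v"
    "\<And>w a. (w, a) \<in> G \<Longrightarrow> a \<le> \<Lambda> w"
proof -
  note q = sublinear_on_inf_cone[OF S p G(1,2), OF G(3,4) dom, simplified]
  obtain \<Lambda> where \<Lambda>: "linear_functional_on S \<Lambda>"
      "\<And>v. v \<in> S \<Longrightarrow> \<Lambda> v \<le> (INF g\<in>G. p (v + fst g) - snd g)"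
    using sublinear_dominates_linear[OF S q(1)] by blast
  show ?thesis
  proof (rule that[OF \<Lambda>(1)])
    show "\<Lambda> v \<le> p v" if "v \<in> S" for v using \<Lambda>(2)[OF that] q(2)[OF that] by simp
    show "a \<le> \<Lambda> w" if wa: "(w, a) \<in> G" for w a
    proof -
      have w: "w \<in> S" using G(1) wa by auto
      have "\<Lambda> (- w) = - \<Lambda> w"
        using \<Lambda>(1) w unfolding linear_functional_on_def by (metis mult_minus1 scaleR_minus1_left)
      then show ?thesis using \<Lambda>(2)[OF subspace_neg[OF S w]] q(3)[OF wa] by simp
    qed
  qed
qed

section \<open>Continuous functionals on normed spaces\<close>

lemma linear_functional_blinfun:
  fixes \<Lambda> :: "'v::real_normed_vector \<Rightarrow> real"
  assumes "linear_functional_on UNIV \<Lambda>" "\<And>v. \<Lambda> v \<le> C * norm v" "0 \<le> C"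
  obtains f :: "'v \<Rightarrow>\<^sub>L real" where "\<And>v. blinfun_apply f v = \<Lambda> v" "norm f \<le> C"
proof -
  have lin: "\<Lambda> (x + y) = \<Lambda> x + \<Lambda> y" "\<Lambda> (c *\<^sub>R x) = c * \<Lambda> x" for x y c
    using assms(1) by (auto simp: linear_functional_on_def)
  have abs: "\<bar>\<Lambda> v\<bar> \<le> C * norm v" for v
    using assms(2)[of v] assms(2)[of "- v"] lin(2)[of "- 1" v] by (simp add: abs_le_iff)
  have bl: "bounded_linear \<Lambda>"
    by (rule bounded_linear_intro[of _ C]) (use lin abs in \<open>auto simp: mult.commute\<close>)
  have ap: "blinfun_apply (Blinfun \<Lambda>) v = \<Lambda> v" for v
    using bl by (simp add: bounded_linear_Blinfun_apply)
  show ?thesis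
    by (rule that[of "Blinfun \<Lambda>"]) (use ap abs assms(3) in \<open>auto intro: norm_blinfun_bound\<close>)
qed

lemma sublinear_on_norm: "sublinear_on UNIV (norm :: 'v::real_normed_vector \<Rightarrow> real)"
  by (auto simp: sublinear_on_def norm_triangle_ineq)

lemma sublinear_on_cmult:
  "sublinear_on S p \<Longrightarrow> 0 \<le> c \<Longrightarrow> sublinear_on S (\<lambda>v. c * p v)"
  by (auto simp: sublinear_on_def mult_left_mono simp flip: distrib_left)

text \<open>The hypothesis \<open>far\<close> says that the cone of all
  \<open>t *\<^sub>R x + w\<close>, with prescribed bound \<open>t * \<delta>\<close>, is dominated
  by \<open>p\<close>. The pairs with \<open>t = 0\<close> make \<open>\<Lambda>\<close> nonnegative
  on \<open>W\<close>, and the symmetry of \<open>W\<close> then forces it to vanish there.\<close>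

lemma Hahn_Banach_separation:
  fixes p :: "'v::real_vector \<Rightarrow> real"
  assumes p: "sublinear_on UNIV p" "\<And>v. 0 \<le> p v" and W: "subspace W"
    and far: "\<And>w. w \<in> W \<Longrightarrow> \<delta> \<le> p (x + w)"
  obtains \<Lambda> where "linear_functional_on UNIV \<Lambda>" "\<And>v. \<Lambda> v \<le> p v" "\<delta> \<le> \<Lambda> x" "\<And>w. w \<in> W \<Longrightarrow> \<Lambda> w = 0"
proof -
  define G where "G = {(t *\<^sub>R x + w, t * \<delta>) |t w. t \<ge> 0 \<and> w \<in> W}"
  have GI: "(t *\<^sub>R x + w, t * \<delta>) \<in> G" if "t \<ge> 0" "w \<in> W" for t w
    using that by (auto simp: G_def)
  have GE: "\<exists>t w. g = (t *\<^sub>R x + w, t * \<delta>) \<and> t \<ge> 0 \<and> w \<in> W" if "g \<in> G" for g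
    using that by (auto simp: G_def)
  have 2: "(0, 0) \<in> G" using GI[of 0 0] subspace_0[OF W] by simp
  have 3: "g + h \<in> G" if gh: "g \<in> G" "h \<in> G" for g h
  proof -
    obtain t w where g: "g = (t *\<^sub>R x + w, t * \<delta>)" "t \<ge> 0" "w \<in> W" using GE[OF gh(1)] by blast
    obtain s u where h: "h = (s *\<^sub>R x + u, s * \<delta>)" "s \<ge> 0" "u \<in> W" using GE[OF gh(2)] by blast
    have "g + h = ((t + s) *\<^sub>R x + (w + u), (t + s) * \<delta>)" by (simp add: g h algebra_simps)
    moreover have "((t + s) *\<^sub>R x + (w + u), (t + s) * \<delta>) \<in> G"
      using g h by (intro GI subspace_add[OF W]) auto
    ultimately show ?thesis by simp
  qed
  have 4: "c *\<^sub>R g \<in> G" if gc: "g \<in> G" "c > 0" for g c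
  proof -
    obtain t w where g: "g = (t *\<^sub>R x + w, t * \<delta>)" "t \<ge> 0" "w \<in> W" using GE[OF gc(1)] by blast
    have "c *\<^sub>R g = ((c * t) *\<^sub>R x + c *\<^sub>R w, (c * t) * \<delta>)" by (simp add: g algebra_simps)
    then show ?thesis using GI[of "c * t" "c *\<^sub>R w"] g gc subspace_scale[OF W] by (simp add: mult.assoc)
  qed
  have 5: "a \<le> p v" if va: "(v, a) \<in> G" for v a
  proof -
    obtain t w where g: "v = t *\<^sub>R x + w" "a = t * \<delta>" "t \<ge> 0" "w \<in> W" using GE[OF va] by blast
    show ?thesis
    proof (cases "t = 0")
      case False
      have "\<delta> \<le> p (x + (1 / t) *\<^sub>R w)" using g by (intro far subspace_scale[OF W])
      then have "t * \<delta> \<le> t * p (x + (1 / t) *\<^sub>R w)" using g by (simp add: mult_left_mono)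
      also have "\<dots> = p (t *\<^sub>R (x + (1 / t) *\<^sub>R w))" using g False sublinear_on_scale[OF p(1), of _ t] by simp
      also have "t *\<^sub>R (x + (1 / t) *\<^sub>R w) = v" using False g by (simp add: scaleR_add_right)
      finally show ?thesis using g by simp
    qed (use g p in auto)
  qed
  obtain \<Lambda> where \<Lambda>: "linear_functional_on UNIV \<Lambda>" "\<And>v. \<Lambda> v \<le> p v" "\<And>w a. (w, a) \<in> G \<Longrightarrow> a \<le> \<Lambda> w"
    using Hahn_Banach_cone[OF subspace_UNIV p(1) _ 2, OF _ 3 4 5] by auto
  show ?thesis
  proof (rule that[OF \<Lambda>(1,2)])
    show "\<delta> \<le> \<Lambda> x" using \<Lambda>(3)[of x \<delta>] GI[of 1 0] subspace_0[OF W] by simp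
    show "\<Lambda> w = 0" if w: "w \<in> W" for w
    proof -
      have "0 \<le> \<Lambda> w" "0 \<le> \<Lambda> (- w)"
        using \<Lambda>(3)[of w 0] \<Lambda>(3)[of "- w" 0] GI[of 0 w] GI[of 0 "- w"] w subspace_neg[OF W w] by auto
      moreover have "\<Lambda> (- w) = - \<Lambda> w"
        using \<Lambda>(1) unfolding linear_functional_on_def by (metis UNIV_I mult_minus1 scaleR_minus1_left)
      ultimately show ?thesis by simp
    qed
  qed
qed

lemma norming_functional:
  fixes x :: "'v::real_normed_vector"
  obtains f :: "'v \<Rightarrow>\<^sub>L real" where "norm f \<le> 1" "blinfun_apply f x = norm x"
proof -
  obtain \<Lambda> :: "'v \<Rightarrow> real" where \<Lambda>: "linear_functional_on UNIV \<Lambda>" "\<And>v. \<Lambda> v \<le> norm v" "norm x \<le> \<Lambda> x"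
    using Hahn_Banach_separation[OF sublinear_on_norm norm_ge_zero, of "{0}" "norm x" x] by auto
  obtain f :: "'v \<Rightarrow>\<^sub>L real" where f: "\<And>v. blinfun_apply f v = \<Lambda> v" "norm f \<le> 1"
    using linear_functional_blinfun[OF \<Lambda>(1), of 1] \<Lambda>(2) by auto
  show ?thesis
    by (rule that[of f]) (use f \<Lambda>(2)[of x] \<Lambda>(3) in auto)
qed

lemma blinfun_le_norm: "norm (f :: 'v::real_normed_vector \<Rightarrow>\<^sub>L real) \<le> 1 \<Longrightarrow> \<bar>blinfun_apply f x\<bar> \<le> norm x"
  using norm_blinfun[of f x] mult_right_mono[of "norm f" 1 "norm x"] by simp

lemma blinfun_separates: "(\<And>f :: 'v::real_normed_vector \<Rightarrow>\<^sub>L real. blinfun_apply f x = blinfun_apply f y) \<Longrightarrow> x = y"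
proof -
  assume *: "\<And>f :: 'v \<Rightarrow>\<^sub>L real. blinfun_apply f x = blinfun_apply f y"
  obtain f :: "'v \<Rightarrow>\<^sub>L real" where "blinfun_apply f (x - y) = norm (x - y)"
    using norming_functional by blast
  then show "x = y" using * by (simp add: blinfun.diff_right)
qed

text \<open>A point off a closed set has a positive distance from it, and this distance is the gap
  that separation needs.\<close>

lemma separating_functional:
  fixes x :: "'v::real_normed_vector"
  assumes "subspace E" "closed E" "x \<notin> E"
  obtains f :: "'v \<Rightarrow>\<^sub>L real" where "\<And>w. w \<in> E \<Longrightarrow> blinfun_apply f w = 0" "blinfun_apply f x \<noteq> 0"
proof -
  obtain \<delta> where \<delta>: "\<delta> > 0" "ball x \<delta> \<subseteq> - E"
    using assms(2,3) open_contains_ball[of "- E"] by (auto simp: open_Compl)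
  have far: "\<delta> \<le> norm (x + w)" if "w \<in> E" for w
    using \<delta>(2) subspace_neg[OF assms(1) that] by (force simp: subset_iff dist_norm not_less)
  obtain \<Lambda> where \<Lambda>: "linear_functional_on UNIV \<Lambda>" "\<And>v. \<Lambda> v \<le> norm v" "\<delta> \<le> \<Lambda> x" "\<And>w. w \<in> E \<Longrightarrow> \<Lambda> w = 0"
    using Hahn_Banach_separation[OF sublinear_on_norm norm_ge_zero assms(1) far] by auto
  obtain f :: "'v \<Rightarrow>\<^sub>L real" where f: "\<And>v. blinfun_apply f v = \<Lambda> v" "norm f \<le> 1"
    using linear_functional_blinfun[OF \<Lambda>(1), of 1] \<Lambda>(2) by auto
  show ?thesis
    by (rule that[of f]) (use f \<Lambda> \<delta>(1) in auto)
qed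

section \<open>Rational combinations and moment problems\<close>

text \<open>The coefficients form a countable type: inequalities for all combinations can hold
  outside a single null set, and the combinations can be enumerated.\<close>

definition rat_comb :: "(nat \<Rightarrow> 'v::real_vector) \<Rightarrow> rat list \<Rightarrow> 'v" where
  "rat_comb z q = (\<Sum>i<length q. of_rat (q ! i) *\<^sub>R z i)"

lemma span_range_sequence:
  fixes z :: "nat \<Rightarrow> 'v::real_vector"
  assumes "v \<in> span (range z)"
  obtains n r where "v = (\<Sum>i<n. r i *\<^sub>R z i)"
proof -
  have "\<exists>n r. v = (\<Sum>i<n. r i *\<^sub>R z i)"
    using assms
  proof (induction rule: span_induct_alt)
    case base then show ?case by (intro exI[of _ 0]) auto
  next
    case (step c x y)
    then obtain j n r where x: "x = z j" and y: "y = (\<Sum>i<n. r i *\<^sub>R z i)" by auto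
    define m where "m = max n (Suc j)"
    have "(\<Sum>i<m. (if i < n then r i else 0) *\<^sub>R z i) = y"
      unfolding y by (rule sum.mono_neutral_cong_right) (auto simp: m_def)
    moreover have "(\<Sum>i<m. (if i = j then c else 0) *\<^sub>R z i) = c *\<^sub>R x"
    proof -
      have "(\<Sum>i<m. (if i = j then c else 0) *\<^sub>R z i) = (\<Sum>i\<in>{j}. c *\<^sub>R z i)"
        by (rule sum.mono_neutral_cong_right) (auto simp: m_def)
      then show ?thesis by (simp add: x)
    qed
    ultimately have "c *\<^sub>R x + y = (\<Sum>i<m. ((if i = j then c else 0) + (if i < n then r i else 0)) *\<^sub>R z i)"
      by (simp add: scaleR_add_left sum.distrib)
    then show ?case by (intro exI[of _ m] exI[of _ "\<lambda>i. (if i = j then c else 0) + (if i < n then r i else 0)"])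
  qed
  then show ?thesis using that by auto
qed

lemma rat_list_approx:
  fixes r w :: "nat \<Rightarrow> real"
  assumes "\<epsilon> > 0" "\<And>i. 0 \<le> w i"
  obtains q where "length q = n" "(\<Sum>i<n. \<bar>r i - of_rat (q ! i)\<bar> * w i) < \<epsilon>"
proof -
  \<comment> \<open>\<open>1 + w i\<close> avoids division by a vanishing weight, and
    \<open>Suc n\<close> instead of \<open>n\<close> keeps the sum of \<open>n\<close> errors
    strictly below \<open>\<epsilon>\<close>.\<close>
  define \<eta> where "\<eta> i = \<epsilon> / (real (Suc n) * (1 + w i))" for i
  have \<eta>: "\<eta> i > 0" for i
    using assms(1) assms(2)[of i] unfolding \<eta>_def by (intro divide_pos_pos mult_pos_pos) auto
  have "\<exists>s::rat. r i < of_rat s \<and> of_rat s < r i + \<eta> i" for i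
    using \<eta>[of i] of_rat_dense[of "r i" "r i + \<eta> i"] by auto
  then obtain s where s: "\<And>i. r i < of_rat (s i)" "\<And>i. of_rat (s i) < r i + \<eta> i" by metis
  define q where "q = map s [0..<n]"
  have "\<bar>r i - of_rat (q ! i)\<bar> * w i \<le> \<epsilon> / real (Suc n)" if "i < n" for i
  proof -
    have "\<bar>r i - of_rat (q ! i)\<bar> * w i \<le> \<eta> i * w i"
      using s[of i] that assms(2)[of i] by (intro mult_right_mono) (auto simp: q_def)
    also have "\<dots> \<le> \<eta> i * (1 + w i)" using \<eta>[of i] by simp
    also have "\<dots> = \<epsilon> / real (Suc n)"
    proof -
      have "1 + w i \<noteq> 0" using assms(2)[of i] by linarith
      then show ?thesis unfolding \<eta>_def by simp
    qed
    finally show ?thesis .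
  qed
  then have "(\<Sum>i<n. \<bar>r i - of_rat (q ! i)\<bar> * w i) \<le> (\<Sum>i<n. \<epsilon> / real (Suc n))"
    by (intro sum_mono) auto
  also have "\<dots> < \<epsilon>" using assms(1) by (simp add: field_simps)
  finally show ?thesis using that[of q] by (simp add: q_def)
qed

lemma sublinear_on_sum_le:
  fixes p :: "'v::real_vector \<Rightarrow> real"
  assumes p: "sublinear_on UNIV p" and "\<And>v. p (- v) = p v"
  shows "p (\<Sum>i<n. r i *\<^sub>R z i) \<le> (\<Sum>i<n::nat. \<bar>r i\<bar> * p (z i))"
proof -
  have sc: "p (c *\<^sub>R v) = \<bar>c\<bar> * p v" for c v
  proof -
    consider "c > 0" | "c = 0" | "c < 0" by linarith
    then show ?thesis
    proof cases
      case 3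
      then have "p (- (c *\<^sub>R v)) = - c * p v" using sublinear_on_scale[OF p, of v "- c"] by simp
      then show ?thesis using assms(2) 3 by simp
    qed (use sublinear_on_scale[OF p] sublinear_on_zero[OF p] in auto)
  qed
  show ?thesis
  proof (induction n)
    case 0 then show ?case using sublinear_on_zero[OF p] by simp
  next
    case (Suc n)
    then show ?case using sublinear_on_add[OF p, of "\<Sum>i<n. r i *\<^sub>R z i" "r n *\<^sub>R z n"] sc by simp
  qed
qed

text \<open>For an arbitrary seminorm, as it will serve the norm of the space, the dual seminorm and
  a seminorm on pairs.\<close>

lemma rat_comb_dense:
  fixes z :: "nat \<Rightarrow> 'v::real_vector"
  assumes p: "sublinear_on UNIV p" "\<And>v. p (- v) = p v" "\<And>v. 0 \<le> p v"
    and v: "v \<in> span (range z)" and "\<epsilon> > 0"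
  obtains q where "p (v - rat_comb z q) < \<epsilon>"
proof -
  obtain n r where r: "v = (\<Sum>i<n. r i *\<^sub>R z i)" using span_range_sequence[OF v] .
  obtain q where q: "length q = n" "(\<Sum>i<n. \<bar>r i - of_rat (q ! i)\<bar> * p (z i)) < \<epsilon>"
    using rat_list_approx[OF \<open>\<epsilon> > 0\<close>, of "\<lambda>i. p (z i)" n r] p by blast
  have "v - rat_comb z q = (\<Sum>i<n. (r i - of_rat (q ! i)) *\<^sub>R z i)"
    by (simp add: r rat_comb_def q sum_subtractf scaleR_diff_left)
  then have "p (v - rat_comb z q) < \<epsilon>"
    using sublinear_on_sum_le[OF p(1,2), of "\<lambda>i. r i - of_rat (q ! i)" z n] q(2) by simp
  then show ?thesis using that by blast
qed

text \<open>Helly's moment condition. By density the rational inequalities bound the whole span of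
  the pairs \<open>(z i, a i)\<close> by \<open>c * p\<close>; taken as the cone in Hahn--Banach,
  this span prescribes the lower bounds \<open>a i\<close> at \<open>z i\<close> and
  \<open>- a i\<close> at \<open>- z i\<close>.\<close>

lemma moment_functional:
  fixes p :: "'v::real_vector \<Rightarrow> real" and a :: "nat \<Rightarrow> real"
  assumes p: "sublinear_on UNIV p" "\<And>v. p (- v) = p v" "\<And>v. 0 \<le> p v" and c: "0 \<le> c"
    and a: "\<And>q. \<bar>rat_comb a q\<bar> \<le> c * p (rat_comb z q)"
  obtains \<Lambda> where "linear_functional_on UNIV \<Lambda>" "\<And>v. \<Lambda> v \<le> c * p v" "\<And>i. \<Lambda> (z i) = a i"
proof -
  define G where "G = span (range (\<lambda>i. (z i, a i)))"
  have G: "subspace G" by (simp add: G_def)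
  have dom: "b \<le> c * p w" if wb: "(w, b) \<in> G" for w b
  proof (rule field_le_epsilon)
    fix \<epsilon> :: real assume "\<epsilon> > 0"
    \<comment> \<open>Measuring vectors and moments together lets the same rational coefficients
      approximate both.\<close>
    define P where "P x = c * p (fst x) + \<bar>snd x\<bar>" for x :: "'v \<times> real"
    have "sublinear_on UNIV P"
    proof (rule sublinear_onI_le[OF subspace_UNIV])
      fix x y :: "'v \<times> real"
      have "c * p (fst x + fst y) \<le> c * (p (fst x) + p (fst y))"
        using c by (intro mult_left_mono sublinear_on_add[OF p(1)]) auto
      then show "P (x + y) \<le> P x + P y"
        using abs_triangle_ineq[of "snd x" "snd y"] by (simp add: P_def distrib_left)
    next
      fix x :: "'v \<times> real" and t :: real assume "t > 0"
      then show "P (t *\<^sub>R x) \<le> t * P x"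
        using sublinear_on_scale[OF p(1), of "fst x" t] by (simp add: P_def abs_mult algebra_simps)
    qed
    moreover have "P (- v) = P v" "0 \<le> P v" for v using p c by (auto simp: P_def)
    ultimately obtain q where "P ((w, b) - rat_comb (\<lambda>i. (z i, a i)) q) < \<epsilon>"
      using rat_comb_dense[of P "(w, b)" "\<lambda>i. (z i, a i)" \<epsilon>] wb \<open>\<epsilon> > 0\<close> unfolding G_def by blast
    moreover have "rat_comb (\<lambda>i. (z i, a i)) q = (rat_comb z q, rat_comb a q)"
      by (simp add: rat_comb_def prod_eq_iff fst_sum snd_sum)
    ultimately have *: "c * p (w - rat_comb z q) + \<bar>b - rat_comb a q\<bar> < \<epsilon>" by (simp add: P_def)
    have "p (rat_comb z q) \<le> p w + p (rat_comb z q - w)"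
      using sublinear_on_add[OF p(1), of w "rat_comb z q - w"] by simp
    also have "p (rat_comb z q - w) = p (w - rat_comb z q)" using p(2)[of "w - rat_comb z q"] by simp
    finally have "c * p (rat_comb z q) \<le> c * p w + c * p (w - rat_comb z q)"
      using c by (metis mult_left_mono distrib_left)
    then show "b \<le> c * p w + \<epsilon>" using * a[of q] by linarith
  qed
  obtain \<Lambda> where \<Lambda>: "linear_functional_on UNIV \<Lambda>" "\<And>v. \<Lambda> v \<le> c * p v" "\<And>w b. (w, b) \<in> G \<Longrightarrow> b \<le> \<Lambda> w"
    using Hahn_Banach_cone[OF subspace_UNIV sublinear_on_cmult[OF p(1) c], of G]
      subspace_0[OF G] subspace_add[OF G] subspace_scale[OF G] dom
    unfolding zero_prod_def by auto
  have "\<Lambda> (z i) = a i" for i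
  proof (rule antisym)
    have g: "(z i, a i) \<in> G" unfolding G_def by (intro span_base) auto
    then show "a i \<le> \<Lambda> (z i)" by (rule \<Lambda>)
    have "(- z i, - a i) \<in> G" using subspace_neg[OF G g] by simp
    then have "- a i \<le> \<Lambda> (- z i)" by (rule \<Lambda>)
    also have "\<Lambda> (- z i) = - \<Lambda> (z i)"
      using \<Lambda>(1) unfolding linear_functional_on_def by (metis UNIV_I mult_minus1 scaleR_minus1_left)
    finally show "\<Lambda> (z i) \<le> a i" by simp
  qed
  then show ?thesis using that \<Lambda> by blast
qed

section \<open>Separable subspaces of a reflexive space\<close>

text \<open>The norm of the restriction of \<open>f\<close> to \<open>E\<close>, kept as a seminorm
  on the dual of the whole space, so that functionals on \<open>E\<close> need no type of their
  own.\<close>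

definition dual_seminorm :: "'v::real_normed_vector set \<Rightarrow> ('v \<Rightarrow>\<^sub>L real) \<Rightarrow> real" where
  "dual_seminorm E f = (SUP v\<in>{v\<in>E. norm v \<le> 1}. \<bar>blinfun_apply f v\<bar>)"

context
  fixes E :: "'v::real_normed_vector set"
  assumes E: "subspace E"
begin

lemma dual_seminorm_bdd:
  fixes f :: "'v \<Rightarrow>\<^sub>L real"
  shows "bdd_above ((\<lambda>v. \<bar>blinfun_apply f v\<bar>) ` {v\<in>E. norm v \<le> 1})"
proof (rule bdd_aboveI2)
  fix v assume "v \<in> {v\<in>E. norm v \<le> 1}"
  then show "\<bar>blinfun_apply f v\<bar> \<le> norm f"
    using norm_blinfun[of f v] mult_left_mono[of "norm v" 1 "norm f"] by simp
qed

lemma dual_seminorm_least: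
  assumes "\<And>v. v \<in> E \<Longrightarrow> \<bar>blinfun_apply f v\<bar> \<le> C * norm v" "0 \<le> C"
  shows "dual_seminorm E f \<le> C"
  unfolding dual_seminorm_def
proof (rule cSUP_least)
  show "{v \<in> E. norm v \<le> 1} \<noteq> {}" using subspace_0[OF E] by force
  fix v assume v: "v \<in> {v\<in>E. norm v \<le> 1}"
  then have "C * norm v \<le> C" using assms(2) mult_left_mono[of "norm v" 1 C] by simp
  then show "\<bar>blinfun_apply f v\<bar> \<le> C" using assms(1)[of v] v by simp
qed

lemma dual_seminorm_nonneg: "0 \<le> dual_seminorm E f"
  using cSUP_upper[OF _ dual_seminorm_bdd[of f], of 0] subspace_0[OF E] by (simp add: dual_seminorm_def)

lemma dual_seminorm_bound: assumes v: "v \<in> E" shows "\<bar>blinfun_apply f v\<bar> \<le> dual_seminorm E f * norm v"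
proof (cases "v = 0")
  case False
  have "\<bar>blinfun_apply f ((1 / norm v) *\<^sub>R v)\<bar> \<le> dual_seminorm E f"
    unfolding dual_seminorm_def using v False subspace_scale[OF E v]
    by (intro cSUP_upper dual_seminorm_bdd) auto
  then show ?thesis using False by (simp add: blinfun.scaleR_right field_simps)
qed simp

lemma dual_seminorm_le_norm: "dual_seminorm E f \<le> norm f"
  using norm_blinfun[of f] by (intro dual_seminorm_least) auto

lemma dual_seminorm_uminus: "dual_seminorm E (- f) = dual_seminorm E f"
  by (simp add: dual_seminorm_def blinfun.minus_left)

lemma sublinear_on_dual_seminorm: "sublinear_on UNIV (dual_seminorm E)"
proof (rule sublinear_onI_le[OF subspace_UNIV])
  fix f g :: "'v \<Rightarrow>\<^sub>L real"
  show "dual_seminorm E (f + g) \<le> dual_seminorm E f + dual_seminorm E g"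
  proof (rule dual_seminorm_least)
    fix v assume "v \<in> E"
    then show "\<bar>blinfun_apply (f + g) v\<bar> \<le> (dual_seminorm E f + dual_seminorm E g) * norm v"
      using dual_seminorm_bound[of v f] dual_seminorm_bound[of v g] by (simp add: blinfun.add_left distrib_right)
  qed (simp add: dual_seminorm_nonneg)
next
  fix f :: "'v \<Rightarrow>\<^sub>L real" and c :: real assume "c > 0"
  then show "dual_seminorm E (c *\<^sub>R f) \<le> c * dual_seminorm E f"
    using dual_seminorm_bound[of _ f] dual_seminorm_nonneg
    by (intro dual_seminorm_least) (auto simp: blinfun.scaleR_left abs_mult)
qed

lemma dual_seminorm_diff_triangle:
  "dual_seminorm E (f - h) \<le> dual_seminorm E (f - g) + dual_seminorm E (g - h)"
  using sublinear_on_add[OF sublinear_on_dual_seminorm, of "f - g" "g - h"] by simp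

text \<open>Closed subspaces inherit reflexivity. The bound by the seminorm implies one by the norm,
  which yields a representing point of the whole space. If it lay outside \<open>E\<close>, a
  functional vanishing on \<open>E\<close> but not at this point would have seminorm
  \<open>0\<close>, against \<open>le\<close>.\<close>

lemma reflexive_functional_in_subspace:
  fixes \<Lambda> :: "('v \<Rightarrow>\<^sub>L real) \<Rightarrow> real"
  assumes refl: "\<And>\<Phi> :: ('v \<Rightarrow>\<^sub>L real) \<Rightarrow>\<^sub>L real. \<exists>x :: 'v. \<forall>f. blinfun_apply \<Phi> f = blinfun_apply f x"
    and cl: "closed E" and \<Lambda>: "linear_functional_on UNIV \<Lambda>"
    and le: "\<And>f. \<Lambda> f \<le> c * dual_seminorm E f" and c: "0 \<le> c"
  obtains x where "x \<in> E" "norm x \<le> c" "\<And>f. \<Lambda> f = blinfun_apply f x"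
proof -
  have "\<Lambda> f \<le> c * norm f" for f
    using le[of f] mult_left_mono[OF dual_seminorm_le_norm c] by (rule order_trans)
  then obtain \<Phi> where \<Phi>: "\<And>f. blinfun_apply \<Phi> f = \<Lambda> f"
    using linear_functional_blinfun[OF \<Lambda> _ c] by blast
  obtain x where x: "\<And>f. \<Lambda> f = blinfun_apply f x" using refl[of \<Phi>] \<Phi> by auto
  show ?thesis
  proof (rule that[OF _ _ x])
    show "x \<in> E"
    proof (rule ccontr)
      assume "x \<notin> E"
      then obtain f :: "'v \<Rightarrow>\<^sub>L real" where f: "\<And>w. w \<in> E \<Longrightarrow> blinfun_apply f w = 0" "blinfun_apply f x \<noteq> 0"
        using separating_functional[OF E cl] by blast
      have "dual_seminorm E f \<le> 0" "dual_seminorm E (- f) \<le> 0"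
        using f(1) by (auto intro!: dual_seminorm_least simp: blinfun.minus_left)
      then have "dual_seminorm E f = 0" "dual_seminorm E (- f) = 0" using dual_seminorm_nonneg by (auto intro: antisym)
      then have "blinfun_apply f x \<le> 0" "- blinfun_apply f x \<le> 0"
        using le[of f] le[of "- f"] x[of f] x[of "- f"] by (auto simp: blinfun.minus_left)
      then show False using f(2) by simp
    qed
    obtain f :: "'v \<Rightarrow>\<^sub>L real" where f: "norm f \<le> 1" "blinfun_apply f x = norm x"
      using norming_functional by blast
    have "norm x \<le> c * dual_seminorm E f" using le[of f] x[of f] f by simp
    also have "\<dots> \<le> c * 1" using dual_seminorm_le_norm[of f] f c by (intro mult_left_mono) auto
    finally show "norm x \<le> c" by simp
  qed
qed

end

lemma subspace_closure:
  fixes S :: "'v::real_normed_vector set"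
  assumes "subspace S" shows "subspace (closure S)"
proof (rule subspaceI)
  show "0 \<in> closure S" using closure_subset subspace_0[OF assms] by blast
next
  fix x y assume "x \<in> closure S" "y \<in> closure S"
  then obtain f g where fg: "\<And>n. f n \<in> S" "f \<longlonglongrightarrow> x" "\<And>n. g n \<in> S" "g \<longlonglongrightarrow> y"
    unfolding closure_sequential by blast
  then show "x + y \<in> closure S"
    unfolding closure_sequential using tendsto_add[OF fg(2,4)] subspace_add[OF assms] by fast
next
  fix c x assume "x \<in> closure S"
  then obtain f where f: "\<And>n. f n \<in> S" "f \<longlonglongrightarrow> x"
    unfolding closure_sequential by blast
  then show "c *\<^sub>R x \<in> closure S"
    unfolding closure_sequential using tendsto_scaleR[OF tendsto_const f(2)] subspace_scale[OF assms] by fast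
qed

text \<open>Functionals norming a dense sequence of \<open>E\<close> span a subspace that is dense
  for the seminorm. Otherwise Hahn--Banach and reflexivity would give a nonzero point of
  \<open>E\<close> annihilated by all of them, and no member of the dense sequence could come close
  to it.\<close>

lemma dual_seminorm_separable:
  fixes z :: "nat \<Rightarrow> 'v::real_normed_vector"
  assumes refl: "\<And>\<Phi> :: ('v \<Rightarrow>\<^sub>L real) \<Rightarrow>\<^sub>L real. \<exists>x :: 'v. \<forall>f. blinfun_apply \<Phi> f = blinfun_apply f x"
  defines "E \<equiv> closure (span (range z))"
  obtains d :: "nat \<Rightarrow> 'v \<Rightarrow>\<^sub>L real" where "\<And>f \<epsilon>. \<epsilon> > 0 \<Longrightarrow> \<exists>i. dual_seminorm E (f - d i) < \<epsilon>"
proof -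
  have E: "subspace E" "closed E" by (simp_all add: E_def subspace_closure)
  define y where "y i = rat_comb z (from_nat i)" for i
  have y: "\<exists>i. norm (v - y i) < \<epsilon>" if v: "v \<in> E" and \<epsilon>: "\<epsilon> > 0" for v \<epsilon>
  proof -
    obtain w where w: "w \<in> span (range z)" "norm (w - v) < \<epsilon> / 2"
      using v \<epsilon> unfolding E_def closure_approachable dist_norm by (meson half_gt_zero)
    obtain q where "norm (w - rat_comb z q) < \<epsilon> / 2"
      using rat_comb_dense[OF sublinear_on_norm _ _ w(1), of "\<epsilon> / 2"] \<epsilon> by auto
    then have "norm (v - rat_comb z q) < \<epsilon>"
      using w(2) norm_triangle_ineq[of "v - w" "w - rat_comb z q"] by (simp add: norm_minus_commute)
    then show ?thesis by (intro exI[of _ "to_nat q"]) (simp add: y_def)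
  qed
  have "\<exists>f :: 'v \<Rightarrow>\<^sub>L real. norm f \<le> 1 \<and> blinfun_apply f (y i) = norm (y i)" for i
    using norming_functional by blast
  then obtain F :: "nat \<Rightarrow> 'v \<Rightarrow>\<^sub>L real" where F: "\<And>i. norm (F i) \<le> 1" "\<And>i. blinfun_apply (F i) (y i) = norm (y i)"
    by metis
  define p where "p = dual_seminorm E"
  have p: "sublinear_on UNIV p" "p (- f) = p f" "0 \<le> p f" for f
    using sublinear_on_dual_seminorm[OF E(1)] dual_seminorm_uminus[OF E(1)] dual_seminorm_nonneg[OF E(1)] by (auto simp: p_def)
  have dense: "\<exists>g\<in>span (range F). p (f - g) < \<epsilon>" if \<epsilon>: "\<epsilon> > 0" for f \<epsilon>
  proof (rule ccontr)
    assume "\<not> ?thesis"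
    then have far: "\<epsilon> \<le> p (f - g)" if "g \<in> span (range F)" for g using that by (meson not_less)
    have far': "\<epsilon> \<le> p (f + g)" if "g \<in> span (range F)" for g
      using far[OF span_neg[OF that]] by simp
    obtain \<Lambda> where \<Lambda>: "linear_functional_on UNIV \<Lambda>" "\<And>v. \<Lambda> v \<le> p v" "\<epsilon> \<le> \<Lambda> f"
        "\<And>w. w \<in> span (range F) \<Longrightarrow> \<Lambda> w = 0"
      using Hahn_Banach_separation[OF p(1,3) subspace_span far'] by auto
    obtain x where x: "x \<in> E" "norm x \<le> 1" "\<And>f. \<Lambda> f = blinfun_apply f x"
      using reflexive_functional_in_subspace[OF E(1) refl E(2) \<Lambda>(1), of 1] \<Lambda>(2) by (auto simp: p_def)
    have Fx: "blinfun_apply (F i) x = 0" for i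
      using \<Lambda>(4)[of "F i"] x(3)[of "F i"] by (auto intro: span_base)
    have "blinfun_apply f x > 0" using \<Lambda>(3) \<epsilon> x(3) by simp
    then have "x \<noteq> 0" by auto
    \<comment> \<open>Since \<open>F i\<close> vanishes at \<open>x\<close>, the norm of
      \<open>y i\<close> is at most \<open>norm (x - y i)\<close>; so \<open>norm x\<close> would be
      less than two thirds of itself.\<close>
    then obtain i where i: "norm (x - y i) < norm x / 3" using y[OF x(1), of "norm x / 3"] by auto
    have "\<bar>blinfun_apply (F i) (x - y i)\<bar> \<le> norm (x - y i)" using F(1) by (rule blinfun_le_norm)
    then have "norm (y i) \<le> norm (x - y i)" using Fx[of i] F(2)[of i] by (simp add: blinfun.diff_right)
    then show False using i norm_triangle_ineq[of "x - y i" "y i"] norm_ge_zero[of "x - y i"] by simp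
  qed
  show ?thesis
  proof (rule that[of "\<lambda>i. rat_comb F (from_nat i)"])
    fix f \<epsilon> assume "(\<epsilon>::real) > 0"
    then obtain g where g: "g \<in> span (range F)" "p (f - g) < \<epsilon> / 2" using dense[of "\<epsilon> / 2" f] by auto
    obtain q where q: "p (g - rat_comb F q) < \<epsilon> / 2"
      using rat_comb_dense[OF p g(1), of "\<epsilon> / 2"] \<open>\<epsilon> > 0\<close> by auto
    have "p (f - rat_comb F q) < \<epsilon>"
      using g(2) q dual_seminorm_diff_triangle[OF E(1), of f "rat_comb F q" g] by (simp add: p_def)
    then show "\<exists>i. dual_seminorm E (f - rat_comb F (from_nat i)) < \<epsilon>"
      by (intro exI[of _ "to_nat q"]) (simp add: p_def)
  qed
qed

section \<open>Strong measurability and Bochner integrability\<close>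

text \<open>Instantiated by the basic probability measure and also by its restrictions to the
  \<sigma>-algebras of the filtration. Completeness allows limits and representatives to be changed
  on null sets.\<close>

locale finite_complete_measure = finite_measure M + complete_measure M for M :: "'x measure"
begin

lemma measurable_AE_cong:
  assumes f: "f \<in> measurable M N" and eq: "AE x in M. f x = g x" and sp: "\<And>x. x \<in> space M \<Longrightarrow> g x \<in> space N"
  shows "g \<in> measurable M N"
proof (rule measurableI)
  fix A assume A: "A \<in> sets N"
  show "g -` A \<inter> space M \<in> sets M"
  proof (rule in_sets_AE[where A = "f -` A \<inter> space M"])
    from eq show "AE x in M. (x \<in> f -` A \<inter> space M) = (x \<in> g -` A \<inter> space M)"
      by eventually_elim simp
  qed (use A f in auto)
qed (use sp in auto)

lemma borel_measurable_AE_LIMSEQ: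
  fixes f :: "nat \<Rightarrow> 'x \<Rightarrow> 'e::real_normed_vector"
  assumes f: "\<And>i. f i \<in> borel_measurable M" and lim: "AE x in M. (\<lambda>i. f i x) \<longlonglongrightarrow> g x"
  shows "g \<in> borel_measurable M"
proof -
  obtain N where N: "N \<in> null_sets M" "\<And>x. x \<in> space M - N \<Longrightarrow> (\<lambda>i. f i x) \<longlonglongrightarrow> g x"
    using AE_E3[OF lim] by blast
  have NM: "N \<in> sets M" using N(1) by auto
  have "(\<lambda>x. if x \<in> N then 0 else g x) \<in> borel_measurable M"
  proof (rule borel_measurable_LIMSEQ_metric[where f = "\<lambda>i x. if x \<in> N then 0 else f i x"])
    show "(\<lambda>x. if x \<in> N then 0 else f i x) \<in> borel_measurable M" for i
      using f[of i] NM by (intro measurable_If_set) (auto simp: Int_absorb2 sets.sets_into_space)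
    show "(\<lambda>i. if x \<in> N then 0 else f i x) \<longlonglongrightarrow> (if x \<in> N then 0 else g x)" if "x \<in> space M" for x
      using N(2)[of x] that by simp
  qed
  moreover have "AE x in M. (if x \<in> N then 0 else g x) = g x"
    using AE_not_in[OF N(1)] by eventually_elim auto
  ultimately show ?thesis by (rule measurable_AE_cong) auto
qed

lemma strongly_measurable_simple: "simple_function M s \<Longrightarrow> strongly_measurable M s"
  unfolding strongly_measurable_def by (intro exI[of _ "\<lambda>_. s"]) auto

lemma strongly_measurable_borel:
  "strongly_measurable M f \<Longrightarrow> f \<in> borel_measurable M"
  unfolding strongly_measurable_def
  by (elim exE conjE, rule borel_measurable_AE_LIMSEQ) (auto intro: borel_measurable_simple_function)

lemma strongly_measurable_separable:
  assumes "strongly_measurable M f"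
  obtains y :: "nat \<Rightarrow> 'e::banach" where "AE x in M. f x \<in> closure (range y)"
proof -
  obtain s where s: "\<And>i::nat. simple_function M (s i)" "AE x in M. (\<lambda>i. s i x) \<longlonglongrightarrow> f x"
    using assms by (auto simp: strongly_measurable_def)
  define D where "D = insert 0 (\<Union>i. s i ` space M)"
  have "countable D" unfolding D_def using simple_functionD(1)[OF s(1)]
    by (simp add: countable_finite)
  then have D: "range (from_nat_into D) = D" by (intro range_from_nat_into) (auto simp: D_def)
  have "AE x in M. f x \<in> closure (range (from_nat_into D))"
    using s(2) AE_space
  proof eventually_elim
    case (elim x)
    then have "\<forall>i. s i x \<in> D" by (auto simp: D_def)
    then show ?case unfolding D closure_sequential using elim(1) by (intro exI[of _ "\<lambda>i. s i x"]) simp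
  qed
  then show ?thesis by (rule that)
qed

text \<open>The approximating simple functions move to the next point of the dense sequence whenever it is
  closer.\<close>

lemma dense_sequence_simple_approx:
  fixes y :: "nat \<Rightarrow> 'e::banach"
  assumes cl: "AE x in M. f x \<in> closure (range y)"
    and dist: "\<And>j. (\<lambda>x. norm (f x - y j)) \<in> borel_measurable M"
  obtains s where "\<And>n::nat. simple_function M (s n)" "AE x in M. (\<lambda>n. s n x) \<longlonglongrightarrow> f x"
    "\<And>n x. s n x \<in> range y"
proof -
  define s where "s = rec_nat (\<lambda>x. y 0) (\<lambda>n g x. if norm (f x - y (Suc n)) < norm (f x - g x) then y (Suc n) else g x)"
  have s0: "s 0 x = y 0" for x by (simp add: s_def)
  have sS: "s (Suc n) x = (if norm (f x - y (Suc n)) < norm (f x - s n x) then y (Suc n) else s n x)" for n x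
    by (simp add: s_def)
  have sf: "simple_function M (s n) \<and> (\<lambda>x. norm (f x - s n x)) \<in> borel_measurable M" for n
  proof (induction n)
    case 0 show ?case using dist[of 0] by (simp add: s0)
  next
    case (Suc n)
    have [measurable]: "(\<lambda>x. norm (f x - s n x)) \<in> borel_measurable M"
        "(\<lambda>x. norm (f x - y (Suc n))) \<in> borel_measurable M" using Suc dist by auto
    have "(\<lambda>x. norm (f x - s (Suc n) x)) = (\<lambda>x. min (norm (f x - y (Suc n))) (norm (f x - s n x)))"
      by (auto simp: sS)
    moreover have "simple_function M (s (Suc n))"
      unfolding sS using Suc by (intro simple_function_If) auto
    ultimately show ?case by simp
  qed
  have le: "norm (f x - s n x) \<le> norm (f x - y i)" if "i \<le> n" for i n x
    using that
  proof (induction n)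
    case 0 then show ?case by (simp add: s0)
  next
    case (Suc n) then show ?case by (cases "i = Suc n") (auto simp: sS)
  qed
  have lim: "(\<lambda>n. s n x) \<longlonglongrightarrow> f x" if x: "f x \<in> closure (range y)" for x
  proof (rule LIMSEQ_I)
    fix r :: real assume "r > 0"
    then obtain i where "norm (f x - y i) < r"
      using x unfolding closure_approachable dist_norm by (auto simp: norm_minus_commute)
    then show "\<exists>no. \<forall>n\<ge>no. norm (s n x - f x) < r"
      using le[of i _ x] by (intro exI[of _ i]) (force simp: norm_minus_commute)
  qed
  have rng: "s n x \<in> range y" for n x by (induction n) (auto simp: s0 sS)
  show ?thesis
    by (rule that[of s]) (use sf lim rng cl in auto)
qed

text \<open>Pettis' measurability criterion, with distances to a dense sequence in the role of
  functionals.\<close>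

lemma strongly_measurable_dense_sequence:
  fixes y :: "nat \<Rightarrow> 'e::banach"
  assumes "AE x in M. f x \<in> closure (range y)"
    and "\<And>j. (\<lambda>x. norm (f x - y j)) \<in> borel_measurable M"
  shows "strongly_measurable M f"
  using dense_sequence_simple_approx[OF assms] unfolding strongly_measurable_def by metis

lemma borel_measurable_norm_diff:
  fixes f :: "'x \<Rightarrow> 'e::real_normed_vector"
  assumes "f \<in> borel_measurable M" shows "(\<lambda>x. norm (f x - c)) \<in> borel_measurable M"
proof -
  have "(\<lambda>v. norm (v - c)) \<in> borel_measurable borel"
    by (intro borel_measurable_continuous_onI continuous_intros)
  then show ?thesis using measurable_compose[OF assms] by blast
qed

lemma strongly_measurable_norm:
  "strongly_measurable M f \<Longrightarrow> (\<lambda>x. norm (f x)) \<in> borel_measurable M"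
  using borel_measurable_norm_diff[OF strongly_measurable_borel, of f 0] by simp

text \<open>The essential ranges of countably many maps lie in the closure of one countable set, and
  this closure also contains the limit almost surely.\<close>

lemma strongly_measurable_AE_limit:
  fixes f :: "nat \<Rightarrow> 'x \<Rightarrow> 'e::banach"
  assumes f: "\<And>i. strongly_measurable M (f i)" and lim: "AE x in M. (\<lambda>i. f i x) \<longlonglongrightarrow> g x"
  shows "strongly_measurable M g"
proof -
  have "\<exists>y::nat \<Rightarrow> 'e. AE x in M. f i x \<in> closure (range y)" for i
    using strongly_measurable_separable[OF f] by blast
  then obtain y :: "nat \<Rightarrow> nat \<Rightarrow> 'e" where y: "\<And>i. AE x in M. f i x \<in> closure (range (y i))" by metis
  define D where "D = (\<Union>i. range (y i))"
  have "countable D" unfolding D_def by auto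
  then have D: "range (from_nat_into D) = D" by (intro range_from_nat_into) (auto simp: D_def)
  have "AE x in M. \<forall>i. f i x \<in> closure (range (y i))" using y by (simp add: AE_all_countable)
  with lim have "AE x in M. g x \<in> closure (range (from_nat_into D))"
  proof eventually_elim
    case (elim x)
    have "f i x \<in> closure D" for i
      using elim(2) closure_mono[of "range (y i)" D] unfolding D_def by blast
    then show ?case unfolding D using elim(1) closed_closure[of D] by (metis closed_sequentially)
  qed
  then show ?thesis
    using borel_measurable_AE_LIMSEQ[OF strongly_measurable_borel[OF f] lim]
    by (intro strongly_measurable_dense_sequence borel_measurable_norm_diff)
qed

lemma strongly_measurable_AE_cong:
  assumes "strongly_measurable M f" "AE x in M. f x = g x" shows "strongly_measurable M g"
proof (rule strongly_measurable_AE_limit[of "\<lambda>_. f"])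
  from assms(2) show "AE x in M. (\<lambda>_. f x) \<longlonglongrightarrow> g x" by eventually_elim simp
qed (rule assms(1))

lemma strongly_measurable_compose2:
  assumes "continuous_on UNIV (\<lambda>(a, b). h a b)" "strongly_measurable M f" "strongly_measurable M g"
  shows "strongly_measurable M (\<lambda>x. h (f x) (g x))"
proof -
  obtain s t where s: "\<And>i::nat. simple_function M (s i)" "AE x in M. (\<lambda>i. s i x) \<longlonglongrightarrow> f x"
    and t: "\<And>i::nat. simple_function M (t i)" "AE x in M. (\<lambda>i. t i x) \<longlonglongrightarrow> g x"
    using assms(2,3) by (auto simp: strongly_measurable_def)
  have "simple_function M (\<lambda>x. h (s i x) (t i x))" for i
    using s(1) t(1) by (rule simple_function_compose2)
  moreover from s(2) t(2) have "AE x in M. (\<lambda>i. h (s i x) (t i x)) \<longlonglongrightarrow> h (f x) (g x)"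
  proof eventually_elim
    case (elim x)
    have "isCont (\<lambda>(a, b). h a b) (f x, g x)" using assms(1) by (simp add: continuous_on_eq_continuous_at)
    from isCont_tendsto_compose[OF this tendsto_Pair[OF elim]] show ?case by simp
  qed
  ultimately show ?thesis
    unfolding strongly_measurable_def by (intro exI[of _ "\<lambda>i x. h (s i x) (t i x)"]) auto
qed

lemma strongly_measurable_add:
  "strongly_measurable M f \<Longrightarrow> strongly_measurable M g \<Longrightarrow> strongly_measurable M (\<lambda>x. f x + g x)"
  by (rule strongly_measurable_compose2) (auto simp: split_beta intro!: continuous_intros)

lemma strongly_measurable_diff:
  "strongly_measurable M f \<Longrightarrow> strongly_measurable M g \<Longrightarrow> strongly_measurable M (\<lambda>x. f x - g x)"
  by (rule strongly_measurable_compose2) (auto simp: split_beta intro!: continuous_intros)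

lemma strongly_measurable_const: "strongly_measurable M (\<lambda>x. c)"
  by (rule strongly_measurable_simple) simp

lemma strongly_measurable_scaleR:
  "strongly_measurable M f \<Longrightarrow> strongly_measurable M (\<lambda>x. c *\<^sub>R f x)"
  by (rule strongly_measurable_compose2[of "\<lambda>a b. c *\<^sub>R b" f f]) (auto simp: split_beta intro!: continuous_intros)

lemma strongly_measurable_indicator:
  assumes "A \<in> sets M" "strongly_measurable M f"
  shows "strongly_measurable M (\<lambda>x. indicat_real A x *\<^sub>R f x)"
proof -
  have "strongly_measurable M (indicat_real A)" using assms(1) by (intro strongly_measurable_simple) auto
  then show ?thesis using assms(2)
    by (rule strongly_measurable_compose2[rotated]) (auto simp: split_beta intro!: continuous_intros)
qed

lemma strongly_measurable_sum:
  "(\<And>i. i \<in> I \<Longrightarrow> strongly_measurable M (f i)) \<Longrightarrow> strongly_measurable M (\<lambda>x. \<Sum>i\<in>I. f i x)"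
proof (induction I rule: infinite_finite_induct)
  case (insert i I)
  then show ?case using strongly_measurable_add[of "f i" "\<lambda>x. \<Sum>i\<in>I. f i x"] by simp
qed (auto simp: strongly_measurable_const)

lemma borel_measurable_blinfun_apply:
  fixes \<phi> :: "'e::banach \<Rightarrow>\<^sub>L real"
  assumes "strongly_measurable M f" shows "(\<lambda>x. blinfun_apply \<phi> (f x)) \<in> borel_measurable M"
proof -
  have "blinfun_apply \<phi> \<in> borel_measurable borel"
    by (intro borel_measurable_continuous_onI continuous_intros)
  then show ?thesis using measurable_compose[OF strongly_measurable_borel[OF assms]] by blast
qed

section \<open>Bochner integrals seen through functionals\<close>

lemma simple_bochner_integrable_iff: "Bochner_Integration.simple_bochner_integrable M s \<longleftrightarrow> simple_function M s"
  by (auto simp: Bochner_Integration.simple_bochner_integrable.simps)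

lemma simple_function_bounded:
  assumes "simple_function M s" obtains C where "\<And>x. x \<in> space M \<Longrightarrow> norm (s x) \<le> C"
proof -
  have fin: "finite (s ` space M)" using assms by (simp add: simple_function_def)
  show ?thesis
  proof (rule that)
    show "norm (s x) \<le> Max ((\<lambda>v. norm v) ` s ` space M)" if "x \<in> space M" for x
      using fin that by (intro Max_ge) auto
  qed
qed

lemma simple_function_integrable_norm:
  fixes s :: "'x \<Rightarrow> 'e::banach"
  assumes "simple_function M s" shows "integrable M (\<lambda>x. norm (s x))"
proof -
  obtain C where "\<And>x. x \<in> space M \<Longrightarrow> norm (s x) \<le> C" using simple_function_bounded[OF assms] by blast
  then show ?thesis
    using strongly_measurable_norm[OF strongly_measurable_simple[OF assms]]
    by (intro integrable_const_bound[where B = C]) auto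
qed

text \<open>Values larger than \<open>2 * norm (f x)\<close> are cut to \<open>0\<close>. Where
  \<open>f x \<noteq> 0\<close> this eventually changes nothing, since \<open>norm (s i x)\<close>
  tends to \<open>norm (f x)\<close>. The last conclusion records the possible values, for the case
  that they have to stay in a prescribed set containing \<open>0\<close>.\<close>

lemma strongly_measurable_simple_approx_dominated:
  assumes f: "strongly_measurable M f"
    and s: "\<And>i::nat. simple_function M (s i)" "AE x in M. (\<lambda>i. s i x) \<longlonglongrightarrow> f x"
  obtains t where "\<And>i::nat. simple_function M (t i)" "AE x in M. (\<lambda>i. t i x) \<longlonglongrightarrow> f x"
    "\<And>i x. x \<in> space M \<Longrightarrow> norm (t i x) \<le> 2 * norm (f x)" "\<And>i x. t i x \<in> {0, s i x}"
proof -
  define t where "t i x = (if norm (s i x) \<le> 2 * norm (f x) then s i x else 0)" for i x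
  show ?thesis
  proof (rule that[of t])
    fix i
    have [measurable]: "(\<lambda>x. norm (s i x)) \<in> borel_measurable M" "(\<lambda>x. norm (f x)) \<in> borel_measurable M"
      using strongly_measurable_norm strongly_measurable_simple s(1) f by auto
    show "simple_function M (t i)" unfolding t_def using s(1) by (intro simple_function_If) auto
    show "norm (t i x) \<le> 2 * norm (f x)" "t i x \<in> {0, s i x}" for x by (simp_all add: t_def)
  next
    from s(2) show "AE x in M. (\<lambda>i. t i x) \<longlonglongrightarrow> f x"
    proof eventually_elim
      case (elim x)
      show ?case
      proof (cases "f x = 0")
        case True
        then have "t i x = 0" for i by (simp add: t_def)
        then show ?thesis using True by simp
      next
        case False
        then have "\<forall>\<^sub>F i in sequentially. norm (s i x) < 2 * norm (f x)"
          using tendsto_norm[OF elim] by (intro order_tendstoD(2)) auto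
        then have "\<forall>\<^sub>F i in sequentially. s i x = t i x" by eventually_elim (simp add: t_def)
        then show ?thesis using elim by (rule Lim_transform_eventually[rotated])
      qed
    qed
  qed
qed

lemma strongly_measurable_simple_approx:
  assumes f: "strongly_measurable M f"
  obtains s where "\<And>i::nat. simple_function M (s i)" "AE x in M. (\<lambda>i. s i x) \<longlonglongrightarrow> f x"
    "\<And>i x. x \<in> space M \<Longrightarrow> norm (s i x) \<le> 2 * norm (f x)"
proof -
  obtain s where s: "\<And>i::nat. simple_function M (s i)" "AE x in M. (\<lambda>i. s i x) \<longlonglongrightarrow> f x"
    using f by (auto simp: strongly_measurable_def)
  show ?thesis by (rule strongly_measurable_simple_approx_dominated[OF f s]) (rule that)
qed

lemma simple_approx_integral_norm:
  assumes f: "strongly_measurable M f" "integrable M (\<lambda>x. norm (f x))"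
    and s: "\<And>i::nat. simple_function M (s i)" "AE x in M. (\<lambda>i. s i x) \<longlonglongrightarrow> f x"
    "\<And>i x. x \<in> space M \<Longrightarrow> norm (s i x) \<le> 2 * norm (f x)"
  shows "\<And>i. integrable M (\<lambda>x. norm (f x - s i x))" "(\<lambda>i. \<integral>x. norm (f x - s i x) \<partial>M) \<longlonglongrightarrow> 0"
proof -
  have [measurable]: "(\<lambda>x. norm (f x - s i x)) \<in> borel_measurable M" for i
    by (intro strongly_measurable_norm strongly_measurable_diff f(1) strongly_measurable_simple[OF s(1)])
  have dom: "norm (f x - s i x) \<le> 3 * norm (f x)" if "x \<in> space M" for i x
    using s(3)[OF that, of i] norm_triangle_ineq4[of "f x" "s i x"] by simp
  show i: "integrable M (\<lambda>x. norm (f x - s i x))" for i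
  proof (rule Bochner_Integration.integrable_bound[of M "\<lambda>x. 3 * norm (f x)"])
    show "AE x in M. norm (norm (f x - s i x)) \<le> norm (3 * norm (f x))"
      using AE_space by eventually_elim (use dom in simp)
  qed (use f(2) in simp_all)
  have "(\<lambda>i. \<integral>x. norm (f x - s i x) \<partial>M) \<longlonglongrightarrow> (\<integral>x. 0 \<partial>M)"
  proof (rule integral_dominated_convergence[where w = "\<lambda>x. 3 * norm (f x)"])
    show "AE x in M. (\<lambda>i. norm (f x - s i x)) \<longlonglongrightarrow> 0"
      using s(2)
    proof eventually_elim
      case (elim x)
      have "(\<lambda>i. norm (f x - s i x)) \<longlonglongrightarrow> norm (f x - f x)"
        using elim by (intro tendsto_intros)
      then show ?case by simp
    qed
    show "AE x in M. norm (norm (f x - s i x)) \<le> 3 * norm (f x)" for i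
      using AE_space by eventually_elim (use dom in simp)
  qed (use f(2) in auto)
  then show "(\<lambda>i. \<integral>x. norm (f x - s i x) \<partial>M) \<longlonglongrightarrow> 0" by simp
qed

text \<open>Bochner's criterion; it reduces integrability to a real function, which is how all later
  estimates are made.\<close>

lemma bochner_integrable_iff:
  "bochner_integrable M f \<longleftrightarrow> strongly_measurable M f \<and> integrable M (\<lambda>x. norm (f x))"
proof safe
  assume f: "bochner_integrable M f"
  then show sm: "strongly_measurable M f" by (simp add: bochner_integrable_def)
  obtain s where s: "bochner_approx M f s" using f by (auto simp: bochner_integrable_def)
  then have sf: "simple_function M (s i)" for i by (auto simp: bochner_approx_def simple_bochner_integrable_iff)
  have "\<forall>\<^sub>F i in sequentially. (\<integral>\<^sup>+x. ennreal (norm (f x - s i x)) \<partial>M) < 1"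
    using s by (intro order_tendstoD(2)) (auto simp: bochner_approx_def)
  then obtain i where i: "(\<integral>\<^sup>+x. ennreal (norm (f x - s i x)) \<partial>M) < 1"
    using eventually_happens by force
  have [measurable]: "(\<lambda>x. norm (f x - s i x)) \<in> borel_measurable M"
    by (intro strongly_measurable_norm strongly_measurable_diff sm strongly_measurable_simple[OF sf])
  have "integrable M (\<lambda>x. norm (f x - s i x))"
    using i by (intro integrableI_bounded) (auto intro: less_trans)
  then have "integrable M (\<lambda>x. norm (f x - s i x) + norm (s i x))"
    using simple_function_integrable_norm[OF sf] by simp
  then show "integrable M (\<lambda>x. norm (f x))"
    by (rule Bochner_Integration.integrable_bound)
      (use strongly_measurable_norm[OF sm] norm_triangle_sub[of "f _" "s i _"] in \<open>auto simp: add.commute\<close>)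
next
  assume f: "strongly_measurable M f" "integrable M (\<lambda>x. norm (f x))"
  obtain s where s: "\<And>i::nat. simple_function M (s i)" "AE x in M. (\<lambda>i. s i x) \<longlonglongrightarrow> f x"
    "\<And>i x. x \<in> space M \<Longrightarrow> norm (s i x) \<le> 2 * norm (f x)"
    by (rule strongly_measurable_simple_approx[OF f(1)]) blast
  have "(\<integral>\<^sup>+x. ennreal (norm (f x - s i x)) \<partial>M) = ennreal (\<integral>x. norm (f x - s i x) \<partial>M)" for i
    by (intro nn_integral_eq_integral simple_approx_integral_norm(1)[OF f s]) auto
  then have "bochner_approx M f s"
    unfolding bochner_approx_def
    using s(1) tendsto_ennrealI[OF simple_approx_integral_norm(2)[OF f s]]
    by (auto simp: simple_bochner_integrable_iff)
  then show "bochner_integrable M f" using f(1) by (auto simp: bochner_integrable_def)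
qed

lemma bochner_integrableD:
  assumes "bochner_integrable M f"
  shows "strongly_measurable M f" "integrable M (\<lambda>x. norm (f x))"
  using assms by (auto simp: bochner_integrable_iff)

lemma integrable_blinfun_apply:
  fixes \<phi> :: "'e::banach \<Rightarrow>\<^sub>L real"
  assumes "bochner_integrable M f"
  shows "integrable M (\<lambda>x. blinfun_apply \<phi> (f x))"
proof (rule Bochner_Integration.integrable_bound)
  show "integrable M (\<lambda>x. norm \<phi> * norm (f x))" using bochner_integrableD[OF assms] by simp
  show "(\<lambda>x. blinfun_apply \<phi> (f x)) \<in> borel_measurable M"
    using bochner_integrableD(1)[OF assms] by (rule borel_measurable_blinfun_apply)
  have "norm (blinfun_apply \<phi> (f x)) \<le> norm (norm \<phi> * norm (f x))" for x
    using norm_blinfun[of \<phi> "f x"] by simp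
  then show "AE x in M. norm (blinfun_apply \<phi> (f x)) \<le> norm (norm \<phi> * norm (f x))" by simp
qed

text \<open>Under a functional the integrals of the simple approximations become real integrals,
  with error at most \<open>norm \<psi> * e i\<close>. Choosing a norming functional for a
  difference turns these weak bounds into a bound in norm, hence the Cauchy property.\<close>

lemma bochner_approx_weak_limit:
  fixes \<phi> :: "'e::banach \<Rightarrow>\<^sub>L real"
  assumes f: "bochner_integrable M f" and s: "bochner_approx M f s"
  shows "(\<lambda>i. blinfun_apply \<phi> (Bochner_Integration.simple_bochner_integral M (s i))) \<longlonglongrightarrow> (\<integral>x. blinfun_apply \<phi> (f x) \<partial>M)"
    "Cauchy (\<lambda>i. Bochner_Integration.simple_bochner_integral M (s i))"
proof -
  let ?I = "\<lambda>i. Bochner_Integration.simple_bochner_integral M (s i)"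
  define e where "e i = enn2real (\<integral>\<^sup>+x. ennreal (norm (f x - s i x)) \<partial>M)" for i
  have sf: "simple_function M (s i)" for i using s by (auto simp: bochner_approx_def simple_bochner_integrable_iff)
  have bs: "bochner_integrable M (s i)" for i
    using sf simple_function_integrable_norm strongly_measurable_simple by (auto simp: bochner_integrable_iff)
  have [measurable]: "(\<lambda>x. norm (f x - s i x)) \<in> borel_measurable M" for i
    by (intro strongly_measurable_norm strongly_measurable_diff bochner_integrableD(1)[OF f] strongly_measurable_simple[OF sf])
  have int: "integrable M (\<lambda>x. norm (f x - s i x))" for i
  proof (rule Bochner_Integration.integrable_bound)
    show "integrable M (\<lambda>x. norm (f x) + norm (s i x))"
      using bochner_integrableD(2)[OF f] bochner_integrableD(2)[OF bs] by simp
  qed (use norm_triangle_ineq4[of "f _" "s i _"] in auto)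
  have e: "e i = (\<integral>x. norm (f x - s i x) \<partial>M)" for i
    unfolding e_def by (subst nn_integral_eq_integral[OF int]) auto
  have e0: "e \<longlonglongrightarrow> 0"
    using s tendsto_enn2real[of "\<lambda>i. \<integral>\<^sup>+x. ennreal (norm (f x - s i x)) \<partial>M" 0 sequentially]
    unfolding bochner_approx_def e_def by simp
  have simple: "blinfun_apply \<psi> (?I i) = (\<integral>x. blinfun_apply \<psi> (s i x) \<partial>M)" for i and \<psi> :: "'e \<Rightarrow>\<^sub>L real"
  proof -
    have "blinfun_apply \<psi> (?I i) = Bochner_Integration.simple_bochner_integral M (\<lambda>x. blinfun_apply \<psi> (s i x))"
      using sf blinfun.bounded_linear_right[of \<psi>]
      by (intro Bochner_Integration.simple_bochner_integral_linear[symmetric])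
        (auto simp: simple_bochner_integrable_iff bounded_linear.linear)
    also have "\<dots> = (\<integral>x. blinfun_apply \<psi> (s i x) \<partial>M)"
      using sf by (intro simple_bochner_integrable_eq_integral)
        (auto simp: simple_bochner_integrable_iff intro: simple_function_compose1)
    finally show ?thesis .
  qed
  have bound: "\<bar>(\<integral>x. blinfun_apply \<psi> (f x) \<partial>M) - blinfun_apply \<psi> (?I i)\<bar> \<le> norm \<psi> * e i" for i and \<psi> :: "'e \<Rightarrow>\<^sub>L real"
  proof -
    have "(\<integral>x. blinfun_apply \<psi> (f x) \<partial>M) - blinfun_apply \<psi> (?I i) = (\<integral>x. blinfun_apply \<psi> (f x - s i x) \<partial>M)"
      unfolding simple using integrable_blinfun_apply[OF f] integrable_blinfun_apply[OF bs]
      by (simp add: blinfun.diff_right)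
    also have "\<bar>\<dots>\<bar> \<le> (\<integral>x. \<bar>blinfun_apply \<psi> (f x - s i x)\<bar> \<partial>M)"
      by (rule integral_abs_bound)
    also have "\<dots> \<le> (\<integral>x. norm \<psi> * norm (f x - s i x) \<partial>M)"
    proof (rule integral_mono)
      show "\<bar>blinfun_apply \<psi> (f x - s i x)\<bar> \<le> norm \<psi> * norm (f x - s i x)" for x
        using norm_blinfun[of \<psi> "f x - s i x"] by simp
    qed (use int integrable_blinfun_apply[OF f, of \<psi>] integrable_blinfun_apply[OF bs, of \<psi>]
      in \<open>simp_all add: blinfun.diff_right\<close>)
    finally show ?thesis by (simp add: e)
  qed
  show "(\<lambda>i. blinfun_apply \<phi> (?I i)) \<longlonglongrightarrow> (\<integral>x. blinfun_apply \<phi> (f x) \<partial>M)"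
  proof (rule Lim_null_comparison[where g = "\<lambda>i. norm \<phi> * e i", THEN LIM_zero_cancel])
    show "\<forall>\<^sub>F i in sequentially. norm (blinfun_apply \<phi> (?I i) - (\<integral>x. blinfun_apply \<phi> (f x) \<partial>M)) \<le> norm \<phi> * e i"
      using bound[of \<phi>] by (simp add: abs_minus_commute)
    show "(\<lambda>i. norm \<phi> * e i) \<longlonglongrightarrow> 0" using tendsto_mult_right_zero[OF e0] by simp
  qed
  have diff: "norm (?I i - ?I j) \<le> e i + e j" for i j
  proof -
    obtain \<psi> :: "'e \<Rightarrow>\<^sub>L real" where \<psi>: "norm \<psi> \<le> 1" "blinfun_apply \<psi> (?I i - ?I j) = norm (?I i - ?I j)"
      using norming_functional by blast
    have ep: "e k \<ge> 0" for k by (simp add: e_def)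
    have "norm \<psi> * e k \<le> e k" for k using mult_right_mono[OF \<psi>(1) ep[of k]] by simp
    then show ?thesis using bound[of \<psi> i] bound[of \<psi> j] \<psi>(2) by (smt (verit) blinfun.diff_right)
  qed
  show "Cauchy ?I"
  proof (rule metric_CauchyI)
    fix r :: real assume "r > 0"
    then have "\<forall>\<^sub>F i in sequentially. e i < r / 2" using e0 by (intro order_tendstoD(2)) auto
    then obtain n where n: "\<And>i. i \<ge> n \<Longrightarrow> e i < r / 2" by (auto simp: eventually_sequentially)
    show "\<exists>n. \<forall>i\<ge>n. \<forall>j\<ge>n. dist (?I i) (?I j) < r"
    proof (intro exI[of _ n] allI impI)
      fix i j assume "i \<ge> n" "j \<ge> n"
      then show "dist (?I i) (?I j) < r" using diff[of i j] n[of i] n[of j] by (simp add: dist_norm)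
    qed
  qed
qed

text \<open>All limits of admissible simple integrals have the same image under every functional. As
  functionals separate points, the limit is unique, and the description that defines
  \<open>bochner_integral\<close> denotes it.\<close>

lemma blinfun_apply_bochner_integral:
  fixes \<phi> :: "'e::banach \<Rightarrow>\<^sub>L real"
  assumes f: "bochner_integrable M f"
  shows "blinfun_apply \<phi> (bochner_integral M f) = (\<integral>x. blinfun_apply \<phi> (f x) \<partial>M)"
proof -
  let ?P = "\<lambda>y. \<exists>s. bochner_approx M f s \<and> (\<lambda>i. Bochner_Integration.simple_bochner_integral M (s i)) \<longlonglongrightarrow> y"
  have val: "blinfun_apply \<psi> y = (\<integral>x. blinfun_apply \<psi> (f x) \<partial>M)" if y: "?P y" for y and \<psi> :: "'e \<Rightarrow>\<^sub>L real"
  proof -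
    obtain s where s: "bochner_approx M f s" "(\<lambda>i. Bochner_Integration.simple_bochner_integral M (s i)) \<longlonglongrightarrow> y"
      using y by blast
    show ?thesis
      by (rule LIMSEQ_unique[OF _ bochner_approx_weak_limit(1)[OF f s(1)]])
        (intro tendsto_intros s(2))
  qed
  obtain s where s: "bochner_approx M f s" using f by (auto simp: bochner_integrable_def)
  obtain y where "(\<lambda>i. Bochner_Integration.simple_bochner_integral M (s i)) \<longlonglongrightarrow> y"
    using bochner_approx_weak_limit(2)[OF f s] by (auto simp: Cauchy_convergent_iff convergent_def)
  then have y: "?P y" using s by blast
  have "bochner_integral M f = y"
    unfolding bochner_integral_def
    by (rule the_equality[of ?P, OF y]) (metis val y blinfun_separates)
  then show ?thesis using val[OF y] by simp
qed

lemma bochner_integral_eq_iff: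
  fixes f g :: "'x \<Rightarrow> 'e::banach"
  assumes "bochner_integrable M f" "bochner_integrable M g"
  shows "bochner_integral M f = bochner_integral M g \<longleftrightarrow>
    (\<forall>\<phi> :: 'e \<Rightarrow>\<^sub>L real. (\<integral>x. blinfun_apply \<phi> (f x) \<partial>M) = (\<integral>x. blinfun_apply \<phi> (g x) \<partial>M))"
  using blinfun_apply_bochner_integral[OF assms(1)] blinfun_apply_bochner_integral[OF assms(2)]
  by (metis blinfun_separates)

lemma bochner_integrable_add:
  assumes "bochner_integrable M f" "bochner_integrable M g"
  shows "bochner_integrable M (\<lambda>x. f x + g x)"
  unfolding bochner_integrable_iff
proof
  show sm: "strongly_measurable M (\<lambda>x. f x + g x)"
    using assms by (intro strongly_measurable_add bochner_integrableD)
  show "integrable M (\<lambda>x. norm (f x + g x))"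
  proof (rule Bochner_Integration.integrable_bound)
    show "integrable M (\<lambda>x. norm (f x) + norm (g x))"
      using bochner_integrableD(2)[OF assms(1)] bochner_integrableD(2)[OF assms(2)] by simp
  qed (use strongly_measurable_norm[OF sm] norm_triangle_ineq in auto)
qed

lemma bochner_integrable_scaleR:
  "bochner_integrable M f \<Longrightarrow> bochner_integrable M (\<lambda>x. c *\<^sub>R f x)"
  unfolding bochner_integrable_iff by (auto intro: strongly_measurable_scaleR)

lemma bochner_integrable_diff:
  "bochner_integrable M f \<Longrightarrow> bochner_integrable M g \<Longrightarrow> bochner_integrable M (\<lambda>x. f x - g x)"
  using bochner_integrable_add[of f "\<lambda>x. (- 1) *\<^sub>R g x"] bochner_integrable_scaleR[of g "- 1"] by simp

lemma bochner_integrable_zero: "bochner_integrable M (\<lambda>x. 0)"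
  by (simp add: bochner_integrable_iff strongly_measurable_const)

lemma bochner_integrable_sum:
  "(\<And>i. i \<in> I \<Longrightarrow> bochner_integrable M (f i)) \<Longrightarrow> bochner_integrable M (\<lambda>x. \<Sum>i\<in>I. f i x)"
proof (induction I rule: infinite_finite_induct)
  case (insert i I)
  then show ?case using bochner_integrable_add[of "f i" "\<lambda>x. \<Sum>i\<in>I. f i x"] by simp
qed (auto simp: bochner_integrable_zero)

lemma bochner_integrable_indicator:
  assumes "A \<in> sets M" "bochner_integrable M f"
  shows "bochner_integrable M (\<lambda>x. indicat_real A x *\<^sub>R f x)"
  unfolding bochner_integrable_iff
proof
  show sm: "strongly_measurable M (\<lambda>x. indicat_real A x *\<^sub>R f x)"
    using assms by (intro strongly_measurable_indicator bochner_integrableD)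
  show "integrable M (\<lambda>x. norm (indicat_real A x *\<^sub>R f x))"
    by (rule Bochner_Integration.integrable_bound[OF bochner_integrableD(2)[OF assms(2)]])
      (use strongly_measurable_norm[OF sm] in \<open>auto simp: indicator_def\<close>)
qed

lemma bochner_integrable_bound:
  assumes "strongly_measurable M f" "integrable M g" "AE x in M. norm (f x) \<le> g x"
  shows "bochner_integrable M f"
  unfolding bochner_integrable_iff
proof
  show "integrable M (\<lambda>x. norm (f x))"
    by (rule Bochner_Integration.integrable_bound[OF assms(2)])
      (use strongly_measurable_norm[OF assms(1)] assms(3) in auto)
qed fact

lemma bochner_integrable_AE_cong:
  assumes "bochner_integrable M f" "AE x in M. f x = g x" shows "bochner_integrable M g"
proof (rule bochner_integrable_bound)
  show "strongly_measurable M g" using assms bochner_integrableD(1) strongly_measurable_AE_cong by blast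
  show "integrable M (\<lambda>x. norm (f x))" using assms bochner_integrableD(2) by blast
qed (use assms(2) in auto)

end

section \<open>Generalized limits of set functions\<close>

definition indicator_integral :: "'x measure \<Rightarrow> 'x set \<Rightarrow> ('x \<Rightarrow> real) \<Rightarrow> real" where
  "indicator_integral M A f = (\<integral>x. indicator A x * f x \<partial>M)"

lemma integrable_indicator_mult:
  fixes f :: "'x \<Rightarrow> real"
  shows "A \<in> sets M \<Longrightarrow> integrable M f \<Longrightarrow> integrable M (\<lambda>x. indicator A x * f x)"
  using integrable_mult_indicator[of A M f] by simp

context finite_complete_measure
begin

lemma indicator_integral_add:
  "A \<in> sets M \<Longrightarrow> integrable M f \<Longrightarrow> integrable M g \<Longrightarrow>
    indicator_integral M A (\<lambda>x. f x + g x) = indicator_integral M A f + indicator_integral M A g"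
  by (simp add: indicator_integral_def distrib_left integrable_indicator_mult)

lemma indicator_integral_diff:
  "A \<in> sets M \<Longrightarrow> integrable M f \<Longrightarrow> integrable M g \<Longrightarrow>
    indicator_integral M A (\<lambda>x. f x - g x) = indicator_integral M A f - indicator_integral M A g"
  by (simp add: indicator_integral_def right_diff_distrib integrable_indicator_mult)

lemma indicator_integral_cmult: "indicator_integral M A (\<lambda>x. c * f x) = c * indicator_integral M A f"
  by (simp add: indicator_integral_def mult.left_commute)

lemma indicator_integral_sum:
  "A \<in> sets M \<Longrightarrow> (\<And>i. i \<in> I \<Longrightarrow> integrable M (f i)) \<Longrightarrow>
    indicator_integral M A (\<lambda>x. \<Sum>i\<in>I. f i x) = (\<Sum>i\<in>I. indicator_integral M A (f i))"
  by (simp add: indicator_integral_def sum_distrib_left integrable_indicator_mult)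

lemma indicator_integral_mono:
  assumes "A \<in> sets M" "integrable M f" "integrable M g" "AE x in M. f x \<le> g x"
  shows "indicator_integral M A f \<le> indicator_integral M A g"
  unfolding indicator_integral_def
proof (rule integral_mono_AE)
  from assms(4) show "AE x in M. indicator A x * f x \<le> indicator A x * g x"
    by eventually_elim (auto simp: indicator_def)
qed (use assms in \<open>auto intro: integrable_indicator_mult\<close>)

lemma indicator_integral_nonneg:
  "AE x in M. 0 \<le> f x \<Longrightarrow> 0 \<le> indicator_integral M A f"
  unfolding indicator_integral_def by (rule integral_nonneg_AE) (auto elim: eventually_mono)

lemma indicator_integral_Un:
  assumes "A \<in> sets M" "B \<in> sets M" "A \<inter> B = {}" "integrable M f"
  shows "indicator_integral M (A \<union> B) f = indicator_integral M A f + indicator_integral M B f"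
proof -
  have "indicator (A \<union> B) x * f x = indicator A x * f x + indicator B x * f x" for x
    using assms(3) by (auto simp: indicator_def)
  then show ?thesis using assms by (simp add: indicator_integral_def integrable_indicator_mult)
qed

lemma indicator_integral_null:
  assumes "A \<in> null_sets M" shows "indicator_integral M A f = 0"
  unfolding indicator_integral_def
  by (rule integral_eq_zero_AE) (use AE_not_in[OF assms] in eventually_elim, simp)

lemma indicator_integral_abs_le:
  assumes "A \<in> sets M" "integrable M f"
  shows "\<bar>indicator_integral M A f\<bar> \<le> indicator_integral M A (\<lambda>x. \<bar>f x\<bar>)"
  unfolding indicator_integral_def
  using integral_abs_bound[of M "\<lambda>x. indicator A x * f x"] by (simp add: abs_mult)

lemma indicator_integral_space: "indicator_integral M (space M) f = (\<integral>x. f x \<partial>M)"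
  unfolding indicator_integral_def by (rule Bochner_Integration.integral_cong) auto

lemma indicator_integral_subset:
  assumes "A \<in> sets M" "B \<in> sets M" "A \<subseteq> B" "integrable M f" "AE x in M. 0 \<le> f x"
  shows "indicator_integral M A f \<le> indicator_integral M B f"
  unfolding indicator_integral_def
proof (rule integral_mono_AE)
  from assms(5) show "AE x in M. indicator A x * f x \<le> indicator B x * f x"
    by eventually_elim (use assms(3) in \<open>auto simp: indicator_def\<close>)
qed (use assms in \<open>auto intro: integrable_indicator_mult\<close>)

lemma indicator_integral_le_integral:
  assumes "A \<in> sets M" "integrable M f" "AE x in M. 0 \<le> f x"
  shows "indicator_integral M A f \<le> (\<integral>x. f x \<partial>M)"
  using indicator_integral_subset[of A "space M" f] assms sets.sets_into_space[OF assms(1)]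
  by (simp add: indicator_integral_space)

lemma indicator_integral_decseq:
  assumes A: "range A \<subseteq> sets M" "decseq A" "(\<Inter>i. A i) = {}" and f: "integrable M f"
  shows "(\<lambda>i. indicator_integral M (A i) f) \<longlonglongrightarrow> 0"
proof -
  have "(\<lambda>i. \<integral>x. indicator (A i) x * f x \<partial>M) \<longlonglongrightarrow> (\<integral>x. 0 \<partial>M)"
  proof (rule integral_dominated_convergence[where w = "\<lambda>x. \<bar>f x\<bar>"])
    show "(\<lambda>x. indicator (A i) x * f x) \<in> borel_measurable M" for i
      using A(1) f by (intro borel_measurable_times borel_measurable_indicator) auto
    show "AE x in M. (\<lambda>i. indicator (A i) x * f x) \<longlonglongrightarrow> 0"
    proof (rule AE_I2)
      fix x
      obtain i where "x \<notin> A i" using A(3) by auto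
      then have "indicator (A j) x * f x = 0" if "j \<ge> i" for j
        using A(2) that by (auto simp: decseq_def indicator_def)
      then show "(\<lambda>i. indicator (A i) x * f x) \<longlonglongrightarrow> 0"
        by (intro tendsto_eventually eventually_sequentiallyI) auto
    qed
  qed (use f in \<open>auto simp: indicator_def\<close>)
  then show ?thesis by (simp add: indicator_integral_def)
qed

lemma AE_nonneg_indicator_integral:
  assumes f: "integrable M f" and nn: "\<And>A. A \<in> sets M \<Longrightarrow> 0 \<le> indicator_integral M A f"
  shows "AE x in M. 0 \<le> f x"
proof -
  define A where "A = {x \<in> space M. f x < 0}"
  have [measurable]: "f \<in> borel_measurable M" using f by simp
  have A: "A \<in> sets M" unfolding A_def by measurable
  have int: "integrable M (\<lambda>x. - (indicator A x * f x))" using integrable_indicator_mult[OF A f] by simp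
  have nn': "0 \<le> - (indicator A x * f x)" for x by (auto simp: A_def indicator_def)
  have "(\<integral>x. - (indicator A x * f x) \<partial>M) = 0"
  proof (rule antisym)
    show "0 \<le> (\<integral>x. - (indicator A x * f x) \<partial>M)"
      by (rule integral_nonneg_AE) (use nn' in simp)
  qed (use nn[OF A] in \<open>simp add: indicator_integral_def\<close>)
  then have "AE x in M. - (indicator A x * f x) = 0"
    using integral_nonneg_eq_0_iff_AE[OF int] nn' by simp
  then show ?thesis
    using AE_space
  proof eventually_elim
    case (elim x) then show ?case by (cases "f x < 0") (auto simp: A_def)
  qed
qed

lemma AE_le_indicator_integral:
  assumes "integrable M f" "integrable M g"
    "\<And>A. A \<in> sets M \<Longrightarrow> indicator_integral M A f \<le> indicator_integral M A g"
  shows "AE x in M. f x \<le> g x"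
  using AE_nonneg_indicator_integral[of "\<lambda>x. g x - f x"] assms
  by (simp add: indicator_integral_diff)

text \<open>Finite additivity with continuity at the empty set is countable additivity, and
  vanishing on null sets is absolute continuity. The measure obtained is finite, so its density is
  finite almost everywhere and has a real version.\<close>

lemma Radon_Nikodym_set_function:
  fixes \<kappa> :: "'x set \<Rightarrow> real"
  assumes nn: "\<And>A. A \<in> sets M \<Longrightarrow> 0 \<le> \<kappa> A"
    and add: "\<And>A B. A \<in> sets M \<Longrightarrow> B \<in> sets M \<Longrightarrow> A \<inter> B = {} \<Longrightarrow> \<kappa> (A \<union> B) = \<kappa> A + \<kappa> B"
    and null: "\<And>A. A \<in> null_sets M \<Longrightarrow> \<kappa> A = 0"
    and cont: "\<And>A. range A \<subseteq> sets M \<Longrightarrow> decseq A \<Longrightarrow> (\<Inter>i. A i) = {} \<Longrightarrow> (\<lambda>i::nat. \<kappa> (A i)) \<longlonglongrightarrow> 0"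
  obtains g where "integrable M g" "\<And>x. 0 \<le> g x" "\<And>A. A \<in> sets M \<Longrightarrow> \<kappa> A = indicator_integral M A g"
proof -
  define N where "N = measure_of (space M) (sets M) (\<lambda>A. ennreal (\<kappa> A))"
  have pos: "positive (sets M) (\<lambda>A. ennreal (\<kappa> A))" using null[of "{}"] by (simp add: positive_def)
  have ca: "countably_additive (sets M) (\<lambda>A. ennreal (\<kappa> A))"
  proof (rule sets.empty_continuous_imp_countably_additive[OF pos])
    show "additive (sets M) (\<lambda>A. ennreal (\<kappa> A))"
      unfolding additive_def using add nn by (simp add: ennreal_plus)
    fix A assume "range A \<subseteq> sets M" "decseq A" "(\<Inter>i::nat. A i) = {}"
    from tendsto_ennrealI[OF cont[OF this]] show "(\<lambda>i. ennreal (\<kappa> (A i))) \<longlonglongrightarrow> 0" by simp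
  qed auto
  have em: "emeasure N A = ennreal (\<kappa> A)" if "A \<in> sets M" for A
    unfolding N_def by (rule emeasure_measure_of_sigma) (use pos ca that sets.sigma_algebra_axioms in auto)
  have sN: "sets N = sets M" "space N = space M" by (simp_all add: N_def)
  have "absolutely_continuous M N"
    unfolding absolutely_continuous_def using em null by (auto simp: null_sets_def sN)
  then obtain f where f: "f \<in> borel_measurable M" "density M f = N"
    using Radon_Nikodym sN by blast
  have "(\<integral>\<^sup>+x. f x \<partial>M) = emeasure (density M f) (space M)"
    using f(1) by (subst emeasure_density) (auto cong: nn_integral_cong)
  also have "\<dots> < \<infinity>" using em[of "space M"] f(2) by simp
  finally have fin: "(\<integral>\<^sup>+x. f x \<partial>M) < \<infinity>" .
  then have AEf: "AE x in M. f x \<noteq> \<infinity>" using nn_integral_PInf_AE[OF f(1)] by auto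
  define g where "g x = enn2real (f x)" for x
  have fg: "AE x in M. f x = ennreal (g x)" using AEf by eventually_elim (simp add: g_def less_top)
  have gm[measurable]: "g \<in> borel_measurable M" unfolding g_def using f(1) by measurable
  have gnn: "0 \<le> g x" for x by (simp add: g_def)
  have g: "integrable M g"
  proof (rule integrableI_nonneg)
    show "(\<integral>\<^sup>+x. ennreal (g x) \<partial>M) < \<infinity>" using fin fg by (subst nn_integral_cong_AE[of _ f]) (auto elim: eventually_mono)
  qed (auto simp: g_def)
  show ?thesis
  proof (rule that[OF g])
    show "0 \<le> g x" for x by (rule gnn)
    fix A assume A: "A \<in> sets M"
    have "ennreal (\<kappa> A) = (\<integral>\<^sup>+x. f x * indicator A x \<partial>M)"
      using em[OF A] emeasure_density[OF f(1) A] by (simp add: f(2))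
    also have "\<dots> = (\<integral>\<^sup>+x. ennreal (indicator A x * g x) \<partial>M)"
      using fg by (intro nn_integral_cong_AE) (auto elim!: eventually_mono simp: indicator_def)
    also have "\<dots> = ennreal (indicator_integral M A g)"
      unfolding indicator_integral_def using g A
      by (intro nn_integral_eq_integral integrable_indicator_mult) (auto simp: gnn)
    finally show "\<kappa> A = indicator_integral M A g"
      using nn[OF A] indicator_integral_nonneg[of g A] gnn by simp
  qed
qed

text \<open>Adding the dominating integral makes the set function nonnegative, and domination also
  supplies continuity at the empty set and vanishing on null sets. Subtracting \<open>g\<close> from
  the density undoes the shift.\<close>

lemma Radon_Nikodym_dominated:
  fixes \<nu> :: "'x set \<Rightarrow> real"
  assumes g: "integrable M g" "\<And>x. 0 \<le> g x"
    and add: "\<And>A B. A \<in> sets M \<Longrightarrow> B \<in> sets M \<Longrightarrow> A \<inter> B = {} \<Longrightarrow> \<nu> (A \<union> B) = \<nu> A + \<nu> B"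
    and dom: "\<And>A. A \<in> sets M \<Longrightarrow> \<bar>\<nu> A\<bar> \<le> indicator_integral M A g"
  obtains h where "integrable M h" "\<And>A. A \<in> sets M \<Longrightarrow> \<nu> A = indicator_integral M A h"
proof -
  define \<kappa> where "\<kappa> A = \<nu> A + indicator_integral M A g" for A
  have bd: "0 \<le> \<kappa> A" "\<kappa> A \<le> 2 * indicator_integral M A g" if "A \<in> sets M" for A
    using dom[OF that] by (auto simp: \<kappa>_def)
  obtain f where f: "integrable M f" "\<And>A. A \<in> sets M \<Longrightarrow> \<kappa> A = indicator_integral M A f"
  proof (rule Radon_Nikodym_set_function[of \<kappa>])
    show "\<kappa> (A \<union> B) = \<kappa> A + \<kappa> B" if "A \<in> sets M" "B \<in> sets M" "A \<inter> B = {}" for A B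
      using add[OF that] indicator_integral_Un[OF that g(1)] by (simp add: \<kappa>_def)
    show "\<kappa> A = 0" if "A \<in> null_sets M" for A
      using bd[of A] indicator_integral_null[OF that, of g] that by auto
    show "(\<lambda>i. \<kappa> (A i)) \<longlonglongrightarrow> 0" if A: "range A \<subseteq> sets M" "decseq A" "(\<Inter>i::nat. A i) = {}" for A
    proof (rule tendsto_sandwich[of "\<lambda>_. 0" _ _ "\<lambda>i. 2 * indicator_integral M (A i) g"])
      show "(\<lambda>i. 2 * indicator_integral M (A i) g) \<longlonglongrightarrow> 0"
        using tendsto_mult_right_zero[OF indicator_integral_decseq[OF A g(1)]] .
    qed (use bd A(1) in auto)
  qed (use bd that in auto)
  show ?thesis
  proof (rule that[of "\<lambda>x. f x - g x"])
    show "\<nu> A = indicator_integral M A (\<lambda>x. f x - g x)" if "A \<in> sets M" for A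
      using f(2)[OF that] indicator_integral_diff[OF that f(1) g(1)] by (simp add: \<kappa>_def)
  qed (use f g in simp)
qed

end

text \<open>A positive normalised functional on bounded sequences. Evaluation at a single index
  qualifies, in keeping with the later use: a point of the closure of a set may be a member of the
  set.\<close>

locale generalized_limit =
  fixes L :: "(nat \<Rightarrow> real) \<Rightarrow> real"
  assumes L_add: "\<And>u v. bounded (range u) \<Longrightarrow> bounded (range v) \<Longrightarrow> L (\<lambda>k. u k + v k) = L u + L v"
    and L_cmult: "\<And>u c. bounded (range u) \<Longrightarrow> L (\<lambda>k. c * u k) = c * L u"
    and L_le: "\<And>u C. bounded (range u) \<Longrightarrow> (\<And>k. u k \<le> C) \<Longrightarrow> L u \<le> C"
begin

lemma L_ge: assumes u: "bounded (range u)" "\<And>k. C \<le> u k" shows "C \<le> L u"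
proof -
  have "bounded (range (\<lambda>k. - u k))" using u(1) unfolding bounded_iff by simp
  then have "L (\<lambda>k. - u k) \<le> - C" using u(2) by (intro L_le) auto
  moreover have "L (\<lambda>k. - u k) = - L u" using L_cmult[OF u(1), of "- 1"] by simp
  ultimately show ?thesis by simp
qed

lemma L_diff: assumes "bounded (range u)" "bounded (range v)" shows "L (\<lambda>k. u k - v k) = L u - L v"
proof -
  have "bounded (range (\<lambda>k. - 1 * v k))" using assms(2) unfolding bounded_iff by simp
  from L_add[OF assms(1) this] show ?thesis using L_cmult[OF assms(2), of "- 1"] by simp
qed

lemma L_const: "L (\<lambda>k. c) = c"
  using L_le[of "\<lambda>_. c" c] L_ge[of "\<lambda>_. c" c] by (auto intro: antisym)

lemma L_abs_le: assumes "\<And>k. \<bar>u k\<bar> \<le> C" shows "\<bar>L u\<bar> \<le> C"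
proof -
  have "bounded (range u)" using assms unfolding bounded_iff by auto
  moreover have "- C \<le> u k" "u k \<le> C" for k using assms[of k] by auto
  ultimately show ?thesis using L_le[of u C] L_ge[of u "- C"] by auto
qed

lemma L_mono: assumes "bounded (range u)" "bounded (range v)" "\<And>k. u k \<le> v k" shows "L u \<le> L v"
proof -
  have "bounded (range (\<lambda>k. u k - v k))"
    using bounded_minus_comp[OF assms(1,2)] .
  then have "L (\<lambda>k. u k - v k) \<le> 0" using assms(3) by (intro L_le) auto
  then show ?thesis using L_diff[OF assms(1,2)] by simp
qed

lemma L_sum:
  assumes "\<And>i. i \<in> I \<Longrightarrow> bounded (range (u i))"
  shows "bounded (range (\<lambda>k. \<Sum>i\<in>I. u i k)) \<and> L (\<lambda>k. \<Sum>i\<in>I. u i k) = (\<Sum>i\<in>I. L (u i))"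
  using assms
proof (induction I rule: infinite_finite_induct)
  case (insert i I)
  then have "bounded (range (\<lambda>k. u i k + (\<Sum>i\<in>I. u i k)))"
    by (intro bounded_plus_comp) auto
  then show ?case using insert L_add[of "u i" "\<lambda>k. \<Sum>i\<in>I. u i k"] by simp
qed (use L_const in auto)

end

section \<open>Weak limits in $L^1$\<close>

text \<open>\<open>E\<close> is a separable subspace carrying the \<open>Z k\<close>; as \<open>'e\<close> is reflexive, the dual of \<open>E\<close> is
  separable, and \<open>d\<close> is dense in it.\<close>

locale weak_limit = finite_complete_measure M + generalized_limit L
  for M :: "'x measure" and L :: "(nat \<Rightarrow> real) \<Rightarrow> real" +
  fixes Z :: "nat \<Rightarrow> 'x \<Rightarrow> 'e::banach" and B :: real and y :: "nat \<Rightarrow> 'e" and d :: "nat \<Rightarrow> 'e \<Rightarrow>\<^sub>L real"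
    and E :: "'e set"
  assumes refl: "\<And>\<Phi> :: ('e \<Rightarrow>\<^sub>L real) \<Rightarrow>\<^sub>L real. \<exists>x :: 'e. \<forall>f. blinfun_apply \<Phi> f = blinfun_apply f x"
    and Z: "\<And>k. bochner_integrable M (Z k)"
    and Z_bound: "\<And>k. (\<integral>x. norm (Z k x) \<partial>M) \<le> B"
    and Z_ui: "\<And>\<epsilon>. \<epsilon> > 0 \<Longrightarrow> \<exists>\<delta>>0. \<forall>k. \<forall>A\<in>sets M. measure M A \<le> \<delta> \<longrightarrow>
      indicator_integral M A (\<lambda>x. norm (Z k x)) \<le> \<epsilon>"
    and E_def: "E = closure (span (range y))"
    and Z_E: "\<And>k. AE x in M. Z k x \<in> E"
    and d_dense: "\<And>f \<epsilon>. \<epsilon> > 0 \<Longrightarrow> \<exists>i. dual_seminorm E (f - d i) < \<epsilon>"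
begin

lemma E: "subspace E" "closed E"
  by (simp_all add: E_def subspace_closure)

definition z :: "nat \<Rightarrow> 'e" where "z i = rat_comb y (from_nat i)"

lemma z_dense: "v \<in> E \<Longrightarrow> v \<in> closure (range z)"
  unfolding closure_approachable
proof (intro allI impI)
  fix \<epsilon> :: real assume v: "v \<in> E" and \<epsilon>: "\<epsilon> > 0"
  obtain w where w: "w \<in> span (range y)" "norm (w - v) < \<epsilon> / 2"
    using v \<epsilon> unfolding E_def closure_approachable dist_norm by (meson half_gt_zero)
  obtain q where "norm (w - rat_comb y q) < \<epsilon> / 2"
    using rat_comb_dense[OF sublinear_on_norm _ _ w(1), of "\<epsilon> / 2"] \<epsilon> by auto
  then have "norm (v - rat_comb y q) < \<epsilon>"
    using w(2) norm_triangle_ineq[of "v - w" "w - rat_comb y q"] by (simp add: norm_minus_commute)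
  then have "dist (z (to_nat q)) v < \<epsilon>" by (simp add: z_def dist_norm norm_minus_commute)
  then show "\<exists>u\<in>range z. dist u v < \<epsilon>" by blast
qed

lemma rat_comb_E: "(\<And>i. u i \<in> E) \<Longrightarrow> rat_comb u q \<in> E"
  unfolding rat_comb_def by (intro subspace_sum[OF E(1)] subspace_scale[OF E(1)]) auto

lemma z_E: "z i \<in> E"
  unfolding z_def using closure_subset[of "span (range y)"]
  by (intro rat_comb_E) (auto simp: E_def intro: span_base)

lemma norm_Z: "integrable M (\<lambda>x. norm (Z k x))"
  using bochner_integrableD(2)[OF Z] .

lemma Z_indicator_bound: "A \<in> sets M \<Longrightarrow> \<bar>indicator_integral M A (\<lambda>x. norm (Z k x))\<bar> \<le> B"
  using indicator_integral_le_integral[OF _ norm_Z, of A k] indicator_integral_nonneg[of "\<lambda>x. norm (Z k x)" A] Z_bound[of k]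
  by auto

lemma bounded_rangeI: "(\<And>k. \<bar>u k :: real\<bar> \<le> C) \<Longrightarrow> bounded (range u)"
  unfolding bounded_iff by auto

lemma functional_Z: "integrable M (\<lambda>x. blinfun_apply \<phi> (Z k x))" for \<phi> :: "'e \<Rightarrow>\<^sub>L real"
  using integrable_blinfun_apply[OF Z] .

text \<open>As \<open>Z k\<close> has values in \<open>E\<close>, the seminorm can stand in for the
  norm of \<open>\<phi>\<close>; this is what makes approximation of functionals by the
  \<open>d i\<close> sufficient.\<close>

lemma functional_bound:
  fixes \<phi> :: "'e \<Rightarrow>\<^sub>L real"
  assumes A: "A \<in> sets M"
  shows "\<bar>indicator_integral M A (\<lambda>x. blinfun_apply \<phi> (Z k x))\<bar>
    \<le> dual_seminorm E \<phi> * indicator_integral M A (\<lambda>x. norm (Z k x))"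
proof -
  have "\<bar>indicator_integral M A (\<lambda>x. blinfun_apply \<phi> (Z k x))\<bar>
      \<le> indicator_integral M A (\<lambda>x. \<bar>blinfun_apply \<phi> (Z k x)\<bar>)"
    by (rule indicator_integral_abs_le[OF A functional_Z])
  also have "\<dots> \<le> indicator_integral M A (\<lambda>x. dual_seminorm E \<phi> * norm (Z k x))"
  proof (rule indicator_integral_mono[OF A])
    show "AE x in M. \<bar>blinfun_apply \<phi> (Z k x)\<bar> \<le> dual_seminorm E \<phi> * norm (Z k x)"
      using Z_E[of k] by eventually_elim (rule dual_seminorm_bound[OF E(1)])
  qed (use functional_Z norm_Z in auto)
  finally show ?thesis by (simp add: indicator_integral_cmult)
qed

lemma functional_bounded:
  fixes \<phi> :: "'e \<Rightarrow>\<^sub>L real"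
  assumes A: "A \<in> sets M"
  shows "bounded (range (\<lambda>k. indicator_integral M A (\<lambda>x. blinfun_apply \<phi> (Z k x))))"
proof (rule bounded_rangeI)
  fix k
  show "\<bar>indicator_integral M A (\<lambda>x. blinfun_apply \<phi> (Z k x))\<bar> \<le> dual_seminorm E \<phi> * B"
    using functional_bound[OF A, of \<phi> k] mult_left_mono[OF _ dual_seminorm_nonneg[OF E(1)], of _ B \<phi>]
      Z_indicator_bound[OF A, of k] by (smt (verit))
qed

lemma norm_bounded: "A \<in> sets M \<Longrightarrow> bounded (range (\<lambda>k. indicator_integral M A (\<lambda>x. norm (Z k x))))"
  using Z_indicator_bound by (intro bounded_rangeI)

text \<open>Uniform integrability of the norms makes the limiting set function continuous at the
  empty set. Its density \<open>g\<close> will bound the norm of the weak limit pointwise.\<close>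

lemma control_density:
  obtains g where "integrable M g" "\<And>x. 0 \<le> g x"
    "\<And>A. A \<in> sets M \<Longrightarrow> L (\<lambda>k. indicator_integral M A (\<lambda>x. norm (Z k x))) = indicator_integral M A g"
proof (rule Radon_Nikodym_set_function[of "\<lambda>A. L (\<lambda>k. indicator_integral M A (\<lambda>x. norm (Z k x)))"])
  fix A assume A: "A \<in> sets M"
  show "0 \<le> L (\<lambda>k. indicator_integral M A (\<lambda>x. norm (Z k x)))"
    by (intro L_ge norm_bounded A indicator_integral_nonneg) auto
next
  fix A B assume AB: "A \<in> sets M" "B \<in> sets M" "A \<inter> B = {}"
  show "L (\<lambda>k. indicator_integral M (A \<union> B) (\<lambda>x. norm (Z k x))) =
      L (\<lambda>k. indicator_integral M A (\<lambda>x. norm (Z k x))) + L (\<lambda>k. indicator_integral M B (\<lambda>x. norm (Z k x)))"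
    using indicator_integral_Un[OF AB norm_Z] L_add[OF norm_bounded norm_bounded] AB by simp
next
  fix A assume "A \<in> null_sets M"
  then show "L (\<lambda>k. indicator_integral M A (\<lambda>x. norm (Z k x))) = 0"
    by (simp add: indicator_integral_null L_const)
next
  fix A :: "nat \<Rightarrow> 'x set" assume A: "range A \<subseteq> sets M" "decseq A" "(\<Inter>i. A i) = {}"
  show "(\<lambda>i. L (\<lambda>k. indicator_integral M (A i) (\<lambda>x. norm (Z k x)))) \<longlonglongrightarrow> 0"
  proof (rule LIMSEQ_I)
    fix r :: real assume "r > 0"
    then obtain \<delta> where \<delta>: "\<delta> > 0" "\<And>k A. A \<in> sets M \<Longrightarrow> measure M A \<le> \<delta> \<Longrightarrow>
        indicator_integral M A (\<lambda>x. norm (Z k x)) \<le> r / 2"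
      using Z_ui[of "r / 2"] by auto
    have "(\<lambda>i. measure M (A i)) \<longlonglongrightarrow> 0" using finite_Lim_measure_decseq[OF A(1,2)] A(3) by simp
    then have "\<forall>\<^sub>F i in sequentially. measure M (A i) < \<delta>" using \<delta>(1) by (rule order_tendstoD(2))
    then obtain n where n: "\<And>i. i \<ge> n \<Longrightarrow> measure M (A i) < \<delta>" by (auto simp: eventually_sequentially)
    show "\<exists>no. \<forall>i\<ge>no. norm (L (\<lambda>k. indicator_integral M (A i) (\<lambda>x. norm (Z k x))) - 0) < r"
    proof (intro exI[of _ n] allI impI)
      fix i assume "i \<ge> n"
      then have "\<bar>L (\<lambda>k. indicator_integral M (A i) (\<lambda>x. norm (Z k x)))\<bar> \<le> r / 2"
        using \<delta>(2)[of "A i"] n[of i] A(1) indicator_integral_nonneg[of "\<lambda>x. norm (Z _ x)" "A i"]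
        by (intro L_abs_le) (auto simp: less_imp_le)
      then show "norm (L (\<lambda>k. indicator_integral M (A i) (\<lambda>x. norm (Z k x))) - 0) < r"
        using \<open>r > 0\<close> by simp
    qed
  qed
qed (use that in blast)

lemma functional_limit_bound:
  fixes \<phi> :: "'e \<Rightarrow>\<^sub>L real"
  assumes g: "\<And>A. A \<in> sets M \<Longrightarrow> L (\<lambda>k. indicator_integral M A (\<lambda>x. norm (Z k x))) = indicator_integral M A g"
    and A: "A \<in> sets M"
  shows "\<bar>L (\<lambda>k. indicator_integral M A (\<lambda>x. blinfun_apply \<phi> (Z k x)))\<bar> \<le> dual_seminorm E \<phi> * indicator_integral M A g"
proof -
  let ?u = "\<lambda>k. indicator_integral M A (\<lambda>x. blinfun_apply \<phi> (Z k x))"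
  let ?v = "\<lambda>k. indicator_integral M A (\<lambda>x. norm (Z k x))"
  have u: "bounded (range ?u)" by (rule functional_bounded[OF A])
  have v: "bounded (range (\<lambda>k. dual_seminorm E \<phi> * ?v k))"
    using dual_seminorm_nonneg[OF E(1), of \<phi>] Z_indicator_bound[OF A]
    by (intro bounded_rangeI[of _ "dual_seminorm E \<phi> * B"]) (auto simp: abs_mult intro: mult_left_mono)
  have Lv: "L (\<lambda>k. dual_seminorm E \<phi> * ?v k) = dual_seminorm E \<phi> * indicator_integral M A g"
    using L_cmult[OF norm_bounded[OF A]] g[OF A] by simp
  have "L ?u \<le> L (\<lambda>k. dual_seminorm E \<phi> * ?v k)"
    using functional_bound[OF A, of \<phi>] by (intro L_mono u v) (auto simp: abs_le_iff)
  moreover have "L (\<lambda>k. - 1 * ?u k) \<le> L (\<lambda>k. dual_seminorm E \<phi> * ?v k)"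
    using functional_bound[OF A, of \<phi>] u
    by (intro L_mono v) (auto simp: abs_le_iff bounded_iff)
  moreover have "L (\<lambda>k. - 1 * ?u k) = - L ?u" using L_cmult[OF u, of "- 1"] by simp
  ultimately show ?thesis by (simp add: Lv abs_le_iff)
qed

lemma functional_rat_comb:
  fixes f :: "nat \<Rightarrow> 'e \<Rightarrow>\<^sub>L real"
  shows "blinfun_apply (rat_comb f q) v = rat_comb (\<lambda>i. blinfun_apply (f i) v) q"
  by (simp add: rat_comb_def blinfun.sum_left blinfun.scaleR_left)

lemma indicator_integral_rat_comb:
  fixes h :: "nat \<Rightarrow> 'x \<Rightarrow> real"
  assumes "A \<in> sets M" "\<And>i. integrable M (h i)"
  shows "indicator_integral M A (\<lambda>x. rat_comb (\<lambda>i. h i x) q) = rat_comb (\<lambda>i. indicator_integral M A (h i)) q"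
    "integrable M (\<lambda>x. rat_comb (\<lambda>i. h i x) q)"
  using assms by (simp_all add: rat_comb_def indicator_integral_sum indicator_integral_cmult)

lemma L_rat_comb:
  assumes "\<And>i. bounded (range (u i))"
  shows "L (\<lambda>k. rat_comb (\<lambda>i. u i k) q) = rat_comb (\<lambda>i. L (u i)) q"
proof -
  have b: "bounded (range (\<lambda>k. c * u i k))" for c i
    using bounded_scaling[OF assms[of i], of c] by (simp add: image_image)
  show ?thesis
    unfolding rat_comb_def real_scaleR_def using L_sum[of _ "\<lambda>i k. of_rat (q ! i) * u i k"] b
    by (simp add: L_cmult[OF assms])
qed

text \<open>Each \<open>d i\<close> gives a real density \<open>h i\<close>. Outside one null set
  all rational combinations of the numbers \<open>h i x\<close> are bounded by \<open>g x\<close>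
  times the seminorm of the same combination of the \<open>d i\<close>. There the moment criterion
  and the reflexivity of \<open>E\<close> produce a point of \<open>E\<close> at which every
  \<open>d i\<close> takes the value \<open>h i x\<close>.\<close>

lemma weak_limit_exists:
  obtains \<xi> where "bochner_integrable M \<xi>" "\<And>x. \<xi> x \<in> E"
    "\<And>i A. A \<in> sets M \<Longrightarrow>
      L (\<lambda>k. indicator_integral M A (\<lambda>x. blinfun_apply (d i) (Z k x))) = indicator_integral M A (\<lambda>x. blinfun_apply (d i) (\<xi> x))"
proof -
  obtain g where g: "integrable M g" "\<And>x. 0 \<le> g x"
    "\<And>A. A \<in> sets M \<Longrightarrow> L (\<lambda>k. indicator_integral M A (\<lambda>x. norm (Z k x))) = indicator_integral M A g"
    by (rule control_density) blast
  let ?\<nu> = "\<lambda>\<phi> A. L (\<lambda>k. indicator_integral M A (\<lambda>x. blinfun_apply \<phi> (Z k x)))"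
  have "\<exists>h. integrable M h \<and> (\<forall>A\<in>sets M. ?\<nu> (d i) A = indicator_integral M A h)" for i
  proof -
    obtain h where "integrable M h" "\<And>A. A \<in> sets M \<Longrightarrow> ?\<nu> (d i) A = indicator_integral M A h"
    proof (rule Radon_Nikodym_dominated[of "\<lambda>x. dual_seminorm E (d i) * g x" "?\<nu> (d i)"])
      fix A B assume AB: "A \<in> sets M" "B \<in> sets M" "A \<inter> B = {}"
      show "?\<nu> (d i) (A \<union> B) = ?\<nu> (d i) A + ?\<nu> (d i) B"
        using indicator_integral_Un[OF AB functional_Z] L_add[OF functional_bounded functional_bounded] AB by simp
    qed (use g functional_limit_bound[OF g(3)] dual_seminorm_nonneg[OF E(1)] in \<open>auto simp: indicator_integral_cmult\<close>)
    then show ?thesis by blast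
  qed
  then obtain h where h: "\<And>i. integrable M (h i)"
      "\<And>i A. A \<in> sets M \<Longrightarrow> ?\<nu> (d i) A = indicator_integral M A (h i)" by metis
  \<comment> \<open>Inequalities between integrals over all \<open>A\<close> become pointwise ones,
    and countability of the rational lists places all of them outside one null set.\<close>
  have bounds: "AE x in M. \<forall>q. \<bar>rat_comb (\<lambda>i. h i x) q\<bar> \<le> g x * dual_seminorm E (rat_comb d q)"
    unfolding AE_all_countable
  proof
    fix q
    have eq: "indicator_integral M A (\<lambda>x. rat_comb (\<lambda>i. h i x) q) = ?\<nu> (rat_comb d q) A" if A: "A \<in> sets M" for A
      unfolding functional_rat_comb indicator_integral_rat_comb(1)[OF A functional_Z] L_rat_comb[OF functional_bounded[OF A]]
        indicator_integral_rat_comb(1)[OF A h(1)] using h(2)[OF A] by simp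
    have int: "integrable M (\<lambda>x. rat_comb (\<lambda>i. h i x) q)" "integrable M (\<lambda>x. dual_seminorm E (rat_comb d q) * g x)"
      using h(1) g(1) by (auto intro: indicator_integral_rat_comb(2)[of "space M"])
    have b: "\<bar>indicator_integral M A (\<lambda>x. rat_comb (\<lambda>i. h i x) q)\<bar> \<le> indicator_integral M A (\<lambda>x. dual_seminorm E (rat_comb d q) * g x)"
      if "A \<in> sets M" for A
      using functional_limit_bound[OF g(3) that] eq[OF that] by (simp add: indicator_integral_cmult)
    have "AE x in M. rat_comb (\<lambda>i. h i x) q \<le> dual_seminorm E (rat_comb d q) * g x"
      using b by (intro AE_le_indicator_integral int) (auto simp: abs_le_iff)
    moreover have "AE x in M. - 1 * rat_comb (\<lambda>i. h i x) q \<le> dual_seminorm E (rat_comb d q) * g x"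
    proof (rule AE_le_indicator_integral)
      fix A assume A: "A \<in> sets M"
      show "indicator_integral M A (\<lambda>x. - 1 * rat_comb (\<lambda>i. h i x) q) \<le> indicator_integral M A (\<lambda>x. dual_seminorm E (rat_comb d q) * g x)"
        unfolding indicator_integral_cmult[of A "- 1"] using b[OF A] by (simp add: abs_le_iff)
    qed (use int in auto)
    ultimately show "AE x in M. \<bar>rat_comb (\<lambda>i. h i x) q\<bar> \<le> g x * dual_seminorm E (rat_comb d q)"
      by eventually_elim (simp add: abs_le_iff mult.commute)
  qed
  have rep: "\<exists>v\<in>E. norm v \<le> g x \<and> (\<forall>i. blinfun_apply (d i) v = h i x)"
    if x: "\<forall>q. \<bar>rat_comb (\<lambda>i. h i x) q\<bar> \<le> g x * dual_seminorm E (rat_comb d q)" for x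
  proof -
    obtain \<Lambda> where \<Lambda>: "linear_functional_on UNIV \<Lambda>" "\<And>v. \<Lambda> v \<le> g x * dual_seminorm E v" "\<And>i. \<Lambda> (d i) = h i x"
      using moment_functional[OF sublinear_on_dual_seminorm[OF E(1)] dual_seminorm_uminus[OF E(1)]
        dual_seminorm_nonneg[OF E(1)] g(2), of "\<lambda>i. h i x" x d] x by auto
    obtain v where "v \<in> E" "norm v \<le> g x" "\<And>f. \<Lambda> f = blinfun_apply f v"
      by (rule reflexive_functional_in_subspace[OF E(1) refl E(2) \<Lambda>(1,2) g(2)]) blast
    then show ?thesis using \<Lambda>(3) by auto
  qed
  from bounds have AEv: "AE x in M. \<exists>v\<in>E. norm v \<le> g x \<and> (\<forall>i. blinfun_apply (d i) v = h i x)"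
    by eventually_elim (rule rep)
  obtain N where N: "\<And>x. x \<in> space M - N \<Longrightarrow> \<exists>v\<in>E. norm v \<le> g x \<and> (\<forall>i. blinfun_apply (d i) v = h i x)"
      "N \<in> null_sets M"
    by (rule AE_E3[OF AEv]) blast
  \<comment> \<open>An arbitrary choice is good enough: almost surely every \<open>d i\<close> has
    the measurable value \<open>h i x\<close> at it, and the \<open>d i\<close> are dense, so every
    functional of \<open>\<xi>\<close> is measurable.\<close>
  define \<xi> where "\<xi> x = (if x \<in> space M - N then SOME v. v \<in> E \<and> norm v \<le> g x \<and> (\<forall>i. blinfun_apply (d i) v = h i x) else 0)" for x
  have \<xi>': "\<xi> x \<in> E \<and> norm (\<xi> x) \<le> g x \<and> (\<forall>i. blinfun_apply (d i) (\<xi> x) = h i x)" if "x \<in> space M - N" for x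
    using someI_ex[OF N(1)[OF that, unfolded Bex_def]] that by (simp add: \<xi>_def)
  have \<xi>E: "\<xi> x \<in> E" for x using \<xi>'[of x] subspace_0[OF E(1)] by (cases "x \<in> space M - N") (auto simp: \<xi>_def)
  have AE\<xi>: "AE x in M. norm (\<xi> x) \<le> g x \<and> (\<forall>i. blinfun_apply (d i) (\<xi> x) = h i x)"
    using AE_not_in[OF N(2)] AE_space by eventually_elim (use \<xi>' in auto)
  have meas: "(\<lambda>x. blinfun_apply f (\<xi> x)) \<in> borel_measurable M" for f :: "'e \<Rightarrow>\<^sub>L real"
  proof -
    have "\<exists>i. dual_seminorm E (f - d i) < 1 / real (Suc n)" for n by (rule d_dense) simp
    then obtain i where i: "\<And>n. dual_seminorm E (f - d (i n)) < 1 / real (Suc n)" by metis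
    show ?thesis
    proof (rule borel_measurable_AE_LIMSEQ[of "\<lambda>n. h (i n)"])
      show "h (i n) \<in> borel_measurable M" for n using h(1) by auto
      from AE\<xi> show "AE x in M. (\<lambda>n. h (i n) x) \<longlonglongrightarrow> blinfun_apply f (\<xi> x)"
      proof eventually_elim
        case (elim x)
        show ?case
        proof (rule Lim_null_comparison[where g = "\<lambda>n. norm (\<xi> x) * (1 / real (Suc n))", THEN LIM_zero_cancel])
          show "(\<lambda>n. norm (\<xi> x) * (1 / real (Suc n))) \<longlonglongrightarrow> 0"
            using tendsto_mult_right_zero[OF LIMSEQ_inverse_real_of_nat] by (simp add: inverse_eq_divide)
          have "norm (h (i n) x - blinfun_apply f (\<xi> x)) \<le> norm (\<xi> x) * (1 / real (Suc n))" for n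
          proof -
            have "norm (h (i n) x - blinfun_apply f (\<xi> x)) = \<bar>blinfun_apply (f - d (i n)) (\<xi> x)\<bar>"
              using elim by (simp add: blinfun.diff_left abs_minus_commute)
            also have "\<dots> \<le> dual_seminorm E (f - d (i n)) * norm (\<xi> x)"
              by (rule dual_seminorm_bound[OF E(1) \<xi>E])
            also have "\<dots> \<le> (1 / real (Suc n)) * norm (\<xi> x)" using i[of n] by (intro mult_right_mono) auto
            finally show ?thesis by (simp add: mult.commute)
          qed
          then show "\<forall>\<^sub>F n in sequentially. norm (h (i n) x - blinfun_apply f (\<xi> x)) \<le> norm (\<xi> x) * (1 / real (Suc n))"
            by simp
        qed
      qed
    qed
  qed
  have sm: "strongly_measurable M \<xi>"
  proof (rule strongly_measurable_dense_sequence[of _ z])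
    show "AE x in M. \<xi> x \<in> closure (range z)" using z_dense \<xi>E by simp
    have "\<exists>f :: 'e \<Rightarrow>\<^sub>L real. norm f \<le> 1 \<and> blinfun_apply f (z i) = norm (z i)" for i
      using norming_functional by blast
    then obtain F :: "nat \<Rightarrow> 'e \<Rightarrow>\<^sub>L real" where F: "\<And>i. norm (F i) \<le> 1" "\<And>i. blinfun_apply (F i) (z i) = norm (z i)"
      by metis
    \<comment> \<open>On the separable subspace \<open>E\<close> the norm is a supremum of countably
      many functionals, so scalar measurability carries over to the distances from the
      \<open>z j\<close>.\<close>
    have sup: "norm v = (SUP i. blinfun_apply (F i) v)" if v: "v \<in> E" for v
    proof (rule antisym)
      have le: "blinfun_apply (F i) v \<le> norm v" for i using blinfun_le_norm[OF F(1), of i v] by simp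
      then have bdd: "bdd_above (range (\<lambda>i. blinfun_apply (F i) v))" by (auto simp: bdd_above_def)
      show "(SUP i. blinfun_apply (F i) v) \<le> norm v" using le by (intro cSUP_least) auto
      show "norm v \<le> (SUP i. blinfun_apply (F i) v)"
      proof (rule field_le_epsilon)
        fix \<epsilon> :: real assume "\<epsilon> > 0"
        then obtain i where i: "norm (z i - v) < \<epsilon> / 2"
          using z_dense[OF v] unfolding closure_approachable dist_norm by (metis half_gt_zero rangeE)
        have "norm v \<le> norm (z i) + norm (z i - v)" using norm_triangle_ineq4[of "z i" "z i - v"] by simp
        also have "norm (z i) = blinfun_apply (F i) v + blinfun_apply (F i) (z i - v)" by (simp add: blinfun.diff_right F)
        also have "\<dots> \<le> (SUP i. blinfun_apply (F i) v) + norm (z i - v)"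
          using cSUP_upper[OF _ bdd, of i] blinfun_le_norm[OF F(1), of i "z i - v"] by auto
        finally show "norm v \<le> (SUP i. blinfun_apply (F i) v) + \<epsilon>" using i by simp
      qed
    qed
    fix j
    have bdd: "bdd_above (range (\<lambda>i. blinfun_apply (F i) v))" for v
      using blinfun_le_norm[OF F(1), of _ v] by (intro bdd_aboveI2[of _ _ "norm v"]) (auto simp: abs_le_iff)
    have "(\<lambda>x. SUP i. blinfun_apply (F i) (\<xi> x) - blinfun_apply (F i) (z j)) \<in> borel_measurable M"
    proof (rule borel_measurable_cSUP)
      show "bdd_above (range (\<lambda>i. blinfun_apply (F i) (\<xi> x) - blinfun_apply (F i) (z j)))" for x
        using bdd[of "\<xi> x - z j"] by (simp add: blinfun.diff_right)
    qed (use meas in auto)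
    moreover have "norm (\<xi> x - z j) = (SUP i. blinfun_apply (F i) (\<xi> x) - blinfun_apply (F i) (z j))" for x
      using sup[OF subspace_diff[OF E(1) \<xi>E z_E]] by (simp add: blinfun.diff_right)
    ultimately show "(\<lambda>x. norm (\<xi> x - z j)) \<in> borel_measurable M" by simp
  qed
  show ?thesis
  proof (rule that[of \<xi>])
    show "bochner_integrable M \<xi>"
      by (rule bochner_integrable_bound[OF sm g(1)]) (use AE\<xi> in eventually_elim, simp)
    show "\<xi> x \<in> E" for x by (rule \<xi>E)
    fix i A assume A: "A \<in> sets M"
    have "indicator_integral M A (h i) = indicator_integral M A (\<lambda>x. blinfun_apply (d i) (\<xi> x))"
      unfolding indicator_integral_def
    proof (rule integral_cong_AE)
      from AE\<xi> show "AE x in M. indicator A x * h i x = indicator A x * blinfun_apply (d i) (\<xi> x)"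
        by eventually_elim simp
    qed (use meas h(1)[of i] A in \<open>auto intro!: borel_measurable_times\<close>)
    then show "?\<nu> (d i) A = indicator_integral M A (\<lambda>x. blinfun_apply (d i) (\<xi> x))" using h(2)[OF A] by simp
  qed
qed

end

section \<open>Arbitrary continuous functionals on L1\<close>

context finite_complete_measure
begin

lemma subspace_bochner_integrable: "subspace {w :: 'x \<Rightarrow> 'e::banach. bochner_integrable M w}"
  by (rule subspaceI)
    (auto simp: plus_fun_def scaleR_fun_def zero_fun_def intro: bochner_integrable_zero bochner_integrable_add bochner_integrable_scaleR)

lemma simple_function_sum_indicator:
  fixes s :: "'x \<Rightarrow> 'e::real_vector"
  assumes "simple_function M s" "x \<in> space M"
  shows "s x = (\<Sum>v\<in>s ` space M. indicat_real (s -` {v} \<inter> space M) x *\<^sub>R v)"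
proof -
  have fin: "finite (s ` space M)" using assms(1) by (simp add: simple_function_def)
  have "(\<Sum>v\<in>s ` space M. indicat_real (s -` {v} \<inter> space M) x *\<^sub>R v)
      = (\<Sum>v\<in>s ` space M. if v = s x then v else 0)"
    using assms(2) by (intro sum.cong) (auto simp: indicator_def)
  also have "\<dots> = s x" using fin assms(2) by (simp add: sum.delta)
  finally show ?thesis by simp
qed

lemma blinfun_indicator_scaleR:
  fixes \<phi> :: "'e::real_normed_vector \<Rightarrow>\<^sub>L real"
  shows "blinfun_apply \<phi> (indicat_real A x *\<^sub>R v) = indicat_real A x * blinfun_apply \<phi> v"
  by (simp add: blinfun.scaleR_right)

lemma indicator_integral_const: "A \<in> sets M \<Longrightarrow> indicator_integral M A (\<lambda>x. c) = c * measure M A"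
  unfolding indicator_integral_def using sets.sets_into_space[of A M] by (simp add: Int_absorb2 mult.commute)

lemma integrable_indicator: "A \<in> sets M \<Longrightarrow> integrable M (indicat_real A)"
  using integrable_indicator_mult[of A M "\<lambda>_. 1"] by simp

lemma bochner_integrable_const: "bochner_integrable M (\<lambda>x. c)"
  by (simp add: bochner_integrable_iff strongly_measurable_const)

end

text \<open>An arbitrary continuous functional on L1. Passing to the limit in it calls for a
  representation by a density with values in the dual; what is constructed is an approximation of
  such a density by countably many constant values \<open>d i\<close>.\<close>

locale L1_functional = weak_limit M L Z B y d E
  for M :: "'x measure" and L and Z :: "nat \<Rightarrow> 'x \<Rightarrow> 'e::banach" and B y d E +
  fixes \<Lambda> :: "('x \<Rightarrow> 'e) \<Rightarrow> real" and C :: real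
  assumes \<Lambda>_linear: "linear_functional_on {w. bochner_integrable M w} \<Lambda>"
    and \<Lambda>_bound: "\<And>w. bochner_integrable M w \<Longrightarrow> \<bar>\<Lambda> w\<bar> \<le> C * (\<integral>x. norm (w x) \<partial>M)"
    and C_nonneg: "0 \<le> C"
begin

lemma \<Lambda>_add: "bochner_integrable M v \<Longrightarrow> bochner_integrable M w \<Longrightarrow> \<Lambda> (\<lambda>x. v x + w x) = \<Lambda> v + \<Lambda> w"
  using \<Lambda>_linear unfolding linear_functional_on_def plus_fun_def by auto

lemma \<Lambda>_scaleR: "bochner_integrable M w \<Longrightarrow> \<Lambda> (\<lambda>x. c *\<^sub>R w x) = c * \<Lambda> w"
  using \<Lambda>_linear unfolding linear_functional_on_def scaleR_fun_def by auto

lemma \<Lambda>_diff: "bochner_integrable M v \<Longrightarrow> bochner_integrable M w \<Longrightarrow> \<Lambda> (\<lambda>x. v x - w x) = \<Lambda> v - \<Lambda> w"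
  using \<Lambda>_add[of v "\<lambda>x. (- 1) *\<^sub>R w x"] \<Lambda>_scaleR[of w "- 1"] bochner_integrable_scaleR[of w "- 1"] by simp

lemma \<Lambda>_sum:
  "(\<And>i. i \<in> I \<Longrightarrow> bochner_integrable M (w i)) \<Longrightarrow> \<Lambda> (\<lambda>x. \<Sum>i\<in>I. w i x) = (\<Sum>i\<in>I. \<Lambda> (w i))"
proof (induction I rule: infinite_finite_induct)
  case (insert i I)
  then show ?case using \<Lambda>_add[of "w i" "\<lambda>x. \<Sum>i\<in>I. w i x"] bochner_integrable_sum[of I w] by simp
qed (use \<Lambda>_scaleR[OF bochner_integrable_zero, of 0] in auto)

lemma \<Lambda>_AE_cong:
  assumes v: "bochner_integrable M v" and eq: "AE x in M. v x = w x" shows "\<Lambda> v = \<Lambda> w"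
proof -
  have w: "bochner_integrable M w" by (rule bochner_integrable_AE_cong[OF assms])
  have "(\<integral>x. norm (v x - w x) \<partial>M) = 0"
    by (rule integral_eq_zero_AE) (use eq in eventually_elim, simp)
  then show ?thesis using \<Lambda>_bound[OF bochner_integrable_diff[OF v w]] \<Lambda>_diff[OF v w] by simp
qed

lemma \<Lambda>_continuous:
  assumes "bochner_integrable M v" "bochner_integrable M w" "A \<in> sets M"
  shows "\<bar>\<Lambda> (\<lambda>x. indicat_real A x *\<^sub>R v x) - \<Lambda> (\<lambda>x. indicat_real A x *\<^sub>R w x)\<bar> \<le> C * (\<integral>x. norm (v x - w x) \<partial>M)"
proof -
  have vw: "bochner_integrable M (\<lambda>x. v x - w x)" using assms by (intro bochner_integrable_diff)
  have "\<Lambda> (\<lambda>x. indicat_real A x *\<^sub>R v x) - \<Lambda> (\<lambda>x. indicat_real A x *\<^sub>R w x) = \<Lambda> (\<lambda>x. indicat_real A x *\<^sub>R (v x - w x))"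
    using \<Lambda>_diff[of "\<lambda>x. indicat_real A x *\<^sub>R v x" "\<lambda>x. indicat_real A x *\<^sub>R w x"] assms
    by (simp add: bochner_integrable_indicator scaleR_diff_right)
  also have "\<bar>\<dots>\<bar> \<le> C * (\<integral>x. norm (indicat_real A x *\<^sub>R (v x - w x)) \<partial>M)"
    using assms vw by (intro \<Lambda>_bound bochner_integrable_indicator)
  also have "(\<integral>x. norm (indicat_real A x *\<^sub>R (v x - w x)) \<partial>M) \<le> (\<integral>x. norm (v x - w x) \<partial>M)"
    using indicator_integral_le_integral[OF assms(3) bochner_integrableD(2)[OF vw]]
    by (simp add: indicator_integral_def)
  finally show ?thesis using C_nonneg by (simp add: mult_left_mono)
qed

lemma \<Lambda>_indicator_bound:
  assumes "bochner_integrable M w" "A \<in> sets M"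
  shows "\<bar>\<Lambda> (\<lambda>x. indicat_real A x *\<^sub>R w x)\<bar> \<le> C * indicator_integral M A (\<lambda>x. norm (w x))"
  using \<Lambda>_bound[OF bochner_integrable_indicator[OF assms(2,1)]]
  by (simp add: indicator_integral_def)

text \<open>For a fixed vector \<open>z j\<close> the values of \<open>\<Lambda>\<close> on
  \<open>z j\<close> restricted to \<open>A\<close> are dominated by a multiple of the measure of
  \<open>A\<close>, hence have a density in \<open>A\<close>. The bounds for rational combinations
  say that at almost every point these densities satisfy the moment condition for a functional of
  norm at most \<open>C\<close>.\<close>

lemma \<Lambda>_densities:
  obtains u where "\<And>j. integrable M (u j)"
    "\<And>j A. A \<in> sets M \<Longrightarrow> \<Lambda> (\<lambda>x. indicat_real A x *\<^sub>R z j) = indicator_integral M A (u j)"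
    "AE x in M. \<forall>q. \<bar>rat_comb (\<lambda>j. u j x) q\<bar> \<le> C * norm (rat_comb z q)"
proof -
  have "\<exists>u. integrable M u \<and> (\<forall>A\<in>sets M. \<Lambda> (\<lambda>x. indicat_real A x *\<^sub>R z j) = indicator_integral M A u)" for j
  proof -
    obtain u where "integrable M u" "\<And>A. A \<in> sets M \<Longrightarrow> \<Lambda> (\<lambda>x. indicat_real A x *\<^sub>R z j) = indicator_integral M A u"
    proof (rule Radon_Nikodym_dominated[of "\<lambda>_. C * norm (z j)" "\<lambda>A. \<Lambda> (\<lambda>x. indicat_real A x *\<^sub>R z j)"])
      fix A A' assume A: "A \<in> sets M" "A' \<in> sets M" "A \<inter> A' = {}"
      have "(\<lambda>x. indicat_real (A \<union> A') x *\<^sub>R z j) = (\<lambda>x. indicat_real A x *\<^sub>R z j + indicat_real A' x *\<^sub>R z j)"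
        using A(3) by (auto simp: fun_eq_iff indicator_def)
      then show "\<Lambda> (\<lambda>x. indicat_real (A \<union> A') x *\<^sub>R z j)
          = \<Lambda> (\<lambda>x. indicat_real A x *\<^sub>R z j) + \<Lambda> (\<lambda>x. indicat_real A' x *\<^sub>R z j)"
        using \<Lambda>_add[OF bochner_integrable_indicator[OF A(1) bochner_integrable_const] bochner_integrable_indicator[OF A(2) bochner_integrable_const]]
        by simp
    next
      fix A assume A: "A \<in> sets M"
      show "\<bar>\<Lambda> (\<lambda>x. indicat_real A x *\<^sub>R z j)\<bar> \<le> indicator_integral M A (\<lambda>_. C * norm (z j))"
        using \<Lambda>_indicator_bound[OF bochner_integrable_const A, of "z j"] by (simp add: indicator_integral_cmult)
    qed (use C_nonneg in auto)
    then show ?thesis by blast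
  qed
  then obtain u where u: "\<And>j. integrable M (u j)"
      "\<And>j A. A \<in> sets M \<Longrightarrow> \<Lambda> (\<lambda>x. indicat_real A x *\<^sub>R z j) = indicator_integral M A (u j)" by metis
  have ae: "AE x in M. \<forall>q. \<bar>rat_comb (\<lambda>j. u j x) q\<bar> \<le> C * norm (rat_comb z q)"
    unfolding AE_all_countable
  proof
    fix q
    have int: "integrable M (\<lambda>x. rat_comb (\<lambda>j. u j x) q)"
      using u(1) by (rule indicator_integral_rat_comb(2)[OF sets.top])
    have b: "\<bar>indicator_integral M A (\<lambda>x. rat_comb (\<lambda>j. u j x) q)\<bar> \<le> indicator_integral M A (\<lambda>x. C * norm (rat_comb z q))"
      if A: "A \<in> sets M" for A
    proof -
      have bi: "bochner_integrable M (\<lambda>x. indicat_real A x *\<^sub>R z j)" for j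
        by (intro bochner_integrable_indicator A bochner_integrable_const)
      have "indicator_integral M A (\<lambda>x. rat_comb (\<lambda>j. u j x) q) = rat_comb (\<lambda>j. \<Lambda> (\<lambda>x. indicat_real A x *\<^sub>R z j)) q"
        using indicator_integral_rat_comb(1)[OF A u(1)] u(2)[OF A] by simp
      also have "\<dots> = (\<Sum>i<length q. \<Lambda> (\<lambda>x. real_of_rat (q ! i) *\<^sub>R (indicat_real A x *\<^sub>R z i)))"
        by (simp only: rat_comb_def real_scaleR_def \<Lambda>_scaleR[OF bi])
      also have "\<dots> = \<Lambda> (\<lambda>x. \<Sum>i<length q. real_of_rat (q ! i) *\<^sub>R (indicat_real A x *\<^sub>R z i))"
        by (rule \<Lambda>_sum[symmetric]) (intro bochner_integrable_scaleR bi)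
      also have "(\<lambda>x. \<Sum>i<length q. real_of_rat (q ! i) *\<^sub>R (indicat_real A x *\<^sub>R z i)) = (\<lambda>x. indicat_real A x *\<^sub>R rat_comb z q)"
        by (simp add: rat_comb_def scaleR_sum_right mult.commute)
      finally show ?thesis
        using \<Lambda>_indicator_bound[OF bochner_integrable_const A, of "rat_comb z q"] by (simp add: indicator_integral_cmult)
    qed
    have "AE x in M. rat_comb (\<lambda>j. u j x) q \<le> C * norm (rat_comb z q)"
      using b by (intro AE_le_indicator_integral int) (auto simp: abs_le_iff)
    moreover have "AE x in M. - 1 * rat_comb (\<lambda>j. u j x) q \<le> C * norm (rat_comb z q)"
    proof (rule AE_le_indicator_integral)
      fix A assume A: "A \<in> sets M"
      show "indicator_integral M A (\<lambda>x. - 1 * rat_comb (\<lambda>j. u j x) q) \<le> indicator_integral M A (\<lambda>x. C * norm (rat_comb z q))"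
        unfolding indicator_integral_cmult[of A "- 1"] using b[OF A] by (simp add: abs_le_iff)
    qed (use int in auto)
    ultimately show "AE x in M. \<bar>rat_comb (\<lambda>j. u j x) q\<bar> \<le> C * norm (rat_comb z q)"
      by eventually_elim (simp add: abs_le_iff)
  qed
  show ?thesis by (rule that[of u]) (fact u(1), fact u(2), fact ae)
qed

text \<open>At almost every point the densities at the \<open>z j\<close> are the values of one
  functional, and some \<open>d i\<close> is within \<open>\<epsilon>\<close> of it in the seminorm
  of \<open>E\<close>. So countably many sets \<open>D i\<close> cover the space up to a null set,
  and on each of them \<open>\<Lambda>\<close> is close to integration of the constant functional
  \<open>d i\<close>.\<close>

lemma \<Lambda>_piecewise_constant:
  assumes \<epsilon>: "\<epsilon> > 0"
  obtains D where "\<And>i. D i \<in> sets M" "AE x in M. \<exists>i. x \<in> D i"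
    "\<And>i A j. A \<in> sets M \<Longrightarrow> A \<subseteq> D i \<Longrightarrow>
      \<bar>\<Lambda> (\<lambda>x. indicat_real A x *\<^sub>R z j) - blinfun_apply (d i) (z j) * measure M A\<bar> \<le> \<epsilon> * norm (z j) * measure M A"
proof -
  obtain u where u: "\<And>j. integrable M (u j)"
    "\<And>j A. A \<in> sets M \<Longrightarrow> \<Lambda> (\<lambda>x. indicat_real A x *\<^sub>R z j) = indicator_integral M A (u j)"
    and ae: "AE x in M. \<forall>q. \<bar>rat_comb (\<lambda>j. u j x) q\<bar> \<le> C * norm (rat_comb z q)"
    by (rule \<Lambda>_densities) blast
  have [measurable]: "u j \<in> borel_measurable M" for j using u(1) by auto
  define D where "D i = {x \<in> space M. \<forall>j. \<bar>u j x - blinfun_apply (d i) (z j)\<bar> \<le> \<epsilon> * norm (z j)}" for i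
  show ?thesis
  proof (rule that[of D])
    show "D i \<in> sets M" for i unfolding D_def by measurable
    from ae AE_space show "AE x in M. \<exists>i. x \<in> D i"
    proof eventually_elim
      case (elim x)
      obtain \<Gamma> :: "'e \<Rightarrow> real" where \<Gamma>: "linear_functional_on UNIV \<Gamma>" "\<And>v. \<Gamma> v \<le> C * norm v" "\<And>i. \<Gamma> (z i) = u i x"
        using moment_functional[OF sublinear_on_norm _ norm_ge_zero C_nonneg, of "\<lambda>j. u j x" z] elim(1) by auto
      obtain f :: "'e \<Rightarrow>\<^sub>L real" where f: "\<And>v. blinfun_apply f v = \<Gamma> v"
        using linear_functional_blinfun[OF \<Gamma>(1,2) C_nonneg] by blast
      obtain i where i: "dual_seminorm E (f - d i) < \<epsilon>" using d_dense[OF \<epsilon>] by blast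
      have "\<bar>u j x - blinfun_apply (d i) (z j)\<bar> \<le> \<epsilon> * norm (z j)" for j
      proof -
        have "\<bar>u j x - blinfun_apply (d i) (z j)\<bar> = \<bar>blinfun_apply (f - d i) (z j)\<bar>"
          by (simp add: blinfun.diff_left f \<Gamma>(3))
        also have "\<dots> \<le> dual_seminorm E (f - d i) * norm (z j)" by (rule dual_seminorm_bound[OF E(1) z_E])
        also have "\<dots> \<le> \<epsilon> * norm (z j)" using i by (intro mult_right_mono) auto
        finally show ?thesis .
      qed
      then show ?case using elim(2) by (auto simp: D_def)
    qed
    fix i A j assume A: "A \<in> sets M" "A \<subseteq> D i"
    have int: "integrable M (\<lambda>x. u j x - blinfun_apply (d i) (z j))" using u(1) by simp
    have "\<Lambda> (\<lambda>x. indicat_real A x *\<^sub>R z j) - blinfun_apply (d i) (z j) * measure M A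
        = indicator_integral M A (\<lambda>x. u j x - blinfun_apply (d i) (z j))"
      using A u by (simp add: indicator_integral_diff indicator_integral_const)
    also have "\<bar>\<dots>\<bar> \<le> indicator_integral M A (\<lambda>x. \<bar>u j x - blinfun_apply (d i) (z j)\<bar>)"
      by (rule indicator_integral_abs_le[OF A(1) int])
    also have "\<dots> \<le> indicator_integral M A (\<lambda>x. \<epsilon> * norm (z j))"
      unfolding indicator_integral_def
    proof (rule integral_mono)
      show "indicat_real A x * \<bar>u j x - blinfun_apply (d i) (z j)\<bar> \<le> indicat_real A x * (\<epsilon> * norm (z j))" for x
        using A(2) by (auto simp: indicator_def D_def)
    qed (use int A in \<open>auto intro!: integrable_indicator_mult integrable_mult_left integrable_indicator\<close>)
    finally show "\<bar>\<Lambda> (\<lambda>x. indicat_real A x *\<^sub>R z j) - blinfun_apply (d i) (z j) * measure M A\<bar> \<le> \<epsilon> * norm (z j) * measure M A"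
      using A by (simp add: indicator_integral_const)
  qed
qed

text \<open>Truncated approximations take the value \<open>0\<close>, which therefore has to be
  among the enumerated vectors; it is the empty combination.\<close>

lemma zero_in_range_z: "0 \<in> range z"
proof
  show "0 = z (to_nat ([] :: rat list))" by (simp add: z_def rat_comb_def)
qed simp

text \<open>A simple function with values among the \<open>z j\<close> is constant on its level
  sets; \<open>P\<close> applies to each of them, and the errors add up to the integral of the
  norm.\<close>

lemma \<Lambda>_simple_approx:
  assumes P: "\<And>A j. A \<in> sets M \<Longrightarrow> A \<subseteq> D \<Longrightarrow>
      \<bar>\<Lambda> (\<lambda>x. indicat_real A x *\<^sub>R z j) - blinfun_apply \<phi> (z j) * measure M A\<bar> \<le> \<epsilon> * norm (z j) * measure M A"
    and A: "A \<in> sets M" "A \<subseteq> D" and s: "simple_function M s" "\<And>x. s x \<in> range z"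
  shows "\<bar>\<Lambda> (\<lambda>x. indicat_real A x *\<^sub>R s x) - indicator_integral M A (\<lambda>x. blinfun_apply \<phi> (s x))\<bar>
    \<le> \<epsilon> * indicator_integral M A (\<lambda>x. norm (s x))"
proof -
  let ?S = "s ` space M"
  define A' where "A' v = A \<inter> (s -` {v} \<inter> space M)" for v
  have fin: "finite ?S" using s(1) by (simp add: simple_function_def)
  have A': "A' v \<in> sets M" "A' v \<subseteq> D" for v
    using A s(1) unfolding A'_def by (auto intro: sets.Int simple_functionD(2))
  have A'_space: "A' v \<subseteq> space M" for v by (auto simp: A'_def)
  have ind: "indicat_real A x * indicat_real (s -` {v} \<inter> space M) x = indicat_real (A' v) x" for v x
    by (simp add: A'_def indicator_inter_arith)
  have sum_eq: "indicat_real A x *\<^sub>R s x = (\<Sum>v\<in>?S. indicat_real (A' v) x *\<^sub>R v)" if "x \<in> space M" for x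
  proof -
    have "indicat_real A x *\<^sub>R s x = indicat_real A x *\<^sub>R (\<Sum>v\<in>?S. indicat_real (s -` {v} \<inter> space M) x *\<^sub>R v)"
      by (rule arg_cong[OF simple_function_sum_indicator[OF s(1) that]])
    then show ?thesis by (simp add: scaleR_sum_right ind)
  qed
  have int: "integrable M (indicat_real (A' v))" for v
    using A'(1) by (rule integrable_indicator)
  have bi: "bochner_integrable M (\<lambda>x. indicat_real (A' v) x *\<^sub>R v)" for v
    by (intro bochner_integrable_indicator A' bochner_integrable_const)
  have "\<Lambda> (\<lambda>x. indicat_real A x *\<^sub>R s x) = \<Lambda> (\<lambda>x. \<Sum>v\<in>?S. indicat_real (A' v) x *\<^sub>R v)"
    by (rule \<Lambda>_AE_cong[symmetric]) (auto intro!: bochner_integrable_sum bi simp: sum_eq)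
  also have "\<dots> = (\<Sum>v\<in>?S. \<Lambda> (\<lambda>x. indicat_real (A' v) x *\<^sub>R v))" by (rule \<Lambda>_sum) (rule bi)
  finally have 1: "\<Lambda> (\<lambda>x. indicat_real A x *\<^sub>R s x) = (\<Sum>v\<in>?S. \<Lambda> (\<lambda>x. indicat_real (A' v) x *\<^sub>R v))" .
  have gen: "indicator_integral M A (\<lambda>x. h (s x)) = (\<Sum>v\<in>?S. h v * measure M (A' v))" if h0: "h 0 = 0" for h :: "'e \<Rightarrow> real"
  proof -
    have "indicator_integral M A (\<lambda>x. h (s x)) = (\<integral>x. (\<Sum>v\<in>?S. indicat_real (A' v) x * h v) \<partial>M)"
      unfolding indicator_integral_def
    proof (rule Bochner_Integration.integral_cong)
      fix x assume x: "x \<in> space M"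
      have "(\<Sum>v\<in>?S. indicat_real (A' v) x * h v) = (\<Sum>v\<in>?S. if v = s x then indicat_real A x * h v else 0)"
        using x by (intro sum.cong) (auto simp: A'_def indicator_def)
      then show "indicat_real A x * h (s x) = (\<Sum>v\<in>?S. indicat_real (A' v) x * h v)"
        using x fin by (simp add: sum.delta)
    qed simp
    also have "\<dots> = (\<Sum>v\<in>?S. \<integral>x. indicat_real (A' v) x * h v \<partial>M)"
      using int by (intro Bochner_Integration.integral_sum integrable_mult_left) auto
    also have "\<dots> = (\<Sum>v\<in>?S. h v * measure M (A' v))"
      using A'_space by (simp add: Int_absorb2 mult.commute)
    finally show ?thesis .
  qed
  have "\<bar>\<Lambda> (\<lambda>x. indicat_real A x *\<^sub>R s x) - indicator_integral M A (\<lambda>x. blinfun_apply \<phi> (s x))\<bar>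
      = \<bar>\<Sum>v\<in>?S. \<Lambda> (\<lambda>x. indicat_real (A' v) x *\<^sub>R v) - blinfun_apply \<phi> v * measure M (A' v)\<bar>"
    using gen[of "blinfun_apply \<phi>"] by (simp add: 1 sum_subtractf)
  also have "\<dots> \<le> (\<Sum>v\<in>?S. \<bar>\<Lambda> (\<lambda>x. indicat_real (A' v) x *\<^sub>R v) - blinfun_apply \<phi> v * measure M (A' v)\<bar>)"
    by (rule sum_abs)
  also have "\<dots> \<le> (\<Sum>v\<in>?S. \<epsilon> * norm v * measure M (A' v))"
  proof (rule sum_mono)
    fix v assume "v \<in> ?S"
    then obtain j where "v = z j" using s(2) by blast
    then show "\<bar>\<Lambda> (\<lambda>x. indicat_real (A' v) x *\<^sub>R v) - blinfun_apply \<phi> v * measure M (A' v)\<bar> \<le> \<epsilon> * norm v * measure M (A' v)"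
      using P[OF A', of v j] by simp
  qed
  also have "\<dots> = \<epsilon> * indicator_integral M A (\<lambda>x. norm (s x))"
    using gen[of norm] by (simp add: sum_distrib_left mult.assoc)
  finally show ?thesis .
qed

lemma indicator_integral_LIMSEQ:
  assumes A: "A \<in> sets M" and f: "integrable M f" "\<And>n. integrable M (g n)"
    and lim: "(\<lambda>n. \<integral>x. e n x \<partial>M) \<longlonglongrightarrow> 0" and e: "\<And>n. integrable M (e n)"
    and le: "\<And>n x. x \<in> space M \<Longrightarrow> \<bar>g n x - f x\<bar> \<le> K * e n x"
  shows "(\<lambda>n. indicator_integral M A (g n)) \<longlonglongrightarrow> indicator_integral M A f"
proof (rule Lim_null_comparison[where g = "\<lambda>n. K * (\<integral>x. e n x \<partial>M)", THEN LIM_zero_cancel])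
  show "(\<lambda>n. K * (\<integral>x. e n x \<partial>M)) \<longlonglongrightarrow> 0" using tendsto_mult_right_zero[OF lim] .
  have "norm (indicator_integral M A (g n) - indicator_integral M A f) \<le> K * (\<integral>x. e n x \<partial>M)" for n
  proof -
    have int: "integrable M (\<lambda>x. g n x - f x)" using f by simp
    have "norm (indicator_integral M A (g n) - indicator_integral M A f) = \<bar>indicator_integral M A (\<lambda>x. g n x - f x)\<bar>"
      using f A by (simp add: indicator_integral_diff)
    also have "\<dots> \<le> indicator_integral M A (\<lambda>x. \<bar>g n x - f x\<bar>)" by (rule indicator_integral_abs_le[OF A int])
    also have "\<dots> \<le> (\<integral>x. \<bar>g n x - f x\<bar> \<partial>M)" using int by (intro indicator_integral_le_integral[OF A]) auto
    also have "\<dots> \<le> (\<integral>x. K * e n x \<partial>M)" using int e le by (intro integral_mono) auto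
    finally show ?thesis by simp
  qed
  then show "\<forall>\<^sub>F n in sequentially. norm (indicator_integral M A (g n) - indicator_integral M A f) \<le> K * (\<integral>x. e n x \<partial>M)"
    by simp
qed

text \<open>All three terms are continuous in L1, so it is enough to approximate \<open>w\<close> by
  simple functions whose values lie in the enumerated dense subset of \<open>E\<close>.\<close>

lemma \<Lambda>_local_approx:
  assumes P: "\<And>A j. A \<in> sets M \<Longrightarrow> A \<subseteq> D \<Longrightarrow>
      \<bar>\<Lambda> (\<lambda>x. indicat_real A x *\<^sub>R z j) - blinfun_apply \<phi> (z j) * measure M A\<bar> \<le> \<epsilon> * norm (z j) * measure M A"
    and A: "A \<in> sets M" "A \<subseteq> D" and w: "bochner_integrable M w" "AE x in M. w x \<in> E"
  shows "\<bar>\<Lambda> (\<lambda>x. indicat_real A x *\<^sub>R w x) - indicator_integral M A (\<lambda>x. blinfun_apply \<phi> (w x))\<bar>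
    \<le> \<epsilon> * indicator_integral M A (\<lambda>x. norm (w x))"
proof -
  have wsm: "strongly_measurable M w" and wint: "integrable M (\<lambda>x. norm (w x))" using bochner_integrableD[OF w(1)] .
  have "AE x in M. w x \<in> closure (range z)" using w(2) by eventually_elim (rule z_dense)
  then obtain s0 where s0: "\<And>n::nat. simple_function M (s0 n)" "AE x in M. (\<lambda>n. s0 n x) \<longlonglongrightarrow> w x"
      "\<And>n x. s0 n x \<in> range z"
    using dense_sequence_simple_approx[OF _ borel_measurable_norm_diff[OF strongly_measurable_borel[OF wsm]]] by metis
  obtain s where s: "\<And>n::nat. simple_function M (s n)" "AE x in M. (\<lambda>n. s n x) \<longlonglongrightarrow> w x"
      "\<And>n x. x \<in> space M \<Longrightarrow> norm (s n x) \<le> 2 * norm (w x)" and s': "\<And>n x. s n x \<in> {0, s0 n x}"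
    by (rule strongly_measurable_simple_approx_dominated[OF wsm s0(1,2)]) blast
  have rng: "s n x \<in> range z" for n x using s'[of n x] s0(3)[of n x] zero_in_range_z by auto
  have bs: "bochner_integrable M (s n)" for n
    using s(1) simple_function_integrable_norm strongly_measurable_simple by (auto simp: bochner_integrable_iff)
  note e = simple_approx_integral_norm[OF wsm wint s]
  have "(\<lambda>n. \<Lambda> (\<lambda>x. indicat_real A x *\<^sub>R s n x)) \<longlonglongrightarrow> \<Lambda> (\<lambda>x. indicat_real A x *\<^sub>R w x)"
  proof (rule Lim_null_comparison[where g = "\<lambda>n. C * (\<integral>x. norm (w x - s n x) \<partial>M)", THEN LIM_zero_cancel])
    show "(\<lambda>n. C * (\<integral>x. norm (w x - s n x) \<partial>M)) \<longlonglongrightarrow> 0" using tendsto_mult_right_zero[OF e(2)] .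
    show "\<forall>\<^sub>F n in sequentially. norm (\<Lambda> (\<lambda>x. indicat_real A x *\<^sub>R s n x) - \<Lambda> (\<lambda>x. indicat_real A x *\<^sub>R w x))
        \<le> C * (\<integral>x. norm (w x - s n x) \<partial>M)"
      using \<Lambda>_continuous[OF bs w(1) A(1)] by (simp add: norm_minus_commute)
  qed
  moreover have "(\<lambda>n. indicator_integral M A (\<lambda>x. blinfun_apply \<phi> (s n x))) \<longlonglongrightarrow> indicator_integral M A (\<lambda>x. blinfun_apply \<phi> (w x))"
    using norm_blinfun[of \<phi> "_ - _"]
    by (intro indicator_integral_LIMSEQ[OF A(1) integrable_blinfun_apply[OF w(1)] integrable_blinfun_apply[OF bs] e(2,1), where K = "norm \<phi>"])
      (auto simp: blinfun.diff_right abs_minus_commute)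
  moreover have "(\<lambda>n. indicator_integral M A (\<lambda>x. norm (s n x))) \<longlonglongrightarrow> indicator_integral M A (\<lambda>x. norm (w x))"
  proof (rule indicator_integral_LIMSEQ[OF A(1) wint bochner_integrableD(2)[OF bs] e(2,1), where K = 1])
    show "\<bar>norm (s n x) - norm (w x)\<bar> \<le> 1 * norm (w x - s n x)" for n x
      using norm_triangle_ineq3[of "s n x" "w x"] by (simp add: norm_minus_commute)
  qed
  ultimately show ?thesis
    using \<Lambda>_simple_approx[OF P A s(1) rng]
    by (intro LIMSEQ_le[OF tendsto_rabs[OF tendsto_diff] tendsto_mult_left]) auto
qed

lemma norm_integral_split:
  assumes D: "\<And>i::nat. D i \<in> sets M" "disjoint_family D" and w: "bochner_integrable M w"
  shows "(\<integral>x. norm (w x) \<partial>M) = (\<Sum>i<n. indicator_integral M (D i) (\<lambda>x. norm (w x)))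
      + indicator_integral M (space M - (\<Union>i<n. D i)) (\<lambda>x. norm (w x))"
    and "\<Lambda> w = (\<Sum>i<n. \<Lambda> (\<lambda>x. indicat_real (D i) x *\<^sub>R w x))
      + \<Lambda> (\<lambda>x. indicat_real (space M - (\<Union>i<n. D i)) x *\<^sub>R w x)"
proof -
  let ?R = "space M - (\<Union>i<n. D i)"
  have R: "?R \<in> sets M" using D(1) by auto
  have one: "(\<Sum>i<n. indicat_real (D i) x) + indicat_real ?R x = 1" if "x \<in> space M" for x
  proof (cases "\<exists>i<n. x \<in> D i")
    case True
    then obtain i where i: "i < n" "x \<in> D i" by blast
    have "(\<Sum>j<n. indicat_real (D j) x) = (\<Sum>j<n. if j = i then 1 else 0)"
      using D(2) i(2) by (intro sum.cong) (auto simp: indicator_def disjoint_family_on_def)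
    then show ?thesis using i by (auto simp: indicator_def)
  next
    case False
    then show ?thesis using that by auto
  qed
  have int: "integrable M (\<lambda>x. norm (w x))" using bochner_integrableD(2)[OF w] .
  have "(\<integral>x. norm (w x) \<partial>M) = (\<integral>x. (\<Sum>i<n. indicat_real (D i) x * norm (w x)) + indicat_real ?R x * norm (w x) \<partial>M)"
    by (rule Bochner_Integration.integral_cong) (use one in \<open>simp_all flip: sum_distrib_right distrib_right\<close>)
  also have "\<dots> = (\<Sum>i<n. indicator_integral M (D i) (\<lambda>x. norm (w x))) + indicator_integral M ?R (\<lambda>x. norm (w x))"
    unfolding indicator_integral_def
    by (simp only: Bochner_Integration.integral_add[OF Bochner_Integration.integrable_sum[OF integrable_indicator_mult[OF D(1) int]]
        integrable_indicator_mult[OF R int]] Bochner_Integration.integral_sum[OF integrable_indicator_mult[OF D(1) int]])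
  finally show "(\<integral>x. norm (w x) \<partial>M) = (\<Sum>i<n. indicator_integral M (D i) (\<lambda>x. norm (w x)))
      + indicator_integral M ?R (\<lambda>x. norm (w x))" .
  have bi: "bochner_integrable M (\<lambda>x. indicat_real (D i) x *\<^sub>R w x)" for i
    by (intro bochner_integrable_indicator D w)
  have "\<Lambda> w = \<Lambda> (\<lambda>x. (\<Sum>i<n. indicat_real (D i) x *\<^sub>R w x) + indicat_real ?R x *\<^sub>R w x)"
  proof (rule \<Lambda>_AE_cong[OF w], rule AE_I2)
    fix x assume "x \<in> space M"
    then show "w x = (\<Sum>i<n. indicat_real (D i) x *\<^sub>R w x) + indicat_real ?R x *\<^sub>R w x"
      using one by (simp flip: scaleR_sum_left scaleR_add_left)
  qed
  also have "\<dots> = (\<Sum>i<n. \<Lambda> (\<lambda>x. indicat_real (D i) x *\<^sub>R w x)) + \<Lambda> (\<lambda>x. indicat_real ?R x *\<^sub>R w x)"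
    by (simp only: \<Lambda>_add[OF bochner_integrable_sum[OF bi] bochner_integrable_indicator[OF R w]] \<Lambda>_sum[OF bi])
  finally show "\<Lambda> w = (\<Sum>i<n. \<Lambda> (\<lambda>x. indicat_real (D i) x *\<^sub>R w x)) + \<Lambda> (\<lambda>x. indicat_real ?R x *\<^sub>R w x)" .
qed

text \<open>On the first \<open>n\<close> pieces \<open>\<Lambda>\<close> is replaced by the
  \<open>d i\<close>. On the rest only the crude bound by \<open>C\<close> is available, which is
  acceptable once the norm has a small integral there.\<close>

lemma \<Lambda>_global_approx:
  assumes D: "\<And>i. D i \<in> sets M" "disjoint_family D"
    and P: "\<And>i A j. A \<in> sets M \<Longrightarrow> A \<subseteq> D i \<Longrightarrow>
      \<bar>\<Lambda> (\<lambda>x. indicat_real A x *\<^sub>R z j) - blinfun_apply (d i) (z j) * measure M A\<bar> \<le> \<epsilon> * norm (z j) * measure M A"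
    and \<epsilon>: "\<epsilon> > 0" and w: "bochner_integrable M w" "AE x in M. w x \<in> E"
  shows "\<bar>\<Lambda> w - (\<Sum>i<n. indicator_integral M (D i) (\<lambda>x. blinfun_apply (d i) (w x)))\<bar>
    \<le> \<epsilon> * (\<integral>x. norm (w x) \<partial>M) + C * indicator_integral M (space M - (\<Union>i<n. D i)) (\<lambda>x. norm (w x))"
proof -
  let ?R = "space M - (\<Union>i<n. D i)"
  have R: "?R \<in> sets M" using D(1) by auto
  have "\<bar>\<Lambda> w - (\<Sum>i<n. indicator_integral M (D i) (\<lambda>x. blinfun_apply (d i) (w x)))\<bar>
      = \<bar>(\<Sum>i<n. \<Lambda> (\<lambda>x. indicat_real (D i) x *\<^sub>R w x) - indicator_integral M (D i) (\<lambda>x. blinfun_apply (d i) (w x)))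
        + \<Lambda> (\<lambda>x. indicat_real ?R x *\<^sub>R w x)\<bar>"
    by (simp add: norm_integral_split(2)[OF D w(1), of n] sum_subtractf)
  also have "\<dots> \<le> (\<Sum>i<n. \<bar>\<Lambda> (\<lambda>x. indicat_real (D i) x *\<^sub>R w x) - indicator_integral M (D i) (\<lambda>x. blinfun_apply (d i) (w x))\<bar>)
        + \<bar>\<Lambda> (\<lambda>x. indicat_real ?R x *\<^sub>R w x)\<bar>"
    by (intro order_trans[OF abs_triangle_ineq] add_mono sum_abs) simp
  also have "\<dots> \<le> (\<Sum>i<n. \<epsilon> * indicator_integral M (D i) (\<lambda>x. norm (w x))) + C * indicator_integral M ?R (\<lambda>x. norm (w x))"
    by (intro add_mono sum_mono \<Lambda>_local_approx[OF P D(1) subset_refl w] \<Lambda>_indicator_bound[OF w(1) R])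
  also have "\<dots> \<le> \<epsilon> * (\<integral>x. norm (w x) \<partial>M) + C * indicator_integral M ?R (\<lambda>x. norm (w x))"
  proof -
    have "(\<Sum>i<n. indicator_integral M (D i) (\<lambda>x. norm (w x))) \<le> (\<integral>x. norm (w x) \<partial>M)"
      using norm_integral_split(1)[OF D w(1), of n] indicator_integral_nonneg[of "\<lambda>x. norm (w x)" ?R] by simp
    then show ?thesis using \<epsilon> by (simp flip: sum_distrib_left)
  qed
  finally show ?thesis .
qed

lemma \<Lambda>_Z_bounded: "bounded (range (\<lambda>k. \<Lambda> (Z k)))"
proof (rule bounded_rangeI)
  show "\<bar>\<Lambda> (Z k)\<bar> \<le> C * B" for k
    using \<Lambda>_bound[OF Z, of k] mult_left_mono[OF Z_bound[of k] C_nonneg] by simp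
qed

text \<open>With finitely many \<open>d i\<close> on disjoint sets in place of
  \<open>\<Lambda>\<close> the limit is known. The remaining set has small measure, so by uniform
  integrability the replacement error is small for all \<open>Z k\<close> simultaneously, and
  \<open>L\<close> does not enlarge a uniform error bound.\<close>

lemma \<Lambda>_weak_limit:
  assumes \<xi>: "bochner_integrable M \<xi>" "\<And>x. \<xi> x \<in> E"
    and lim: "\<And>i A. A \<in> sets M \<Longrightarrow>
      L (\<lambda>k. indicator_integral M A (\<lambda>x. blinfun_apply (d i) (Z k x))) = indicator_integral M A (\<lambda>x. blinfun_apply (d i) (\<xi> x))"
  shows "L (\<lambda>k. \<Lambda> (Z k)) = \<Lambda> \<xi>"
proof -
  \<comment> \<open>The replacement error is \<open>\<epsilon> * B + C * \<epsilon>\<close> for each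
    \<open>Z k\<close>, and for \<open>\<xi>\<close> the same with the integral of its norm in place
    of \<open>B\<close>.\<close>
  define K where "K = B + 2 * C + (\<integral>x. norm (\<xi> x) \<partial>M)"
  have \<xi>int: "integrable M (\<lambda>x. norm (\<xi> x))" using bochner_integrableD(2)[OF \<xi>(1)] .
  have close: "\<bar>L (\<lambda>k. \<Lambda> (Z k)) - \<Lambda> \<xi>\<bar> \<le> \<epsilon> * K" if \<epsilon>: "\<epsilon> > 0" for \<epsilon>
  proof -
    obtain D0 where D0: "\<And>i. D0 i \<in> sets M" "AE x in M. \<exists>i. x \<in> D0 i"
      "\<And>i A j. A \<in> sets M \<Longrightarrow> A \<subseteq> D0 i \<Longrightarrow>
        \<bar>\<Lambda> (\<lambda>x. indicat_real A x *\<^sub>R z j) - blinfun_apply (d i) (z j) * measure M A\<bar> \<le> \<epsilon> * norm (z j) * measure M A"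
      by (rule \<Lambda>_piecewise_constant[OF \<epsilon>]) blast
    define D where "D = disjointed D0"
    have D: "\<And>i. D i \<in> sets M" "disjoint_family D" "\<And>i. D i \<subseteq> D0 i" "(\<Union>i. D i) = (\<Union>i. D0 i)"
      using sets.range_disjointed_sets[of D0 M] D0(1) disjoint_family_disjointed[of D0] disjointed_subset[of D0] UN_disjointed_eq[of D0]
      by (auto simp: D_def)
    define R where "R n = space M - (\<Union>i<n. D i)" for n
    have R: "R n \<in> sets M" for n unfolding R_def using D(1) by auto
    have dec: "decseq R" unfolding decseq_def R_def by force
    have "(\<Inter>n. R n) = space M - (\<Union>i. D0 i)" unfolding R_def D(4)[symmetric] by auto
    moreover have "space M - (\<Union>i. D0 i) \<in> null_sets M"
      using D0(1,2) by (subst null_sets_iff_AE) auto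
    ultimately have R0: "(\<Inter>n. R n) \<in> null_sets M" by simp
    have "(\<lambda>n. measure M (R n)) \<longlonglongrightarrow> 0"
      using finite_Lim_measure_decseq[OF _ dec] R R0 by (auto simp: measure_eq_0_null_sets)
    moreover obtain \<delta> where \<delta>: "\<delta> > 0" "\<And>k A. A \<in> sets M \<Longrightarrow> measure M A \<le> \<delta> \<Longrightarrow>
        indicator_integral M A (\<lambda>x. norm (Z k x)) \<le> \<epsilon>"
      using Z_ui[OF \<epsilon>] by auto
    ultimately have ev1: "\<forall>\<^sub>F n in sequentially. measure M (R n) < \<delta>" by (intro order_tendstoD(2))
    \<comment> \<open>The sets \<open>R n\<close> decrease to a null set, not to the empty set;
      removing their intersection makes continuity at the empty set applicable.\<close>
    have "(\<lambda>n. indicator_integral M (R n - (\<Inter>n. R n)) (\<lambda>x. norm (\<xi> x))) \<longlonglongrightarrow> 0"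
    proof (rule indicator_integral_decseq[OF _ _ _ \<xi>int])
      show "range (\<lambda>n. R n - (\<Inter>n. R n)) \<subseteq> sets M" using R R0 by (auto intro: sets.Diff null_setsD2)
      show "decseq (\<lambda>n. R n - (\<Inter>n. R n))" using dec unfolding decseq_def by blast
      show "(\<Inter>n. R n - (\<Inter>n. R n)) = {}" by auto
    qed
    moreover have "indicator_integral M (R n - (\<Inter>n. R n)) (\<lambda>x. norm (\<xi> x)) = indicator_integral M (R n) (\<lambda>x. norm (\<xi> x))" for n
      unfolding indicator_integral_def
    proof (rule integral_cong_AE)
      show "AE x in M. indicator (R n - (\<Inter>n. R n)) x * norm (\<xi> x) = indicator (R n) x * norm (\<xi> x)"
        using AE_not_in[OF R0] by eventually_elim (auto simp: indicator_def)
    qed (use \<xi>int R R0 in \<open>auto intro!: borel_measurable_times borel_measurable_indicator sets.Diff intro: null_setsD2\<close>)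
    ultimately have "(\<lambda>n. indicator_integral M (R n) (\<lambda>x. norm (\<xi> x))) \<longlonglongrightarrow> 0" by simp
    then have ev2: "\<forall>\<^sub>F n in sequentially. indicator_integral M (R n) (\<lambda>x. norm (\<xi> x)) < \<epsilon>"
      using \<epsilon> by (rule order_tendstoD(2))
    from eventually_conj[OF ev1 ev2] obtain n where n: "measure M (R n) < \<delta>" "indicator_integral M (R n) (\<lambda>x. norm (\<xi> x)) < \<epsilon>"
      by (auto simp: eventually_sequentially)
    let ?S = "\<lambda>w. \<Sum>i<n. indicator_integral M (D i) (\<lambda>x. blinfun_apply (d i) (w x))"
    have P: "\<bar>\<Lambda> (\<lambda>x. indicat_real A x *\<^sub>R z j) - blinfun_apply (d i) (z j) * measure M A\<bar> \<le> \<epsilon> * norm (z j) * measure M A"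
      if "A \<in> sets M" "A \<subseteq> D i" for i A j using D0(3)[OF that(1)] D(3)[of i] that(2) by blast
    have Zk: "\<bar>\<Lambda> (Z k) - ?S (Z k)\<bar> \<le> \<epsilon> * B + C * \<epsilon>" for k
    proof -
      have "\<bar>\<Lambda> (Z k) - ?S (Z k)\<bar> \<le> \<epsilon> * (\<integral>x. norm (Z k x) \<partial>M) + C * indicator_integral M (R n) (\<lambda>x. norm (Z k x))"
        unfolding R_def by (rule \<Lambda>_global_approx[OF D(1,2) P \<epsilon> Z Z_E])
      also have "\<dots> \<le> \<epsilon> * B + C * \<epsilon>"
        using Z_bound[of k] \<epsilon> C_nonneg \<delta>(2)[OF R[of n], of k] n(1) by (intro add_mono mult_left_mono) auto
      finally show ?thesis .
    qed
    have \<xi>S: "\<bar>\<Lambda> \<xi> - ?S \<xi>\<bar> \<le> \<epsilon> * (\<integral>x. norm (\<xi> x) \<partial>M) + C * \<epsilon>"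
    proof -
      have "\<bar>\<Lambda> \<xi> - ?S \<xi>\<bar> \<le> \<epsilon> * (\<integral>x. norm (\<xi> x) \<partial>M) + C * indicator_integral M (R n) (\<lambda>x. norm (\<xi> x))"
        unfolding R_def by (rule \<Lambda>_global_approx[OF D(1,2) P \<epsilon> \<xi>(1)]) (auto intro: \<xi>(2))
      also have "\<dots> \<le> \<epsilon> * (\<integral>x. norm (\<xi> x) \<partial>M) + C * \<epsilon>"
        using C_nonneg n(2) \<epsilon> by (intro add_mono mult_left_mono) auto
      finally show ?thesis .
    qed
    have S: "bounded (range (\<lambda>k. ?S (Z k)))" "L (\<lambda>k. ?S (Z k)) = ?S \<xi>"
      using L_sum[of "{..<n}" "\<lambda>i k. indicator_integral M (D i) (\<lambda>x. blinfun_apply (d i) (Z k x))", OF functional_bounded[OF D(1)]]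
        lim[OF D(1)] by auto
    have "\<bar>L (\<lambda>k. \<Lambda> (Z k) - ?S (Z k))\<bar> \<le> \<epsilon> * B + C * \<epsilon>" by (rule L_abs_le[OF Zk])
    moreover have "L (\<lambda>k. \<Lambda> (Z k) - ?S (Z k)) = L (\<lambda>k. \<Lambda> (Z k)) - ?S \<xi>"
      using L_diff[OF \<Lambda>_Z_bounded S(1)] S(2) by simp
    moreover have "\<epsilon> * K = (\<epsilon> * B + C * \<epsilon>) + (\<epsilon> * (\<integral>x. norm (\<xi> x) \<partial>M) + C * \<epsilon>)"
      by (simp add: K_def algebra_simps)
    ultimately show ?thesis using \<xi>S by linarith
  qed
  \<comment> \<open>The estimate itself at \<open>\<epsilon> = 1\<close> shows that \<open>K\<close>
    is nonnegative.\<close>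
  have Knn: "0 \<le> K"
    using close[of 1] by simp
  have "\<bar>L (\<lambda>k. \<Lambda> (Z k)) - \<Lambda> \<xi>\<bar> \<le> 0"
  proof (rule field_le_epsilon)
    fix e :: real assume e: "e > 0"
    have "\<bar>L (\<lambda>k. \<Lambda> (Z k)) - \<Lambda> \<xi>\<bar> \<le> e / (K + 1) * K" using e Knn by (intro close) auto
    also have "\<dots> \<le> e" using e Knn by (simp add: field_simps)
    finally show "\<bar>L (\<lambda>k. \<Lambda> (Z k)) - \<Lambda> \<xi>\<bar> \<le> 0 + e" by simp
  qed
  then show ?thesis by simp
qed

end

section \<open>Mazur's theorem along a generalized limit\<close>

context weak_limit
begin

text \<open>Mazur's argument in the product of L1 and the reals. If all convex combinations stayed
  \<open>\<epsilon>\<close> away, Hahn--Banach would give a functional \<open>\<Gamma>\<close> with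
  \<open>\<epsilon> \<le> \<Gamma> (v k)\<close> for all \<open>k\<close>. Its L1 component passes
  to the limit by \<open>\<Lambda>_weak_limit\<close>, its real component by linearity of
  \<open>L\<close>; so \<open>L\<close> of these values is \<open>0\<close>, although it should be
  at least \<open>\<epsilon>\<close>.\<close>

lemma convex_combination_approx:
  assumes \<xi>: "bochner_integrable M \<xi>" "\<And>x. \<xi> x \<in> E"
    and lim: "\<And>i A. A \<in> sets M \<Longrightarrow>
      L (\<lambda>k. indicator_integral M A (\<lambda>x. blinfun_apply (d i) (Z k x))) = indicator_integral M A (\<lambda>x. blinfun_apply (d i) (\<xi> x))"
    and a: "bounded (range a)" and \<epsilon>: "\<epsilon> > 0"
  obtains n :: nat and c :: "nat \<Rightarrow> real" where "\<And>k. 0 \<le> c k" "(\<Sum>k<n. c k) = 1"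
    "(\<integral>x. norm ((\<Sum>k<n. c k *\<^sub>R Z k x) - \<xi> x) \<partial>M) + \<bar>(\<Sum>k<n. c k * a k) - L a\<bar> < \<epsilon>"
proof (rule ccontr)
  assume neg: "\<not> thesis"
  note found = that
  have far: "\<epsilon> \<le> (\<integral>x. norm ((\<Sum>k<n. c k *\<^sub>R Z k x) - \<xi> x) \<partial>M) + \<bar>(\<Sum>k<n. c k * a k) - L a\<bar>"
    if c: "\<And>k. 0 \<le> c k" "(\<Sum>k<n. c k) = 1" for n :: nat and c :: "nat \<Rightarrow> real"
    using neg found[OF c] by linarith
  define S where "S = {w :: 'x \<Rightarrow> 'e. bochner_integrable M w} \<times> (UNIV :: real set)"
  define p where "p w = (\<integral>x. norm (fst w x) \<partial>M) + \<bar>snd w\<bar>" for w :: "('x \<Rightarrow> 'e) \<times> real"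
  define v where "v k = (Z k - \<xi>, a k - L a)" for k
  have S: "subspace S" unfolding S_def by (intro subspace_Times subspace_bochner_integrable subspace_UNIV)
  have vS: "v k \<in> S" for k
    using bochner_integrable_diff[OF Z \<xi>(1)] by (auto simp: S_def v_def fun_diff_def)
  have psub: "sublinear_on S p"
  proof (rule sublinear_onI_le[OF S])
    fix u w assume uw: "u \<in> S" "w \<in> S"
    then have b: "bochner_integrable M (fst u)" "bochner_integrable M (fst w)" by (auto simp: S_def)
    have "(\<integral>x. norm (fst u x + fst w x) \<partial>M) \<le> (\<integral>x. norm (fst u x) + norm (fst w x) \<partial>M)"
      using bochner_integrableD(2)[OF bochner_integrable_add[OF b]] bochner_integrableD(2)[OF b(1)] bochner_integrableD(2)[OF b(2)]
      by (intro integral_mono) (auto simp: norm_triangle_ineq)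
    also have "\<dots> = (\<integral>x. norm (fst u x) \<partial>M) + (\<integral>x. norm (fst w x) \<partial>M)"
      using bochner_integrableD(2)[OF b(1)] bochner_integrableD(2)[OF b(2)] by simp
    finally show "p (u + w) \<le> p u + p w"
      using abs_triangle_ineq[of "snd u" "snd w"] by (simp add: p_def)
  qed (simp add: p_def abs_mult distrib_left)
  \<comment> \<open>The cone over the convex hull of the \<open>v k\<close>. The bound is
    \<open>\<epsilon>\<close> times the total weight, so that each single \<open>v k\<close>
    receives exactly \<open>\<epsilon>\<close>.\<close>
  define G where "G = {(\<Sum>k<n. c k *\<^sub>R v k, (\<Sum>k<n. c k) * \<epsilon>) | n c. \<forall>k::nat. 0 \<le> (c k :: real)}"
  have GE: "\<exists>n c. (\<forall>k. 0 \<le> c k) \<and> g = (\<Sum>k<n. c k *\<^sub>R v k, (\<Sum>k<n. c k) * \<epsilon>)" if "g \<in> G" for g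
    using that by (auto simp: G_def)
  have GI: "(\<Sum>k<n. c k *\<^sub>R v k, (\<Sum>k<n. c k) * \<epsilon>) \<in> G" if "\<And>k. 0 \<le> c k" for n c
    using that by (auto simp: G_def)
  have G1: "G \<subseteq> S \<times> UNIV"
  proof
    fix g assume "g \<in> G"
    then obtain n c where "g = (\<Sum>k<n. c k *\<^sub>R v k, (\<Sum>k<n. c k) * \<epsilon>)" using GE by blast
    then show "g \<in> S \<times> UNIV" by (simp add: subspace_sum[OF S subspace_scale[OF S vS]])
  qed
  have G2: "(0, 0) \<in> G" using GI[of "\<lambda>_. 0" 0] by simp
  have G3: "g + h \<in> G" if gh: "g \<in> G" "h \<in> G" for g h
  proof -
    obtain n c where g: "\<forall>k. 0 \<le> c k" "g = (\<Sum>k<n. c k *\<^sub>R v k, (\<Sum>k<n. c k) * \<epsilon>)" using GE[OF gh(1)] by blast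
    obtain m b where h: "\<forall>k. 0 \<le> b k" "h = (\<Sum>k<m. b k *\<^sub>R v k, (\<Sum>k<m. b k) * \<epsilon>)" using GE[OF gh(2)] by blast
    define e where "e k = (if k < n then c k else 0) + (if k < m then b k else 0)" for k
    have 1: "(\<Sum>k<max n m. (if k < n then c k else 0) *\<^sub>R v k) = (\<Sum>k<n. c k *\<^sub>R v k)"
        "(\<Sum>k<max n m. (if k < m then b k else 0) *\<^sub>R v k) = (\<Sum>k<m. b k *\<^sub>R v k)"
        "(\<Sum>k<max n m. if k < n then c k else 0) = (\<Sum>k<n. c k)"
        "(\<Sum>k<max n m. if k < m then b k else 0) = (\<Sum>k<m. b k)"
      by (rule sum.mono_neutral_cong_right; auto)+
    have "g + h = (\<Sum>k<max n m. e k *\<^sub>R v k, (\<Sum>k<max n m. e k) * \<epsilon>)"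
      unfolding g h e_def by (simp add: 1 scaleR_add_left sum.distrib distrib_right)
    then show ?thesis using GI[of e] g(1) h(1) by (simp add: e_def)
  qed
  have G4: "t *\<^sub>R g \<in> G" if gt: "g \<in> G" "t > 0" for g t
  proof -
    obtain n c where g: "\<forall>k. 0 \<le> c k" "g = (\<Sum>k<n. c k *\<^sub>R v k, (\<Sum>k<n. c k) * \<epsilon>)" using GE[OF gt(1)] by blast
    have "t *\<^sub>R g = (\<Sum>k<n. (t * c k) *\<^sub>R v k, (\<Sum>k<n. t * c k) * \<epsilon>)"
      unfolding g by (simp add: scaleR_sum_right sum_distrib_left mult.assoc)
    then show ?thesis using GI[of "\<lambda>k. t * c k"] g(1) gt(2) by simp
  qed
  have G5: "b \<le> p w" if wb: "(w, b) \<in> G" for w b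
  proof -
    obtain n c where c: "\<forall>k. 0 \<le> c k" "w = (\<Sum>k<n. c k *\<^sub>R v k)" "b = (\<Sum>k<n. c k) * \<epsilon>" using GE[OF wb] by auto
    define s where "s = (\<Sum>k<n. c k)"
    show ?thesis
    proof (cases "s = 0")
      case True
      then show ?thesis using c(3) by (simp add: s_def p_def)
    next
      case False
      then have s: "s > 0" using c(1) by (simp add: s_def sum_nonneg less_le)
      \<comment> \<open>Normalised weights turn a cone element into a convex combination; the
        subtracted terms then add up to exactly \<open>\<xi>\<close> and \<open>L a\<close>.\<close>
      have cs: "(\<Sum>k<n. c k / s) = 1" using s by (simp add: s_def flip: sum_divide_distrib)
      have w': "(\<Sum>k<n. (c k / s) *\<^sub>R v k) \<in> S" by (rule subspace_sum[OF S subspace_scale[OF S vS]])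
      have eq: "fst (\<Sum>k<n. (c k / s) *\<^sub>R v k) x = (\<Sum>k<n. (c k / s) *\<^sub>R Z k x) - \<xi> x" for x
      proof -
        have "fst (\<Sum>k<n. (c k / s) *\<^sub>R v k) x = (\<Sum>k<n. (c k / s) *\<^sub>R (Z k x - \<xi> x))"
          by (induction n) (auto simp: v_def)
        also have "\<dots> = (\<Sum>k<n. (c k / s) *\<^sub>R Z k x) - (\<Sum>k<n. c k / s) *\<^sub>R \<xi> x"
          by (simp add: scaleR_diff_right sum_subtractf scaleR_sum_left)
        finally show ?thesis by (simp add: cs)
      qed
      have "snd (\<Sum>k<n. (c k / s) *\<^sub>R v k) = (\<Sum>k<n. (c k / s) * (a k - L a))"
        by (simp add: snd_sum v_def)
      also have "\<dots> = (\<Sum>k<n. (c k / s) * a k) - (\<Sum>k<n. c k / s) * L a"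
        by (simp add: right_diff_distrib sum_subtractf sum_distrib_right)
      finally have "\<epsilon> \<le> p (\<Sum>k<n. (c k / s) *\<^sub>R v k)"
        using far[of "\<lambda>k. c k / s" n] c(1) s cs by (simp add: p_def eq)
      then have "s * \<epsilon> \<le> s * p (\<Sum>k<n. (c k / s) *\<^sub>R v k)" using s by simp
      also have "\<dots> = p (s *\<^sub>R (\<Sum>k<n. (c k / s) *\<^sub>R v k))" using sublinear_on_scale[OF psub w' s] by simp
      also have "s *\<^sub>R (\<Sum>k<n. (c k / s) *\<^sub>R v k) = w" using s by (simp add: c(2) scaleR_sum_right)
      finally show ?thesis by (simp add: c(3) s_def)
    qed
  qed
  obtain \<Gamma> where \<Gamma>: "linear_functional_on S \<Gamma>" "\<And>w. w \<in> S \<Longrightarrow> \<Gamma> w \<le> p w" "\<And>w b. (w, b) \<in> G \<Longrightarrow> b \<le> \<Gamma> w"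
    using Hahn_Banach_cone[OF S psub G1 G2 G3 G4 G5] by blast
  define \<Lambda> where "\<Lambda> w = \<Gamma> (w, 0)" for w
  define \<beta> where "\<beta> = \<Gamma> (0, 1)"
  have S0: "(w, t) \<in> S" if "bochner_integrable M w" for w t using that by (simp add: S_def)
  have b0: "bochner_integrable M 0" using bochner_integrable_zero by (simp add: zero_fun_def)
  have \<Lambda>lin: "linear_functional_on {w. bochner_integrable M w} \<Lambda>"
    unfolding linear_functional_on_def
  proof (intro conjI ballI allI)
    fix u w :: "'x \<Rightarrow> 'e" assume "u \<in> {w. bochner_integrable M w}" "w \<in> {w. bochner_integrable M w}"
    then have "\<Gamma> ((u, 0) + (w, 0)) = \<Gamma> (u, 0) + \<Gamma> (w, 0)"
      using \<Gamma>(1) S0[of u 0] S0[of w 0] unfolding linear_functional_on_def by blast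
    then show "\<Lambda> (u + w) = \<Lambda> u + \<Lambda> w" by (simp add: \<Lambda>_def)
  next
    fix w :: "'x \<Rightarrow> 'e" and c :: real assume "w \<in> {w. bochner_integrable M w}"
    then have "\<Gamma> (c *\<^sub>R (w, 0)) = c * \<Gamma> (w, 0)"
      using \<Gamma>(1) S0[of w 0] unfolding linear_functional_on_def by blast
    then show "\<Lambda> (c *\<^sub>R w) = c * \<Lambda> w" by (simp add: \<Lambda>_def)
  qed
  have \<Lambda>le: "\<Lambda> w \<le> (\<integral>x. norm (w x) \<partial>M)" if "bochner_integrable M w" for w
    using \<Gamma>(2)[OF S0[OF that, of 0]] by (simp add: \<Lambda>_def p_def)
  have \<Lambda>abs: "\<bar>\<Lambda> w\<bar> \<le> 1 * (\<integral>x. norm (w x) \<partial>M)" if w: "bochner_integrable M w" for w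
  proof -
    have "\<Lambda> ((- 1) *\<^sub>R w) = - 1 * \<Lambda> w" using \<Lambda>lin w unfolding linear_functional_on_def by blast
    moreover have "\<Lambda> ((- 1) *\<^sub>R w) \<le> (\<integral>x. norm (((- 1) *\<^sub>R w) x) \<partial>M)"
      using bochner_integrable_scaleR[OF w, of "- 1"] by (intro \<Lambda>le) (simp add: scaleR_fun_def)
    ultimately show ?thesis using \<Lambda>le[OF w] by (simp add: abs_le_iff)
  qed
  interpret L1_functional M L Z B y d E \<Lambda> 1
    by unfold_locales (use \<Lambda>lin \<Lambda>abs in auto)
  have \<Gamma>v: "\<Gamma> (v k) = \<Lambda> (Z k) - \<Lambda> \<xi> + \<beta> * (a k - L a)" for k
  proof -
    have bd: "bochner_integrable M (Z k - \<xi>)" using bochner_integrable_diff[OF Z \<xi>(1)] by (simp add: fun_diff_def)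
    have "v k = (Z k - \<xi>, 0) + (a k - L a) *\<^sub>R (0, 1)" by (simp add: v_def)
    then have "\<Gamma> (v k) = \<Gamma> (Z k - \<xi>, 0) + \<Gamma> ((a k - L a) *\<^sub>R (0, 1))"
      using \<Gamma>(1) S0[OF bd, of 0] subspace_scale[OF S S0[OF b0, of 1], of "a k - L a"] unfolding linear_functional_on_def by metis
    also have "\<Gamma> ((a k - L a) *\<^sub>R (0, 1)) = (a k - L a) * \<beta>"
      using \<Gamma>(1) S0[OF b0, of 1] unfolding linear_functional_on_def \<beta>_def by blast
    also have "\<Gamma> (Z k - \<xi>, 0) = \<Lambda> (Z k) - \<Lambda> \<xi>"
      using \<Lambda>_diff[OF Z \<xi>(1), of k] by (simp add: \<Lambda>_def fun_diff_def)
    finally show ?thesis by (simp add: mult.commute)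
  qed
  have ge: "\<epsilon> \<le> \<Gamma> (v k)" for k
  proof (rule \<Gamma>(3))
    have "(\<Sum>i<Suc k. (if i = k then 1 else 0) *\<^sub>R v i) = (\<Sum>i\<in>{k}. v i)"
      by (rule sum.mono_neutral_cong_right) auto
    moreover have "(\<Sum>i<Suc k. if i = k then 1 else 0) = (1::real)" by (simp add: sum.delta)
    ultimately show "(v k, \<epsilon>) \<in> G" using GI[of "\<lambda>i. if i = k then 1 else 0" "Suc k"] by simp
  qed
  have bA: "bounded (range (\<lambda>k. a k - L a))"
    using a by (intro bounded_minus_comp) auto
  have b1: "bounded (range (\<lambda>k. \<Lambda> (Z k) - \<Lambda> \<xi>))" by (intro bounded_minus_comp \<Lambda>_Z_bounded) auto
  have b2: "bounded (range (\<lambda>k. \<beta> * (a k - L a)))"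
    using bounded_scaling[OF bA, of \<beta>] by (simp add: image_image)
  have "L (\<lambda>k. \<Gamma> (v k)) = L (\<lambda>k. \<Lambda> (Z k) - \<Lambda> \<xi>) + L (\<lambda>k. \<beta> * (a k - L a))"
    unfolding \<Gamma>v by (rule L_add[OF b1 b2])
  also have "L (\<lambda>k. \<Lambda> (Z k) - \<Lambda> \<xi>) = 0"
    using L_diff[OF \<Lambda>_Z_bounded, of "\<lambda>_. \<Lambda> \<xi>"] \<Lambda>_weak_limit[OF \<xi> lim] by (simp add: L_const)
  also have "L (\<lambda>k. \<beta> * (a k - L a)) = 0"
    using L_cmult[OF bA] L_diff[OF a, of "\<lambda>_. L a"] by (simp add: L_const)
  finally have "L (\<lambda>k. \<Gamma> (v k)) = 0" by simp
  moreover have "\<epsilon> \<le> L (\<lambda>k. \<Gamma> (v k))"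
    using bounded_plus_comp[OF b1 b2] ge by (intro L_ge) (simp_all add: \<Gamma>v)
  ultimately show False using \<epsilon> by simp
qed

end

section \<open>Projections and maximal inequalities\<close>

lemma strongly_measurable_mono:
  assumes "strongly_measurable N f" "space N = space M" "sets N \<subseteq> sets M" "null_sets N \<subseteq> null_sets M"
  shows "strongly_measurable M f"
proof -
  obtain s where s: "\<And>i::nat. simple_function N (s i)" "AE x in N. (\<lambda>i. s i x) \<longlonglongrightarrow> f x"
    using assms(1) by (auto simp: strongly_measurable_def)
  have "AE x in M. (\<lambda>i. s i x) \<longlonglongrightarrow> f x"
    using s(2) assms(2,4) unfolding eventually_ae_filter by auto
  then show ?thesis
    unfolding strongly_measurable_def using simple_function_subalgebra[OF s(1) assms(3,2)] by blast
qed

sublocale stochastic_basis \<subseteq> finite_complete_measure \<mu> ..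

context stochastic_basis
begin

abbreviation restr :: "real \<Rightarrow> 'x measure" where "restr t \<equiv> restr_to_subalg \<mu> (F t)"

lemma F_mono: assumes "0 \<le> s" "s \<le> t" shows "sets (F s) \<subseteq> sets (F t)"
  using right_continuous[OF assms(1)] assms(2) by (cases "s = t") auto

lemma null_sets_F: assumes "0 \<le> t" "A \<in> null_sets \<mu>" shows "A \<in> sets (F t)"
  using F_mono[of 0 t] sets_F_0 assms by (auto intro: sigma_sets.Basic)

lemma space_F: "0 \<le> t \<Longrightarrow> space (F t) = space \<mu>"
  using subalgebra[of t] by (simp add: subalgebra_def)

lemma sets_F: "0 \<le> t \<Longrightarrow> A \<in> sets (F t) \<Longrightarrow> A \<in> sets \<mu>"
  using subalgebra[of t] by (auto simp: subalgebra_def)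

lemma sets_restr: "0 \<le> t \<Longrightarrow> sets (restr t) = sets (F t)"
  using sets_restr_to_subalg[OF subalgebra] .

lemma null_sets_restr: assumes "0 \<le> t" shows "null_sets (restr t) = null_sets \<mu>"
  using null_sets_restr_to_subalg[OF subalgebra[OF assms]] null_sets_F[OF assms] by auto

text \<open>All null sets lie in \<open>F 0\<close>, hence in every \<open>F t\<close>, so
  restriction preserves completeness and the theory of \<open>finite_complete_measure\<close>
  applies at each time.\<close>

lemma finite_complete_restr: assumes t: "0 \<le> t" shows "finite_complete_measure (restr t)"
proof -
  interpret R: finite_measure "restr t"
    using finite_measure_restr_to_subalg[OF subalgebra[OF t]] finite_measure_axioms by blast
  show ?thesis
  proof
    fix A B assume "B \<subseteq> A" "A \<in> null_sets (restr t)"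
    then have "B \<in> null_sets \<mu>" using complete2 null_sets_restr[OF t] by auto
    then show "B \<in> sets (restr t)" using null_sets_F[OF t] sets_restr[OF t] by simp
  qed
qed

lemma AE_restr_iff: "0 \<le> t \<Longrightarrow> (AE x in restr t. P x) \<longleftrightarrow> (AE x in \<mu>. P x)"
  unfolding eventually_ae_filter by (simp add: null_sets_restr space_restr_to_subalg)

lemma strongly_measurable_restr:
  assumes "0 \<le> t" "strongly_measurable (restr t) f" shows "strongly_measurable \<mu> f"
  using assms by (intro strongly_measurable_mono[OF assms(2)])
    (auto simp: sets_restr null_sets_restr space_restr_to_subalg sets_F)

lemma strongly_measurable_restr_mono:
  assumes "0 \<le> s" "s \<le> t" "strongly_measurable (restr s) f" shows "strongly_measurable (restr t) f"
  using assms F_mono[OF assms(1,2)] by (intro strongly_measurable_mono[OF assms(3)])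
    (auto simp: sets_restr null_sets_restr space_restr_to_subalg)

lemma norm_measurable_F:
  assumes t: "0 \<le> t" and "strongly_measurable (restr t) f" shows "(\<lambda>x. norm (f x)) \<in> borel_measurable (F t)"
proof -
  interpret R: finite_complete_measure "restr t" by (rule finite_complete_restr[OF t])
  show ?thesis
    using R.strongly_measurable_norm[OF assms(2)] measurable_in_subalg'[OF subalgebra[OF t]] by blast
qed

lemma bochner_integrable_restr_iff:
  assumes t: "0 \<le> t"
  shows "bochner_integrable (restr t) g \<longleftrightarrow> strongly_measurable (restr t) g \<and> integrable \<mu> (\<lambda>x. norm (g x))"
proof -
  interpret R: finite_complete_measure "restr t" by (rule finite_complete_restr[OF t])
  show ?thesis
    unfolding R.bochner_integrable_iff
    using integrable_from_subalg[OF subalgebra[OF t]] integrable_in_subalg[OF subalgebra[OF t] norm_measurable_F[OF t]]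
    by blast
qed

text \<open>Conditional expectations tested against functionals, so that only integrals of real functions
  occur.\<close>

definition is_projection :: "real \<Rightarrow> ('x \<Rightarrow> 'e::banach) \<Rightarrow> ('x \<Rightarrow> 'e) \<Rightarrow> bool" where
  "is_projection t f g \<longleftrightarrow> strongly_measurable (restr t) g \<and> bochner_integrable \<mu> g \<and>
     (\<forall>A\<in>sets (F t). \<forall>\<phi> :: 'e \<Rightarrow>\<^sub>L real.
       indicator_integral \<mu> A (\<lambda>x. blinfun_apply \<phi> (g x)) = indicator_integral \<mu> A (\<lambda>x. blinfun_apply \<phi> (f x)))"

text \<open>Functionals determine Bochner integrals, so the identity of vector integrals over
  \<open>A\<close> is a family of identities of real ones.\<close>

lemma is_cond_exp_iff:
  fixes f g :: "'x \<Rightarrow> 'e::banach"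
  assumes t: "0 \<le> t" and f: "bochner_integrable \<mu> f"
  shows "is_cond_exp \<mu> (F t) f g \<longleftrightarrow> is_projection t f g"
proof -
  have sm: "bochner_integrable (restr t) g \<longleftrightarrow> strongly_measurable (restr t) g \<and> bochner_integrable \<mu> g"
    unfolding bochner_integrable_restr_iff[OF t] bochner_integrable_iff
    using strongly_measurable_restr[OF t] by blast
  have "bochner_integral \<mu> (\<lambda>x. indicat_real A x *\<^sub>R g x) = bochner_integral \<mu> (\<lambda>x. indicat_real A x *\<^sub>R f x) \<longleftrightarrow>
      (\<forall>\<phi> :: 'e \<Rightarrow>\<^sub>L real.
       indicator_integral \<mu> A (\<lambda>x. blinfun_apply \<phi> (g x)) = indicator_integral \<mu> A (\<lambda>x. blinfun_apply \<phi> (f x)))"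
    if "bochner_integrable \<mu> g" "A \<in> sets (F t)" for A
    using bochner_integral_eq_iff[OF bochner_integrable_indicator[OF sets_F[OF t that(2)] that(1)] bochner_integrable_indicator[OF sets_F[OF t that(2)] f]]
    by (simp add: indicator_integral_def blinfun_indicator_scaleR)
  then show ?thesis
    unfolding is_cond_exp_def is_projection_def sm by blast
qed

lemma simple_function_restr_level:
  assumes t: "0 \<le> t" and s: "simple_function (restr t) s" shows "s -` {v} \<inter> space \<mu> \<in> sets (F t)"
  using simple_functionD(2)[OF s, of "{v}"] by (simp add: sets_restr[OF t] space_restr_to_subalg)

text \<open>On a level set of a simple approximation of \<open>g\<close> the norm is almost computed by a single
  functional, to which the projection property applies.\<close>

lemma projection_norm_le:
  fixes f g :: "'x \<Rightarrow> 'e::banach"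
  assumes t: "0 \<le> t" and f: "bochner_integrable \<mu> f" and g: "is_projection t f g" and A: "A \<in> sets (F t)"
  shows "indicator_integral \<mu> A (\<lambda>x. norm (g x)) \<le> indicator_integral \<mu> A (\<lambda>x. norm (f x))"
proof (rule field_le_epsilon)
  fix e :: real assume e: "e > 0"
  interpret R: finite_complete_measure "restr t" by (rule finite_complete_restr[OF t])
  have gsm: "strongly_measurable (restr t) g" and gb: "bochner_integrable \<mu> g" using g by (auto simp: is_projection_def)
  have gint: "integrable \<mu> (\<lambda>x. norm (g x))" and fint: "integrable \<mu> (\<lambda>x. norm (f x))"
    using bochner_integrableD(2) gb f by auto
  have A\<mu>: "A \<in> sets \<mu>" by (rule sets_F[OF t A])
  obtain s where s: "\<And>i::nat. simple_function (restr t) (s i)" "AE x in restr t. (\<lambda>i. s i x) \<longlonglongrightarrow> g x"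
    "\<And>i x. x \<in> space (restr t) \<Longrightarrow> norm (s i x) \<le> 2 * norm (g x)"
    by (rule R.strongly_measurable_simple_approx[OF gsm]) blast
  have s\<mu>: "simple_function \<mu> (s i)" for i
    using s(1) by (rule simple_function_subalgebra) (auto simp: sets_restr[OF t] sets_F[OF t] space_restr_to_subalg)
  have s2: "AE x in \<mu>. (\<lambda>i. s i x) \<longlonglongrightarrow> g x" using s(2) by (simp add: AE_restr_iff[OF t])
  have s3: "\<And>i x. x \<in> space \<mu> \<Longrightarrow> norm (s i x) \<le> 2 * norm (g x)" using s(3) by (simp add: space_restr_to_subalg)
  note app = simple_approx_integral_norm[OF strongly_measurable_restr[OF t gsm] gint s\<mu> s2 s3]
  have "\<forall>\<^sub>F i in sequentially. (\<integral>x. norm (g x - s i x) \<partial>\<mu>) < e / 2"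
    using app(2) e by (intro order_tendstoD(2)) auto
  then obtain i where i: "(\<integral>x. norm (g x - s i x) \<partial>\<mu>) < e / 2"
    using eventually_happens by force
  define u where "u = s i"
  have u: "simple_function (restr t) u" and u\<mu>: "simple_function \<mu> u" using s(1) s\<mu> by (auto simp: u_def)
  have gu: "integrable \<mu> (\<lambda>x. norm (g x - u x))" "(\<integral>x. norm (g x - u x) \<partial>\<mu>) < e / 2"
    using app(1) i by (auto simp: u_def)
  have uint: "integrable \<mu> (\<lambda>x. norm (u x))" using simple_function_integrable_norm[OF u\<mu>] .
  let ?V = "u ` space \<mu>"
  have fin: "finite ?V" using u\<mu> by (simp add: simple_function_def)
  define A' where "A' v = A \<inter> (u -` {v} \<inter> space \<mu>)" for v
  have A': "A' v \<in> sets (F t)" for v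
    unfolding A'_def using A simple_function_restr_level[OF t u] by blast
  have A'\<mu>: "A' v \<in> sets \<mu>" for v by (rule sets_F[OF t A'])
  have ind: "indicat_real A x = (\<Sum>v\<in>?V. indicat_real (A' v) x)" if "x \<in> space \<mu>" for x
  proof -
    have "(\<Sum>v\<in>?V. indicat_real (A' v) x) = (\<Sum>v\<in>?V. if v = u x then indicat_real A x else 0)"
      using that by (intro sum.cong) (auto simp: A'_def indicator_def)
    then show ?thesis using that fin by (simp add: sum.delta)
  qed
  have split: "indicator_integral \<mu> A h = (\<Sum>v\<in>?V. indicator_integral \<mu> (A' v) h)" if h: "integrable \<mu> h" for h :: "'x \<Rightarrow> real"
  proof -
    have "indicator_integral \<mu> A h = (\<integral>x. (\<Sum>v\<in>?V. indicat_real (A' v) x * h x) \<partial>\<mu>)"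
      unfolding indicator_integral_def by (rule Bochner_Integration.integral_cong) (simp_all only: ind sum_distrib_right)
    also have "\<dots> = (\<Sum>v\<in>?V. indicator_integral \<mu> (A' v) h)"
      unfolding indicator_integral_def by (rule Bochner_Integration.integral_sum) (rule integrable_indicator_mult[OF A'\<mu> h])
    finally show ?thesis .
  qed
  have piece: "indicator_integral \<mu> (A' v) (\<lambda>x. norm (u x))
      \<le> indicator_integral \<mu> (A' v) (\<lambda>x. norm (f x) + norm (g x - u x))" for v
  proof -
    obtain \<phi> :: "'e \<Rightarrow>\<^sub>L real" where \<phi>: "norm \<phi> \<le> 1" "blinfun_apply \<phi> v = norm v"
      using norming_functional by blast
    have gint': "integrable \<mu> (\<lambda>x. blinfun_apply \<phi> (g x))" and fint': "integrable \<mu> (\<lambda>x. blinfun_apply \<phi> (f x))"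
      using integrable_blinfun_apply gb f by auto
    have "indicator_integral \<mu> (A' v) (\<lambda>x. norm (u x)) \<le> indicator_integral \<mu> (A' v) (\<lambda>x. blinfun_apply \<phi> (g x) + norm (g x - u x))"
      unfolding indicator_integral_def
    proof (rule integral_mono)
      show "indicat_real (A' v) x * norm (u x) \<le> indicat_real (A' v) x * (blinfun_apply \<phi> (g x) + norm (g x - u x))" for x
      proof (cases "x \<in> A' v")
        case True
        then have "norm (u x) = blinfun_apply \<phi> (g x) - blinfun_apply \<phi> (g x - u x)"
          using \<phi>(2) by (simp add: A'_def blinfun.diff_right)
        then show ?thesis using True blinfun_le_norm[OF \<phi>(1), of "g x - u x"] by (simp add: abs_le_iff)
      qed simp
    qed (use uint gint' gu A'\<mu> in \<open>auto intro!: integrable_indicator_mult\<close>)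
    also have "\<dots> = indicator_integral \<mu> (A' v) (\<lambda>x. blinfun_apply \<phi> (f x) + norm (g x - u x))"
      using g A'[of v] gint' fint' gu(1) A'\<mu>[of v] by (simp add: indicator_integral_add is_projection_def)
    also have "\<dots> \<le> indicator_integral \<mu> (A' v) (\<lambda>x. norm (f x) + norm (g x - u x))"
      using fint' fint gu(1) blinfun_le_norm[OF \<phi>(1)] by (intro indicator_integral_mono[OF A'\<mu>]) (auto simp: abs_le_iff)
    finally show ?thesis .
  qed
  have "indicator_integral \<mu> A (\<lambda>x. norm (u x)) \<le> indicator_integral \<mu> A (\<lambda>x. norm (f x) + norm (g x - u x))"
    unfolding split[OF uint] split[OF Bochner_Integration.integrable_add[OF fint gu(1)]] by (intro sum_mono piece)
  moreover have "indicator_integral \<mu> A (\<lambda>x. norm (g x)) \<le> indicator_integral \<mu> A (\<lambda>x. norm (u x) + norm (g x - u x))"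
    using gint uint gu(1) norm_triangle_sub[of "g _" "u _"] by (intro indicator_integral_mono[OF A\<mu>]) auto
  moreover have "indicator_integral \<mu> A (\<lambda>x. norm (g x - u x)) \<le> e / 2"
    using indicator_integral_le_integral[OF A\<mu> gu(1)] gu(2) by auto
  ultimately show "indicator_integral \<mu> A (\<lambda>x. norm (g x)) \<le> indicator_integral \<mu> A (\<lambda>x. norm (f x)) + e"
    using A\<mu> fint uint gu(1) by (simp add: indicator_integral_add)
qed

lemma projection_integral_norm_le:
  fixes f g :: "'x \<Rightarrow> 'e::banach"
  assumes t: "0 \<le> t" and "bochner_integrable \<mu> f" and "is_projection t f g"
  shows "(\<integral>x. norm (g x) \<partial>\<mu>) \<le> (\<integral>x. norm (f x) \<partial>\<mu>)"
proof -
  have "space \<mu> \<in> sets (F t)" using sets.top[of "F t"] by (simp add: space_F[OF t])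
  from projection_norm_le[OF assms this] show ?thesis by (simp only: indicator_integral_space)
qed

text \<open>The test sets available at the earlier time are also test sets at the later one.\<close>

lemma projection_tower:
  fixes f g h :: "'x \<Rightarrow> 'e::banach"
  assumes "0 \<le> s" "s \<le> t" "is_projection s f g" "is_projection t f h"
  shows "is_projection s h g"
  unfolding is_projection_def
proof (intro conjI ballI allI)
  fix A and \<phi> :: "'e \<Rightarrow>\<^sub>L real" assume A: "A \<in> sets (F s)"
  then have "A \<in> sets (F t)" using F_mono[OF assms(1,2)] by blast
  then show "indicator_integral \<mu> A (\<lambda>x. blinfun_apply \<phi> (g x)) = indicator_integral \<mu> A (\<lambda>x. blinfun_apply \<phi> (h x))"
    using assms(3,4) A by (simp add: is_projection_def)
qed (use assms(3) in \<open>simp_all add: is_projection_def\<close>)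

lemma projection_add:
  fixes f1 f2 g1 g2 :: "'x \<Rightarrow> 'e::banach"
  assumes t: "0 \<le> t" and f: "bochner_integrable \<mu> f1" "bochner_integrable \<mu> f2"
    and g: "is_projection t f1 g1" "is_projection t f2 g2"
  shows "is_projection t (\<lambda>x. f1 x + f2 x) (\<lambda>x. g1 x + g2 x)"
proof -
  interpret R: finite_complete_measure "restr t" by (rule finite_complete_restr[OF t])
  have g': "bochner_integrable \<mu> g1" "bochner_integrable \<mu> g2" using g by (auto simp: is_projection_def)
  show ?thesis
    unfolding is_projection_def
  proof (intro conjI ballI allI)
    show "strongly_measurable (restr t) (\<lambda>x. g1 x + g2 x)"
      using g by (intro R.strongly_measurable_add) (simp_all add: is_projection_def)
    show "bochner_integrable \<mu> (\<lambda>x. g1 x + g2 x)" by (rule bochner_integrable_add[OF g'])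
    fix A and \<phi> :: "'e \<Rightarrow>\<^sub>L real" assume A: "A \<in> sets (F t)"
    show "indicator_integral \<mu> A (\<lambda>x. blinfun_apply \<phi> (g1 x + g2 x))
        = indicator_integral \<mu> A (\<lambda>x. blinfun_apply \<phi> (f1 x + f2 x))"
      using g A unfolding is_projection_def
      by (simp add: blinfun.add_right indicator_integral_add[OF sets_F[OF t A]] integrable_blinfun_apply f g')
  qed
qed

lemma projection_scaleR:
  fixes f g :: "'x \<Rightarrow> 'e::banach"
  assumes t: "0 \<le> t" and g: "is_projection t f g"
  shows "is_projection t (\<lambda>x. c *\<^sub>R f x) (\<lambda>x. c *\<^sub>R g x)"
proof -
  interpret R: finite_complete_measure "restr t" by (rule finite_complete_restr[OF t])
  show ?thesis
    using g R.strongly_measurable_scaleR[of g c] bochner_integrable_scaleR[of g c] unfolding is_projection_def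
    by (simp add: blinfun.scaleR_right indicator_integral_cmult)
qed

section \<open>Maximal functions and the vector space H1\<close>

lemma maximal_inf_eq: "maximal_inf M x = (SUP s\<in>{0..}. ennreal (norm (M s x)))"
proof (rule antisym)
  show "maximal_inf M x \<le> (SUP s\<in>{0..}. ennreal (norm (M s x)))"
    unfolding maximal_inf_def maximal_def by (intro SUP_least SUP_upper) auto
  show "(SUP s\<in>{0..}. ennreal (norm (M s x))) \<le> maximal_inf M x"
  proof (rule SUP_least)
    fix s :: real assume "s \<in> {0..}"
    then have "ennreal (norm (M s x)) \<le> maximal M (s + 1) x"
      unfolding maximal_def by (intro SUP_upper) auto
    also have "\<dots> \<le> maximal_inf M x"
      unfolding maximal_inf_def using \<open>s \<in> {0..}\<close> by (intro SUP_upper) auto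
    finally show "ennreal (norm (M s x)) \<le> maximal_inf M x" .
  qed
qed

lemma norm_le_maximal_inf: "0 \<le> s \<Longrightarrow> ennreal (norm (M s x)) \<le> maximal_inf M x"
  unfolding maximal_inf_eq by (intro SUP_upper) auto

definition nonneg_rat :: "nat \<Rightarrow> real" where
  "nonneg_rat n = real_of_rat \<bar>from_nat n\<bar>"

lemma nonneg_rat_nonneg: "0 \<le> nonneg_rat n" by (simp add: nonneg_rat_def)

lemma nonneg_rat_dense:
  assumes "0 \<le> s" "s < u" obtains n where "s < nonneg_rat n" "nonneg_rat n < u"
proof -
  obtain q :: rat where q: "s < of_rat q" "of_rat q < u" using of_rat_dense[OF assms(2)] by blast
  then have "nonneg_rat (to_nat q) = of_rat q"
  proof -
    have "(0::real) \<le> of_rat q" using assms(1) q(1) by linarith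
    then show ?thesis by (simp add: nonneg_rat_def)
  qed
  then show ?thesis using q that[of "to_nat q"] by simp
qed

text \<open>By right-continuity the norm at \<open>s\<close> is a limit along rational times
  strictly above \<open>s\<close>. So countably many times suffice, which makes the maximal function
  measurable.\<close>

lemma maximal_inf_countable:
  assumes "cadlag \<mu> M" "x \<in> space \<mu>"
  shows "maximal_inf M x = (SUP n. ennreal (norm (M (nonneg_rat n) x)))"
proof (rule antisym)
  show "(SUP n. ennreal (norm (M (nonneg_rat n) x))) \<le> maximal_inf M x"
    by (intro SUP_least norm_le_maximal_inf nonneg_rat_nonneg)
  show "maximal_inf M x \<le> (SUP n. ennreal (norm (M (nonneg_rat n) x)))"
    unfolding maximal_inf_eq
  proof (rule SUP_least)
    fix s :: real assume s: "s \<in> {0..}"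
    have "\<exists>n. s < nonneg_rat n \<and> nonneg_rat n < s + 1 / real (Suc k)" for k
      using nonneg_rat_dense[of s "s + 1 / real (Suc k)"] s by auto
    then obtain n where n: "\<And>k. s < nonneg_rat (n k)" "\<And>k. nonneg_rat (n k) < s + 1 / real (Suc k)" by metis
    have "(\<lambda>k. nonneg_rat (n k)) \<longlonglongrightarrow> s"
    proof (rule tendsto_sandwich[of "\<lambda>_. s" _ _ "\<lambda>k. s + 1 / real (Suc k)"])
      show "(\<lambda>k. s + 1 / real (Suc k)) \<longlonglongrightarrow> s"
        using tendsto_add[OF tendsto_const LIMSEQ_inverse_real_of_nat, of s] by (simp add: inverse_eq_divide)
    qed (use n in \<open>auto intro!: always_eventually less_imp_le simp del: of_nat_Suc\<close>)
    then have "filterlim (\<lambda>k. nonneg_rat (n k)) (at_right s) sequentially"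
      unfolding filterlim_at using n(1) less_imp_neq[OF n(1), symmetric] by (auto intro!: always_eventually)
    moreover have "((\<lambda>u. M u x) \<longlongrightarrow> M s x) (at_right s)" using assms s by (auto simp: cadlag_def)
    ultimately have "(\<lambda>k. M (nonneg_rat (n k)) x) \<longlonglongrightarrow> M s x" by (rule filterlim_compose[rotated])
    then have "(\<lambda>k. ennreal (norm (M (nonneg_rat (n k)) x))) \<longlonglongrightarrow> ennreal (norm (M s x))"
      by (intro tendsto_intros)
    then show "ennreal (norm (M s x)) \<le> (SUP n. ennreal (norm (M (nonneg_rat n) x)))"
      by (rule LIMSEQ_le_const2) (intro exI allI impI SUP_upper UNIV_I)
  qed
qed

lemma maximal_inf_measurable:
  assumes "cadlag \<mu> M" "adapted \<mu> F M" shows "maximal_inf M \<in> borel_measurable \<mu>"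
proof -
  have "(\<lambda>x. norm (M (nonneg_rat n) x)) \<in> borel_measurable \<mu>" for n
    using assms(2) strongly_measurable_restr[OF nonneg_rat_nonneg] nonneg_rat_nonneg
    by (intro strongly_measurable_norm) (auto simp: adapted_def)
  then have "(\<lambda>x. SUP n. ennreal (norm (M (nonneg_rat n) x))) \<in> borel_measurable \<mu>" by measurable
  then show ?thesis
    by (subst measurable_cong[OF maximal_inf_countable[OF assms(1)]])
qed

text \<open>Apart from regular paths and an integrable maximal function, membership in
  \<open>H1\<close> comes down to closure by one terminal value: adaptedness is part of being a
  projection, and the martingale property is the tower property.\<close>

lemma H1_I:
  fixes M :: "('x, 'e::banach) process"
  assumes c: "cadlag \<mu> M" and fin: "(\<integral>\<^sup>+x. maximal_inf M x \<partial>\<mu>) < \<infinity>"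
    and \<xi>: "bochner_integrable \<mu> \<xi>" "\<And>t. 0 \<le> t \<Longrightarrow> is_projection t \<xi> (M t)"
  shows "M \<in> H1 \<mu> F"
proof -
  have ad: "adapted \<mu> F M" using \<xi>(2) by (auto simp: adapted_def is_projection_def)
  have int: "bochner_integrable \<mu> (M t)" if "0 \<le> t" for t using \<xi>(2)[OF that] by (simp add: is_projection_def)
  have "is_cond_exp \<mu> (F s) (M t) (M s)" if "0 \<le> s" "s \<le> t" for s t
    using is_cond_exp_iff[OF that(1) int] projection_tower[OF that \<xi>(2) \<xi>(2)] that by simp
  then show ?thesis
    unfolding H1_def martingale_def
    using c ad int fin maximal_inf_measurable[OF c ad] \<xi> is_cond_exp_iff[OF _ \<xi>(1)] by auto
qed

lemma H1_D:
  fixes M :: "('x, 'e::banach) process"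
  assumes "M \<in> H1 \<mu> F"
  shows "cadlag \<mu> M" "adapted \<mu> F M" "maximal_inf M \<in> borel_measurable \<mu>" "(\<integral>\<^sup>+x. maximal_inf M x \<partial>\<mu>) < \<infinity>"
    and "\<exists>\<xi>. bochner_integrable \<mu> \<xi> \<and> (\<forall>t\<ge>0. is_projection t \<xi> (M t))"
proof -
  show "cadlag \<mu> M" "adapted \<mu> F M" "maximal_inf M \<in> borel_measurable \<mu>" "(\<integral>\<^sup>+x. maximal_inf M x \<partial>\<mu>) < \<infinity>"
    using assms by (simp_all add: H1_def martingale_def)
  obtain \<xi> where "bochner_integrable \<mu> \<xi>" "\<forall>t\<ge>0. is_cond_exp \<mu> (F t) \<xi> (M t)"
    using assms by (auto simp: H1_def)
  then show "\<exists>\<xi>. bochner_integrable \<mu> \<xi> \<and> (\<forall>t\<ge>0. is_projection t \<xi> (M t))"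
    using is_cond_exp_iff[of _ \<xi>] by (intro exI[of _ \<xi>]) simp
qed

lemma H1_bochner_integrable: "M \<in> H1 \<mu> F \<Longrightarrow> 0 \<le> t \<Longrightarrow> bochner_integrable \<mu> (M t)"
  using H1_D(5)[of M] by (auto simp: is_projection_def)

lemma H1_projection:
  assumes "M \<in> H1 \<mu> F" "0 \<le> s" "s \<le> t" shows "is_projection s (M t) (M s)"
proof -
  obtain \<xi> where \<xi>: "\<forall>t\<ge>0. is_projection t \<xi> (M t)" using H1_D(5)[OF assms(1)] by blast
  show ?thesis by (rule projection_tower[OF assms(2,3)]) (use \<xi> assms(2,3) in auto)
qed

lemma maximal_inf_add: "maximal_inf (\<lambda>t x. M t x + N t x) x \<le> maximal_inf M x + maximal_inf N x"
proof -
  have "ennreal (norm (M s x + N s x)) \<le> maximal_inf M x + maximal_inf N x" if "0 \<le> s" for s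
  proof -
    have "ennreal (norm (M s x + N s x)) \<le> ennreal (norm (M s x)) + ennreal (norm (N s x))"
      using norm_triangle_ineq[of "M s x" "N s x"] by (simp flip: ennreal_plus)
    also have "\<dots> \<le> maximal_inf M x + maximal_inf N x" using that by (intro add_mono norm_le_maximal_inf)
    finally show ?thesis .
  qed
  then show ?thesis unfolding maximal_inf_eq[of "\<lambda>t x. M t x + N t x"] by (intro SUP_least) auto
qed

lemma maximal_inf_scaleR: "maximal_inf (\<lambda>t x. c *\<^sub>R M t x) x = ennreal \<bar>c\<bar> * maximal_inf M x"
proof -
  have "ennreal (norm (c *\<^sub>R M s x)) = ennreal \<bar>c\<bar> * ennreal (norm (M s x))" for s
    by (simp only: norm_scaleR ennreal_mult[OF abs_ge_zero norm_ge_zero])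
  then show ?thesis unfolding maximal_inf_eq by (simp only: SUP_mult_left_ennreal)
qed

lemma cadlag_right: "cadlag \<mu> M \<Longrightarrow> x \<in> space \<mu> \<Longrightarrow> 0 \<le> t \<Longrightarrow> ((\<lambda>s. M s x) \<longlongrightarrow> M t x) (at_right t)"
  by (simp add: cadlag_def)

lemma cadlag_left:
  assumes "cadlag \<mu> M" "x \<in> space \<mu>" "0 < t" obtains l where "((\<lambda>s. M s x) \<longlongrightarrow> l) (at_left t)"
  using assms unfolding cadlag_def by blast

lemma cadlag_add:
  assumes "cadlag \<mu> M" "cadlag \<mu> N" shows "cadlag \<mu> (\<lambda>t x. M t x + N t x)"
  unfolding cadlag_def
proof (intro ballI conjI allI impI)
  fix x and t :: real assume x: "x \<in> space \<mu>"
  show "((\<lambda>s. M s x + N s x) \<longlongrightarrow> M t x + N t x) (at_right t)" if "0 \<le> t"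
    by (intro tendsto_add cadlag_right assms x that)
  show "\<exists>l. ((\<lambda>s. M s x + N s x) \<longlongrightarrow> l) (at_left t)" if t: "0 < t"
  proof -
    obtain a where a: "((\<lambda>s. M s x) \<longlongrightarrow> a) (at_left t)" using cadlag_left[OF assms(1) x t] .
    obtain b where "((\<lambda>s. N s x) \<longlongrightarrow> b) (at_left t)" using cadlag_left[OF assms(2) x t] .
    from tendsto_add[OF a this] show ?thesis by blast
  qed
qed

lemma cadlag_scaleR:
  assumes "cadlag \<mu> M" shows "cadlag \<mu> (\<lambda>t x. c *\<^sub>R M t x)"
  unfolding cadlag_def
proof (intro ballI conjI allI impI)
  fix x and t :: real assume x: "x \<in> space \<mu>"
  show "((\<lambda>s. c *\<^sub>R M s x) \<longlongrightarrow> c *\<^sub>R M t x) (at_right t)" if "0 \<le> t"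
    by (intro tendsto_scaleR tendsto_const cadlag_right assms x that)
  show "\<exists>l. ((\<lambda>s. c *\<^sub>R M s x) \<longlongrightarrow> l) (at_left t)" if t: "0 < t"
  proof -
    obtain a where "((\<lambda>s. M s x) \<longlongrightarrow> a) (at_left t)" using cadlag_left[OF assms(1) x t] .
    from tendsto_scaleR[OF tendsto_const this] show ?thesis by blast
  qed
qed

lemma H1_add:
  assumes "M \<in> H1 \<mu> F" "N \<in> H1 \<mu> F" shows "(\<lambda>t x. M t x + N t x) \<in> H1 \<mu> F"
proof -
  obtain \<xi> \<eta> where \<xi>: "bochner_integrable \<mu> \<xi>" "\<forall>t\<ge>0. is_projection t \<xi> (M t)"
    and \<eta>: "bochner_integrable \<mu> \<eta>" "\<forall>t\<ge>0. is_projection t \<eta> (N t)"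
    using H1_D(5) assms by blast
  show ?thesis
  proof (rule H1_I)
    show "cadlag \<mu> (\<lambda>t x. M t x + N t x)" using H1_D(1) assms by (intro cadlag_add)
    have "(\<integral>\<^sup>+x. maximal_inf (\<lambda>t x. M t x + N t x) x \<partial>\<mu>) \<le> (\<integral>\<^sup>+x. maximal_inf M x + maximal_inf N x \<partial>\<mu>)"
      by (intro nn_integral_mono maximal_inf_add)
    also have "\<dots> < \<infinity>" using H1_D(3,4) assms by (subst nn_integral_add) auto
    finally show "(\<integral>\<^sup>+x. maximal_inf (\<lambda>t x. M t x + N t x) x \<partial>\<mu>) < \<infinity>" .
    show "bochner_integrable \<mu> (\<lambda>x. \<xi> x + \<eta> x)" using \<xi> \<eta> by (intro bochner_integrable_add)
    show "is_projection t (\<lambda>x. \<xi> x + \<eta> x) (\<lambda>x. M t x + N t x)" if "0 \<le> t" for t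
      using \<xi> \<eta> that by (intro projection_add) auto
  qed
qed

lemma H1_scaleR:
  assumes "M \<in> H1 \<mu> F" shows "(\<lambda>t x. c *\<^sub>R M t x) \<in> H1 \<mu> F"
proof -
  obtain \<xi> where \<xi>: "bochner_integrable \<mu> \<xi>" "\<forall>t\<ge>0. is_projection t \<xi> (M t)" using H1_D(5) assms by blast
  show ?thesis
  proof (rule H1_I)
    show "cadlag \<mu> (\<lambda>t x. c *\<^sub>R M t x)" using H1_D(1) assms by (intro cadlag_scaleR)
    show "(\<integral>\<^sup>+x. maximal_inf (\<lambda>t x. c *\<^sub>R M t x) x \<partial>\<mu>) < \<infinity>"
      using H1_D(3,4)[OF assms] by (simp add: maximal_inf_scaleR nn_integral_cmult ennreal_mult_less_top)
    show "bochner_integrable \<mu> (\<lambda>x. c *\<^sub>R \<xi> x)" using \<xi> by (intro bochner_integrable_scaleR)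
    show "is_projection t (\<lambda>x. c *\<^sub>R \<xi> x) (\<lambda>x. c *\<^sub>R M t x)" if "0 \<le> t" for t
      using \<xi> that by (intro projection_scaleR) auto
  qed
qed

lemma H1_sum:
  assumes "\<And>k. k \<in> I \<Longrightarrow> M k \<in> H1 \<mu> F" "finite I"
  shows "(\<lambda>t x. \<Sum>k\<in>I. c k *\<^sub>R M k t x) \<in> H1 \<mu> F"
  using assms(2,1)
proof (induction I rule: finite_induct)
  case empty
  show ?case
    by (rule H1_I[of _ "\<lambda>_. 0"])
      (auto simp: cadlag_def is_projection_def maximal_inf_eq bochner_integrable_zero
        finite_complete_measure.strongly_measurable_const[OF finite_complete_restr])
next
  case (insert i I)
  then show ?case using H1_add[OF H1_scaleR[of "M i" "c i"], of "\<lambda>t x. \<Sum>k\<in>I. c k *\<^sub>R M k t x"] by simp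
qed

lemma H1_diff:
  assumes "M \<in> H1 \<mu> F" "N \<in> H1 \<mu> F" shows "(\<lambda>t x. M t x - N t x) \<in> H1 \<mu> F"
  using H1_add[OF assms(1) H1_scaleR[OF assms(2), of "- 1"]] by simp

text \<open>The events are split according to the first time of \<open>T\<close> at which the level is exceeded.\<close>

lemma Doob_finite:
  fixes M :: "('x, 'e::banach) process"
  assumes T: "finite T" "T \<subseteq> {0..}" and f: "bochner_integrable \<mu> f"
    and M: "\<And>t. t \<in> T \<Longrightarrow> is_projection t f (M t)" and r: "0 < r"
  shows "r * measure \<mu> {x \<in> space \<mu>. \<exists>t\<in>T. r < norm (M t x)} \<le> (\<integral>x. norm (f x) \<partial>\<mu>)"
proof -
  define A where "A s = {x \<in> space \<mu>. r < norm (M s x) \<and> (\<forall>u\<in>{u\<in>T. u < s}. norm (M u x) \<le> r)}" for s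
  have AF: "A s \<in> sets (F s)" if s: "s \<in> T" for s
  proof -
    have s0: "0 \<le> s" using s T by auto
    have meas: "(\<lambda>x. norm (M u x)) \<in> borel_measurable (F s)" if u: "u \<in> T" "u \<le> s" for u
    proof -
      have "strongly_measurable (restr s) (M u)"
        using M[OF u(1)] u T by (intro strongly_measurable_restr_mono[of u s]) (auto simp: is_projection_def)
      then show ?thesis by (rule norm_measurable_F[OF s0])
    qed
    have 1: "{x \<in> space (F s). r < norm (M s x)} \<in> sets (F s)" using meas[OF s order_refl] by measurable
    have 2: "{x \<in> space (F s). norm (M u x) \<le> r} \<in> sets (F s)" if "u \<in> {u\<in>T. u < s}" for u
    proof -
      have "(\<lambda>x. norm (M u x)) \<in> borel_measurable (F s)" using meas[of u] that by simp
      then show ?thesis by measurable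
    qed
    have "{x \<in> space (F s). \<forall>u\<in>{u\<in>T. u < s}. norm (M u x) \<le> r} \<in> sets (F s)"
      using T(1) 2 by (intro sets.sets_Collect_finite_All) auto
    from sets.Int[OF 1 this] show ?thesis
      by (rule back_subst[of "\<lambda>A. A \<in> sets (F s)"]) (auto simp: A_def space_F[OF s0])
  qed
  have fint: "integrable \<mu> (\<lambda>x. norm (f x))" using bochner_integrableD(2)[OF f] .
  have A\<mu>: "A s \<in> sets \<mu>" if "s \<in> T" for s using AF[OF that] that T by (intro sets_F[of s]) auto
  have disj: "A s \<inter> A u = {}" if "s \<in> T" "u \<in> T" "s \<noteq> u" for s u
    using that by (auto simp: A_def) (metis linorder_neqE not_less)
  have un: "{x \<in> space \<mu>. \<exists>t\<in>T. r < norm (M t x)} = (\<Union>s\<in>T. A s)"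
  proof safe
    fix x t assume x: "x \<in> space \<mu>" "t \<in> T" "r < norm (M t x)"
    define s where "s = Min {t\<in>T. r < norm (M t x)}"
    have "s \<in> {t\<in>T. r < norm (M t x)}" unfolding s_def using x T(1) by (intro Min_in) auto
    moreover have "norm (M u x) \<le> r" if u: "u \<in> T" "u < s" for u
    proof (rule ccontr)
      assume "\<not> norm (M u x) \<le> r"
      then have "s \<le> u" unfolding s_def using u T(1) by (intro Min_le) auto
      then show False using u by simp
    qed
    ultimately show "x \<in> (\<Union>s\<in>T. A s)" using x(1) by (auto simp: A_def)
  qed (auto simp: A_def)
  have "r * measure \<mu> (\<Union>s\<in>T. A s) = (\<Sum>s\<in>T. r * measure \<mu> (A s))"
    using T(1) A\<mu> disj by (subst finite_measure_finite_Union) (auto simp: disjoint_family_on_def sum_distrib_left)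
  also have "\<dots> \<le> (\<Sum>s\<in>T. indicator_integral \<mu> (A s) (\<lambda>x. norm (f x)))"
  proof (rule sum_mono)
    fix s assume s: "s \<in> T"
    have s0: "0 \<le> s" using s T by auto
    have "r * measure \<mu> (A s) = indicator_integral \<mu> (A s) (\<lambda>x. r)" using A\<mu>[OF s] by (simp add: indicator_integral_const)
    also have "\<dots> \<le> indicator_integral \<mu> (A s) (\<lambda>x. norm (M s x))"
      unfolding indicator_integral_def
    proof (rule integral_mono)
      show "indicat_real (A s) x * r \<le> indicat_real (A s) x * norm (M s x)" for x
        by (auto simp: A_def indicator_def)
      show "integrable \<mu> (\<lambda>x. indicat_real (A s) x * norm (M s x))"
        using M[OF s] A\<mu>[OF s] by (intro integrable_indicator_mult) (auto simp: is_projection_def dest: bochner_integrableD(2))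
    qed (intro integrable_indicator_mult A\<mu> s, simp)
    also have "\<dots> \<le> indicator_integral \<mu> (A s) (\<lambda>x. norm (f x))"
      by (rule projection_norm_le[OF s0 f M[OF s] AF[OF s]])
    finally show "r * measure \<mu> (A s) \<le> indicator_integral \<mu> (A s) (\<lambda>x. norm (f x))" .
  qed
  also have "\<dots> = (\<integral>x. (\<Sum>s\<in>T. indicat_real (A s) x * norm (f x)) \<partial>\<mu>)"
    unfolding indicator_integral_def
    by (rule Bochner_Integration.integral_sum[symmetric]) (intro integrable_indicator_mult A\<mu> fint)
  also have "\<dots> \<le> (\<integral>x. norm (f x) \<partial>\<mu>)"
  proof (rule integral_mono)
    show "(\<Sum>s\<in>T. indicat_real (A s) x * norm (f x)) \<le> norm (f x)" for x
    proof -
      have "(\<Sum>s\<in>T. indicat_real (A s) x) = indicat_real (\<Union>s\<in>T. A s) x"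
        by (rule indicator_UN_disjoint[symmetric]) (use T(1) disj in \<open>auto simp: disjoint_family_on_def\<close>)
      also have "\<dots> \<le> 1" by (simp add: indicator_def)
      finally show ?thesis using mult_right_mono[of _ 1 "norm (f x)"] by (simp only: sum_distrib_right[symmetric]) auto
    qed
    show "integrable \<mu> (\<lambda>x. \<Sum>s\<in>T. indicat_real (A s) x * norm (f x))"
      by (intro Bochner_Integration.integrable_sum integrable_indicator_mult A\<mu> fint)
  qed (rule fint)
  finally show ?thesis by (simp add: un)
qed

text \<open>The event is the increasing union of the events for finite sets of rational times;
  because the inequality is strict, a supremum above \<open>r\<close> is witnessed at some finite
  stage.\<close>

lemma Doob_maximal:
  fixes M :: "('x, 'e::banach) process"
  assumes c: "cadlag \<mu> M" and f: "bochner_integrable \<mu> f" and M: "\<And>t. 0 \<le> t \<Longrightarrow> is_projection t f (M t)" and r: "0 < r"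
  shows "r * measure \<mu> {x \<in> space \<mu>. ennreal r < maximal_inf M x} \<le> (\<integral>x. norm (f x) \<partial>\<mu>)"
proof -
  define B where "B n = {x \<in> space \<mu>. \<exists>t\<in>nonneg_rat ` {..n}. r < norm (M t x)}" for n
  have meas: "(\<lambda>x. norm (M (nonneg_rat k) x)) \<in> borel_measurable \<mu>" for k
    using M[OF nonneg_rat_nonneg[of k]] by (intro strongly_measurable_norm bochner_integrableD(1)) (auto simp: is_projection_def)
  have Bm: "B n \<in> sets \<mu>" for n
  proof -
    have "{x \<in> space \<mu>. r < norm (M (nonneg_rat k) x)} \<in> sets \<mu>" for k using meas[of k] by measurable
    then have "{x \<in> space \<mu>. \<exists>k\<in>{..n}. r < norm (M (nonneg_rat k) x)} \<in> sets \<mu>"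
      by (intro sets.sets_Collect_finite_Ex) auto
    then show ?thesis by (simp add: B_def)
  qed
  have inc: "incseq B" unfolding incseq_def B_def by fastforce
  have "{x \<in> space \<mu>. ennreal r < maximal_inf M x} = (\<Union>n. B n)"
  proof safe
    fix x assume x: "x \<in> space \<mu>" "ennreal r < maximal_inf M x"
    then obtain k where "ennreal r < ennreal (norm (M (nonneg_rat k) x))"
      using maximal_inf_countable[OF c x(1)] by (auto simp: less_SUP_iff)
    then have "r < norm (M (nonneg_rat k) x)" using r by (simp add: ennreal_less_iff)
    then show "x \<in> (\<Union>n. B n)" using x by (auto simp: B_def intro!: exI[of _ k])
  next
    fix x n assume "x \<in> B n"
    then obtain k where k: "x \<in> space \<mu>" "r < norm (M (nonneg_rat k) x)" by (auto simp: B_def)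
    then have "ennreal r < ennreal (norm (M (nonneg_rat k) x))" using r by (simp add: ennreal_less_iff)
    also have "\<dots> \<le> maximal_inf M x" by (rule norm_le_maximal_inf[OF nonneg_rat_nonneg])
    finally show "ennreal r < maximal_inf M x" .
  qed (auto simp: B_def)
  moreover have "(\<lambda>n. r * measure \<mu> (B n)) \<longlonglongrightarrow> r * measure \<mu> (\<Union>n. B n)"
    using Bm inc by (intro tendsto_mult_left finite_Lim_measure_incseq) auto
  moreover have "r * measure \<mu> (B n) \<le> (\<integral>x. norm (f x) \<partial>\<mu>)" for n
    unfolding B_def by (rule Doob_finite[OF _ _ f _ r]) (auto intro: M nonneg_rat_nonneg)
  ultimately show ?thesis by (auto intro: LIMSEQ_le_const2)
qed

end

section \<open>Optional stopping\<close>

context stochastic_basis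
begin

text \<open>The extended-valued maximal function is finite almost surely, and its real version is
  one integrable bound for all times at once; it is the dominating function in the limit arguments
  for stopped values.\<close>

lemma H1_maximal:
  assumes "M \<in> H1 \<mu> F"
  shows "integrable \<mu> (\<lambda>x. enn2real (maximal_inf M x))"
    and "AE x in \<mu>. ennreal (enn2real (maximal_inf M x)) = maximal_inf M x"
    and "AE x in \<mu>. \<forall>t\<ge>0. norm (M t x) \<le> enn2real (maximal_inf M x)"
proof -
  note meas = H1_D(3)[OF assms] and fin = H1_D(4)[OF assms]
  have "AE x in \<mu>. maximal_inf M x \<noteq> \<infinity>" by (rule nn_integral_PInf_AE[OF meas]) (use fin in auto)
  then show eq: "AE x in \<mu>. ennreal (enn2real (maximal_inf M x)) = maximal_inf M x"
    by eventually_elim (simp add: less_top)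
  then show "AE x in \<mu>. \<forall>t\<ge>0. norm (M t x) \<le> enn2real (maximal_inf M x)"
  proof eventually_elim
    case (elim x)
    show ?case
    proof (intro allI impI)
      fix t :: real assume "0 \<le> t"
      then have "ennreal (norm (M t x)) \<le> ennreal (enn2real (maximal_inf M x))"
        using norm_le_maximal_inf[of t M x] elim by simp
      then show "norm (M t x) \<le> enn2real (maximal_inf M x)" by (simp add: ennreal_le_iff)
    qed
  qed
  show "integrable \<mu> (\<lambda>x. enn2real (maximal_inf M x))"
  proof (rule integrableI_nonneg)
    show "(\<lambda>x. enn2real (maximal_inf M x)) \<in> borel_measurable \<mu>" using meas by measurable
    have "(\<integral>\<^sup>+x. ennreal (enn2real (maximal_inf M x)) \<partial>\<mu>) = (\<integral>\<^sup>+x. maximal_inf M x \<partial>\<mu>)"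
      by (rule nn_integral_cong_AE[OF eq])
    then show "(\<integral>\<^sup>+x. ennreal (enn2real (maximal_inf M x)) \<partial>\<mu>) < \<infinity>" using fin by simp
  qed simp
qed

section \<open>Bounded stopping times and their discretization\<close>

definition bounded_stopping_time :: "real \<Rightarrow> ('x \<Rightarrow> real) \<Rightarrow> bool" where
  "bounded_stopping_time K \<tau> \<longleftrightarrow> (\<forall>x\<in>space \<mu>. 0 \<le> \<tau> x \<and> \<tau> x \<le> K) \<and>
     (\<forall>s\<ge>0. {x \<in> space \<mu>. \<tau> x \<le> s} \<in> sets (F s))"

lemma bounded_stopping_time_min:
  assumes "bounded_stopping_time K \<tau>" "0 \<le> t" shows "bounded_stopping_time t (\<lambda>x. min t (\<tau> x))"
  unfolding bounded_stopping_time_def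
proof (intro conjI allI impI ballI)
  fix s :: real assume s: "0 \<le> s"
  show "{x \<in> space \<mu>. min t (\<tau> x) \<le> s} \<in> sets (F s)"
  proof (cases "t \<le> s")
    case True
    then have "{x \<in> space \<mu>. min t (\<tau> x) \<le> s} = space (F s)" using space_F[OF s] by auto
    then show ?thesis by simp
  next
    case False
    then have "{x \<in> space \<mu>. min t (\<tau> x) \<le> s} = {x \<in> space \<mu>. \<tau> x \<le> s}" by auto
    then show ?thesis using assms s by (simp add: bounded_stopping_time_def)
  qed
qed (use assms in \<open>auto simp: bounded_stopping_time_def\<close>)

lemma stopping_time_less:
  assumes \<tau>: "bounded_stopping_time K \<tau>" and s: "0 \<le> s"
  shows "{x \<in> space \<mu>. \<tau> x < s} \<in> sets (F s)"
proof -
  have eq: "{x \<in> space \<mu>. \<tau> x < s} = (\<Union>n. {x \<in> space \<mu>. 0 \<le> s - 1 / real (Suc n) \<and> \<tau> x \<le> s - 1 / real (Suc n)})"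
  proof safe
    fix x assume x: "x \<in> space \<mu>" "\<tau> x < s"
    obtain n where "1 / real (Suc n) < s - \<tau> x" using reals_Archimedean[of "s - \<tau> x"] x by (auto simp: inverse_eq_divide)
    moreover have "0 \<le> \<tau> x" using \<tau> x by (simp add: bounded_stopping_time_def)
    ultimately show "x \<in> (\<Union>n. {x \<in> space \<mu>. 0 \<le> s - 1 / real (Suc n) \<and> \<tau> x \<le> s - 1 / real (Suc n)})"
      using x by (auto intro!: exI[of _ n] simp del: of_nat_Suc)
  next
    fix x n assume "0 \<le> s - 1 / real (Suc n)" "\<tau> x \<le> s - 1 / real (Suc n)"
    moreover have "1 / real (Suc n) > 0" by simp
    ultimately show "\<tau> x < s" by linarith
  qed
  have piece: "{x \<in> space \<mu>. 0 \<le> s - 1 / real (Suc n) \<and> \<tau> x \<le> s - 1 / real (Suc n)} \<in> sets (F s)" for n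
  proof (cases "0 \<le> s - 1 / real (Suc n)")
    case True
    have "s - 1 / real (Suc n) \<le> s" by simp
    moreover have "{x \<in> space \<mu>. \<tau> x \<le> s - 1 / real (Suc n)} \<in> sets (F (s - 1 / real (Suc n)))"
      using \<tau> True by (simp add: bounded_stopping_time_def)
    ultimately have "{x \<in> space \<mu>. \<tau> x \<le> s - 1 / real (Suc n)} \<in> sets (F s)"
      using F_mono[OF True] by blast
    then show ?thesis using True by simp
  qed simp
  show ?thesis unfolding eq by (rule sets.countable_UN, rule image_subsetI, rule piece)
qed

text \<open>A stopping time bounded by \<open>K\<close> is approximated from the right by stopping times taking the
  finitely many values \<open>grid K n i\<close>.\<close>

definition grid :: "real \<Rightarrow> nat \<Rightarrow> nat \<Rightarrow> real" where
  "grid K n i = min K (real (Suc i) / real (Suc n))"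

definition cell :: "('x \<Rightarrow> real) \<Rightarrow> nat \<Rightarrow> nat \<Rightarrow> 'x set" where
  "cell \<tau> n i = {x \<in> space \<mu>. real i / real (Suc n) \<le> \<tau> x \<and> \<tau> x < real (Suc i) / real (Suc n)}"

lemma grid_bounds: "0 \<le> K \<Longrightarrow> 0 \<le> grid K n i" "grid K n i \<le> K"
  by (auto simp: grid_def)

lemma cell_index:
  assumes \<tau>: "bounded_stopping_time K \<tau>" and x: "x \<in> space \<mu>"
  shows "x \<in> cell \<tau> n i \<longleftrightarrow> i = nat \<lfloor>real (Suc n) * \<tau> x\<rfloor>"
proof -
  have t0: "0 \<le> \<tau> x" using \<tau> x by (simp add: bounded_stopping_time_def)
  have "x \<in> cell \<tau> n i \<longleftrightarrow> real i \<le> real (Suc n) * \<tau> x \<and> real (Suc n) * \<tau> x < real i + 1"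
    using x by (simp add: cell_def field_simps)
  also have "\<dots> \<longleftrightarrow> \<lfloor>real (Suc n) * \<tau> x\<rfloor> = int i"
    by (auto simp: floor_eq_iff)
  also have "\<dots> \<longleftrightarrow> i = nat \<lfloor>real (Suc n) * \<tau> x\<rfloor>" using t0 by (auto simp: nat_eq_iff2)
  finally show ?thesis .
qed

lemma cell_index_bound:
  assumes \<tau>: "bounded_stopping_time K \<tau>" and x: "x \<in> space \<mu>"
  shows "nat \<lfloor>real (Suc n) * \<tau> x\<rfloor> < Suc (nat \<lfloor>real (Suc n) * K\<rfloor>)"
proof -
  have "\<lfloor>real (Suc n) * \<tau> x\<rfloor> \<le> \<lfloor>real (Suc n) * K\<rfloor>"
    using \<tau> x by (intro floor_mono mult_left_mono) (auto simp: bounded_stopping_time_def)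
  then show ?thesis by (simp add: nat_mono less_Suc_eq_le)
qed

text \<open>Membership in the cell is decided at its right endpoint. If the cap \<open>K\<close>
  comes earlier, the upper condition holds everywhere because \<open>\<tau>\<close> is at most
  \<open>K\<close>; a cell that begins after \<open>K\<close> is empty.\<close>

lemma cell_measurable:
  assumes \<tau>: "bounded_stopping_time K \<tau>" and K: "0 \<le> K"
  shows "cell \<tau> n i \<in> sets (F (grid K n i))"
proof -
  let ?a = "real i / real (Suc n)" and ?b = "real (Suc i) / real (Suc n)"
  have ab: "?a \<le> ?b" by (simp add: divide_right_mono)
  have eq: "cell \<tau> n i = {x \<in> space \<mu>. \<tau> x < ?b} - {x \<in> space \<mu>. \<tau> x < ?a}" by (auto simp: cell_def)
  show ?thesis
  proof (cases "?b \<le> K")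
    case True
    have "{x \<in> space \<mu>. \<tau> x < ?b} \<in> sets (F ?b)" by (rule stopping_time_less[OF \<tau>]) simp
    moreover have "{x \<in> space \<mu>. \<tau> x < ?a} \<in> sets (F ?b)"
      using stopping_time_less[OF \<tau>, of ?a] F_mono[OF _ ab] by auto
    ultimately show ?thesis using True unfolding eq grid_def by (simp add: min_absorb2)
  next
    case False
    then have g: "grid K n i = K" by (simp add: grid_def)
    show ?thesis
    proof (cases "?a \<le> K")
      case True
      have "{x \<in> space \<mu>. \<tau> x < ?b} = space (F K)"
        using False \<tau> space_F[OF K] by (force simp: bounded_stopping_time_def)
      moreover have "{x \<in> space \<mu>. \<tau> x < ?a} \<in> sets (F K)"
        using stopping_time_less[OF \<tau>, of ?a] F_mono[OF _ True] by auto
      ultimately show ?thesis unfolding eq g by auto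
    next
      case F: False
      then have "cell \<tau> n i = {}" using \<tau> by (force simp: cell_def bounded_stopping_time_def)
      then show ?thesis by simp
    qed
  qed
qed

lemma stopped_approx_sum:
  fixes h :: "nat \<Rightarrow> 'v::real_vector"
  assumes \<tau>: "bounded_stopping_time K \<tau>" and x: "x \<in> space \<mu>"
  shows "(\<Sum>i<Suc (nat \<lfloor>real (Suc n) * K\<rfloor>). indicat_real (cell \<tau> n i) x *\<^sub>R h i) = h (nat \<lfloor>real (Suc n) * \<tau> x\<rfloor>)"
proof -
  let ?j = "nat \<lfloor>real (Suc n) * \<tau> x\<rfloor>"
  have "(\<Sum>i<Suc (nat \<lfloor>real (Suc n) * K\<rfloor>). indicat_real (cell \<tau> n i) x *\<^sub>R h i)
      = (\<Sum>i<Suc (nat \<lfloor>real (Suc n) * K\<rfloor>). if i = ?j then h i else 0)"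
    using cell_index[OF \<tau> x] by (intro sum.cong) (auto simp: indicator_def)
  then show ?thesis
    by (simp only: sum.delta[OF finite_lessThan]) (use cell_index_bound[OF \<tau> x, of n] in \<open>simp only: lessThan_iff if_True\<close>)
qed

definition stopped_approx :: "('x, 'e::banach) process \<Rightarrow> real \<Rightarrow> ('x \<Rightarrow> real) \<Rightarrow> nat \<Rightarrow> 'x \<Rightarrow> 'e" where
  "stopped_approx M K \<tau> n x = (\<Sum>i<Suc (nat \<lfloor>real (Suc n) * K\<rfloor>). indicat_real (cell \<tau> n i) x *\<^sub>R M (grid K n i) x)"

lemma stopped_approx_eq:
  assumes "bounded_stopping_time K \<tau>" "x \<in> space \<mu>"
  shows "stopped_approx M K \<tau> n x = M (grid K n (nat \<lfloor>real (Suc n) * \<tau> x\<rfloor>)) x"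
  unfolding stopped_approx_def by (rule stopped_approx_sum[OF assms])

text \<open>Where \<open>\<tau> x < K\<close> the grid values lie strictly above
  \<open>\<tau> x\<close>, by at most \<open>1 / Suc n\<close>, because cells are open on the right;
  so right-continuity applies. Where \<open>\<tau> x = K\<close> the cap makes the approximation
  exact.\<close>

lemma stopped_approx_tendsto:
  assumes \<tau>: "bounded_stopping_time K \<tau>" and x: "x \<in> space \<mu>" and M: "cadlag \<mu> M"
  shows "(\<lambda>n. stopped_approx M K \<tau> n x) \<longlonglongrightarrow> M (\<tau> x) x"
proof -
  have t: "0 \<le> \<tau> x" "\<tau> x \<le> K" using \<tau> x by (auto simp: bounded_stopping_time_def)
  define r where "r n = grid K n (nat \<lfloor>real (Suc n) * \<tau> x\<rfloor>)" for n
  have val: "stopped_approx M K \<tau> n x = M (r n) x" for n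
    unfolding r_def by (rule stopped_approx_eq[OF \<tau> x])
  have j: "real (nat \<lfloor>real (Suc n) * \<tau> x\<rfloor>) \<le> real (Suc n) * \<tau> x" "real (Suc n) * \<tau> x < real (nat \<lfloor>real (Suc n) * \<tau> x\<rfloor>) + 1" for n
    using t by (simp_all add: of_nat_nat)
  have up: "real (Suc (nat \<lfloor>real (Suc n) * \<tau> x\<rfloor>)) / real (Suc n) > \<tau> x"
      "real (Suc (nat \<lfloor>real (Suc n) * \<tau> x\<rfloor>)) / real (Suc n) \<le> \<tau> x + 1 / real (Suc n)" for n
  proof -
    let ?a = "real (Suc n)" and ?m = "nat \<lfloor>real (Suc n) * \<tau> x\<rfloor>"
    have a: "?a > 0" by simp
    show "real (Suc ?m) / ?a > \<tau> x"
      unfolding pos_less_divide_eq[OF a] using j(2)[of n] by (simp only: of_nat_Suc[of ?m] mult.commute)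
    have "real ?m / ?a \<le> \<tau> x" unfolding pos_divide_le_eq[OF a] using j(1)[of n] by (simp only: mult.commute)
    then show "real (Suc ?m) / ?a \<le> \<tau> x + 1 / ?a"
      by (simp only: of_nat_Suc[of ?m] add_divide_distrib)
  qed
  have r_le: "r n \<le> \<tau> x + 1 / real (Suc n)" for n
    unfolding r_def grid_def using up(2)[of n] by linarith
  show ?thesis
  proof (cases "\<tau> x = K")
    case True
    then have "r n = \<tau> x" for n unfolding r_def grid_def using up(1)[of n] by simp
    then show ?thesis by (simp only: val tendsto_const)
  next
    case False
    then have r_gt: "\<tau> x < r n" for n unfolding r_def grid_def using up(1)[of n] t by simp
    have "r \<longlonglongrightarrow> \<tau> x"
    proof (rule tendsto_sandwich[of "\<lambda>_. \<tau> x" _ _ "\<lambda>n. \<tau> x + 1 / real (Suc n)"])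
      show "(\<lambda>n. \<tau> x + 1 / real (Suc n)) \<longlonglongrightarrow> \<tau> x"
        using tendsto_add[OF tendsto_const LIMSEQ_inverse_real_of_nat, of "\<tau> x"] by (simp add: inverse_eq_divide)
    qed (use r_gt r_le in \<open>auto intro!: always_eventually less_imp_le simp del: of_nat_Suc\<close>)
    then have "filterlim r (at_right (\<tau> x)) sequentially"
      unfolding filterlim_at using r_gt less_imp_neq[OF r_gt, symmetric] by (auto intro!: always_eventually)
    from filterlim_compose[OF cadlag_right[OF M x t(1)] this] show ?thesis by (simp only: val)
  qed
qed

text \<open>The approximations use only grid times up to \<open>K\<close>, so they are measurable at
  time \<open>K\<close>, and with them their limit.\<close>

lemma stopped_value_measurable:
  assumes \<tau>: "bounded_stopping_time K \<tau>" and K: "0 \<le> K" and M: "cadlag \<mu> M" "adapted \<mu> F M"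
  shows "strongly_measurable (restr K) (\<lambda>x. M (\<tau> x) x)"
proof -
  interpret R: finite_complete_measure "restr K" by (rule finite_complete_restr[OF K])
  show ?thesis
  proof (rule R.strongly_measurable_AE_limit)
    show "strongly_measurable (restr K) (stopped_approx M K \<tau> n)" for n
      unfolding stopped_approx_def
    proof (rule R.strongly_measurable_sum)
      fix i
      have g: "0 \<le> grid K n i" "grid K n i \<le> K" using grid_bounds K by auto
      have "cell \<tau> n i \<in> sets (restr K)"
        using cell_measurable[OF \<tau> K, of n i] F_mono[OF g] by (auto simp: sets_restr[OF K])
      moreover have "strongly_measurable (restr K) (M (grid K n i))"
        using M(2) g by (intro strongly_measurable_restr_mono[OF g]) (simp add: adapted_def)
      ultimately show "strongly_measurable (restr K) (\<lambda>x. indicat_real (cell \<tau> n i) x *\<^sub>R M (grid K n i) x)"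
        by (rule R.strongly_measurable_indicator)
    qed
    show "AE x in restr K. (\<lambda>n. stopped_approx M K \<tau> n x) \<longlonglongrightarrow> M (\<tau> x) x"
      by (rule AE_I2) (use stopped_approx_tendsto[OF \<tau> _ M(1)] in \<open>simp add: space_restr_to_subalg\<close>)
  qed
qed

text \<open>On a cell the approximation is the martingale at one deterministic time. This time is at
  least \<open>t\<close> whenever the cell meets \<open>A\<close>, so the projection property
  replaces the value by \<open>M K\<close>. The maximal function dominates the passage to the
  limit.\<close>

lemma optional_stopping_integral:
  fixes M :: "('x, 'e::banach) process" and \<phi> :: "'e \<Rightarrow>\<^sub>L real"
  assumes \<tau>: "bounded_stopping_time K \<tau>" and K: "0 \<le> K" and M: "M \<in> H1 \<mu> F"
    and t: "0 \<le> t" and A: "A \<in> sets (F t)" "\<And>x. x \<in> A \<Longrightarrow> t \<le> \<tau> x"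
  shows "indicator_integral \<mu> A (\<lambda>x. blinfun_apply \<phi> (M (\<tau> x) x)) = indicator_integral \<mu> A (\<lambda>x. blinfun_apply \<phi> (M K x))"
proof -
  note mx = H1_maximal[OF M]
  have A\<mu>: "A \<in> sets \<mu>" by (rule sets_F[OF t A(1)])
  define m where "m n = Suc (nat \<lfloor>real (Suc n) * K\<rfloor>)" for n
  have g: "0 \<le> grid K n i" "grid K n i \<le> K" for n i using grid_bounds K by auto
  have cell: "cell \<tau> n i \<in> sets \<mu>" for n i by (rule sets_F[OF g(1) cell_measurable[OF \<tau> K]])
  have int: "integrable \<mu> (\<lambda>x. blinfun_apply \<phi> (M s x))" if "0 \<le> s" for s
    using integrable_blinfun_apply[OF H1_bochner_integrable[OF M that]] .
  have step: "indicator_integral \<mu> A (\<lambda>x. blinfun_apply \<phi> (stopped_approx M K \<tau> n x)) = indicator_integral \<mu> A (\<lambda>x. blinfun_apply \<phi> (M K x))" for n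
  proof -
    have sum: "indicator_integral \<mu> A (\<lambda>x. \<Sum>i<m n. indicat_real (cell \<tau> n i) x * blinfun_apply \<phi> (M (s i) x))
        = (\<Sum>i<m n. indicator_integral \<mu> (A \<inter> cell \<tau> n i) (\<lambda>x. blinfun_apply \<phi> (M (s i) x)))"
      if s: "\<And>i. 0 \<le> s i" for s
      using indicator_integral_sum[OF A\<mu>, of "{..<m n}" "\<lambda>i x. indicat_real (cell \<tau> n i) x * blinfun_apply \<phi> (M (s i) x)"]
        integrable_indicator_mult[OF cell int[OF s]]
      by (simp add: indicator_integral_def indicator_inter_arith mult.assoc)
    have eq: "indicator_integral \<mu> (A \<inter> cell \<tau> n i) (\<lambda>x. blinfun_apply \<phi> (M (grid K n i) x))
        = indicator_integral \<mu> (A \<inter> cell \<tau> n i) (\<lambda>x. blinfun_apply \<phi> (M K x))" for i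
    proof (cases "t \<le> grid K n i")
      case True
      then have "A \<inter> cell \<tau> n i \<in> sets (F (grid K n i))"
        using A(1) F_mono[OF t True] cell_measurable[OF \<tau> K, of n i] by auto
      then show ?thesis using H1_projection[OF M g] by (simp add: is_projection_def)
    next
      case False
      have "A \<inter> cell \<tau> n i = {}"
      proof (rule ccontr)
        assume "A \<inter> cell \<tau> n i \<noteq> {}"
        then obtain x where x: "x \<in> A" "x \<in> cell \<tau> n i" by blast
        then have "t \<le> \<tau> x" "\<tau> x < real (Suc i) / real (Suc n)" "\<tau> x \<le> K"
          using A(2) \<tau> by (auto simp: cell_def bounded_stopping_time_def)
        then show False using False by (simp add: grid_def)
      qed
      then show ?thesis by (simp add: indicator_integral_def)
    qed
    have "indicator_integral \<mu> A (\<lambda>x. blinfun_apply \<phi> (stopped_approx M K \<tau> n x))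
        = indicator_integral \<mu> A (\<lambda>x. \<Sum>i<m n. indicat_real (cell \<tau> n i) x * blinfun_apply \<phi> (M (grid K n i) x))"
      unfolding stopped_approx_def m_def by (simp only: blinfun.sum_right blinfun.scaleR_right real_scaleR_def)
    also have "\<dots> = (\<Sum>i<m n. indicator_integral \<mu> (A \<inter> cell \<tau> n i) (\<lambda>x. blinfun_apply \<phi> (M (grid K n i) x)))"
      by (rule sum[OF g(1)])
    also have "\<dots> = (\<Sum>i<m n. indicator_integral \<mu> (A \<inter> cell \<tau> n i) (\<lambda>x. blinfun_apply \<phi> (M K x)))" by (simp only: eq)
    also have "\<dots> = indicator_integral \<mu> A (\<lambda>x. \<Sum>i<m n. indicat_real (cell \<tau> n i) x * blinfun_apply \<phi> (M K x))"
      by (rule sum[OF K, symmetric])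
    also have "\<dots> = indicator_integral \<mu> A (\<lambda>x. blinfun_apply \<phi> (M K x))"
      unfolding indicator_integral_def
    proof (rule Bochner_Integration.integral_cong)
      fix x assume "x \<in> space \<mu>"
      from stopped_approx_sum[OF \<tau> this, of n "\<lambda>_. blinfun_apply \<phi> (M K x)"]
      show "indicat_real A x * (\<Sum>i<m n. indicat_real (cell \<tau> n i) x * blinfun_apply \<phi> (M K x)) = indicat_real A x * blinfun_apply \<phi> (M K x)"
        by (simp only: m_def real_scaleR_def)
    qed simp
    finally show ?thesis .
  qed
  have "(\<lambda>n. indicator_integral \<mu> A (\<lambda>x. blinfun_apply \<phi> (stopped_approx M K \<tau> n x))) \<longlonglongrightarrow> indicator_integral \<mu> A (\<lambda>x. blinfun_apply \<phi> (M (\<tau> x) x))"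
    unfolding indicator_integral_def
  proof (rule integral_dominated_convergence[where w = "\<lambda>x. norm \<phi> * enn2real (maximal_inf M x)"])
    have sm: "strongly_measurable \<mu> (\<lambda>x. M (\<tau> x) x)"
      by (rule strongly_measurable_restr[OF K stopped_value_measurable[OF \<tau> K H1_D(1,2)[OF M]]])
    then show "(\<lambda>x. indicat_real A x * blinfun_apply \<phi> (M (\<tau> x) x)) \<in> borel_measurable \<mu>"
      using A\<mu> by (intro borel_measurable_times borel_measurable_blinfun_apply borel_measurable_indicator)
    have "strongly_measurable \<mu> (stopped_approx M K \<tau> n)" for n
      unfolding stopped_approx_def
      by (intro strongly_measurable_sum strongly_measurable_indicator cell bochner_integrableD(1) H1_bochner_integrable[OF M g(1)])
    then show "(\<lambda>x. indicat_real A x * blinfun_apply \<phi> (stopped_approx M K \<tau> n x)) \<in> borel_measurable \<mu>" for n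
      using A\<mu> by (intro borel_measurable_times borel_measurable_blinfun_apply borel_measurable_indicator)
    show "integrable \<mu> (\<lambda>x. norm \<phi> * enn2real (maximal_inf M x))" using mx(1) by simp
    show "AE x in \<mu>. (\<lambda>n. indicat_real A x * blinfun_apply \<phi> (stopped_approx M K \<tau> n x)) \<longlonglongrightarrow> indicat_real A x * blinfun_apply \<phi> (M (\<tau> x) x)"
      by (rule AE_I2) (intro tendsto_intros stopped_approx_tendsto[OF \<tau> _ H1_D(1)[OF M]])
    show "AE x in \<mu>. norm (indicat_real A x * blinfun_apply \<phi> (stopped_approx M K \<tau> n x)) \<le> norm \<phi> * enn2real (maximal_inf M x)" for n
      using mx(3) AE_space
    proof eventually_elim
      case (elim x)
      have "norm (indicat_real A x * blinfun_apply \<phi> (stopped_approx M K \<tau> n x)) \<le> \<bar>blinfun_apply \<phi> (stopped_approx M K \<tau> n x)\<bar>"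
        by (simp add: abs_mult indicator_def)
      also have "\<dots> \<le> norm \<phi> * norm (stopped_approx M K \<tau> n x)" using norm_blinfun[of \<phi>] by simp
      also have "\<dots> \<le> norm \<phi> * enn2real (maximal_inf M x)"
        unfolding stopped_approx_eq[OF \<tau> elim(2)] using elim(1) g(1) by (intro mult_left_mono) auto
      finally show ?case .
    qed
  qed
  then have "(\<lambda>n. indicator_integral \<mu> A (\<lambda>x. blinfun_apply \<phi> (M K x))) \<longlonglongrightarrow> indicator_integral \<mu> A (\<lambda>x. blinfun_apply \<phi> (M (\<tau> x) x))"
    by (simp only: step)
  from LIMSEQ_unique[OF this tendsto_const] show ?thesis .
qed

section \<open>Stopped martingales\<close>

definition stop :: "('x \<Rightarrow> real) \<Rightarrow> ('x, 'e) process \<Rightarrow> ('x, 'e) process" where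
  "stop \<tau> M t x = M (min t (\<tau> x)) x"

lemma cadlag_stop:
  assumes \<tau>: "bounded_stopping_time K \<tau>" and M: "cadlag \<mu> M" shows "cadlag \<mu> (stop \<tau> M)"
  unfolding cadlag_def
proof (intro ballI conjI allI impI)
  fix x and t :: real assume x: "x \<in> space \<mu>"
  have \<tau>0: "0 \<le> \<tau> x" using \<tau> x by (simp add: bounded_stopping_time_def)
  show "((\<lambda>s. stop \<tau> M s x) \<longlongrightarrow> stop \<tau> M t x) (at_right t)" if t: "0 \<le> t"
  proof (cases "t < \<tau> x")
    case True
    have "\<forall>\<^sub>F s in at_right t. M s x = stop \<tau> M s x"
      using eventually_at_right_real[OF True] by eventually_elim (simp add: stop_def min_def)
    from Lim_transform_eventually[OF cadlag_right[OF M x t] this] show ?thesis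
      using True by (simp add: stop_def)
  next
    case False
    have "\<forall>\<^sub>F s in at_right t. stop \<tau> M t x = stop \<tau> M s x"
      using eventually_at_right_less[of t] by eventually_elim (use False in \<open>simp add: stop_def\<close>)
    then show ?thesis by (rule Lim_transform_eventually[OF tendsto_const])
  qed
  show "\<exists>l. ((\<lambda>s. stop \<tau> M s x) \<longlongrightarrow> l) (at_left t)" if t: "0 < t"
  proof (cases "t \<le> \<tau> x")
    case True
    obtain l where l: "((\<lambda>s. M s x) \<longlongrightarrow> l) (at_left t)" using cadlag_left[OF M x t] .
    have "\<forall>\<^sub>F s in at_left t. M s x = stop \<tau> M s x"
      using eventually_at_left_real[OF t] by eventually_elim (use True in \<open>simp add: stop_def\<close>)
    from Lim_transform_eventually[OF l this] show ?thesis by blast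
  next
    case False
    then have "\<forall>\<^sub>F s in at_left t. M (\<tau> x) x = stop \<tau> M s x"
      using eventually_at_left_real[of "\<tau> x" t] by (auto elim!: eventually_mono simp: stop_def)
    from Lim_transform_eventually[OF tendsto_const this] show ?thesis by blast
  qed
qed

lemma maximal_inf_stop:
  assumes "bounded_stopping_time K \<tau>" "x \<in> space \<mu>" shows "maximal_inf (stop \<tau> M) x \<le> maximal_inf M x"
  unfolding maximal_inf_eq[of "stop \<tau> M"] stop_def
  using assms by (intro SUP_least norm_le_maximal_inf) (auto simp: bounded_stopping_time_def)

text \<open>\<open>A\<close> is split by whether stopping has occurred by time \<open>t\<close>.
  Where it has, the stopped process no longer moves. On the other part \<open>t < \<tau> x\<close>,
  and the stopped value and \<open>M t\<close> both have the same integrals as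
  \<open>M K\<close>.\<close>

theorem optional_stopping:
  fixes M :: "('x, 'e::banach) process"
  assumes \<tau>: "bounded_stopping_time K \<tau>" and K: "0 \<le> K" and M: "M \<in> H1 \<mu> F"
  shows "stop \<tau> M \<in> H1 \<mu> F" "bochner_integrable \<mu> (stop \<tau> M K)"
    "\<And>t. 0 \<le> t \<Longrightarrow> is_projection t (stop \<tau> M K) (stop \<tau> M t)"
proof -
  note mx = H1_maximal[OF M]
  have sm: "strongly_measurable (restr t) (stop \<tau> M t)" if t: "0 \<le> t" for t
    unfolding stop_def[abs_def] by (rule stopped_value_measurable[OF bounded_stopping_time_min[OF \<tau> t] t H1_D(1,2)[OF M]])
  have bi: "bochner_integrable \<mu> (stop \<tau> M t)" if t: "0 \<le> t" for t
  proof (rule bochner_integrable_bound[OF strongly_measurable_restr[OF t sm[OF t]] mx(1)])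
    from mx(3) AE_space show "AE x in \<mu>. norm (stop \<tau> M t x) \<le> enn2real (maximal_inf M x)"
      by eventually_elim (use t \<tau> in \<open>simp add: stop_def bounded_stopping_time_def\<close>)
  qed
  then show bK: "bochner_integrable \<mu> (stop \<tau> M K)" using K by blast
  have \<tau>K: "stop \<tau> M t x = M (\<tau> x) x" if "K \<le> t" "x \<in> space \<mu>" for t x
  proof -
    have "\<tau> x \<le> K" using \<tau> that(2) by (simp add: bounded_stopping_time_def)
    then show ?thesis using that(1) by (simp add: stop_def min_absorb2)
  qed
  show proj: "is_projection t (stop \<tau> M K) (stop \<tau> M t)" if t: "0 \<le> t" for t
    unfolding is_projection_def
  proof (intro conjI ballI allI sm[OF t] bi[OF t])
    fix A and \<phi> :: "'e \<Rightarrow>\<^sub>L real" assume A: "A \<in> sets (F t)"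
    have A\<mu>: "A \<in> sets \<mu>" by (rule sets_F[OF t A])
    let ?I = "\<lambda>A s. indicator_integral \<mu> A (\<lambda>x. blinfun_apply \<phi> (stop \<tau> M s x))"
    have int: "integrable \<mu> (\<lambda>x. blinfun_apply \<phi> (stop \<tau> M s x))" if "0 \<le> s" for s
      by (rule integrable_blinfun_apply[OF bi[OF that]])
    show "?I A t = ?I A K"
    proof (cases "K \<le> t")
      case True
      then show ?thesis unfolding indicator_integral_def
        by (intro Bochner_Integration.integral_cong) (simp_all add: \<tau>K)
    next
      case False
      let ?B = "{x \<in> space \<mu>. \<tau> x \<le> t}"
      have B: "?B \<in> sets (F t)" using \<tau> t by (simp add: bounded_stopping_time_def)
      have AB: "A \<inter> ?B \<in> sets (F t)" "A - ?B \<in> sets (F t)" using A B by auto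
      have AB\<mu>: "A \<inter> ?B \<in> sets \<mu>" "A - ?B \<in> sets \<mu>" using AB sets_F[OF t] by auto
      have split: "?I A s = ?I (A \<inter> ?B) s + ?I (A - ?B) s" if "0 \<le> s" for s
      proof -
        have "A = (A \<inter> ?B) \<union> (A - ?B)" by blast
        then show ?thesis using indicator_integral_Un[OF AB\<mu> _ int[OF that]] by (metis Int_Diff_disjoint)
      qed
      have 1: "?I (A \<inter> ?B) t = ?I (A \<inter> ?B) K"
        unfolding indicator_integral_def using False
        by (intro Bochner_Integration.integral_cong) (auto simp: indicator_def stop_def min_def)
      have Atau: "t \<le> \<tau> x" if "x \<in> A - ?B" for x using that sets.sets_into_space[OF A\<mu>] by force
      have "?I (A - ?B) K = indicator_integral \<mu> (A - ?B) (\<lambda>x. blinfun_apply \<phi> (M (\<tau> x) x))"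
        unfolding indicator_integral_def by (rule Bochner_Integration.integral_cong) (simp_all add: \<tau>K)
      also have "\<dots> = indicator_integral \<mu> (A - ?B) (\<lambda>x. blinfun_apply \<phi> (M K x))"
        by (rule optional_stopping_integral[OF \<tau> K M t AB(2) Atau])
      also have "\<dots> = indicator_integral \<mu> (A - ?B) (\<lambda>x. blinfun_apply \<phi> (M t x))"
        using H1_projection[OF M t, of K] False AB(2) by (simp add: is_projection_def)
      also have "\<dots> = ?I (A - ?B) t"
        unfolding indicator_integral_def using Atau
        by (intro Bochner_Integration.integral_cong) (auto simp: indicator_def stop_def min_def)
      finally show ?thesis unfolding split[OF t] split[OF K] using 1 by simp
    qed
  qed
  show "stop \<tau> M \<in> H1 \<mu> F"
  proof (rule H1_I[OF cadlag_stop[OF \<tau> H1_D(1)[OF M]] _ bK proj])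
    have "(\<integral>\<^sup>+x. maximal_inf (stop \<tau> M) x \<partial>\<mu>) \<le> (\<integral>\<^sup>+x. maximal_inf M x \<partial>\<mu>)"
      by (intro nn_integral_mono maximal_inf_stop[OF \<tau>])
    then show "(\<integral>\<^sup>+x. maximal_inf (stop \<tau> M) x \<partial>\<mu>) < \<infinity>" using H1_D(4)[OF M] by (rule le_less_trans)
  qed
qed

end

section \<open>Weak limits in $H^1$\<close>

text \<open>Uniform convergence lets the limits be exchanged. The estimates start at an index
  \<open>j0\<close> because for the paths of a process their onset depends on the path. On the left,
  the limits \<open>l j\<close> form a Cauchy sequence whose limit is the one sought.\<close>

lemma uniform_limit_one_sided:
  fixes f :: "nat \<Rightarrow> real \<Rightarrow> 'e::banach"
  assumes unif: "\<And>j s. j0 \<le> j \<Longrightarrow> 0 \<le> s \<Longrightarrow> norm (h s - f j s) \<le> e j" and e: "e \<longlonglongrightarrow> 0"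
  shows "0 \<le> t \<Longrightarrow> (\<And>j. (f j \<longlongrightarrow> f j t) (at_right t)) \<Longrightarrow> (h \<longlongrightarrow> h t) (at_right t)"
    and "0 < t \<Longrightarrow> (\<And>j. \<exists>l. (f j \<longlongrightarrow> l) (at_left t)) \<Longrightarrow> \<exists>l. (h \<longlongrightarrow> l) (at_left t)"
proof -
  have ul: "uniform_limit {0..} f h sequentially"
    unfolding uniform_limit_iff
  proof (intro allI impI)
    fix r :: real assume "r > 0"
    with e have "\<forall>\<^sub>F j in sequentially. e j < r" by (rule order_tendstoD(2))
    with eventually_ge_at_top[of j0] show "\<forall>\<^sub>F j in sequentially. \<forall>s\<in>{0..}. dist (f j s) (h s) < r"
    proof eventually_elim
      case (elim j)
      show ?case
      proof
        fix s :: real assume "s \<in> {0..}"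
        then have "norm (h s - f j s) \<le> e j" using unif[OF elim(1)] by simp
        then show "dist (f j s) (h s) < r" using elim(2) by (simp add: dist_norm norm_minus_commute)
      qed
    qed
  qed
  have sub: "uniform_limit S f h sequentially" if "S \<subseteq> {0..}" for S
    using ul that by (rule uniform_limit_on_subset)
  have pt: "(\<lambda>j. f j t) \<longlonglongrightarrow> h t" if "0 \<le> t" using tendsto_uniform_limitI[OF ul, of t] that by simp
  show "(h \<longlongrightarrow> h t) (at_right t)" if t: "0 \<le> t" and r: "\<And>j. (f j \<longlongrightarrow> f j t) (at_right t)"
    by (rule swap_uniform_limit[OF _ pt[OF t] sub]) (use t r in auto)
  show "\<exists>l. (h \<longlongrightarrow> l) (at_left t)" if t: "0 < t" and l: "\<And>j. \<exists>l. (f j \<longlongrightarrow> l) (at_left t)"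
  proof -
    obtain l where l: "\<And>j. (f j \<longlongrightarrow> l j) (at_left t)" using l by metis
    have bound: "norm (l i - l j) \<le> e i + e j" if "j0 \<le> i" "j0 \<le> j" for i j
    proof (rule tendsto_upperbound)
      show "((\<lambda>s. norm (f i s - f j s)) \<longlongrightarrow> norm (l i - l j)) (at_left t)" by (intro tendsto_intros l)
      show "\<forall>\<^sub>F s in at_left t. norm (f i s - f j s) \<le> e i + e j"
        using eventually_at_left_real[OF t]
      proof eventually_elim
        case (elim s)
        have "norm (f i s - f j s) \<le> norm (h s - f i s) + norm (h s - f j s)"
          using norm_triangle_ineq4[of "h s - f j s" "h s - f i s"] by (simp add: add.commute)
        then show ?case using unif[OF that(1), of s] unif[OF that(2), of s] elim by simp
      qed
    qed simp
    have "Cauchy l"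
    proof (rule metric_CauchyI)
      fix r :: real assume r: "r > 0"
      then have "\<forall>\<^sub>F j in sequentially. e j < r / 2" using e by (intro order_tendstoD(2)) auto
      with eventually_ge_at_top[of j0] have "\<forall>\<^sub>F j in sequentially. j0 \<le> j \<and> e j < r / 2" by eventually_elim simp
      then obtain n where n: "\<And>j. n \<le> j \<Longrightarrow> j0 \<le> j \<and> e j < r / 2" by (auto simp: eventually_sequentially)
      show "\<exists>n. \<forall>i\<ge>n. \<forall>j\<ge>n. dist (l i) (l j) < r"
      proof (intro exI[of _ n] allI impI)
        fix i j assume "n \<le> i" "n \<le> j"
        then show "dist (l i) (l j) < r" using n[of i] n[of j] bound[of i j] by (simp add: dist_norm)
      qed
    qed
    then obtain a where a: "l \<longlonglongrightarrow> a" by (auto simp: Cauchy_convergent_iff convergent_def)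
    \<comment> \<open>Uniform closeness is known for nonnegative times only, so left neighbourhoods
      are cut off at \<open>0\<close>.\<close>
    have left: "at_left t = at t within {0<..<t}" by (rule at_within_nhd[of t "{0<..}"]) (use t in auto)
    have "(h \<longlongrightarrow> a) (at t within {0<..<t})"
      by (rule swap_uniform_limit[OF _ a sub]) (use l t in \<open>auto simp: left[symmetric]\<close>)
    then show ?thesis by (auto simp: left)
  qed
qed

lemma geometric_limit:
  fixes g :: "nat \<Rightarrow> 'e::banach"
  assumes g: "\<And>j. j0 \<le> j \<Longrightarrow> norm (g (Suc j) - g j) \<le> (1/2) ^ j"
  shows "g \<longlonglongrightarrow> lim g" "j0 \<le> j \<Longrightarrow> norm (lim g - g j) \<le> 2 * (1/2) ^ j"
proof -
  \<comment> \<open>The right side is the exact partial geometric sum; with the subtracted term the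
    induction closes.\<close>
  have step: "norm (g (j + m) - g j) \<le> 2 * (1/2) ^ j - 2 * (1/2) ^ (j + m)" if "j0 \<le> j" for j m
  proof (induction m)
    case (Suc m)
    have "norm (g (j + Suc m) - g j) \<le> norm (g (Suc (j + m)) - g (j + m)) + norm (g (j + m) - g j)"
      using norm_triangle_ineq[of "g (Suc (j + m)) - g (j + m)" "g (j + m) - g j"] by simp
    also have "\<dots> \<le> (1/2) ^ (j + m) + (2 * (1/2) ^ j - 2 * (1/2) ^ (j + m))"
      using that by (intro add_mono g Suc) simp
    finally show ?case by simp
  qed simp
  have dist: "norm (g i - g j) \<le> 2 * (1/2) ^ j" if ij: "j0 \<le> j" "j \<le> i" for i j
  proof -
    have "norm (g i - g j) \<le> 2 * (1/2) ^ j - 2 * (1/2) ^ i" using step[OF ij(1), of "i - j"] ij(2) by simp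
    then show ?thesis using zero_le_power[of "1/2::real" i] by linarith
  qed
  have "(\<lambda>j. 4 * (1/2::real) ^ j) \<longlonglongrightarrow> 4 * 0" by (intro tendsto_intros LIMSEQ_power_zero) simp
  then have z: "(\<lambda>j. 4 * (1/2::real) ^ j) \<longlonglongrightarrow> 0" by simp
  have "Cauchy g"
  proof (rule metric_CauchyI)
    fix r :: real assume "r > 0"
    with z have "\<forall>\<^sub>F j in sequentially. 4 * (1/2) ^ j < r" by (rule order_tendstoD(2))
    then have "\<forall>\<^sub>F j in sequentially. 4 * (1/2) ^ j < r \<and> j0 \<le> j" using eventually_ge_at_top[of j0] by (rule eventually_conj)
    then obtain j where j: "4 * (1/2) ^ j < r" "j0 \<le> j" by (auto simp: eventually_sequentially)
    show "\<exists>n. \<forall>i\<ge>n. \<forall>k\<ge>n. dist (g i) (g k) < r"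
    proof (intro exI[of _ j] allI impI)
      fix i k assume "j \<le> i" "j \<le> k"
      then have "dist (g i) (g k) \<le> 2 * (1/2) ^ j + 2 * (1/2) ^ j"
        using dist[OF j(2), of i] dist[OF j(2), of k] dist_triangle2[of "g i" "g k" "g j"] by (simp add: dist_norm)
      then show "dist (g i) (g k) < r" using j(1) by simp
    qed
  qed
  then show lim: "g \<longlonglongrightarrow> lim g" by (simp add: Cauchy_convergent_iff convergent_LIMSEQ_iff)
  show "norm (lim g - g j) \<le> 2 * (1/2) ^ j" if "j0 \<le> j"
  proof (rule LIMSEQ_le_const2)
    show "(\<lambda>i. norm (g i - g j)) \<longlonglongrightarrow> norm (lim g - g j)" by (intro tendsto_intros lim)
    show "\<exists>n. \<forall>i\<ge>n. norm (g i - g j) \<le> 2 * (1/2) ^ j" using dist[OF that] by blast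
  qed
qed

context finite_complete_measure
begin

lemma integral_absolutely_continuous:
  assumes f: "integrable M f" "\<And>x. 0 \<le> f x" and \<epsilon>: "0 < \<epsilon>"
  obtains \<delta> where "0 < \<delta>" "\<And>A. A \<in> sets M \<Longrightarrow> measure M A \<le> \<delta> \<Longrightarrow> indicator_integral M A f \<le> \<epsilon>"
proof -
  have "(\<lambda>n. \<integral>x. f x - min (f x) (real n) \<partial>M) \<longlonglongrightarrow> (\<integral>x. 0 \<partial>M)"
  proof (rule integral_dominated_convergence[where w = f])
    show "(\<lambda>x. f x - min (f x) (real n)) \<in> borel_measurable M" for n using f(1) by measurable
    show "AE x in M. (\<lambda>n. f x - min (f x) (real n)) \<longlonglongrightarrow> 0"
    proof (rule AE_I2)
      fix x
      obtain m where m: "f x \<le> real m" using real_arch_simple by blast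
      show "(\<lambda>n. f x - min (f x) (real n)) \<longlonglongrightarrow> 0"
        by (rule tendsto_eventually, rule eventually_sequentiallyI[of m]) (use m in auto)
    qed
  qed (use f in auto)
  then have "\<forall>\<^sub>F n in sequentially. (\<integral>x. f x - min (f x) (real n) \<partial>M) < \<epsilon> / 2"
    using \<epsilon> by (intro order_tendstoD(2)) auto
  then obtain n where n: "(\<integral>x. f x - min (f x) (real n) \<partial>M) < \<epsilon> / 2" using eventually_happens by force
  have int: "integrable M (\<lambda>x. min (f x) (real n))" using f(1) by simp
  have int2: "integrable M (\<lambda>x. f x - min (f x) (real n))" using f(1) int by simp
  show ?thesis
  \<comment> \<open>Truncated at \<open>n\<close>, the integrand contributes at most
    \<open>Suc n\<close> times the measure of \<open>A\<close>; the excess over \<open>n\<close> has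
    total integral below \<open>\<epsilon> / 2\<close>.\<close>
  proof (rule that[of "\<epsilon> / (2 * real (Suc n))"])
    fix A assume A: "A \<in> sets M" "measure M A \<le> \<epsilon> / (2 * real (Suc n))"
    have "indicator_integral M A f = indicator_integral M A (\<lambda>x. (f x - min (f x) (real n)) + min (f x) (real n))" by simp
    also have "\<dots> = indicator_integral M A (\<lambda>x. f x - min (f x) (real n)) + indicator_integral M A (\<lambda>x. min (f x) (real n))"
      by (rule indicator_integral_add[OF A(1) int2 int])
    also have "\<dots> \<le> (\<integral>x. f x - min (f x) (real n) \<partial>M) + indicator_integral M A (\<lambda>x. real (Suc n))"
      using int int2 by (intro add_mono indicator_integral_le_integral indicator_integral_mono A) auto
    also have "indicator_integral M A (\<lambda>x. real (Suc n)) \<le> \<epsilon> / 2"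
    proof -
      have "real (Suc n) * measure M A \<le> real (Suc n) * (\<epsilon> / (2 * real (Suc n)))" using A(2) by (intro mult_left_mono) auto
      also have "\<dots> = \<epsilon> / 2" by (simp add: field_simps del: of_nat_Suc)
      finally show ?thesis using A(1) by (simp add: indicator_integral_const)
    qed
    finally show "indicator_integral M A f \<le> \<epsilon>" using n by simp
  qed (use \<epsilon> in simp)
qed

end

section \<open>Norm estimates in H1\<close>

context stochastic_basis
begin

lemma H1_norm_eq: "M \<in> H1 \<mu> F \<Longrightarrow> H1_norm \<mu> M = (\<integral>x. enn2real (maximal_inf M x) \<partial>\<mu>)"
proof -
  assume M: "M \<in> H1 \<mu> F"
  have "(\<integral>\<^sup>+x. maximal_inf M x \<partial>\<mu>) = (\<integral>\<^sup>+x. ennreal (enn2real (maximal_inf M x)) \<partial>\<mu>)"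
    by (rule nn_integral_cong_AE) (use H1_maximal(2)[OF M] in eventually_elim, simp)
  also have "\<dots> = ennreal (\<integral>x. enn2real (maximal_inf M x) \<partial>\<mu>)"
    by (rule nn_integral_eq_integral[OF H1_maximal(1)[OF M]]) simp
  finally show ?thesis by (simp add: H1_norm_def)
qed

lemma H1_maximal_le:
  assumes "M \<in> H1 \<mu> F" "AE x in \<mu>. \<forall>s\<ge>0. norm (M s x) \<le> g x"
  shows "AE x in \<mu>. enn2real (maximal_inf M x) \<le> g x"
  using assms(2)
proof eventually_elim
  case (elim x)
  have g: "0 \<le> g x" using elim norm_ge_zero[of "M 0 x"] by (meson order_refl order_trans)
  have "maximal_inf M x \<le> ennreal (g x)"
    unfolding maximal_inf_eq by (intro SUP_least ennreal_leI) (use elim in auto)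
  then show ?case using g by (rule enn2real_leI[rotated])
qed

lemma H1_maximal_diff_le:
  assumes "M \<in> H1 \<mu> F" "N \<in> H1 \<mu> F"
  shows "AE x in \<mu>. enn2real (maximal_inf (\<lambda>t x. M t x - N t x) x) \<le> enn2real (maximal_inf M x) + enn2real (maximal_inf N x)"
proof (rule H1_maximal_le[OF H1_diff[OF assms]])
  show "AE x in \<mu>. \<forall>s\<ge>0. norm (M s x - N s x) \<le> enn2real (maximal_inf M x) + enn2real (maximal_inf N x)"
    using H1_maximal(3)[OF assms(1)] H1_maximal(3)[OF assms(2)]
    by eventually_elim (meson add_mono norm_triangle_ineq4 order_trans)
qed

lemma H1_maximal_sum_le:
  assumes M: "\<And>k. M k \<in> H1 \<mu> F" and c: "\<And>k. 0 \<le> c k"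
  shows "AE x in \<mu>. enn2real (maximal_inf (\<lambda>t x. \<Sum>k<n. c k *\<^sub>R M k t x) x) \<le> (\<Sum>k<n::nat. c k * enn2real (maximal_inf (M k) x))"
proof (rule H1_maximal_le[OF H1_sum])
  have "AE x in \<mu>. \<forall>k. \<forall>s\<ge>0. norm (M k s x) \<le> enn2real (maximal_inf (M k) x)"
    using H1_maximal(3)[OF M] by (simp add: AE_all_countable)
  then show "AE x in \<mu>. \<forall>s\<ge>0. norm (\<Sum>k<n. c k *\<^sub>R M k s x) \<le> (\<Sum>k<n. c k * enn2real (maximal_inf (M k) x))"
  proof eventually_elim
    case (elim x)
    show ?case
    proof (intro allI impI)
      fix s :: real assume "0 \<le> s"
      then have "norm (c k *\<^sub>R M k s x) \<le> c k * enn2real (maximal_inf (M k) x)" for k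
        using elim c[of k] by (simp add: mult_left_mono)
      then show "norm (\<Sum>k<n. c k *\<^sub>R M k s x) \<le> (\<Sum>k<n. c k * enn2real (maximal_inf (M k) x))"
        by (intro sum_norm_le)
    qed
  qed
qed (use M in auto)

lemma projection_sum:
  assumes "0 \<le> t" "\<And>k. k \<in> I \<Longrightarrow> bochner_integrable \<mu> (f k)" "\<And>k. k \<in> I \<Longrightarrow> is_projection t (f k) (g k)" "finite I"
  shows "is_projection t (\<lambda>x. \<Sum>k\<in>I. c k *\<^sub>R f k x) (\<lambda>x. \<Sum>k\<in>I. c k *\<^sub>R g k x)"
  using assms(4,2,3)
proof (induction I rule: finite_induct)
  case empty
  show ?case
    by (simp add: is_projection_def bochner_integrable_zero finite_complete_measure.strongly_measurable_const[OF finite_complete_restr[OF assms(1)]])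
next
  case (insert i I)
  have "bochner_integrable \<mu> (\<lambda>x. \<Sum>k\<in>I. c k *\<^sub>R f k x)"
    using insert.prems by (intro bochner_integrable_sum bochner_integrable_scaleR) auto
  then show ?case
    using projection_add[OF assms(1) bochner_integrable_scaleR[of "f i" "c i"], of "\<lambda>x. \<Sum>k\<in>I. c k *\<^sub>R f k x" "\<lambda>x. c i *\<^sub>R g i x" "\<lambda>x. \<Sum>k\<in>I. c k *\<^sub>R g k x"]
      projection_scaleR[OF assms(1), of "f i" "g i" "c i"] insert by simp
qed

lemma projection_diff:
  assumes "0 \<le> t" "bochner_integrable \<mu> f1" "bochner_integrable \<mu> f2" "is_projection t f1 g1" "is_projection t f2 g2"
  shows "is_projection t (\<lambda>x. f1 x - f2 x) (\<lambda>x. g1 x - g2 x)"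
  using projection_add[OF assms(1,2) bochner_integrable_scaleR[OF assms(3), of "- 1"] assms(4) projection_scaleR[OF assms(1,5), of "- 1"]] by simp

lemma Doob_diff:
  assumes "M \<in> H1 \<mu> F" "N \<in> H1 \<mu> F" "bochner_integrable \<mu> f" "bochner_integrable \<mu> g"
    "\<And>t. 0 \<le> t \<Longrightarrow> is_projection t f (M t)" "\<And>t. 0 \<le> t \<Longrightarrow> is_projection t g (N t)" "0 < r"
  shows "r * measure \<mu> {x \<in> space \<mu>. ennreal r < maximal_inf (\<lambda>t x. M t x - N t x) x} \<le> (\<integral>x. norm (f x - g x) \<partial>\<mu>)"
  by (rule Doob_maximal[OF H1_D(1)[OF H1_diff[OF assms(1,2)]] bochner_integrable_diff[OF assms(3,4)] projection_diff])
    (use assms in auto)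

end

section \<open>Sequences of martingales with uniformly integrable maximal functions\<close>

text \<open>Collects what the stopped martingales will satisfy. \<open>Z_le\<close> transfers the
  bounds for the maximal functions to the terminal values.\<close>

locale UI_martingales = stochastic_basis \<mu> F for \<mu> :: "'x measure" and F +
  fixes N :: "nat \<Rightarrow> ('x, 'e::banach) process" and Z :: "nat \<Rightarrow> 'x \<Rightarrow> 'e" and B :: real
  assumes N: "\<And>k. N k \<in> H1 \<mu> F"
    and Z: "\<And>k. bochner_integrable \<mu> (Z k)" "\<And>k t. 0 \<le> t \<Longrightarrow> is_projection t (Z k) (N k t)"
    and Z_le: "\<And>k. AE x in \<mu>. norm (Z k x) \<le> enn2real (maximal_inf (N k) x)"
    and N_bound: "\<And>k. (\<integral>x. enn2real (maximal_inf (N k) x) \<partial>\<mu>) \<le> B"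
    and N_ui: "\<And>\<epsilon>. \<epsilon> > 0 \<Longrightarrow> \<exists>\<delta>>0. \<forall>k. \<forall>A\<in>sets \<mu>. measure \<mu> A \<le> \<delta> \<longrightarrow>
      indicator_integral \<mu> A (\<lambda>x. enn2real (maximal_inf (N k) x)) \<le> \<epsilon>"
begin

definition comb :: "nat \<Rightarrow> (nat \<Rightarrow> real) \<Rightarrow> ('x, 'e) process" where
  "comb n c t x = (\<Sum>k<n. c k *\<^sub>R N k t x)"

definition comb_end :: "nat \<Rightarrow> (nat \<Rightarrow> real) \<Rightarrow> 'x \<Rightarrow> 'e" where
  "comb_end n c x = (\<Sum>k<n. c k *\<^sub>R Z k x)"

lemma comb_H1: "comb n c \<in> H1 \<mu> F"
  unfolding comb_def[abs_def] by (rule H1_sum[OF N]) simp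

lemma comb_end_integrable: "bochner_integrable \<mu> (comb_end n c)"
  unfolding comb_end_def[abs_def] by (intro bochner_integrable_sum bochner_integrable_scaleR Z)

lemma comb_projection: "0 \<le> t \<Longrightarrow> is_projection t (comb_end n c) (comb n c t)"
  unfolding comb_end_def[abs_def] comb_def[abs_def] by (rule projection_sum) (use Z in auto)

text \<open>The maximal function of a convex combination is at most the same combination of maximal
  functions, so every bound that is uniform over the sequence passes to all convex
  combinations.\<close>

lemma comb_maximal:
  assumes c: "\<And>k. 0 \<le> c k" "(\<Sum>k<n. c k) = 1" and A: "A \<in> sets \<mu>"
    and K: "\<And>k. indicator_integral \<mu> A (\<lambda>x. enn2real (maximal_inf (N k) x)) \<le> K"
  shows "indicator_integral \<mu> A (\<lambda>x. enn2real (maximal_inf (comb n c) x)) \<le> K"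
proof -
  have int: "integrable \<mu> (\<lambda>x. c k * enn2real (maximal_inf (N k) x))" for k using H1_maximal(1)[OF N] by simp
  have "indicator_integral \<mu> A (\<lambda>x. enn2real (maximal_inf (comb n c) x))
      \<le> indicator_integral \<mu> A (\<lambda>x. \<Sum>k<n. c k * enn2real (maximal_inf (N k) x))"
    using H1_maximal_sum_le[of N c n, OF N c(1)]
    by (intro indicator_integral_mono[OF A H1_maximal(1)[OF comb_H1] Bochner_Integration.integrable_sum[OF int]])
      (simp add: comb_def[abs_def])
  also have "\<dots> = (\<Sum>k<n. c k * indicator_integral \<mu> A (\<lambda>x. enn2real (maximal_inf (N k) x)))"
    using int by (simp add: indicator_integral_sum[OF A] indicator_integral_cmult)
  also have "\<dots> \<le> (\<Sum>k<n. c k * K)" by (intro sum_mono mult_left_mono K c)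
  also have "\<dots> = K" using c(2) by (simp flip: sum_distrib_right)
  finally show ?thesis .
qed

lemma comb_bound:
  assumes "\<And>k. 0 \<le> c k" "(\<Sum>k<n. c k) = 1"
  shows "(\<integral>x. enn2real (maximal_inf (comb n c) x) \<partial>\<mu>) \<le> B"
  using comb_maximal[OF assms sets.top, of B] N_bound by (simp only: indicator_integral_space)

text \<open>By Doob's inequality the maximal functions converge in probability, and they are uniformly
  integrable.\<close>

lemma comb_H1_convergence:
  assumes M: "M \<in> H1 \<mu> F" and \<xi>: "bochner_integrable \<mu> \<xi>" "\<And>t. 0 \<le> t \<Longrightarrow> is_projection t \<xi> (M t)" and \<epsilon>: "0 < \<epsilon>"
  shows "\<exists>\<eta>>0. \<forall>n c. (\<forall>k. 0 \<le> c k) \<longrightarrow> (\<Sum>k<n. c k) = 1 \<longrightarrow> (\<integral>x. norm (comb_end n c x - \<xi> x) \<partial>\<mu>) < \<eta> \<longrightarrow>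
    H1_norm \<mu> (\<lambda>t x. comb n c t x - M t x) \<le> \<epsilon>"
proof -
  \<comment> \<open>One third for the set where the difference is small, and one third for each of
    the two maximal functions on the exceptional set.\<close>
  define a where "a = \<epsilon> / 3"
  have a: "a > 0" using \<epsilon> by (simp add: a_def)
  obtain \<delta>1 where \<delta>1: "\<delta>1 > 0" "\<And>k A. A \<in> sets \<mu> \<Longrightarrow> measure \<mu> A \<le> \<delta>1 \<Longrightarrow>
      indicator_integral \<mu> A (\<lambda>x. enn2real (maximal_inf (N k) x)) \<le> a" using N_ui[OF a] by blast
  obtain \<delta>2 where \<delta>2: "\<delta>2 > 0" "\<And>A. A \<in> sets \<mu> \<Longrightarrow> measure \<mu> A \<le> \<delta>2 \<Longrightarrow>
      indicator_integral \<mu> A (\<lambda>x. enn2real (maximal_inf M x)) \<le> a"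
    using integral_absolutely_continuous[OF H1_maximal(1)[OF M] enn2real_nonneg a] by blast
  show ?thesis
  \<comment> \<open>Doob's inequality at level \<open>a\<close> then keeps the measure of the
    exceptional set below both \<open>\<delta>1\<close> and \<open>\<delta>2\<close>.\<close>
  proof (intro exI[of _ "a * min \<delta>1 \<delta>2"] conjI allI impI)
    show "0 < a * min \<delta>1 \<delta>2" using a \<delta>1(1) \<delta>2(1) by simp
    fix n c assume "\<forall>k. 0 \<le> c k" and c1: "(\<Sum>k<n. c k) = 1" and small: "(\<integral>x. norm (comb_end n c x - \<xi> x) \<partial>\<mu>) < a * min \<delta>1 \<delta>2"
    then have c: "\<And>k. 0 \<le> c k" "(\<Sum>k<n. c k) = 1" by auto
    let ?D = "\<lambda>t x. comb n c t x - M t x"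
    let ?A = "{x \<in> space \<mu>. ennreal a < maximal_inf ?D x}"
    note D = H1_diff[OF comb_H1[of n c] M]
    have A: "?A \<in> sets \<mu>" using H1_D(3)[OF D] by measurable
    have "a * measure \<mu> ?A \<le> (\<integral>x. norm (comb_end n c x - \<xi> x) \<partial>\<mu>)"
      by (rule Doob_diff[OF comb_H1 M comb_end_integrable \<xi>(1) comb_projection \<xi>(2) a])
    then have mA: "measure \<mu> ?A \<le> \<delta>1" "measure \<mu> ?A \<le> \<delta>2"
    proof -
      assume "a * measure \<mu> ?A \<le> (\<integral>x. norm (comb_end n c x - \<xi> x) \<partial>\<mu>)"
      then have "a * measure \<mu> ?A < a * min \<delta>1 \<delta>2" using small by simp
      then show "measure \<mu> ?A \<le> \<delta>1" "measure \<mu> ?A \<le> \<delta>2" using a by auto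
    qed
    have intC: "integrable \<mu> (\<lambda>x. enn2real (maximal_inf (comb n c) x))" and intM: "integrable \<mu> (\<lambda>x. enn2real (maximal_inf M x))"
      using H1_maximal(1) comb_H1 M by auto
    have "H1_norm \<mu> ?D = (\<integral>x. enn2real (maximal_inf ?D x) \<partial>\<mu>)" by (rule H1_norm_eq[OF D])
    also have "\<dots> \<le> (\<integral>x. a + (indicat_real ?A x * enn2real (maximal_inf (comb n c) x) + indicat_real ?A x * enn2real (maximal_inf M x)) \<partial>\<mu>)"
    proof (rule integral_mono_AE)
      show "integrable \<mu> (\<lambda>x. enn2real (maximal_inf ?D x))" by (rule H1_maximal(1)[OF D])
      show "integrable \<mu> (\<lambda>x. a + (indicat_real ?A x * enn2real (maximal_inf (comb n c) x) + indicat_real ?A x * enn2real (maximal_inf M x)))"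
        using integrable_indicator_mult[OF A intC] integrable_indicator_mult[OF A intM] by simp
      show "AE x in \<mu>. enn2real (maximal_inf ?D x) \<le> a + (indicat_real ?A x * enn2real (maximal_inf (comb n c) x) + indicat_real ?A x * enn2real (maximal_inf M x))"
        using H1_maximal_diff_le[OF comb_H1[of n c] M] AE_space
      proof eventually_elim
        case (elim x)
        show ?case
        proof (cases "x \<in> ?A")
          case True
          then have "indicat_real ?A x = 1" by simp
          then show ?thesis using elim(1) a by (simp only: mult_1)
        next
          case False
          then have "maximal_inf ?D x \<le> ennreal a" using elim(2) by auto
          then have "enn2real (maximal_inf ?D x) \<le> a" using a by (intro enn2real_leI) auto
          moreover have "indicat_real ?A x = 0" using False by simp
          ultimately show ?thesis by (simp only: mult_zero_left)
        qed
      qed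
    qed
    also have "\<dots> = a + (indicator_integral \<mu> ?A (\<lambda>x. enn2real (maximal_inf (comb n c) x)) + indicator_integral \<mu> ?A (\<lambda>x. enn2real (maximal_inf M x)))"
      using integrable_indicator_mult[OF A intC] integrable_indicator_mult[OF A intM] by (simp add: indicator_integral_def prob_space)
    also have "\<dots> \<le> a + (a + a)"
      by (intro add_mono order_refl comb_maximal[OF c A] \<delta>1(2)[OF A mA(1)] \<delta>2(2)[OF A mA(2)])
    finally show "H1_norm \<mu> ?D \<le> \<epsilon>" by (simp add: a_def)
  qed
qed

lemma dual_add:
  fixes M M' :: "('x, 'e) process"
  shows "\<phi> \<in> H1_dual \<mu> F \<Longrightarrow> M \<in> H1 \<mu> F \<Longrightarrow> M' \<in> H1 \<mu> F \<Longrightarrow> \<phi> (\<lambda>t x. M t x + M' t x) = \<phi> M + \<phi> M'"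
  by (simp add: H1_dual_def)

lemma dual_scaleR:
  fixes M :: "('x, 'e) process"
  shows "\<phi> \<in> H1_dual \<mu> F \<Longrightarrow> M \<in> H1 \<mu> F \<Longrightarrow> \<phi> (\<lambda>t x. c *\<^sub>R M t x) = c * \<phi> M"
  by (simp add: H1_dual_def)

lemma dual_comb:
  assumes \<phi>: "\<phi> \<in> H1_dual \<mu> F" shows "\<phi> (comb n c) = (\<Sum>k<n. c k * \<phi> (N k))"
proof (induction n)
  case 0
  show ?case using dual_scaleR[OF \<phi> N, of 0 0] by (simp add: comb_def[abs_def])
next
  case (Suc n)
  have "comb (Suc n) c = (\<lambda>t x. comb n c t x + c n *\<^sub>R N n t x)" by (simp add: comb_def[abs_def])
  then show ?case
    using dual_add[OF \<phi> comb_H1[of n c] H1_scaleR[OF N, of "c n" n]] dual_scaleR[OF \<phi> N, of "c n" n] Suc by simp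
qed

lemma dual_diff:
  fixes M M' :: "('x, 'e) process"
  assumes "\<phi> \<in> H1_dual \<mu> F" and "M \<in> H1 \<mu> F" "M' \<in> H1 \<mu> F"
  shows "\<phi> (\<lambda>t x. M t x - M' t x) = \<phi> M - \<phi> M'"
  using dual_add[OF assms(1,2) H1_scaleR[OF assms(3), of "- 1"]] dual_scaleR[OF assms(1,3), of "- 1"] by simp

lemma dual_bound:
  fixes \<phi> :: "('x, 'e) process \<Rightarrow> real"
  assumes "\<phi> \<in> H1_dual \<mu> F" obtains C where "0 \<le> C" "\<And>M. M \<in> H1 \<mu> F \<Longrightarrow> \<bar>\<phi> M\<bar> \<le> C * H1_norm \<mu> M"
proof -
  obtain C where C: "\<forall>M\<in>H1 \<mu> F. \<bar>\<phi> M\<bar> \<le> C * H1_norm \<mu> M" using assms unfolding H1_dual_def by blast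
  show ?thesis
  proof (rule that[of "\<bar>C\<bar>"])
    fix M :: "('x, 'e) process" assume M: "M \<in> H1 \<mu> F"
    have "\<bar>\<phi> M\<bar> \<le> C * H1_norm \<mu> M" using C M by blast
    also have "\<dots> \<le> \<bar>C\<bar> * H1_norm \<mu> M" by (intro mult_right_mono) (auto simp: H1_norm_def)
    finally show "\<bar>\<phi> M\<bar> \<le> \<bar>C\<bar> * H1_norm \<mu> M" .
  qed simp
qed

lemma dual_bounded: assumes "\<phi> \<in> H1_dual \<mu> F" shows "bounded (range (\<lambda>k. \<phi> (N k)))"
proof -
  obtain C where C: "0 \<le> C" "\<And>M. M \<in> H1 \<mu> F \<Longrightarrow> \<bar>\<phi> M\<bar> \<le> C * H1_norm \<mu> M" by (rule dual_bound[OF assms]) blast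
  have "\<bar>\<phi> (N k)\<bar> \<le> C * B" for k
    using C(2)[OF N, of k] mult_left_mono[OF N_bound C(1), of k] H1_norm_eq[OF N, of k] by simp
  then show ?thesis unfolding bounded_iff by auto
qed

end

context UI_martingales
begin

text \<open>Terminal values at distances of order \<open>(1/4) ^ j\<close> and Doob's inequality at
  level \<open>(1/2) ^ j\<close> give summable exceptional probabilities. By Borel--Cantelli almost
  every path converges uniformly, so the limit is cadlag; its maximal function is integrable by
  Fatou's lemma and the common bound \<open>B\<close>.\<close>

lemma limit_martingale:
  assumes \<xi>: "bochner_integrable \<mu> \<xi>"
    and approx: "\<And>\<epsilon>. 0 < \<epsilon> \<Longrightarrow> \<exists>n c. (\<forall>k. 0 \<le> c k) \<and> (\<Sum>k<n. c k) = 1 \<and> (\<integral>x. norm (comb_end n c x - \<xi> x) \<partial>\<mu>) < \<epsilon>"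
  obtains M where "M \<in> H1 \<mu> F" "\<And>t. 0 \<le> t \<Longrightarrow> is_projection t \<xi> (M t)"
proof -
  \<comment> \<open>The factor one half makes any two terminal values with indices at least
    \<open>j\<close> differ by at most \<open>(1/4) ^ j\<close>.\<close>
  have "\<exists>n c. (\<forall>k. 0 \<le> c k) \<and> (\<Sum>k<n. c k) = 1 \<and> (\<integral>x. norm (comb_end n c x - \<xi> x) \<partial>\<mu>) < (1/4) ^ j / 2" for j :: nat
    by (rule approx) simp
  then obtain n c where c: "\<And>j k. 0 \<le> c j k" "\<And>j. (\<Sum>k<n j. c j k) = 1"
    "\<And>j. (\<integral>x. norm (comb_end (n j) (c j) x - \<xi> x) \<partial>\<mu>) < (1/4) ^ j / 2" by metis
  define C where "C j = comb (n j) (c j)" for j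
  define \<zeta> where "\<zeta> j = comb_end (n j) (c j)" for j
  have CH: "C j \<in> H1 \<mu> F" for j unfolding C_def by (rule comb_H1)
  have \<zeta>: "bochner_integrable \<mu> (\<zeta> j)" for j unfolding \<zeta>_def by (rule comb_end_integrable)
  have proj: "is_projection t (\<zeta> j) (C j t)" if "0 \<le> t" for t j unfolding \<zeta>_def C_def by (rule comb_projection[OF that])
  have \<zeta>\<xi>: "(\<integral>x. norm (\<zeta> j x - \<xi> x) \<partial>\<mu>) < (1/4) ^ j / 2" for j unfolding \<zeta>_def by (rule c)
  have \<zeta>\<zeta>: "(\<integral>x. norm (\<zeta> i x - \<zeta> j x) \<partial>\<mu>) \<le> (1/4) ^ j" if "j \<le> i" for i j
  proof -
    have i1: "integrable \<mu> (\<lambda>x. norm (\<zeta> k x - \<xi> x))" for k by (rule bochner_integrableD(2)[OF bochner_integrable_diff[OF \<zeta> \<xi>]])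
    have "(\<integral>x. norm (\<zeta> i x - \<zeta> j x) \<partial>\<mu>) \<le> (\<integral>x. norm (\<zeta> i x - \<xi> x) + norm (\<zeta> j x - \<xi> x) \<partial>\<mu>)"
    proof (rule integral_mono)
      show "norm (\<zeta> i x - \<zeta> j x) \<le> norm (\<zeta> i x - \<xi> x) + norm (\<zeta> j x - \<xi> x)" for x
        using norm_triangle_ineq4[of "\<zeta> i x - \<xi> x" "\<zeta> j x - \<xi> x"] by simp
    qed (use i1 bochner_integrableD(2)[OF bochner_integrable_diff[OF \<zeta> \<zeta>]] in auto)
    also have "\<dots> = (\<integral>x. norm (\<zeta> i x - \<xi> x) \<partial>\<mu>) + (\<integral>x. norm (\<zeta> j x - \<xi> x) \<partial>\<mu>)" using i1 by simp
    also have "\<dots> \<le> (1/4) ^ i / 2 + (1/4) ^ j / 2" using \<zeta>\<xi>[of i] \<zeta>\<xi>[of j] by simp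
    also have "\<dots> \<le> (1/4) ^ j"
    proof -
      have "(1/4 :: real) ^ i \<le> (1/4) ^ j" by (rule power_decreasing[OF that]) auto
      then show ?thesis by linarith
    qed
    finally show ?thesis .
  qed
  define A where "A j = {x \<in> space \<mu>. ennreal ((1/2) ^ j) < maximal_inf (\<lambda>t x. C (Suc j) t x - C j t x) x}" for j
  have A: "A j \<in> sets \<mu>" for j
    unfolding A_def using H1_D(3)[OF H1_diff[OF CH CH]] by measurable
  have mA: "measure \<mu> (A j) \<le> (1/2) ^ j" for j
  proof -
    have "(1/2) ^ j * measure \<mu> (A j) \<le> (\<integral>x. norm (\<zeta> (Suc j) x - \<zeta> j x) \<partial>\<mu>)"
      unfolding A_def by (rule Doob_diff[OF CH CH \<zeta> \<zeta> proj proj]) auto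
    also have "\<dots> \<le> (1/4) ^ j" by (rule \<zeta>\<zeta>) simp
    also have "(1/4::real) ^ j = (1/2) ^ j * (1/2) ^ j" by (simp flip: power_mult_distrib)
    finally show ?thesis by simp
  qed
  have "summable (\<lambda>j. measure \<mu> (A j))"
    by (rule summable_comparison_test'[of "\<lambda>j. (1/2) ^ j" 0]) (use mA in \<open>auto simp: summable_geometric\<close>)
  then have "AE x in \<mu>. \<forall>\<^sub>F j in sequentially. x \<in> space \<mu> - A j"
    by (intro borel_cantelli_AE1 A) (simp_all add: emeasure_eq_measure)
  then obtain Nul where Nul: "\<And>x. x \<in> space \<mu> - Nul \<Longrightarrow> \<forall>\<^sub>F j in sequentially. x \<in> space \<mu> - A j" "Nul \<in> null_sets \<mu>"
    using AE_E3 by metis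
  \<comment> \<open>The value \<open>0\<close> on the exceptional set makes every path cadlag, as
    the definition demands; completeness keeps the process adapted.\<close>
  define M where "M t x = (if x \<in> space \<mu> - Nul then lim (\<lambda>j. C j t x) else 0)" for t x
  have good: "\<exists>j0. \<forall>j\<ge>j0. \<forall>s\<ge>0. norm (C (Suc j) s x - C j s x) \<le> (1/2) ^ j" if x: "x \<in> space \<mu> - Nul" for x
  proof -
    obtain j0 where j0: "\<And>j. j0 \<le> j \<Longrightarrow> x \<in> space \<mu> - A j" using Nul(1)[OF x] by (auto simp: eventually_sequentially)
    have "norm (C (Suc j) s x - C j s x) \<le> (1/2) ^ j" if "j0 \<le> j" "0 \<le> s" for j s
    proof -
      have "ennreal (norm (C (Suc j) s x - C j s x)) \<le> maximal_inf (\<lambda>t x. C (Suc j) t x - C j t x) x"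
        using norm_le_maximal_inf[OF that(2), of "\<lambda>t x. C (Suc j) t x - C j t x"] .
      also have "\<dots> \<le> ennreal ((1/2) ^ j)" using j0[OF that(1)] by (auto simp: A_def)
      finally show ?thesis by (simp add: ennreal_le_iff)
    qed
    then show ?thesis by blast
  qed
  have conv: "(\<lambda>j. C j s x) \<longlonglongrightarrow> M s x" if x: "x \<in> space \<mu> - Nul" and s: "0 \<le> s" for x s
  proof -
    obtain j0 where "\<forall>j\<ge>j0. \<forall>s\<ge>0. norm (C (Suc j) s x - C j s x) \<le> (1/2) ^ j" using good[OF x] by blast
    then show ?thesis using geometric_limit(1)[of j0 "\<lambda>j. C j s x"] s x by (simp add: M_def)
  qed
  have unif: "\<exists>j0. \<forall>j\<ge>j0. \<forall>s\<ge>0. norm (M s x - C j s x) \<le> 2 * (1/2) ^ j" if x: "x \<in> space \<mu> - Nul" for x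
  proof -
    obtain j0 where "\<forall>j\<ge>j0. \<forall>s\<ge>0. norm (C (Suc j) s x - C j s x) \<le> (1/2) ^ j" using good[OF x] by blast
    then have "\<forall>j\<ge>j0. \<forall>s\<ge>0. norm (M s x - C j s x) \<le> 2 * (1/2) ^ j"
      using geometric_limit(2)[of j0 "\<lambda>j. C j _ x"] x by (simp add: M_def)
    then show ?thesis by blast
  qed
  have AE_good: "AE x in \<mu>. x \<in> space \<mu> - Nul" using AE_not_in[OF Nul(2)] AE_space by eventually_elim simp
  have cad: "cadlag \<mu> M"
    unfolding cadlag_def
  proof (intro ballI conjI allI impI)
    fix x and t :: real assume x: "x \<in> space \<mu>"
    have "(\<lambda>j. 2 * (1/2::real) ^ j) \<longlonglongrightarrow> 2 * 0" by (intro tendsto_intros LIMSEQ_power_zero) simp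
    then have z: "(\<lambda>j. 2 * (1/2::real) ^ j) \<longlonglongrightarrow> 0" by simp
    show "((\<lambda>s. M s x) \<longlongrightarrow> M t x) (at_right t)" if t: "0 \<le> t"
    proof (cases "x \<in> Nul")
      case False
      then obtain j0 where "\<forall>j\<ge>j0. \<forall>s\<ge>0. norm (M s x - C j s x) \<le> 2 * (1/2) ^ j" using unif x by blast
      then show ?thesis
        by (intro uniform_limit_one_sided(1)[OF _ z t, of j0 "\<lambda>s. M s x" "\<lambda>j s. C j s x"])
          (auto intro: cadlag_right[OF H1_D(1)[OF CH] x t])
    qed (simp add: M_def)
    show "\<exists>l. ((\<lambda>s. M s x) \<longlongrightarrow> l) (at_left t)" if t: "0 < t"
    proof (cases "x \<in> Nul")
      case False
      then obtain j0 where "\<forall>j\<ge>j0. \<forall>s\<ge>0. norm (M s x - C j s x) \<le> 2 * (1/2) ^ j" using unif x by blast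
      moreover have "\<exists>l. ((\<lambda>s. C j s x) \<longlongrightarrow> l) (at_left t)" for j
        using cadlag_left[OF H1_D(1)[OF CH] x t] by blast
      ultimately show ?thesis
        by (intro uniform_limit_one_sided(2)[OF _ z t, of j0 "\<lambda>s. M s x" "\<lambda>j s. C j s x"]) auto
    qed (auto simp: M_def)
  qed
  have sm: "strongly_measurable (restr t) (M t)" if t: "0 \<le> t" for t
  proof -
    interpret R: finite_complete_measure "restr t" by (rule finite_complete_restr[OF t])
    show ?thesis
    proof (rule R.strongly_measurable_AE_limit[of "\<lambda>j. C j t"])
      show "strongly_measurable (restr t) (C j t)" for j using proj[OF t] by (simp add: is_projection_def)
      show "AE x in restr t. (\<lambda>j. C j t x) \<longlonglongrightarrow> M t x"
        unfolding AE_restr_iff[OF t] using AE_good by eventually_elim (rule conv[OF _ t])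
    qed
  qed
  have Cb: "bochner_integrable \<mu> (C j t)" if "0 \<le> t" for j t by (rule H1_bochner_integrable[OF CH that])
  \<comment> \<open>Projections contract L1, so distances at time \<open>t\<close> are bounded by
    those of the terminal values; Fatou's lemma carries the bound to the pointwise limit.\<close>
  have Fatou: "(\<integral>\<^sup>+x. ennreal (norm (M t x - C j t x)) \<partial>\<mu>) \<le> ennreal ((1/4) ^ j)" if t: "0 \<le> t" for t j
  proof -
    have int: "integrable \<mu> (\<lambda>x. norm (C i t x - C j t x))" for i
      by (rule bochner_integrableD(2)[OF bochner_integrable_diff[OF Cb[OF t] Cb[OF t]]])
    have "(\<integral>\<^sup>+x. ennreal (norm (M t x - C j t x)) \<partial>\<mu>) = (\<integral>\<^sup>+x. liminf (\<lambda>i. ennreal (norm (C i t x - C j t x))) \<partial>\<mu>)"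
    proof (rule nn_integral_cong_AE)
      from AE_good show "AE x in \<mu>. ennreal (norm (M t x - C j t x)) = liminf (\<lambda>i. ennreal (norm (C i t x - C j t x)))"
      proof eventually_elim
        case (elim x)
        have "(\<lambda>i. ennreal (norm (C i t x - C j t x))) \<longlonglongrightarrow> ennreal (norm (M t x - C j t x))"
          by (intro tendsto_intros conv[OF elim t])
        then show ?case by (rule lim_imp_Liminf[OF trivial_limit_sequentially, symmetric])
      qed
    qed
    also have "\<dots> \<le> liminf (\<lambda>i. \<integral>\<^sup>+x. ennreal (norm (C i t x - C j t x)) \<partial>\<mu>)"
      using int by (intro nn_integral_liminf) auto
    also have "\<dots> \<le> liminf (\<lambda>i::nat. ennreal ((1/4) ^ j))"
    proof (rule Liminf_mono, rule eventually_sequentiallyI[of j])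
      fix i assume ij: "j \<le> i"
      have "(\<integral>\<^sup>+x. ennreal (norm (C i t x - C j t x)) \<partial>\<mu>) = ennreal (\<integral>x. norm (C i t x - C j t x) \<partial>\<mu>)"
        by (rule nn_integral_eq_integral[OF int]) simp
      also have "\<dots> \<le> ennreal (\<integral>x. norm (\<zeta> i x - \<zeta> j x) \<partial>\<mu>)"
        using t by (intro ennreal_leI projection_integral_norm_le[OF t] bochner_integrable_diff[OF \<zeta> \<zeta>] projection_diff[OF t \<zeta> \<zeta>] proj)
      also have "\<dots> \<le> ennreal ((1/4) ^ j)" by (intro ennreal_leI \<zeta>\<zeta>[OF ij])
      finally show "(\<integral>\<^sup>+x. ennreal (norm (C i t x - C j t x)) \<partial>\<mu>) \<le> ennreal ((1/4) ^ j)" .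
    qed
    also have "\<dots> = ennreal ((1/4) ^ j)" by (simp add: Liminf_const)
    finally show ?thesis .
  qed
  have diffsm: "strongly_measurable \<mu> (\<lambda>x. M t x - C j t x)" if t: "0 \<le> t" for t j
    by (intro strongly_measurable_diff strongly_measurable_restr[OF t sm[OF t]] bochner_integrableD(1)[OF Cb[OF t]])
  have diffint: "integrable \<mu> (\<lambda>x. norm (M t x - C j t x))" if t: "0 \<le> t" for t j
    by (rule integrableI_bounded) (use strongly_measurable_norm[OF diffsm[OF t]] Fatou[OF t, of j] in \<open>auto simp: less_top[symmetric] top_unique\<close>)
  have diffle: "(\<integral>x. norm (M t x - C j t x) \<partial>\<mu>) \<le> (1/4) ^ j" if t: "0 \<le> t" for t j
    using Fatou[OF t, of j] nn_integral_eq_integral[OF diffint[OF t]] by (simp add: ennreal_le_iff)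
  have Mb: "bochner_integrable \<mu> (M t)" if t: "0 \<le> t" for t
  proof -
    have "bochner_integrable \<mu> (\<lambda>x. (M t x - C 0 t x) + C 0 t x)"
      using diffsm[OF t] diffint[OF t] Cb[OF t] by (intro bochner_integrable_add) (auto simp: bochner_integrable_iff)
    then show ?thesis by simp
  qed
  have z4: "(\<lambda>j. K * (1/4::real) ^ j) \<longlonglongrightarrow> 0" for K
    using tendsto_mult_right_zero[OF LIMSEQ_power_zero[of "1/4::real"], of K] by simp
  have Mproj: "is_projection t \<xi> (M t)" if t: "0 \<le> t" for t
    unfolding is_projection_def
  proof (intro conjI ballI allI sm[OF t] Mb[OF t])
    fix A and \<phi> :: "'e \<Rightarrow>\<^sub>L real" assume "A \<in> sets (F t)"
    then have A\<mu>: "A \<in> sets \<mu>" and AF: "A \<in> sets (F t)" using sets_F[OF t] by auto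
    let ?I = "\<lambda>f. indicator_integral \<mu> A (\<lambda>x. blinfun_apply \<phi> (f x))"
    have est: "\<bar>?I f - ?I g\<bar> \<le> norm \<phi> * (\<integral>x. norm (f x - g x) \<partial>\<mu>)" if f: "bochner_integrable \<mu> f" and g: "bochner_integrable \<mu> g" for f g
    proof -
      have d: "integrable \<mu> (\<lambda>x. norm (f x - g x))" by (rule bochner_integrableD(2)[OF bochner_integrable_diff[OF f g]])
      have i: "integrable \<mu> (\<lambda>x. blinfun_apply \<phi> (f x) - blinfun_apply \<phi> (g x))"
        using integrable_blinfun_apply[OF f] integrable_blinfun_apply[OF g] by simp
      have "\<bar>?I f - ?I g\<bar> = \<bar>indicator_integral \<mu> A (\<lambda>x. blinfun_apply \<phi> (f x) - blinfun_apply \<phi> (g x))\<bar>"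
        by (simp add: indicator_integral_diff[OF A\<mu>] integrable_blinfun_apply f g)
      also have "\<dots> \<le> indicator_integral \<mu> A (\<lambda>x. \<bar>blinfun_apply \<phi> (f x) - blinfun_apply \<phi> (g x)\<bar>)"
        by (rule indicator_integral_abs_le[OF A\<mu> i])
      also have "\<dots> \<le> indicator_integral \<mu> A (\<lambda>x. norm \<phi> * norm (f x - g x))"
      proof (rule indicator_integral_mono[OF A\<mu>])
        show "AE x in \<mu>. \<bar>blinfun_apply \<phi> (f x) - blinfun_apply \<phi> (g x)\<bar> \<le> norm \<phi> * norm (f x - g x)"
          using norm_blinfun[of \<phi> "f _ - g _"] by (simp add: blinfun.diff_right)
      qed (use i d in auto)
      also have "\<dots> \<le> norm \<phi> * (\<integral>x. norm (f x - g x) \<partial>\<mu>)"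
        unfolding indicator_integral_cmult using d by (intro mult_left_mono indicator_integral_le_integral A\<mu>) auto
      finally show ?thesis .
    qed
    have "(\<lambda>j. ?I (C j t)) \<longlonglongrightarrow> ?I (M t)"
    proof (rule Lim_null_comparison[OF _ z4[of "norm \<phi>"], THEN LIM_zero_cancel], rule always_eventually, rule allI)
      fix j
      have "\<bar>?I (M t) - ?I (C j t)\<bar> \<le> norm \<phi> * (1/4) ^ j"
        using est[OF Mb[OF t] Cb[OF t], of j] mult_left_mono[OF diffle[OF t, of j], of "norm \<phi>"] by simp
      then show "norm (?I (C j t) - ?I (M t)) \<le> norm \<phi> * (1/4) ^ j" by (simp add: abs_minus_commute)
    qed
    moreover have "(\<lambda>j. ?I (C j t)) \<longlonglongrightarrow> ?I \<xi>"
    proof (rule Lim_null_comparison[OF _ z4[of "norm \<phi>"], THEN LIM_zero_cancel], rule always_eventually, rule allI)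
      fix j
      have "?I (C j t) = ?I (\<zeta> j)" using proj[OF t, of j] AF by (simp add: is_projection_def)
      moreover have "(\<integral>x. norm (\<zeta> j x - \<xi> x) \<partial>\<mu>) \<le> (1/4) ^ j" using \<zeta>\<xi>[of j] zero_le_power[of "1/4::real" j] by linarith
      then have "\<bar>?I (\<zeta> j) - ?I \<xi>\<bar> \<le> norm \<phi> * (1/4) ^ j"
        using est[OF \<zeta> \<xi>, of j] mult_left_mono[of _ "(1/4) ^ j" "norm \<phi>"] by (meson norm_ge_zero order_trans)
      ultimately show "norm (?I (C j t) - ?I \<xi>) \<le> norm \<phi> * (1/4) ^ j" by simp
    qed
    ultimately show "?I (M t) = ?I \<xi>" by (rule LIMSEQ_unique)
  qed
  have "(\<integral>\<^sup>+x. maximal_inf M x \<partial>\<mu>) \<le> (\<integral>\<^sup>+x. liminf (\<lambda>j. maximal_inf (C j) x) \<partial>\<mu>)"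
  proof (rule nn_integral_mono_AE)
    from AE_good show "AE x in \<mu>. maximal_inf M x \<le> liminf (\<lambda>j. maximal_inf (C j) x)"
    proof eventually_elim
      case (elim x)
      show ?case
        unfolding maximal_inf_eq[of M]
      proof (rule SUP_least)
        fix s :: real assume "s \<in> {0..}"
        then have s: "0 \<le> s" by simp
        have "(\<lambda>j. ennreal (norm (C j s x))) \<longlonglongrightarrow> ennreal (norm (M s x))" by (intro tendsto_intros conv[OF elim s])
        then have "ennreal (norm (M s x)) = liminf (\<lambda>j. ennreal (norm (C j s x)))"
          by (rule lim_imp_Liminf[OF trivial_limit_sequentially, symmetric])
        also have "\<dots> \<le> liminf (\<lambda>j. maximal_inf (C j) x)"
          by (intro Liminf_mono always_eventually allI norm_le_maximal_inf[OF s])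
        finally show "ennreal (norm (M s x)) \<le> liminf (\<lambda>j. maximal_inf (C j) x)" .
      qed
    qed
  qed
  also have "\<dots> \<le> liminf (\<lambda>j. \<integral>\<^sup>+x. maximal_inf (C j) x \<partial>\<mu>)"
    using H1_D(3)[OF CH] by (intro nn_integral_liminf) auto
  also have "\<dots> \<le> liminf (\<lambda>j::nat. ennreal B)"
  proof (rule Liminf_mono, rule always_eventually, rule allI)
    fix j
    have "(\<integral>\<^sup>+x. maximal_inf (C j) x \<partial>\<mu>) = (\<integral>\<^sup>+x. ennreal (enn2real (maximal_inf (C j) x)) \<partial>\<mu>)"
      by (rule nn_integral_cong_AE) (use H1_maximal(2)[OF CH, of j] in eventually_elim, simp)
    also have "\<dots> = ennreal (\<integral>x. enn2real (maximal_inf (C j) x) \<partial>\<mu>)"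
      by (rule nn_integral_eq_integral[OF H1_maximal(1)[OF CH]]) simp
    also have "\<dots> \<le> ennreal B" unfolding C_def by (intro ennreal_leI comb_bound c)
    finally show "(\<integral>\<^sup>+x. maximal_inf (C j) x \<partial>\<mu>) \<le> ennreal B" .
  qed
  also have "\<dots> < \<infinity>" by (simp add: Liminf_const)
  finally have fin: "(\<integral>\<^sup>+x. maximal_inf M x \<partial>\<mu>) < \<infinity>" .
  show ?thesis by (rule that[OF H1_I[OF cad fin \<xi> Mproj] Mproj])
qed

lemma separable_terminal_values:
  obtains y :: "nat \<Rightarrow> 'e" where "\<And>k. AE x in \<mu>. Z k x \<in> closure (range y)"
proof -
  have "\<exists>y::nat \<Rightarrow> 'e. AE x in \<mu>. Z k x \<in> closure (range y)" for k
    using strongly_measurable_separable[OF bochner_integrableD(1)[OF Z(1)]] by blast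
  then obtain y :: "nat \<Rightarrow> nat \<Rightarrow> 'e" where y: "\<And>k. AE x in \<mu>. Z k x \<in> closure (range (y k))" by metis
  define D where "D = (\<Union>k. range (y k))"
  have "countable D" unfolding D_def by auto
  then have D: "range (from_nat_into D) = D" by (intro range_from_nat_into) (auto simp: D_def)
  show ?thesis
  proof (rule that[of "from_nat_into D"])
    fix k
    have "closure (range (y k)) \<subseteq> closure D" by (rule closure_mono) (auto simp: D_def)
    then show "AE x in \<mu>. Z k x \<in> closure (range (from_nat_into D))"
      using y[of k] unfolding D by (auto elim: eventually_mono)
  qed
qed

text \<open>\<open>M\<close> is built from \<open>\<xi>\<close> alone. For each
  \<open>\<phi>\<close> separately some convex combination is close to \<open>M\<close> in H1, hence
  under \<open>\<phi>\<close>, while its value under \<open>\<phi>\<close> is also close to the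
  generalized limit; so the two numbers agree.\<close>

theorem weak_limit_in_H1:
  assumes refl: "reflexive_space TYPE('e)" and L: "generalized_limit L"
  obtains M where "M \<in> H1 \<mu> F" "\<And>\<phi>. \<phi> \<in> H1_dual \<mu> F \<Longrightarrow> L (\<lambda>k. \<phi> (N k)) = \<phi> M"
proof -
  have refl': "\<exists>x :: 'e. \<forall>f. blinfun_apply \<Phi> f = blinfun_apply f x" for \<Phi> :: "('e \<Rightarrow>\<^sub>L real) \<Rightarrow>\<^sub>L real"
    using refl by (simp add: reflexive_space_def)
  obtain y :: "nat \<Rightarrow> 'e" where y: "\<And>k. AE x in \<mu>. Z k x \<in> closure (range y)"
    by (rule separable_terminal_values) blast
  define E where "E = closure (span (range y))"
  have yE: "closure (range y) \<subseteq> E" unfolding E_def by (intro closure_mono span_superset)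
  obtain d :: "nat \<Rightarrow> 'e \<Rightarrow>\<^sub>L real" where d: "\<And>f \<epsilon>. \<epsilon> > 0 \<Longrightarrow> \<exists>i. dual_seminorm E (f - d i) < \<epsilon>"
    unfolding E_def by (rule dual_seminorm_separable[OF refl']) blast
  have int: "integrable \<mu> (\<lambda>x. norm (Z k x))" for k by (rule bochner_integrableD(2)[OF Z(1)])
  interpret weak_limit \<mu> L Z B y d E
  proof (unfold_locales)
    show "\<exists>x :: 'e. \<forall>f. blinfun_apply \<Phi> f = blinfun_apply f x" for \<Phi> :: "('e \<Rightarrow>\<^sub>L real) \<Rightarrow>\<^sub>L real" by (rule refl')
    show "(\<integral>x. norm (Z k x) \<partial>\<mu>) \<le> B" for k
      using integral_mono_AE[OF int H1_maximal(1)[OF N] Z_le, of k] N_bound[of k] by simp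
    show "\<exists>\<delta>>0. \<forall>k. \<forall>A\<in>sets \<mu>. measure \<mu> A \<le> \<delta> \<longrightarrow> indicator_integral \<mu> A (\<lambda>x. norm (Z k x)) \<le> \<epsilon>" if \<epsilon>: "\<epsilon> > 0" for \<epsilon>
    proof -
      obtain \<delta> where \<delta>: "\<delta> > 0" "\<And>k A. A \<in> sets \<mu> \<Longrightarrow> measure \<mu> A \<le> \<delta> \<Longrightarrow>
          indicator_integral \<mu> A (\<lambda>x. enn2real (maximal_inf (N k) x)) \<le> \<epsilon>" using N_ui[OF \<epsilon>] by blast
      have "indicator_integral \<mu> A (\<lambda>x. norm (Z k x)) \<le> \<epsilon>" if A: "A \<in> sets \<mu>" "measure \<mu> A \<le> \<delta>" for k A
        using indicator_integral_mono[OF A(1) int H1_maximal(1)[OF N] Z_le, of k] \<delta>(2)[OF A, of k] by simp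
      then show ?thesis using \<delta>(1) by blast
    qed
    show "AE x in \<mu>. Z k x \<in> E" for k using y[of k] yE by (auto elim: eventually_mono)
  qed (use Z(1) L d in \<open>auto simp: E_def generalized_limit_def\<close>)
  obtain \<xi> where \<xi>: "bochner_integrable \<mu> \<xi>" "\<And>x. \<xi> x \<in> E"
    "\<And>i A. A \<in> sets \<mu> \<Longrightarrow>
      L (\<lambda>k. indicator_integral \<mu> A (\<lambda>x. blinfun_apply (d i) (Z k x))) = indicator_integral \<mu> A (\<lambda>x. blinfun_apply (d i) (\<xi> x))"
    by (rule weak_limit_exists) blast
  have approx: "\<exists>n c. (\<forall>k. 0 \<le> c k) \<and> (\<Sum>k<n. c k) = 1 \<and>
      (\<integral>x. norm (comb_end n c x - \<xi> x) \<partial>\<mu>) + \<bar>(\<Sum>k<n. c k * a k) - L a\<bar> < \<epsilon>"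
    if eb: "0 < \<epsilon>" "bounded (range a)" for \<epsilon> a
  proof -
    show ?thesis
    proof (rule convex_combination_approx[OF \<xi> eb(2,1)])
      fix n :: nat and c :: "nat \<Rightarrow> real"
      assume "\<And>k. 0 \<le> c k" "(\<Sum>k<n. c k) = 1"
        "(\<integral>x. norm ((\<Sum>k<n. c k *\<^sub>R Z k x) - \<xi> x) \<partial>\<mu>) + \<bar>(\<Sum>k<n. c k * a k) - L a\<bar> < \<epsilon>"
      then show ?thesis unfolding comb_end_def by (intro exI[of _ n] exI[of _ c]) simp
    qed
  qed
  \<comment> \<open>For the zero sequence the real coordinate contributes nothing and only the
    distance in L1 remains.\<close>
  have approx0: "\<exists>n c. (\<forall>k. 0 \<le> c k) \<and> (\<Sum>k<n. c k) = 1 \<and> (\<integral>x. norm (comb_end n c x - \<xi> x) \<partial>\<mu>) < \<epsilon>" if "0 < \<epsilon>" for \<epsilon>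
    using approx[OF that, of "\<lambda>_. 0"] by (simp add: L_const)
  obtain M where M: "M \<in> H1 \<mu> F" "\<And>t. 0 \<le> t \<Longrightarrow> is_projection t \<xi> (M t)"
    by (rule limit_martingale[OF \<xi>(1) approx0], assumption) (rule that)
  show ?thesis
  proof (rule that[OF M(1)])
    fix \<phi> :: "('x, 'e) process \<Rightarrow> real" assume \<phi>: "\<phi> \<in> H1_dual \<mu> F"
    let ?a = "\<lambda>k. \<phi> (N k)"
    obtain C where C: "0 \<le> C" "\<And>M. M \<in> H1 \<mu> F \<Longrightarrow> \<bar>\<phi> M\<bar> \<le> C * H1_norm \<mu> M"
      by (rule dual_bound[OF \<phi>]) blast
    have "\<bar>L ?a - \<phi> M\<bar> \<le> 0 + \<epsilon>" if \<epsilon>: "0 < \<epsilon>" for \<epsilon>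
    proof -
      \<comment> \<open>\<open>C + 1\<close> guards against \<open>C = 0\<close>; the factor
        \<open>2\<close> leaves half of \<open>\<epsilon>\<close> for the distance to the
        generalized limit.\<close>
      define \<kappa> where "\<kappa> = \<epsilon> / (2 * (C + 1))"
      have \<kappa>: "0 < \<kappa>" using \<epsilon> C(1) by (simp add: \<kappa>_def)
      obtain \<eta> where \<eta>: "0 < \<eta>" "\<And>n c. \<forall>k. 0 \<le> c k \<Longrightarrow> (\<Sum>k<n. c k) = 1 \<Longrightarrow> (\<integral>x. norm (comb_end n c x - \<xi> x) \<partial>\<mu>) < \<eta> \<Longrightarrow>
          H1_norm \<mu> (\<lambda>t x. comb n c t x - M t x) \<le> \<kappa>"
        using comb_H1_convergence[OF M(1) \<xi>(1) M(2) \<kappa>] by blast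
      have "0 < min \<eta> (\<epsilon> / 2)" using \<eta>(1) \<epsilon> by simp
      from approx[OF this dual_bounded[OF \<phi>]] obtain n c where c: "\<forall>k. 0 \<le> c k" "(\<Sum>k<n. c k) = 1"
        "(\<integral>x. norm (comb_end n c x - \<xi> x) \<partial>\<mu>) + \<bar>(\<Sum>k<n. c k * ?a k) - L ?a\<bar> < min \<eta> (\<epsilon> / 2)" by blast
      have nn: "0 \<le> (\<integral>x. norm (comb_end n c x - \<xi> x) \<partial>\<mu>)" by (rule integral_nonneg_AE) simp
      have "\<bar>\<phi> (comb n c) - \<phi> M\<bar> = \<bar>\<phi> (\<lambda>t x. comb n c t x - M t x)\<bar>" by (simp add: dual_diff[OF \<phi> comb_H1 M(1)])
      also have "\<dots> \<le> C * H1_norm \<mu> (\<lambda>t x. comb n c t x - M t x)" by (rule C(2)[OF H1_diff[OF comb_H1 M(1)]])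
      also have "\<dots> \<le> C * \<kappa>" using c(3) by (intro mult_left_mono \<eta>(2) c(1,2) C(1)) linarith
      also have "\<dots> \<le> (C + 1) * \<kappa>" using \<kappa> by simp
      also have "\<dots> = \<epsilon> / 2" using C(1) by (simp add: \<kappa>_def field_simps)
      finally have "\<bar>(\<Sum>k<n. c k * ?a k) - \<phi> M\<bar> \<le> \<epsilon> / 2" by (simp only: dual_comb[OF \<phi>])
      then show ?thesis using c(3) nn by linarith
    qed
    then have "\<bar>L ?a - \<phi> M\<bar> \<le> 0" by (rule field_le_epsilon)
    then show "L ?a = \<phi> M" by simp
  qed
qed

end

section \<open>The bidual topology\<close>

lemma subspace_bounded_sequences: "subspace {u :: nat \<Rightarrow> real. bounded (range u)}"
proof (rule subspaceI)
  show "0 \<in> {u :: nat \<Rightarrow> real. bounded (range u)}" by (simp add: zero_fun_def)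
  show "u + v \<in> {u. bounded (range u)}" if "u \<in> {u. bounded (range u)}" "v \<in> {u. bounded (range u)}" for u v :: "nat \<Rightarrow> real"
    using that bounded_plus_comp[of u UNIV v] by (simp add: plus_fun_def)
  show "c *\<^sub>R u \<in> {u. bounded (range u)}" if "u \<in> {u. bounded (range u)}" for c and u :: "nat \<Rightarrow> real"
    using that bounded_scaling[of "range u" c] by (simp add: scaleR_fun_def image_image)
qed

lemma sublinear_on_Sup_range: "sublinear_on {u :: nat \<Rightarrow> real. bounded (range u)} (\<lambda>u. SUP k. u k)"
proof (rule sublinear_onI_le[OF subspace_bounded_sequences])
  have up: "u k \<le> (SUP k. u k)" if "u \<in> {u. bounded (range u)}" for u :: "nat \<Rightarrow> real" and k
    using that by (intro cSUP_upper bounded_imp_bdd_above) auto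
  show "(SUP k. (u + v) k) \<le> (SUP k. u k) + (SUP k. v k)"
    if "u \<in> {u. bounded (range u)}" "v \<in> {u. bounded (range u)}" for u v :: "nat \<Rightarrow> real"
    using up[OF that(1)] up[OF that(2)] by (intro cSUP_least) (auto intro: add_mono)
  show "(SUP k. (c *\<^sub>R u) k) \<le> c * (SUP k. u k)" if "u \<in> {u. bounded (range u)}" "c > 0" for c and u :: "nat \<Rightarrow> real"
    using up[OF that(1)] that(2) by (intro cSUP_least) (auto intro: mult_left_mono)
qed

text \<open>Hahn--Banach with the supremum as sublinear bound. By \<open>near\<close> a prescribed
  value never exceeds the supremum of its sequence, and since \<open>G\<close> is a subspace the
  lower bound at \<open>- u\<close> is the upper bound at \<open>u\<close>.\<close>

lemma generalized_limit_extends: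
  fixes G :: "((nat \<Rightarrow> real) \<times> real) set"
  assumes G: "subspace G" and bnd: "\<And>u a. (u, a) \<in> G \<Longrightarrow> bounded (range u)"
    and near: "\<And>u a \<epsilon>. (u, a) \<in> G \<Longrightarrow> 0 < \<epsilon> \<Longrightarrow> \<exists>k. \<bar>u k - a\<bar> < \<epsilon>"
  obtains L where "generalized_limit L" "\<And>u a. (u, a) \<in> G \<Longrightarrow> L u = a"
proof -
  let ?S = "{u :: nat \<Rightarrow> real. bounded (range u)}"
  have dom: "a \<le> (SUP k. u k)" if ua: "(u, a) \<in> G" for u a
  proof (rule field_le_epsilon)
    fix e :: real assume "e > 0"
    then obtain k where "\<bar>u k - a\<bar> < e" using near[OF ua] by blast
    moreover have "u k \<le> (SUP k. u k)" using bnd[OF ua] by (intro cSUP_upper bounded_imp_bdd_above) auto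
    ultimately show "a \<le> (SUP k. u k) + e" by linarith
  qed
  have GS: "G \<subseteq> ?S \<times> UNIV" using bnd by auto
  have G0: "(0, 0) \<in> G" using subspace_0[OF G] by (simp add: zero_prod_def)
  obtain L where L: "linear_functional_on ?S L" "\<And>u. u \<in> ?S \<Longrightarrow> L u \<le> (SUP k. u k)" "\<And>u a. (u, a) \<in> G \<Longrightarrow> a \<le> L u"
    using Hahn_Banach_cone[OF subspace_bounded_sequences sublinear_on_Sup_range GS G0 subspace_add[OF G] subspace_scale[OF G] dom] by blast
  show ?thesis
  proof (rule that[of L])
    show "generalized_limit L"
    proof
      show "L (\<lambda>k. u k + v k) = L u + L v" if "bounded (range u)" "bounded (range v)" for u v
        using L(1) that unfolding linear_functional_on_def plus_fun_def by simp
      show "L (\<lambda>k. c * u k) = c * L u" if "bounded (range u)" for u c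
        using L(1) that unfolding linear_functional_on_def scaleR_fun_def by simp
      show "L u \<le> C" if "bounded (range u)" "\<And>k. u k \<le> C" for u C
      proof -
        have "L u \<le> (SUP k. u k)" using L(2) that(1) by simp
        also have "\<dots> \<le> C" using that(2) by (intro cSUP_least) auto
        finally show ?thesis .
      qed
    qed
    show "L u = a" if ua: "(u, a) \<in> G" for u a
    proof (rule antisym)
      show "a \<le> L u" by (rule L(3)[OF ua])
      have "(- u, - a) \<in> G" using subspace_neg[OF G ua] by simp
      then have "- a \<le> L (- u)" by (rule L(3))
      also have "L (- u) = - L u"
        using L(1) bnd[OF ua] unfolding linear_functional_on_def by (metis mem_Collect_eq mult_minus1 scaleR_minus1_left)
      finally show "L u \<le> a" by simp
    qed
  qed
qed

section \<open>Evaluation on the dual of H1\<close>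

context stochastic_basis
begin

lemma H1_dual_add:
  fixes \<phi> \<psi> :: "('x, 'e::banach) process \<Rightarrow> real"
  assumes "\<phi> \<in> H1_dual \<mu> F" "\<psi> \<in> H1_dual \<mu> F" shows "\<phi> + \<psi> \<in> H1_dual \<mu> F"
proof -
  obtain C D where C: "\<forall>M\<in>H1 \<mu> F. \<bar>\<phi> M\<bar> \<le> C * H1_norm \<mu> M" and D: "\<forall>M\<in>H1 \<mu> F. \<bar>\<psi> M\<bar> \<le> D * H1_norm \<mu> M"
    using assms unfolding H1_dual_def by blast
  have "\<bar>\<phi> M + \<psi> M\<bar> \<le> (C + D) * H1_norm \<mu> M" if "M \<in> H1 \<mu> F" for M
    using C D that abs_triangle_ineq[of "\<phi> M" "\<psi> M"] by (force simp: distrib_right)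
  then show ?thesis using assms by (auto simp: H1_dual_def distrib_left intro!: exI[of _ "C + D"])
qed

lemma H1_dual_scaleR:
  fixes \<phi> :: "('x, 'e::banach) process \<Rightarrow> real"
  assumes "\<phi> \<in> H1_dual \<mu> F" shows "c *\<^sub>R \<phi> \<in> H1_dual \<mu> F"
proof -
  obtain C where C: "\<forall>M\<in>H1 \<mu> F. \<bar>\<phi> M\<bar> \<le> C * H1_norm \<mu> M" using assms unfolding H1_dual_def by blast
  have "\<bar>c * \<phi> M\<bar> \<le> (\<bar>c\<bar> * C) * H1_norm \<mu> M" if "M \<in> H1 \<mu> F" for M
    using C that by (simp add: abs_mult mult.assoc mult_left_mono)
  then show ?thesis using assms by (auto simp: H1_dual_def distrib_left intro!: exI[of _ "\<bar>c\<bar> * C"])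
qed

lemma H1_dual_zero: "(0 :: ('x, 'e::banach) process \<Rightarrow> real) \<in> H1_dual \<mu> F"
  by (auto simp: H1_dual_def intro!: exI[of _ 0])

text \<open>Restricted to the dual because the points of a product topology are extensional
  functions on the index set.\<close>

definition evaluation :: "('x, 'e::banach) process \<Rightarrow> (('x, 'e) process \<Rightarrow> real) \<Rightarrow> real" where
  "evaluation M = restrict (\<lambda>\<phi>. \<phi> M) (H1_dual \<mu> F)"

abbreviation bidual_topology :: "((('x, 'e::banach) process \<Rightarrow> real) \<Rightarrow> real) topology" where
  "bidual_topology \<equiv> product_topology (\<lambda>_. euclideanreal) (H1_dual \<mu> F)"

lemma evaluation_topspace: "evaluation M \<in> topspace bidual_topology"
  by (simp add: evaluation_def)

lemma continuous_evaluation: "continuous_map (H1_weak_topology \<mu> F) bidual_topology (evaluation :: ('x, 'e::banach) process \<Rightarrow> _)"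
  unfolding continuous_map_componentwise
proof (intro conjI ballI)
  show "(evaluation :: ('x, 'e) process \<Rightarrow> _) ` topspace (H1_weak_topology \<mu> F) \<subseteq> extensional (H1_dual \<mu> F)"
    by (auto simp: evaluation_def)
  fix \<phi> :: "('x, 'e) process \<Rightarrow> real" assume \<phi>: "\<phi> \<in> H1_dual \<mu> F"
  show "continuous_map (H1_weak_topology \<mu> F) euclideanreal (\<lambda>M. evaluation M \<phi>)"
    unfolding continuous_map_def
  proof (intro conjI strip)
    fix U :: "real set" assume "openin euclideanreal U"
    then have "{M \<in> H1 \<mu> F. \<phi> M \<in> U} \<in> {{M \<in> H1 \<mu> F. \<phi> M \<in> U} | \<phi> U. \<phi> \<in> H1_dual \<mu> F \<and> open U}"
      using \<phi> by auto
    then have "openin (H1_weak_topology \<mu> F) {M \<in> H1 \<mu> F. \<phi> M \<in> U}"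
      unfolding H1_weak_topology_def by (rule topology_generated_by_Basis)
    then show "openin (H1_weak_topology \<mu> F) {M \<in> topspace (H1_weak_topology \<mu> F). evaluation M \<phi> \<in> U}"
      using \<phi> by (simp add: topspace_H1_weak_topology evaluation_def)
  qed simp
qed

text \<open>With \<open>continuous_evaluation\<close> this makes the weak topology the initial one
  for \<open>evaluation\<close>. Open sets are pulled back because \<open>evaluation\<close>
  identifies indistinguishable processes and so is not an embedding in general.\<close>

lemma weakly_open_pullback:
  fixes U :: "('x, 'e::banach) process set"
  assumes "openin (H1_weak_topology \<mu> F) U"
  shows "\<exists>V. openin bidual_topology V \<and> U = {M \<in> H1 \<mu> F. evaluation M \<in> V}"
proof -
  have "generate_topology_on {{M \<in> H1 \<mu> F. \<phi> M \<in> U} | \<phi> U. \<phi> \<in> H1_dual \<mu> F \<and> open U} U"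
    using assms unfolding H1_weak_topology_def openin_topology_generated_by_iff .
  then show ?thesis
  proof induction
    case Empty
    show ?case by (intro exI[of _ "{}"]) simp
  next
    case (Int a b)
    then obtain V V' where "openin bidual_topology V \<and> a = {M \<in> H1 \<mu> F. evaluation M \<in> V}"
      "openin bidual_topology V' \<and> b = {M \<in> H1 \<mu> F. evaluation M \<in> V'}" by blast
    then show ?case by (intro exI[of _ "V \<inter> V'"]) auto
  next
    case (UN K)
    from UN(2) have "\<forall>k\<in>K. \<exists>V. openin bidual_topology V \<and> k = {M \<in> H1 \<mu> F. evaluation M \<in> V}" by blast
    then obtain V where V: "\<And>k. k \<in> K \<Longrightarrow> openin bidual_topology (V k)" "\<And>k. k \<in> K \<Longrightarrow> k = {M \<in> H1 \<mu> F. evaluation M \<in> V k}"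
      unfolding bchoice_iff by blast
    then have "\<Union>K = {M \<in> H1 \<mu> F. evaluation M \<in> (\<Union>k\<in>K. V k)}" by blast
    moreover have "openin bidual_topology (\<Union>k\<in>K. V k)" using V by auto
    ultimately show ?case by blast
  next
    case (Basis s)
    then obtain \<phi> T where s: "s = {M \<in> H1 \<mu> F. \<phi> M \<in> T}" "\<phi> \<in> H1_dual \<mu> F" "open T" by blast
    have "openin bidual_topology {f \<in> topspace bidual_topology. f \<phi> \<in> T}"
      by (rule openin_continuous_map_preimage[OF continuous_map_product_projection[OF s(2)]]) (use s(3) in simp)
    moreover have "s = {M \<in> H1 \<mu> F. evaluation M \<in> {f \<in> topspace bidual_topology. f \<phi> \<in> T}}"
      using s(1,2) evaluation_topspace by (auto simp: evaluation_def)
    ultimately show ?case by blast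
  qed
qed

text \<open>The closure in the product of the images under evaluation is compact by Tychonoff's theorem, so
  relative weak compactness means that all its points are evaluations.\<close>

lemma relatively_weakly_compactI:
  fixes S :: "('x, 'e::banach) process set"
  assumes S: "S \<subseteq> H1 \<mu> F" and bnd: "\<And>\<phi>. \<phi> \<in> H1_dual \<mu> F \<Longrightarrow> \<exists>C. \<forall>M\<in>S. \<bar>\<phi> M\<bar> \<le> C"
    and rep: "\<And>\<Psi>. \<Psi> \<in> bidual_topology closure_of (evaluation ` S) \<Longrightarrow> \<exists>M\<in>H1 \<mu> F. evaluation M = \<Psi>"
  shows "relatively_weakly_compact \<mu> F S"
proof -
  let ?W = "H1_weak_topology \<mu> F :: ('x, 'e) process topology"
  let ?C = "bidual_topology closure_of (evaluation ` S)"
  obtain b where b: "\<And>\<phi> M. \<phi> \<in> H1_dual \<mu> F \<Longrightarrow> M \<in> S \<Longrightarrow> \<bar>\<phi> M\<bar> \<le> b \<phi>" using bnd by metis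
  let ?P = "PiE (H1_dual \<mu> F) (\<lambda>\<phi>. {- b \<phi>..b \<phi>})"
  have P: "compactin bidual_topology ?P" unfolding compactin_PiE by simp
  have "closedin bidual_topology ?P" unfolding closedin_product_topology by simp
  moreover have "evaluation ` S \<subseteq> ?P" using b by (force simp: evaluation_def abs_le_iff)
  ultimately have "?C \<subseteq> ?P" by (intro closure_of_minimal)
  then have C: "compactin bidual_topology ?C" by (intro closed_compactin[OF P _ closedin_closure_of])
  \<comment> \<open>The full preimage of the closure. It is weakly closed and contains
    \<open>S\<close>, hence the weak closure of \<open>S\<close>; it inherits compactness because
    every point of the closure is attained.\<close>
  define K where "K = {M \<in> topspace ?W. evaluation M \<in> ?C}"
  have "compactin ?W K"
    unfolding compactin_def
  proof (intro conjI allI impI)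
    show "K \<subseteq> topspace ?W" by (auto simp: K_def)
    fix \<U> assume U: "Ball \<U> (openin ?W) \<and> K \<subseteq> \<Union>\<U>"
    then have "\<forall>U\<in>\<U>. \<exists>V. openin bidual_topology V \<and> U = {M \<in> H1 \<mu> F. evaluation M \<in> V}"
      using weakly_open_pullback by blast
    then obtain V where V: "\<And>U. U \<in> \<U> \<Longrightarrow> openin bidual_topology (V U)" "\<And>U. U \<in> \<U> \<Longrightarrow> U = {M \<in> H1 \<mu> F. evaluation M \<in> V U}"
      unfolding bchoice_iff by blast
    have "?C \<subseteq> \<Union>(V ` \<U>)"
    proof
      fix \<Psi> assume \<Psi>: "\<Psi> \<in> ?C"
      then obtain M where M: "M \<in> H1 \<mu> F" "evaluation M = \<Psi>" using rep by blast
      then have "M \<in> K" using \<Psi> by (simp add: K_def topspace_H1_weak_topology)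
      then obtain U where "U \<in> \<U>" "M \<in> U" using U by blast
      then show "\<Psi> \<in> \<Union>(V ` \<U>)" using V(2) M(2) by blast
    qed
    moreover have "\<forall>B\<in>V ` \<U>. openin bidual_topology B" using V(1) by blast
    ultimately obtain \<F>' where F': "finite \<F>'" "\<F>' \<subseteq> V ` \<U>" "?C \<subseteq> \<Union>\<F>'"
      using C unfolding compactin_def by meson
    then obtain \<F> where \<F>: "finite \<F>" "\<F> \<subseteq> \<U>" "\<F>' = V ` \<F>" using finite_subset_image by metis
    have "K \<subseteq> \<Union>\<F>"
    proof
      fix M assume M: "M \<in> K"
      then have "evaluation M \<in> \<Union>(V ` \<F>)" using F'(3) \<F>(3) by (auto simp: K_def)
      then obtain U where "U \<in> \<F>" "evaluation M \<in> V U" by blast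
      moreover have "M \<in> H1 \<mu> F" using M by (simp add: K_def topspace_H1_weak_topology)
      ultimately show "M \<in> \<Union>\<F>" using V(2) \<F>(2) by blast
    qed
    then show "\<exists>\<F>. finite \<F> \<and> \<F> \<subseteq> \<U> \<and> K \<subseteq> \<Union>\<F>" using \<F> by blast
  qed
  moreover have "?W closure_of S \<subseteq> K"
  proof (rule closure_of_minimal)
    have "evaluation ` S \<subseteq> ?C"
      using evaluation_topspace by (intro closure_of_subset) auto
    then show "S \<subseteq> K" using S by (auto simp: K_def topspace_H1_weak_topology)
    show "closedin ?W K"
      unfolding K_def by (rule closedin_continuous_map_preimage[OF continuous_evaluation]) simp
  qed
  ultimately have "compactin ?W (?W closure_of S)" by (rule closed_compactin[OF _ _ closedin_closure_of])
  then show ?thesis using S by (simp add: relatively_weakly_compact_def)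
qed

lemma closure_evaluation_near:
  fixes N :: "nat \<Rightarrow> ('x, 'e::banach) process"
  assumes \<Psi>: "\<Psi> \<in> bidual_topology closure_of (evaluation ` range N)"
    and \<Phi>: "finite \<Phi>" "\<Phi> \<subseteq> H1_dual \<mu> F" and \<epsilon>: "0 < \<epsilon>"
  shows "\<exists>k. \<forall>\<phi>\<in>\<Phi>. \<bar>\<phi> (N k) - \<Psi> \<phi>\<bar> < \<epsilon>"
proof -
  \<comment> \<open>The intersection with the whole space takes care of an empty
    \<open>\<Phi>\<close>.\<close>
  let ?T = "topspace bidual_topology \<inter> (\<Inter>\<phi>\<in>\<Phi>. {f \<in> topspace bidual_topology. f \<phi> \<in> ball (\<Psi> \<phi>) \<epsilon>})"
  have "openin bidual_topology {f \<in> topspace bidual_topology. f \<phi> \<in> ball (\<Psi> \<phi>) \<epsilon>}" if "\<phi> \<in> \<Phi>" for \<phi>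
    using that \<Phi>(2) by (intro openin_continuous_map_preimage[OF continuous_map_product_projection]) auto
  then have op: "openin bidual_topology ?T"
    using \<Phi>(1) by (cases "\<Phi> = {}") (simp_all only: INT_empty Int_UNIV_right image_empty Inter_empty openin_topspace openin_Int openin_INT2 openin_topspace not_False_eq_True ball_simps)
  have cl: "\<Psi> \<in> topspace bidual_topology"
    "\<forall>T. \<Psi> \<in> T \<and> openin bidual_topology T \<longrightarrow> (\<exists>y. y \<in> evaluation ` range N \<and> y \<in> T)"
    using \<Psi>[unfolded in_closure_of] by (rule conjunct1, rule conjunct2)
  have "\<Psi> \<in> ?T" using cl(1) \<epsilon> by simp
  from cl(2)[rule_format, OF conjI[OF this op]] obtain k where k: "evaluation (N k) \<in> ?T" by blast
  show ?thesis
  proof (intro exI ballI)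
    fix \<phi> assume "\<phi> \<in> \<Phi>"
    moreover from this have "\<phi> \<in> H1_dual \<mu> F" using \<Phi>(2) by blast
    ultimately show "\<bar>\<phi> (N k) - \<Psi> \<phi>\<bar> < \<epsilon>"
      using k by (force simp: evaluation_def dist_real_def abs_minus_commute)
  qed
qed

end

text \<open>A closure point \<open>\<Psi>\<close> is linear, since finitely many coordinates are
  approximated at one common index. Hence the sequences of values \<open>\<phi> (N k)\<close>,
  paired with \<open>\<Psi> \<phi>\<close>, form a subspace, and the same approximation is the
  condition under which a generalized limit with these values exists.\<close>

theorem (in UI_martingales) UI_relatively_weakly_compact:
  assumes "reflexive_space TYPE('e)"
  shows "relatively_weakly_compact \<mu> F (range N)"
proof (rule relatively_weakly_compactI)
  show "range N \<subseteq> H1 \<mu> F" using N by auto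
  show "\<exists>C. \<forall>M\<in>range N. \<bar>\<phi> M\<bar> \<le> C" if "\<phi> \<in> H1_dual \<mu> F" for \<phi>
    using dual_bounded[OF that] by (auto simp: bounded_iff)
  fix \<Psi> assume \<Psi>: "\<Psi> \<in> bidual_topology closure_of (evaluation ` range N)"
  let ?D = "H1_dual \<mu> F :: (('x, 'e) process \<Rightarrow> real) set"
  have add: "\<Psi> (\<phi> + \<psi>) = \<Psi> \<phi> + \<Psi> \<psi>" if "\<phi> \<in> ?D" "\<psi> \<in> ?D" for \<phi> \<psi>
  proof -
    have "\<bar>\<Psi> (\<phi> + \<psi>) - (\<Psi> \<phi> + \<Psi> \<psi>)\<bar> \<le> 0 + e" if "0 < e" for e
    proof -
      obtain k where "\<forall>\<theta>\<in>{\<phi>, \<psi>, \<phi> + \<psi>}. \<bar>\<theta> (N k) - \<Psi> \<theta>\<bar> < e / 3"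
        using closure_evaluation_near[OF \<Psi>, of "{\<phi>, \<psi>, \<phi> + \<psi>}" "e / 3"] \<open>\<phi> \<in> ?D\<close> \<open>\<psi> \<in> ?D\<close> H1_dual_add[OF \<open>\<phi> \<in> ?D\<close> \<open>\<psi> \<in> ?D\<close>] \<open>0 < e\<close> by auto
      then have "\<bar>\<phi> (N k) - \<Psi> \<phi>\<bar> < e / 3" "\<bar>\<psi> (N k) - \<Psi> \<psi>\<bar> < e / 3" "\<bar>(\<phi> (N k) + \<psi> (N k)) - \<Psi> (\<phi> + \<psi>)\<bar> < e / 3"
        by force+
      then show ?thesis by linarith
    qed
    from field_le_epsilon[OF this] show ?thesis by simp
  qed
  have scale: "\<Psi> (c *\<^sub>R \<phi>) = c * \<Psi> \<phi>" if \<phi>: "\<phi> \<in> ?D" for c \<phi>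
  proof -
    have "\<bar>\<Psi> (c *\<^sub>R \<phi>) - c * \<Psi> \<phi>\<bar> \<le> 0 + e" if e: "0 < e" for e
    proof -
      define r where "r = e / (2 * (\<bar>c\<bar> + 1))"
      have r: "0 < r" using e by (simp add: r_def)
      obtain k where "\<forall>\<theta>\<in>{\<phi>, c *\<^sub>R \<phi>}. \<bar>\<theta> (N k) - \<Psi> \<theta>\<bar> < r"
        using closure_evaluation_near[OF \<Psi>, of "{\<phi>, c *\<^sub>R \<phi>}" r] \<phi> H1_dual_scaleR[OF \<phi>] r by auto
      then have k: "\<bar>\<phi> (N k) - \<Psi> \<phi>\<bar> < r" "\<bar>c * \<phi> (N k) - \<Psi> (c *\<^sub>R \<phi>)\<bar> < r" by force+
      have "\<bar>c * \<phi> (N k) - c * \<Psi> \<phi>\<bar> = \<bar>c\<bar> * \<bar>\<phi> (N k) - \<Psi> \<phi>\<bar>" by (simp flip: right_diff_distrib abs_mult)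
      also have "\<dots> \<le> \<bar>c\<bar> * r" using k(1) by (intro mult_left_mono) auto
      finally have "\<bar>\<Psi> (c *\<^sub>R \<phi>) - c * \<Psi> \<phi>\<bar> \<le> (\<bar>c\<bar> + 1) * r" using k(2) by (simp add: distrib_right)
      also have "\<dots> = e / 2" using abs_ge_zero[of c] by (simp add: r_def field_simps)
      finally show ?thesis using e by simp
    qed
    from field_le_epsilon[OF this] show ?thesis by simp
  qed
  define G where "G = (\<lambda>\<phi>. (\<lambda>k. \<phi> (N k), \<Psi> \<phi>)) ` ?D"
  have "subspace G"
  proof (rule subspaceI)
    have "\<Psi> 0 = 0" using scale[OF H1_dual_zero, of 0] by simp
    then show "0 \<in> G" unfolding G_def using H1_dual_zero by (auto simp: zero_prod_def zero_fun_def image_iff intro!: bexI[of _ 0])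
    fix g h assume "g \<in> G" "h \<in> G"
    then obtain \<phi> \<psi> where \<phi>: "\<phi> \<in> ?D" "g = (\<lambda>k. \<phi> (N k), \<Psi> \<phi>)" and \<psi>: "\<psi> \<in> ?D" "h = (\<lambda>k. \<psi> (N k), \<Psi> \<psi>)" by (auto simp: G_def)
    have "g + h = (\<lambda>k. (\<phi> + \<psi>) (N k), \<Psi> (\<phi> + \<psi>))" by (simp add: \<phi> \<psi> add) (simp add: plus_fun_def)
    then show "g + h \<in> G" unfolding G_def using H1_dual_add[OF \<phi>(1) \<psi>(1)] by blast
  next
    fix c g assume "g \<in> G"
    then obtain \<phi> where \<phi>: "\<phi> \<in> ?D" "g = (\<lambda>k. \<phi> (N k), \<Psi> \<phi>)" by (auto simp: G_def)
    have "c *\<^sub>R g = (\<lambda>k. (c *\<^sub>R \<phi>) (N k), \<Psi> (c *\<^sub>R \<phi>))" by (simp add: \<phi> scale) (simp add: scaleR_fun_def)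
    then show "c *\<^sub>R g \<in> G" unfolding G_def using H1_dual_scaleR[OF \<phi>(1)] by blast
  qed
  moreover have "bounded (range u)" if "(u, a) \<in> G" for u a using that dual_bounded by (auto simp: G_def)
  moreover have "\<exists>k. \<bar>u k - a\<bar> < \<epsilon>" if ua: "(u, a) \<in> G" and \<epsilon>: "0 < \<epsilon>" for u a \<epsilon>
  proof -
    obtain \<phi> where \<phi>: "\<phi> \<in> ?D" "u = (\<lambda>k. \<phi> (N k))" "a = \<Psi> \<phi>" using ua by (auto simp: G_def)
    obtain k where "\<forall>\<theta>\<in>{\<phi>}. \<bar>\<theta> (N k) - \<Psi> \<theta>\<bar> < \<epsilon>"
      using closure_evaluation_near[OF \<Psi>, of "{\<phi>}" \<epsilon>] \<phi>(1) \<epsilon> by auto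
    then show ?thesis using \<phi> by auto
  qed
  ultimately obtain L where L: "generalized_limit L" "\<And>u a. (u, a) \<in> G \<Longrightarrow> L u = a"
    using generalized_limit_extends by metis
  obtain M where M: "M \<in> H1 \<mu> F" "\<And>\<phi>. \<phi> \<in> ?D \<Longrightarrow> L (\<lambda>k. \<phi> (N k)) = \<phi> M"
    using weak_limit_in_H1[OF assms L(1)] by metis
  have "\<Psi> \<in> extensional ?D" using \<Psi> closure_of_subset_topspace[of bidual_topology] by (auto simp: PiE_def)
  moreover have "\<phi> M = \<Psi> \<phi>" if "\<phi> \<in> ?D" for \<phi>
    using M(2)[OF that] L(2)[of "\<lambda>k. \<phi> (N k)" "\<Psi> \<phi>"] that by (auto simp: G_def)
  ultimately have "evaluation M = \<Psi>"
    by (intro extensionalityI[of _ ?D]) (auto simp: evaluation_def)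
  then show "\<exists>M\<in>H1 \<mu> F. evaluation M = \<Psi>" using M(1) by blast
qed

section \<open>Truncation at hitting times\<close>

lemma strict_mono_selection:
  assumes "\<And>k::nat. \<exists>n. \<forall>j\<ge>n. P k j"
  obtains s :: "nat \<Rightarrow> nat" where "strict_mono s" "\<And>k. P k (s k)"
proof -
  obtain n where n: "\<And>k j. n k \<le> j \<Longrightarrow> P k j" using assms by metis
  define s where "s = rec_nat (n 0) (\<lambda>k m. max (Suc m) (n (Suc k)))"
  have Suc: "s (Suc k) = max (Suc (s k)) (n (Suc k))" for k by (simp add: s_def)
  show ?thesis
  proof (rule that[of s])
    show "strict_mono s" unfolding strict_mono_Suc_iff by (simp add: Suc less_max_iff_disj)
    show "P k (s k)" for k by (rule n, cases k) (simp_all add: s_def)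
  qed
qed

text \<open>Up to finitely many terms the diagonal sequence is a subsequence of each of the nested
  choices.\<close>

lemma diagonal_convergent_subsequence:
  fixes G :: "nat \<Rightarrow> nat \<Rightarrow> real"
  assumes bnd: "\<And>n m. \<bar>G n m\<bar> \<le> C"
  obtains d g where "strict_mono (d :: nat \<Rightarrow> nat)" "\<And>m. (\<lambda>k. G (d k) m) \<longlonglongrightarrow> g m"
proof -
  interpret D: subseqs "\<lambda>m s. convergent (\<lambda>k. G (s k) m)"
  proof
    fix m and s :: "nat \<Rightarrow> nat" assume "strict_mono s"
    have "bounded (range (\<lambda>k. G (s k) m))" using bnd by (auto simp: bounded_iff)
    then obtain l r where "strict_mono r" "((\<lambda>k. G (s k) m) \<circ> r) \<longlonglongrightarrow> l"
      using bounded_imp_convergent_subsequence by blast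
    then show "\<exists>r. strict_mono r \<and> convergent (\<lambda>k. G ((s \<circ> r) k) m)"
      by (auto simp: comp_def convergent_def)
  qed
  have "convergent (\<lambda>k. G (D.diagseq k) m)" for m
  proof -
    have "convergent (\<lambda>k. G ((D.diagseq \<circ> (+) (Suc m)) k) m)"
    proof (rule D.diagseq_holds)
      show "convergent (\<lambda>k. G ((s \<circ> r) k) n)"
        if r: "strict_mono r" and c: "convergent (\<lambda>k. G (s k) n)" for r s :: "nat \<Rightarrow> nat" and n
        using convergent_subseq_convergent[OF c r] by (simp add: comp_def)
    qed
    then obtain l where "(\<lambda>k. G (D.diagseq (k + Suc m)) m) \<longlonglongrightarrow> l" by (auto simp: convergent_def add.commute)
    then show ?thesis using LIMSEQ_offset convergent_def by blast
  qed
  then show ?thesis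
    by (intro that[OF D.subseq_diagseq, of "\<lambda>m. lim (\<lambda>k. G (D.diagseq k) m)"]) (simp only: convergent_LIMSEQ_iff)
qed

context finite_complete_measure
begin

text \<open>The limits \<open>g m\<close> of the truncated means increase to a finite
  \<open>l\<close>. The index \<open>r k\<close> is taken so late that the means are within
  \<open>1 / Suc k\<close> of \<open>g m\<close> for all \<open>m \<le> c k\<close>. The mean of the
  part between a fixed level \<open>m\<close> and \<open>c k\<close> is then at most
  \<open>l - g m\<close> plus two such errors, so for large \<open>m\<close> and \<open>k\<close> no
  mass escapes.\<close>

lemma truncated_subsequence_UI:
  fixes Y :: "nat \<Rightarrow> 'x \<Rightarrow> real" and c :: "nat \<Rightarrow> nat"
  assumes Y: "\<And>n. integrable M (Y n)" "\<And>n x. 0 \<le> Y n x" "\<And>n. (\<integral>x. Y n x \<partial>M) \<le> C"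
    and c: "\<And>k. k \<le> c k" "mono c"
  obtains r where "strict_mono r"
    "\<And>\<epsilon>. 0 < \<epsilon> \<Longrightarrow> \<exists>\<delta>>0. \<forall>k. \<forall>A\<in>sets M. measure M A \<le> \<delta> \<longrightarrow>
      indicator_integral M A (\<lambda>x. min (Y (r k) x) (real (c k))) \<le> \<epsilon>"
proof -
  define G where "G = (\<lambda>n (m::nat). \<integral>x. min (Y n x) (real m) \<partial>M)"
  have int: "integrable M (\<lambda>x. min (Y n x) (real m))" for n and m :: nat
    using Y(1) by (intro integrable_min) auto
  have G_mono: "G n m \<le> G n m'" if "m \<le> m'" for n m m'
    unfolding G_def using that by (intro integral_mono int) auto
  have G_C: "G n m \<le> C" for n m
  proof -
    have "G n m \<le> (\<integral>x. Y n x \<partial>M)" unfolding G_def by (intro integral_mono int Y) auto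
    then show ?thesis using Y(3)[of n] by simp
  qed
  have "0 \<le> G n m" for n m unfolding G_def using Y(2) by (intro Bochner_Integration.integral_nonneg) simp
  then have Gb: "\<bar>G n m\<bar> \<le> C" for n m using G_C by simp
  obtain d g where d: "strict_mono (d :: nat \<Rightarrow> nat)" "\<And>m. (\<lambda>k. G (d k) m) \<longlonglongrightarrow> g m"
    by (rule diagonal_convergent_subsequence[of G C, OF Gb]) blast
  \<comment> \<open>For each \<open>k\<close> only finitely many levels are involved, so one index
    serves all of them.\<close>
  have "\<exists>n. \<forall>j\<ge>n. \<forall>m\<le>c k. \<bar>G (d j) m - g m\<bar> < 1 / real (Suc k)" for k
  proof -
    have "\<forall>\<^sub>F j in sequentially. \<forall>m\<in>{..c k}. dist (G (d j) m) (g m) < 1 / real (Suc k)"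
      by (intro eventually_ball_finite ballI tendstoD[OF d(2)]) auto
    then show ?thesis by (auto simp: eventually_sequentially dist_real_def)
  qed
  then obtain s where s: "strict_mono s" "\<And>k. \<forall>m\<le>c k. \<bar>G (d (s k)) m - g m\<bar> < 1 / real (Suc k)"
    using strict_mono_selection[of "\<lambda>k j. \<forall>m\<le>c k. \<bar>G (d j) m - g m\<bar> < 1 / real (Suc k)"] by metis
  define r where "r = d \<circ> s"
  have near: "\<bar>G (r k) m - g m\<bar> < 1 / real (Suc k)" if "m \<le> c k" for k m using s(2) that by (simp add: r_def)
  have g_mono: "mono g"
    by (intro monoI LIMSEQ_le[OF d(2) d(2)]) (use G_mono in auto)
  have "g m \<le> C" for m by (rule LIMSEQ_le_const2[OF d(2)]) (use G_C in auto)
  then obtain l where l: "g \<longlonglongrightarrow> l" "\<And>m. g m \<le> l"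
    using incseq_convergent[of g C] g_mono by auto
  show ?thesis
  proof (rule that)
    show "strict_mono r" unfolding r_def using d(1) s(1) by (rule strict_mono_o)
    fix \<epsilon> :: real assume \<epsilon>: "0 < \<epsilon>"
    \<comment> \<open>Three errors of size \<open>\<epsilon> / 6\<close>, one from \<open>l\<close>
      and two from the choice of the index, leave \<open>\<epsilon> / 2\<close> for the truncation
      at the fixed level.\<close>
    obtain m where m: "l - \<epsilon> / 6 < g m"
      using order_tendstoD(1)[OF l(1), of "l - \<epsilon> / 6"] \<epsilon> by (auto simp: eventually_sequentially)
    obtain K0 where K0: "1 / real (Suc K0) < \<epsilon> / 6"
      using reals_Archimedean[of "\<epsilon> / 6"] \<epsilon> by (auto simp: inverse_eq_divide)
    define K where "K = max m K0"
    \<comment> \<open>Exceeds the fixed level \<open>m\<close> and also the levels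
      \<open>c k\<close> for the finitely many \<open>k < K\<close>, to which the asymptotic
      argument does not apply.\<close>
    define b where "b = real m + real (c K) + 1"
    have b: "b > 0" by (simp add: b_def)
    show "\<exists>\<delta>>0. \<forall>k. \<forall>A\<in>sets M. measure M A \<le> \<delta> \<longrightarrow>
      indicator_integral M A (\<lambda>x. min (Y (r k) x) (real (c k))) \<le> \<epsilon>"
    proof (intro exI[of _ "\<epsilon> / 2 / b"] conjI allI ballI impI)
      show "0 < \<epsilon> / 2 / b" using \<epsilon> b by simp
      fix k A assume A: "A \<in> sets M" "measure M A \<le> \<epsilon> / 2 / b"
      let ?W = "\<lambda>m x. min (Y (r k) x) (real m)"
      have A': "b * measure M A \<le> \<epsilon> / 2" using A(2) b by (simp add: field_simps)
      have const: "indicator_integral M A (?W j) \<le> \<epsilon> / 2" if "real j \<le> b" for j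
      proof -
        have "indicator_integral M A (?W j) \<le> indicator_integral M A (\<lambda>x. b)"
          using that by (intro indicator_integral_mono A int) (auto intro!: AE_I2 min.coboundedI2)
        also have "\<dots> = b * measure M A" by (rule indicator_integral_const[OF A(1)])
        finally show ?thesis using A' by simp
      qed
      show "indicator_integral M A (?W (c k)) \<le> \<epsilon>"
      proof (cases "K \<le> k")
        case False
        then have "c k \<le> c K" using monoD[OF c(2), of k K] by simp
        then have "real (c k) \<le> b" by (simp add: b_def)
        then show ?thesis using const[of "c k"] \<epsilon> by linarith
      next
        case True
        then have mc: "m \<le> c k" using c(1)[of k] by (simp add: K_def)
        have "1 / real (Suc k) \<le> 1 / real (Suc K0)" using True unfolding K_def by (simp add: frac_le)
        then have k: "1 / real (Suc k) < \<epsilon> / 6" using K0 by linarith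
        have "indicator_integral M A (?W (c k)) - indicator_integral M A (?W m) = indicator_integral M A (\<lambda>x. ?W (c k) x - ?W m x)"
          by (simp add: indicator_integral_diff[OF A(1) int int])
        also have "\<dots> \<le> (\<integral>x. ?W (c k) x - ?W m x \<partial>M)"
          using mc by (intro indicator_integral_le_integral A Bochner_Integration.integrable_diff int) (auto intro!: AE_I2)
        also have "\<dots> = G (r k) (c k) - G (r k) m" by (simp add: G_def int)
        also have "\<dots> \<le> \<epsilon> / 2" using near[of "c k" k] near[OF mc] l(2)[of "c k"] m k by linarith
        finally show ?thesis using const[of m] by (simp add: b_def)
      qed
    qed
  qed
qed

end

section \<open>Hitting times\<close>

text \<open>Entrance into an open set: by right-continuity a norm above \<open>c\<close> persists
  for a while, so a hit before time \<open>u\<close> is visible at rational times. The infimum of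
  the empty set is infinite.\<close>

definition hitting_time :: "('x, 'e::banach) process \<Rightarrow> real \<Rightarrow> 'x \<Rightarrow> ennreal" where
  "hitting_time M c x = Inf {ennreal t | t. 0 \<le> t \<and> c < norm (M t x)}"

lemma hitting_time_before:
  assumes "0 \<le> t" "ennreal t < hitting_time M c x" shows "norm (M t x) \<le> c"
proof (rule ccontr)
  assume "\<not> norm (M t x) \<le> c"
  then have "hitting_time M c x \<le> ennreal t"
    unfolding hitting_time_def using assms(1) by (intro Inf_lower) auto
  with assms(2) show False by simp
qed

lemma hitting_time_less_iff:
  "hitting_time M c x < u \<longleftrightarrow> (\<exists>t\<ge>0. ennreal t < u \<and> c < norm (M t x))"
  unfolding hitting_time_def Inf_less_iff by auto

context stochastic_basis
begin

lemma hitting_time_less_set: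
  fixes M :: "('x, 'e::banach) process"
  assumes "cadlag \<mu> M" "0 \<le> u"
  shows "{x \<in> space \<mu>. hitting_time M c x < ennreal u} =
    (\<Union>n\<in>{n. nonneg_rat n < u}. {x \<in> space \<mu>. c < norm (M (nonneg_rat n) x)})"
proof (intro equalityI subsetI)
  fix x assume x: "x \<in> {x \<in> space \<mu>. hitting_time M c x < ennreal u}"
  then obtain t where t: "0 \<le> t" "t < u" "c < norm (M t x)"
    by (auto simp: hitting_time_less_iff ennreal_less_iff)
  have "((\<lambda>s. norm (M s x)) \<longlongrightarrow> norm (M t x)) (at_right t)"
    using cadlag_right[OF assms(1) _ t(1), of x] x by (intro tendsto_norm) auto
  then have "\<forall>\<^sub>F s in at_right t. c < norm (M s x)" using t(3) by (rule order_tendstoD)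
  then obtain b where b: "b > t" "\<And>y. t < y \<Longrightarrow> y < b \<Longrightarrow> c < norm (M y x)" by (auto simp: eventually_at_right_field)
  obtain n where "t < nonneg_rat n" "nonneg_rat n < min b u"
    using nonneg_rat_dense[OF t(1), of "min b u"] b t(2) by auto
  then show "x \<in> (\<Union>n\<in>{n. nonneg_rat n < u}. {x \<in> space \<mu>. c < norm (M (nonneg_rat n) x)})"
    using b(2)[of "nonneg_rat n"] x by auto
next
  fix x assume "x \<in> (\<Union>n\<in>{n. nonneg_rat n < u}. {x \<in> space \<mu>. c < norm (M (nonneg_rat n) x)})"
  then obtain n where "nonneg_rat n < u" "x \<in> space \<mu>" "c < norm (M (nonneg_rat n) x)" by blast
  then show "x \<in> {x \<in> space \<mu>. hitting_time M c x < ennreal u}"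
    using nonneg_rat_nonneg[of n] by (auto simp: hitting_time_less_iff ennreal_less_iff)
qed

lemma hitting_time_less_measurable:
  fixes M :: "('x, 'e::banach) process"
  assumes "cadlag \<mu> M" "adapted \<mu> F M" "0 \<le> u"
  shows "{x \<in> space \<mu>. hitting_time M c x < ennreal u} \<in> sets (F u)"
  unfolding hitting_time_less_set[OF assms(1,3)]
proof (rule sets.countable_UN'')
  fix n assume "n \<in> {n. nonneg_rat n < u}"
  then have n: "0 \<le> nonneg_rat n" "nonneg_rat n \<le> u" using nonneg_rat_nonneg by auto
  have "(\<lambda>x. norm (M (nonneg_rat n) x)) \<in> borel_measurable (F (nonneg_rat n))"
    using assms(2) n(1) by (intro norm_measurable_F) (auto simp: adapted_def)
  then have "{x \<in> space (F (nonneg_rat n)). c < norm (M (nonneg_rat n) x)} \<in> sets (F (nonneg_rat n))" by measurable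
  then show "{x \<in> space \<mu>. c < norm (M (nonneg_rat n) x)} \<in> sets (F u)"
    using F_mono[OF n] space_F[OF n(1)] by auto
qed auto

text \<open>The event is a countable intersection of strict events at times tending to
  \<open>t\<close> from above, all of them in \<open>F s\<close> for any given \<open>s > t\<close>;
  right-continuity of the filtration brings it down to \<open>F t\<close>.\<close>

lemma hitting_time_le_measurable:
  fixes M :: "('x, 'e::banach) process"
  assumes "cadlag \<mu> M" "adapted \<mu> F M" "0 \<le> t"
  shows "{x \<in> space \<mu>. hitting_time M c x \<le> ennreal t} \<in> sets (F t)"
  unfolding right_continuous[OF assms(3)]
proof (rule INT_I)
  fix s assume "s \<in> {t<..}"
  then have s: "t < s" by simp
  let ?u = "\<lambda>n. t + (s - t) / real (Suc n)"
  have u: "0 \<le> ?u n" "?u n \<le> s" "t < ?u n" for n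
  proof -
    have "(s - t) / real (Suc n) \<le> (s - t) / 1" using s by (intro divide_left_mono) auto
    then show "?u n \<le> s" by simp
    show "t < ?u n" using s by simp
    then show "0 \<le> ?u n" using assms(3) by linarith
  qed
  have "{x \<in> space \<mu>. hitting_time M c x \<le> ennreal t} = (\<Inter>n. {x \<in> space \<mu>. hitting_time M c x < ennreal (?u n)})"
  proof (intro equalityI subsetI INT_I)
    fix x n assume "x \<in> {x \<in> space \<mu>. hitting_time M c x \<le> ennreal t}"
    moreover have "ennreal t < ennreal (?u n)" using u(3)[of n] assms(3) by (simp add: ennreal_less_iff)
    ultimately show "x \<in> {x \<in> space \<mu>. hitting_time M c x < ennreal (?u n)}" by (auto intro: le_less_trans)
  next
    fix x assume x: "x \<in> (\<Inter>n. {x \<in> space \<mu>. hitting_time M c x < ennreal (?u n)})"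
    have "(\<lambda>n. t + (s - t) * (1 / real (Suc n))) \<longlonglongrightarrow> t + (s - t) * 0"
      by (intro tendsto_intros) (use LIMSEQ_inverse_real_of_nat in \<open>simp add: inverse_eq_divide\<close>)
    then have "?u \<longlonglongrightarrow> t" by simp
    then have "(\<lambda>n. ennreal (?u n)) \<longlonglongrightarrow> ennreal t" by (rule tendsto_ennrealI)
    then have "hitting_time M c x \<le> ennreal t"
      by (rule LIMSEQ_le_const) (use x in \<open>auto intro!: exI[of _ 0] less_imp_le simp del: of_nat_Suc\<close>)
    then show "x \<in> {x \<in> space \<mu>. hitting_time M c x \<le> ennreal t}" using x by simp
  qed
  moreover have "{x \<in> space \<mu>. hitting_time M c x < ennreal (?u n)} \<in> sets (F s)" for n
    using hitting_time_less_measurable[OF assms(1,2) u(1)] F_mono[OF u(1,2)] by blast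
  ultimately show "{x \<in> space \<mu>. hitting_time M c x \<le> ennreal t} \<in> sets (F s)" by auto
qed

lemma hitting_time_stopping_time:
  fixes M :: "('x, 'e::banach) process"
  assumes "cadlag \<mu> M" "adapted \<mu> F M" shows "stopping_time_inf F (hitting_time M c)"
  unfolding stopping_time_inf_def pred_def
  using hitting_time_le_measurable[OF assms] by (simp add: space_F)

text \<open>The cap \<open>K\<close> makes the time bounded, as optional stopping requires. It will
  grow with the index of the sequence, so it does not affect the u.c.p. limit.\<close>

definition hitting_time_min :: "('x, 'e::banach) process \<Rightarrow> real \<Rightarrow> real \<Rightarrow> 'x \<Rightarrow> real" where
  "hitting_time_min M c K x = enn2real (min (hitting_time M c x) (ennreal K))"

lemma ennreal_hitting_time_min: "ennreal (hitting_time_min M c K x) = min (hitting_time M c x) (ennreal K)"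
  by (simp add: hitting_time_min_def less_top min_less_iff_disj)

lemma hitting_time_min_bounds: "0 \<le> K \<Longrightarrow> 0 \<le> hitting_time_min M c K x" "0 \<le> K \<Longrightarrow> hitting_time_min M c K x \<le> K"
proof -
  show nn: "0 \<le> hitting_time_min M c K x" by (simp add: hitting_time_min_def)
  assume "0 \<le> K"
  have "ennreal (hitting_time_min M c K x) \<le> ennreal K" by (simp add: ennreal_hitting_time_min)
  then show "hitting_time_min M c K x \<le> K" using \<open>0 \<le> K\<close> by (simp add: ennreal_le_iff)
qed

lemma bounded_stopping_time_hitting:
  fixes M :: "('x, 'e::banach) process"
  assumes "cadlag \<mu> M" "adapted \<mu> F M" "0 \<le> K" shows "bounded_stopping_time K (hitting_time_min M c K)"
  unfolding bounded_stopping_time_def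
proof (intro conjI ballI allI impI hitting_time_min_bounds assms(3))
  fix s :: real assume s: "0 \<le> s"
  have iff: "hitting_time_min M c K x \<le> s \<longleftrightarrow> hitting_time M c x \<le> ennreal s \<or> K \<le> s" for x
  proof -
    have "hitting_time_min M c K x \<le> s \<longleftrightarrow> ennreal (hitting_time_min M c K x) \<le> ennreal s"
      using s by (simp add: ennreal_le_iff)
    then show ?thesis using s by (simp add: ennreal_hitting_time_min min_le_iff_disj ennreal_le_iff)
  qed
  show "{x \<in> space \<mu>. hitting_time_min M c K x \<le> s} \<in> sets (F s)"
  proof (cases "K \<le> s")
    case True
    then show ?thesis using sets.top[of "F s"] by (simp add: iff space_F[OF s])
  next
    case False
    then show ?thesis using hitting_time_le_measurable[OF assms(1,2) s] by (simp add: iff)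
  qed
qed

text \<open>The class of sets of measure \<open>0\<close> or \<open>1\<close> is closed under
  complements and countable unions, so the dichotomy survives the generation of the \<sigma>-algebra
  from null sets.\<close>

lemma F_0_trivial: "A \<in> sets (F 0) \<Longrightarrow> measure \<mu> A = 0 \<or> measure \<mu> A = 1"
  unfolding sets_F_0
proof (induction rule: sigma_sets.induct)
  case (Basic a) then show ?case by (simp add: measure_eq_0_null_sets)
next
  case Empty show ?case by simp
next
  case (Compl a)
  then have "a \<in> sets (F 0)" by (simp add: sets_F_0)
  then show ?case using Compl.IH prob_compl[OF sets_F[OF order_refl]] by auto
next
  case (Union a)
  then have "a i \<in> sets (F 0)" for i by (simp add: sets_F_0)
  then have m: "a i \<in> sets \<mu>" for i by (rule sets_F[OF order_refl])
  show ?case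
  proof (cases "\<forall>i. measure \<mu> (a i) = 0")
    case True
    then have "a i \<in> null_sets \<mu>" for i using m by (simp add: emeasure_eq_measure null_setsI)
    then have "(\<Union>i. a i) \<in> null_sets \<mu>" by (rule null_sets_UN)
    then show ?thesis by (simp add: measure_eq_0_null_sets)
  next
    case False
    then obtain i where "measure \<mu> (a i) = 1" using Union.IH by blast
    moreover have "measure \<mu> (a i) \<le> measure \<mu> (\<Union>i. a i)" using m by (intro finite_measure_mono) auto
    ultimately show ?thesis using prob_le_1[of "\<Union>i. a i"] by linarith
  qed
qed

text \<open>The event that the initial norm exceeds \<open>c\<close> has probability
  \<open>0\<close> or \<open>1\<close>, and probability \<open>1\<close> would force the mean of the
  maximal function up to \<open>c\<close>.\<close>

lemma H1_initial_bound:
  fixes M :: "('x, 'e::banach) process"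
  assumes M: "M \<in> H1 \<mu> F" and c: "(\<integral>x. enn2real (maximal_inf M x) \<partial>\<mu>) < c"
  shows "AE x in \<mu>. norm (M 0 x) \<le> c"
proof -
  define A where "A = {x \<in> space \<mu>. c < norm (M 0 x)}"
  have "(\<lambda>x. norm (M 0 x)) \<in> borel_measurable (F 0)"
    using H1_D(2)[OF M] by (intro norm_measurable_F) (auto simp: adapted_def)
  then have "{x \<in> space (F 0). c < norm (M 0 x)} \<in> sets (F 0)" by measurable
  then have A: "A \<in> sets (F 0)" by (simp add: A_def space_F)
  have "measure \<mu> A \<noteq> 1"
  proof
    assume "measure \<mu> A = 1"
    then have "AE x in \<mu>. x \<in> A" using sets_F[OF order_refl A] prob_eq_1 by blast
    then have "AE x in \<mu>. c \<le> enn2real (maximal_inf M x)"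
      using H1_maximal(3)[OF M] by eventually_elim (auto simp: A_def intro: order_trans less_imp_le)
    then have "(\<integral>x. c \<partial>\<mu>) \<le> (\<integral>x. enn2real (maximal_inf M x) \<partial>\<mu>)"
      by (intro integral_mono_AE H1_maximal(1)[OF M]) auto
    then show False using c by (simp add: prob_space)
  qed
  then have "measure \<mu> A = 0" using F_0_trivial[OF A] by blast
  then have "A \<in> null_sets \<mu>" using sets_F[OF order_refl A] by (simp add: emeasure_eq_measure null_setsI)
  then have "AE x in \<mu>. x \<notin> A" by (rule AE_not_in)
  then show ?thesis using AE_space by eventually_elim (auto simp: A_def)
qed

end

section \<open>Maximal functions of the stopped martingales and the u.c.p. remainder\<close>

text \<open>The value at \<open>T\<close> is the left limit plus the jump, and the left limit
  inherits the bound that holds before \<open>T\<close>. For \<open>T x = 0\<close> the separate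
  bound on \<open>M 0\<close> is used.\<close>

lemma norm_stopped_le_jump:
  fixes M :: "('x, 'e::banach) process"
  assumes M: "cadlag \<mu> M" and x: "x \<in> space \<mu>" and T: "T x \<noteq> \<infinity>" and b: "norm (M 0 x) \<le> b"
    and before: "\<And>t. 0 \<le> t \<Longrightarrow> ennreal t < T x \<Longrightarrow> norm (M t x) \<le> b"
  shows "norm (stopped M T x) \<le> b + norm (stopped_jump M T x)"
proof -
  define t where "t = enn2real (T x)"
  have t: "0 \<le> t" "ennreal t = T x" using T by (simp_all add: t_def less_top)
  have stopped: "stopped M T x = M t x" using T by (simp add: stopped_def t_def)
  show ?thesis
  proof (cases "t = 0")
    case True
    then show ?thesis using b by (simp add: stopped add_increasing2)
  next
    case False
    then have pos: "0 < t" using t(1) by simp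
    then obtain l where l: "((\<lambda>s. M s x) \<longlongrightarrow> l) (at_left t)" using M x unfolding cadlag_def by blast
    have "\<forall>\<^sub>F s in at_left t. norm (M s x) \<le> b"
      unfolding eventually_at_left_field
    proof (intro exI[of _ 0] conjI allI impI)
      fix s assume "0 < s" "s < t"
      then have "ennreal s < ennreal t" by (simp add: ennreal_less_iff)
      with \<open>0 < s\<close> show "norm (M s x) \<le> b" using before[of s] unfolding t(2) by simp
    qed (rule pos)
    then have "norm l \<le> b"
      by (intro tendsto_upperbound[OF tendsto_norm[OF l]]) (simp_all add: trivial_limit_at_left_real)
    moreover have "Lim (at_left t) (\<lambda>s. M s x) = l"
      by (rule tendsto_Lim[OF _ l]) (simp add: trivial_limit_at_left_real)
    then have "stopped_jump M T x = M t x - l" using T False by (simp add: stopped_jump_def jump_def t_def)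
    ultimately show ?thesis using norm_triangle_ineq[of l "M t x - l"] by (simp add: stopped)
  qed
qed

context stochastic_basis
begin

text \<open>The stopped path runs through values before the hitting time and at most one more, the
  value at the hitting time itself, which \<open>at\<close> controls.\<close>

lemma maximal_stop_hitting:
  fixes M :: "('x, 'e::banach) process"
  assumes K: "0 \<le> K" and R: "0 \<le> R"
    and before: "\<And>t. 0 \<le> t \<Longrightarrow> ennreal t < hitting_time M c x \<Longrightarrow> norm (M t x) \<le> b"
    and at: "hitting_time M c x \<noteq> \<infinity> \<Longrightarrow> norm (stopped M (hitting_time M c) x) \<le> b + R"
  shows "maximal_inf (stop (hitting_time_min M c K) M) x \<le> ennreal (b + R)"
  unfolding maximal_inf_eq
proof (rule SUP_least)
  fix s :: real assume "s \<in> {0..}"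
  then have s: "0 \<le> s" by simp
  define u where "u = min s (hitting_time_min M c K x)"
  have u: "0 \<le> u" using s hitting_time_min_bounds(1)[OF K] by (simp add: u_def)
  have "ennreal u \<le> ennreal (hitting_time_min M c K x)" by (simp add: u_def ennreal_leI)
  then have le: "ennreal u \<le> hitting_time M c x" by (simp add: ennreal_hitting_time_min)
  have "norm (M u x) \<le> b + R"
  proof (cases "ennreal u < hitting_time M c x")
    case True
    then show ?thesis using before[OF u] R by simp
  next
    case False
    then have eq: "hitting_time M c x = ennreal u" using le by simp
    then have "stopped M (hitting_time M c) x = M u x" using u by (simp add: stopped_def)
    then show ?thesis using at eq by simp
  qed
  then show "ennreal (norm (stop (hitting_time_min M c K) M s x)) \<le> ennreal (b + R)"
    by (simp add: stop_def u_def ennreal_leI)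
qed

text \<open>\<open>R\<close> stands for whichever of the two quantities is controlled. For the
  stopped value the estimate at the hitting time is immediate; for the jump it is
  \<open>norm_stopped_le_jump\<close>, with \<open>H1_initial_bound\<close> covering a hitting time
  \<open>0\<close>.\<close>

lemma maximal_stop_hitting_AE:
  fixes M :: "('x, 'e::banach) process"
  assumes M: "M \<in> H1 \<mu> F" and K: "0 \<le> K" and c: "(\<integral>x. enn2real (maximal_inf M x) \<partial>\<mu>) < c"
    and R: "R = (\<lambda>x. norm (stopped M (hitting_time M c) x)) \<or> R = (\<lambda>x. norm (stopped_jump M (hitting_time M c) x))"
  shows "AE x in \<mu>. enn2real (maximal_inf (stop (hitting_time_min M c K) M) x) \<le> min (enn2real (maximal_inf M x)) c + R x"
  using H1_maximal(3)[OF M] H1_initial_bound[OF M c] AE_space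
proof eventually_elim
  case (elim x)
  let ?b = "min (enn2real (maximal_inf M x)) c"
  have "0 \<le> (\<integral>x. enn2real (maximal_inf M x) \<partial>\<mu>)" by (intro Bochner_Integration.integral_nonneg) simp
  then have "0 \<le> c" using c by linarith
  then have b: "0 \<le> ?b" by simp
  have R0: "0 \<le> R x" using R by auto
  have before: "norm (M t x) \<le> ?b" if "0 \<le> t" "ennreal t < hitting_time M c x" for t
    using hitting_time_before[OF that] elim(1) that(1) by simp
  have at: "norm (stopped M (hitting_time M c) x) \<le> ?b + R x" if T: "hitting_time M c x \<noteq> \<infinity>"
    using R
  proof
    assume "R = (\<lambda>x. norm (stopped M (hitting_time M c) x))"
    then show ?thesis using b by simp
  next
    assume "R = (\<lambda>x. norm (stopped_jump M (hitting_time M c) x))"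
    moreover have "norm (M 0 x) \<le> ?b" using elim(1,2) by simp
    ultimately show ?thesis
      using norm_stopped_le_jump[OF H1_D(1)[OF M] elim(3), where T = "hitting_time M c" and b = ?b] T before by blast
  qed
  have "maximal_inf (stop (hitting_time_min M c K) M) x \<le> ennreal (?b + R x)"
    by (rule maximal_stop_hitting[OF K R0 before at])
  then have "enn2real (maximal_inf (stop (hitting_time_min M c K) M) x) \<le> enn2real (ennreal (?b + R x))"
    by (intro enn2real_mono) auto
  moreover have "enn2real (ennreal (?b + R x)) = ?b + R x" using b R0 by (intro enn2real_ennreal) simp
  ultimately show ?case by (simp only:)
qed

text \<open>The bound is arranged to hold for every \<open>n\<close>. For \<open>n > k\<close> it is
  at least \<open>1\<close>, which bounds the integrand. For \<open>n \<le> k\<close> the cap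
  \<open>k + 1\<close> does not act before time \<open>n + 1\<close>, so the difference vanishes
  unless the level is exceeded, and Markov's inequality applies. The subtracted \<open>0\<close>
  matches the u.c.p. distance from the zero process.\<close>

lemma ucp_integrand_le:
  fixes M :: "('x, 'e::banach) process"
  assumes M: "M \<in> H1 \<mu> F" and C: "(\<integral>x. enn2real (maximal_inf M x) \<partial>\<mu>) \<le> C" and c: "real (Suc k) \<le> c"
  shows "(\<integral>x. enn2real (min 1 (maximal (\<lambda>t x. (M t x - stop (hitting_time_min M c (real (Suc k))) M t x) - 0) (real (Suc n)) x)) \<partial>\<mu>)
    \<le> (C + real n) / real (Suc k)"
proof -
  let ?L = "\<lambda>t x. (M t x - stop (hitting_time_min M c (real (Suc k))) M t x) - 0"
  let ?I = "\<lambda>x. enn2real (min 1 (maximal ?L (real (Suc n)) x))"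
  have I1: "?I x \<le> 1" for x
    using enn2real_mono[of "min 1 (maximal ?L (real (Suc n)) x)" 1] by simp
  have "0 \<le> (\<integral>x. enn2real (maximal_inf M x) \<partial>\<mu>)" by (intro Bochner_Integration.integral_nonneg) simp
  then have C0: "0 \<le> C" using C by linarith
  have c0: "0 < c" using c by (simp add: order_less_le_trans[OF _ c])
  show ?thesis
  proof (cases "n \<le> k")
    case False
    have "(\<integral>x. ?I x \<partial>\<mu>) \<le> (\<integral>x. 1 \<partial>\<mu>)" by (rule integral_mono') (use I1 in auto)
    also have "\<dots> = 1" by (simp add: prob_space)
    also have "\<dots> \<le> (C + real n) / real (Suc k)" using False C0 by (simp add: field_simps)
    finally show ?thesis .
  next
    case True
    let ?A = "{x \<in> space \<mu>. c \<le> enn2real (maximal_inf M x)}"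
    have [measurable]: "maximal_inf M \<in> borel_measurable \<mu>" by (rule H1_D(3)[OF M])
    have A: "?A \<in> sets \<mu>" by measurable
    have "AE x in \<mu>. ?I x \<le> indicat_real ?A x"
      using H1_maximal(3)[OF M] AE_space
    proof eventually_elim
      case (elim x)
      show ?case
      proof (cases "hitting_time M c x < \<infinity>")
        case True
        then obtain t where "0 \<le> t" "c < norm (M t x)" unfolding hitting_time_less_iff by blast
        then have "x \<in> ?A" using elim by (auto intro: order_trans less_imp_le)
        then show ?thesis using I1[of x] by simp
      next
        case False
        then have "hitting_time_min M c (real (Suc k)) x = real (Suc k)" by (simp add: hitting_time_min_def top_unique not_less)
        then have "?L s x = 0" if "s \<in> {0..real (Suc n)}" for s
          using that \<open>n \<le> k\<close> by (simp add: stop_def min_absorb1)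
        then have "maximal ?L (real (Suc n)) x = (SUP s\<in>{0..real (Suc n)}. 0)"
          unfolding maximal_def by (intro SUP_cong) simp_all
        then have "maximal ?L (real (Suc n)) x = 0" by simp
        then show ?thesis by simp
      qed
    qed
    then have "(\<integral>x. ?I x \<partial>\<mu>) \<le> (\<integral>x. indicat_real ?A x \<partial>\<mu>)"
      by (intro integral_mono_AE' integrable_indicator A) auto
    also have "\<dots> = measure \<mu> ?A" using A by simp
    also have "\<dots> \<le> (\<integral>x. enn2real (maximal_inf M x) \<partial>\<mu>) / c"
      by (rule integral_Markov_inequality_measure[OF H1_maximal(1)[OF M] sets.empty_sets]) (use c0 in auto)
    also have "\<dots> \<le> C / c" using C c0 by (simp add: divide_right_mono)
    also have "\<dots> \<le> C / real (Suc k)" using c C0 by (intro divide_left_mono) (auto simp: c0)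
    also have "\<dots> \<le> (C + real n) / real (Suc k)" by (intro divide_right_mono) auto
    finally show ?thesis .
  qed
qed

text \<open>Summing the weighted integrals leaves a finite constant independent of \<open>k\<close>,
  divided by \<open>k + 1\<close>.\<close>

lemma ucp_dist_stop_hitting:
  fixes M :: "('x, 'e::banach) process"
  assumes M: "M \<in> H1 \<mu> F" and C: "(\<integral>x. enn2real (maximal_inf M x) \<partial>\<mu>) \<le> C" and c: "real (Suc k) \<le> c"
  shows "\<bar>ucp_dist \<mu> (\<lambda>t x. M t x - stop (hitting_time_min M c (real (Suc k))) M t x) (\<lambda>t x. 0)\<bar>
    \<le> (\<Sum>n. (1 / 2) ^ Suc n * (C + real n)) / real (Suc k)"
proof -
  let ?a = "\<lambda>n. \<integral>x. enn2real (min 1 (maximal (\<lambda>t x. (M t x - stop (hitting_time_min M c (real (Suc k))) M t x) - 0) (real (Suc n)) x)) \<partial>\<mu>"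
  let ?b = "\<lambda>n. (1 / 2 :: real) ^ Suc n * (C + real n)"
  \<comment> \<open>The weighted terms are split into the differentiated geometric series and a
    multiple of the geometric series.\<close>
  have "summable (\<lambda>n. 1 / 2 * (real (Suc n) * (1 / 2) ^ n) + (C - 1) / 2 * (1 / 2) ^ n)"
    using sums_summable[OF geometric_deriv_sums[of "1 / 2 :: real"]]
    by (intro summable_add summable_mult summable_geometric) auto
  moreover have "1 / 2 * (real (Suc n) * (1 / 2) ^ n) + (C - 1) / 2 * (1 / 2) ^ n = ?b n" for n
    by (simp add: field_simps)
  ultimately have b: "summable ?b" by (simp only:)
  have a0: "0 \<le> (1 / 2) ^ Suc n * ?a n" for n
    by (intro mult_nonneg_nonneg Bochner_Integration.integral_nonneg) auto
  have ab: "(1 / 2) ^ Suc n * ?a n \<le> ?b n / real (Suc k)" for n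
    using mult_left_mono[OF ucp_integrand_le[OF M C c, of n], of "(1 / 2) ^ Suc n"] by (simp del: power_Suc)
  have sa: "summable (\<lambda>n. (1 / 2) ^ Suc n * ?a n)"
    by (rule summable_comparison_test'[OF summable_divide[OF b, of "real (Suc k)"], of 0]) (use a0 ab in \<open>simp del: power_Suc\<close>)
  have "(\<Sum>n. (1 / 2) ^ Suc n * ?a n) \<le> (\<Sum>n. ?b n / real (Suc k))"
    by (rule suminf_le[OF ab sa summable_divide[OF b]])
  also have "\<dots> = (\<Sum>n. ?b n) / real (Suc k)" by (rule suminf_divide[OF b])
  finally show ?thesis using suminf_nonneg[OF sa a0] by (simp add: ucp_dist_def)
qed

end

context stochastic_basis
begin

lemma unif_integrable_sequence:
  assumes S: "unif_integrable \<mu> S" and R: "\<And>k::nat. R k \<in> S" and nn: "\<And>k x. 0 \<le> R k x"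
  shows "\<And>k. integrable \<mu> (R k)" "\<exists>D. \<forall>k. (\<integral>x. R k x \<partial>\<mu>) \<le> D"
    "\<And>\<epsilon>. 0 < \<epsilon> \<Longrightarrow> \<exists>\<delta>>0. \<forall>k. \<forall>A\<in>sets \<mu>. measure \<mu> A \<le> \<delta> \<longrightarrow> indicator_integral \<mu> A (R k) \<le> \<epsilon>"
proof -
  have abs: "\<bar>R k x\<bar> = R k x" for k x using nn by simp
  show "integrable \<mu> (R k)" for k using S R by (auto simp: unif_integrable_def)
  obtain D where "\<forall>\<xi>\<in>S. (\<integral>x. \<bar>\<xi> x\<bar> \<partial>\<mu>) \<le> D" using S by (auto simp: unif_integrable_def)
  then have "\<forall>k. (\<integral>x. \<bar>R k x\<bar> \<partial>\<mu>) \<le> D" using R by blast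
  then show "\<exists>D. \<forall>k. (\<integral>x. R k x \<partial>\<mu>) \<le> D" unfolding abs by blast
  fix \<epsilon> :: real assume "0 < \<epsilon>"
  then obtain \<delta> where \<delta>: "\<delta> > 0" "\<forall>\<xi>\<in>S. \<forall>A\<in>sets \<mu>. measure \<mu> A \<le> \<delta> \<longrightarrow> (LINT x:A|\<mu>. \<bar>\<xi> x\<bar>) \<le> \<epsilon>"
    using S unfolding unif_integrable_def by blast
  have "indicator_integral \<mu> A (R k) = (LINT x:A|\<mu>. \<bar>R k x\<bar>)" for A k
    by (simp add: indicator_integral_def set_lebesgue_integral_def abs)
  then show "\<exists>\<delta>>0. \<forall>k. \<forall>A\<in>sets \<mu>. measure \<mu> A \<le> \<delta> \<longrightarrow> indicator_integral \<mu> A (R k) \<le> \<epsilon>"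
    using \<delta> R by auto
qed

end

section \<open>Decomposition into a weakly compact and a u.c.p. null sequence\<close>

theorem proposition2:
  fixes \<mu> :: "'x measure"
    and F :: "real \<Rightarrow> 'x measure"
    and M :: "nat \<Rightarrow> ('x, 'e::banach) process"
  assumes "stochastic_basis \<mu> F"
    and "reflexive_space TYPE('e)"
    and "\<And>n. M n \<in> H1 \<mu> F"
    and "\<exists>C. \<forall>n. H1_norm \<mu> (M n) \<le> C"
    and "unif_integrable_vec \<mu> {stopped (M n) T | n T. stopping_time_inf F T} \<or>
         unif_integrable_vec \<mu> {stopped_jump (M n) T | n T. stopping_time_inf F T}"
  shows "\<exists>(r :: nat \<Rightarrow> nat) (N :: nat \<Rightarrow> ('x, 'e) process) (L :: nat \<Rightarrow> ('x, 'e) process).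
           strict_mono r \<and>
           (\<forall>k. indistinguishable \<mu> (M (r k)) (\<lambda>t x. N k t x + L k t x)) \<and>
           (\<forall>k. N k \<in> H1 \<mu> F) \<and>
           relatively_weakly_compact \<mu> F (range N) \<and>
           ucp_null \<mu> F L"
proof -
  interpret stochastic_basis \<mu> F by (rule assms(1))
  note refl = assms(2) and M = assms(3) and UI = assms(5)
  obtain C where C: "\<And>n. H1_norm \<mu> (M n) \<le> C" using assms(4) by blast
  define Y where "Y = (\<lambda>n x. enn2real (maximal_inf (M n) x))"
  have Y: "integrable \<mu> (Y n)" "0 \<le> Y n x" "(\<integral>x. Y n x \<partial>\<mu>) \<le> C" for n x
    using H1_maximal(1)[OF M] C[of n] H1_norm_eq[OF M, of n] by (simp_all add: Y_def)
  obtain c0 :: nat where c0: "C < real c0" using reals_Archimedean2 by blast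
  \<comment> \<open>The levels exceed \<open>C\<close>, as the bound on the initial values requires,
    and are at least \<open>k + 1\<close>, so that the probability of a hit tends to
    \<open>0\<close>.\<close>
  define c where "c = (\<lambda>k. Suc (k + c0))"
  have c: "k \<le> c k" "mono c" "C < real (c k)" "real (Suc k) \<le> real (c k)" for k
    using c0 by (auto simp: c_def mono_def)
  obtain r where r: "strict_mono r"
    "\<And>\<epsilon>. 0 < \<epsilon> \<Longrightarrow> \<exists>\<delta>>0. \<forall>k. \<forall>A\<in>sets \<mu>. measure \<mu> A \<le> \<delta> \<longrightarrow>
      indicator_integral \<mu> A (\<lambda>x. min (Y (r k) x) (real (c k))) \<le> \<epsilon>"
    by (rule truncated_subsequence_UI[of Y C c, OF Y c(1,2)]) blast
  define T where "T = (\<lambda>k. hitting_time (M (r k)) (real (c k)))"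
  define \<tau> where "\<tau> = (\<lambda>k. hitting_time_min (M (r k)) (real (c k)) (real (Suc k)))"
  define N where "N = (\<lambda>k. stop (\<tau> k) (M (r k)))"
  \<comment> \<open>The stopping time is at most \<open>k + 1\<close>, so the stopped process is
    constant from then on and this value closes it.\<close>
  define Z where "Z = (\<lambda>k. stop (\<tau> k) (M (r k)) (real (Suc k)))"
  define L where "L = (\<lambda>k t x. M (r k) t x - N k t x)"
  have \<tau>: "bounded_stopping_time (real (Suc k)) (\<tau> k)" for k
    unfolding \<tau>_def by (rule bounded_stopping_time_hitting[OF H1_D(1,2)[OF M]]) simp
  have N_H1: "N k \<in> H1 \<mu> F" for k
    unfolding N_def by (rule optional_stopping(1)[OF \<tau> _ M]) simp
  have Z: "bochner_integrable \<mu> (Z k)" for k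
    unfolding Z_def by (rule optional_stopping(2)[OF \<tau> _ M]) simp
  have ZN: "is_projection t (Z k) (N k t)" if "0 \<le> t" for t k
    unfolding Z_def N_def by (rule optional_stopping(3)[OF \<tau> _ M that]) simp
  have Z_le: "AE x in \<mu>. norm (Z k x) \<le> enn2real (maximal_inf (N k) x)" for k
    using H1_maximal(3)[OF N_H1[of k]] by eventually_elim (simp add: Z_def N_def)
  \<comment> \<open>From here on the two alternative hypotheses are treated alike:
    \<open>R k\<close> is the norm either of the stopped value or of the jump at the hitting
    time.\<close>
  have "\<exists>S R. unif_integrable \<mu> S \<and> (\<forall>k. R k \<in> S) \<and>
    (\<forall>k. R k = (\<lambda>x. norm (stopped (M (r k)) (T k) x)) \<or> R k = (\<lambda>x. norm (stopped_jump (M (r k)) (T k) x)))"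
    using UI unfolding unif_integrable_vec_def
  proof
    have T: "stopping_time_inf F (T k)" for k
      unfolding T_def by (rule hitting_time_stopping_time[OF H1_D(1,2)[OF M]])
    {
      let ?S = "(\<lambda>\<xi> x. norm (\<xi> x)) ` {stopped (M n) T | n T. stopping_time_inf F T}"
      assume "unif_integrable \<mu> ?S"
      then show ?thesis using T by (intro exI[of _ ?S] exI[of _ "\<lambda>k x. norm (stopped (M (r k)) (T k) x)"]) blast
    next
      let ?S = "(\<lambda>\<xi> x. norm (\<xi> x)) ` {stopped_jump (M n) T | n T. stopping_time_inf F T}"
      assume "unif_integrable \<mu> ?S"
      then show ?thesis using T by (intro exI[of _ ?S] exI[of _ "\<lambda>k x. norm (stopped_jump (M (r k)) (T k) x)"]) blast
    }
  qed
  then obtain S and R :: "nat \<Rightarrow> 'x \<Rightarrow> real" where S: "unif_integrable \<mu> S" "\<And>k. R k \<in> S"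
    and R: "\<And>k. R k = (\<lambda>x. norm (stopped (M (r k)) (T k) x)) \<or> R k = (\<lambda>x. norm (stopped_jump (M (r k)) (T k) x))"
    by blast
  have R_nn: "0 \<le> R k x" for k x using R[of k] by auto
  note UR = unif_integrable_sequence[where R = R, OF S R_nn]
  obtain D where D: "\<And>k. (\<integral>x. R k x \<partial>\<mu>) \<le> D" using UR(2) by blast
  have N_le: "AE x in \<mu>. enn2real (maximal_inf (N k) x) \<le> min (Y (r k) x) (real (c k)) + R k x" for k
    unfolding N_def \<tau>_def Y_def
  proof (rule maximal_stop_hitting_AE[OF M])
    show "(\<integral>x. enn2real (maximal_inf (M (r k)) x) \<partial>\<mu>) < real (c k)"
      using Y(3)[of "r k"] c(3)[of k] by (simp add: Y_def)
  qed (use R[of k] in \<open>simp_all add: T_def\<close>)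
  have int: "integrable \<mu> (\<lambda>x. min (Y (r k) x) (real (c k)))" for k
    using Y(1) by (intro integrable_min) auto
  have N_le_integral: "indicator_integral \<mu> A (\<lambda>x. enn2real (maximal_inf (N k) x))
    \<le> indicator_integral \<mu> A (\<lambda>x. min (Y (r k) x) (real (c k))) + indicator_integral \<mu> A (R k)" if A: "A \<in> sets \<mu>" for A k
    using indicator_integral_mono[OF A H1_maximal(1)[OF N_H1] Bochner_Integration.integrable_add[OF int UR(1)] N_le]
    by (simp add: indicator_integral_add[OF A int UR(1)])
  \<comment> \<open>\<open>C\<close> bounds the truncated maximal function and \<open>D\<close> the
    contribution of the hitting time.\<close>
  interpret UI_martingales \<mu> F N Z "C + D"
  proof
    show "N k \<in> H1 \<mu> F" for k by (rule N_H1)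
    show "bochner_integrable \<mu> (Z k)" for k by (rule Z)
    show "is_projection t (Z k) (N k t)" if "0 \<le> t" for k t by (rule ZN[OF that])
    show "AE x in \<mu>. norm (Z k x) \<le> enn2real (maximal_inf (N k) x)" for k by (rule Z_le)
    show "(\<integral>x. enn2real (maximal_inf (N k) x) \<partial>\<mu>) \<le> C + D" for k
    proof -
      have "(\<integral>x. min (Y (r k) x) (real (c k)) \<partial>\<mu>) \<le> (\<integral>x. Y (r k) x \<partial>\<mu>)"
        by (intro integral_mono int Y) simp
      then show ?thesis
        using N_le_integral[OF sets.top, of k] Y(3)[of "r k"] D[of k] by (simp add: indicator_integral_space)
    qed
    fix \<epsilon> :: real assume "0 < \<epsilon>"
    then have \<epsilon>: "0 < \<epsilon> / 2" by simp
    obtain \<delta>1 where \<delta>1: "\<delta>1 > 0" "\<forall>k. \<forall>A\<in>sets \<mu>. measure \<mu> A \<le> \<delta>1 \<longrightarrow>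
      indicator_integral \<mu> A (\<lambda>x. min (Y (r k) x) (real (c k))) \<le> \<epsilon> / 2" using r(2)[OF \<epsilon>] by blast
    obtain \<delta>2 where \<delta>2: "\<delta>2 > 0" "\<forall>k. \<forall>A\<in>sets \<mu>. measure \<mu> A \<le> \<delta>2 \<longrightarrow> indicator_integral \<mu> A (R k) \<le> \<epsilon> / 2"
      using UR(3)[OF \<epsilon>] by blast
    show "\<exists>\<delta>>0. \<forall>k. \<forall>A\<in>sets \<mu>. measure \<mu> A \<le> \<delta> \<longrightarrow>
      indicator_integral \<mu> A (\<lambda>x. enn2real (maximal_inf (N k) x)) \<le> \<epsilon>"
    proof (intro exI[of _ "min \<delta>1 \<delta>2"] conjI allI ballI impI)
      fix k A assume A: "A \<in> sets \<mu>" "measure \<mu> A \<le> min \<delta>1 \<delta>2"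
      have "indicator_integral \<mu> A (\<lambda>x. min (Y (r k) x) (real (c k))) \<le> \<epsilon> / 2"
        "indicator_integral \<mu> A (R k) \<le> \<epsilon> / 2" using \<delta>1(2) \<delta>2(2) A by auto
      then show "indicator_integral \<mu> A (\<lambda>x. enn2real (maximal_inf (N k) x)) \<le> \<epsilon>"
        using N_le_integral[OF A(1), of k] by linarith
    qed (use \<delta>1 \<delta>2 in simp)
  qed
  have "ucp_null \<mu> F L"
    unfolding ucp_null_def
  proof (intro conjI allI)
    fix k
    \<comment> \<open>Written as a sum with a multiple, so that closure under addition and scaling
      applies.\<close>
    have neg: "L k = (\<lambda>t x. M (r k) t x + (- 1) *\<^sub>R N k t x)" by (simp add: L_def)
    show "cadlag \<mu> (L k)"
      unfolding neg by (intro cadlag_add cadlag_scaleR H1_D(1) M N_H1)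
    show "adapted \<mu> F (L k)"
      unfolding adapted_def
    proof (intro allI impI)
      fix t :: real assume t: "0 \<le> t"
      interpret R: finite_complete_measure "restr t" by (rule finite_complete_restr[OF t])
      show "strongly_measurable (restr t) (L k t)"
        unfolding neg using t H1_D(2)[OF M] H1_D(2)[OF N_H1]
        by (intro R.strongly_measurable_add R.strongly_measurable_scaleR) (simp_all add: adapted_def)
    qed
  next
    let ?b = "\<Sum>n. (1 / 2) ^ Suc n * (C + real n)"
    have le: "\<bar>ucp_dist \<mu> (L k) (\<lambda>t x. 0)\<bar> \<le> ?b / real (Suc k)" for k
      unfolding L_def N_def \<tau>_def
      by (rule ucp_dist_stop_hitting[OF M _ c(4)]) (use Y(3) in \<open>simp add: Y_def\<close>)
    have "(\<lambda>k. ?b * inverse (real (Suc k))) \<longlonglongrightarrow> ?b * 0"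
      by (intro tendsto_intros LIMSEQ_inverse_real_of_nat)
    then have lim: "(\<lambda>k. ?b / real (Suc k)) \<longlonglongrightarrow> 0" by (simp only: mult_zero_right divide_inverse)
    show "(\<lambda>k. ucp_dist \<mu> (L k) (\<lambda>t x. 0)) \<longlonglongrightarrow> 0"
      by (rule tendsto_rabs_zero_cancel, rule tendsto_sandwich[OF _ _ tendsto_const lim]) (use le in simp_all)
  qed
  \<comment> \<open>\<open>L\<close> was defined as the difference, so the identity holds everywhere
    and the exceptional set is empty.\<close>
  moreover have "indistinguishable \<mu> (M (r k)) (\<lambda>t x. N k t x + L k t x)" for k
    by (simp add: indistinguishable_def evanescent_def L_def)
  ultimately show ?thesis using r(1) N_H1 UI_relatively_weakly_compact[OF refl] by blast
qed

end
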